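(* Fix a graph of groups $\mathbb A$ with finite vertex groups over a finite directed graph $A$, a base vertex $v\in\mathrm{Verts}(A)$, disjoint tuples of symbols $\mathscr G_w$ associated to each $w\in\mathrm{Verts}(A)$, and a presentation $\mathrm{Bass}(\mathbb A)=\langle X\mid R\rangle$ of the form described in the context, with alphabet $X=\mathrm{Edges}(A)\cup\bigcup_{w\in\mathrm{Verts}(A)}\mathscr G_w$. The folding algorithm described in the context takes as input a tuple $(W_1,\ldots,W_n)$ of words in $(X^{\pm1})^*$ representing elements of $\pi_1(\mathbb A,v)$ and outputs $(\mathcal A_F,v_0)$, a based directed graph with edges labelled in $X$, with the following property: $g\in\pi_1(\mathbb A,v)$ lies in the subgroup $H=\langle \epsilon(W_1),\ldots,\epsilon(W_n)\rangle$ if and only if any reduced word $U\in(X^{\pm1})^*$ that evaluates to $g$ (i.e. $\epsilon(U)=g$) can be read as the label of a closed loop in $\mathcal A_F$ starting and ending at $v_0$. Moreover, $(\mathcal A_F,v_0)$ can be constructed in time $O(N\log^*(N))$ from the input $(W_1,\ldots,W_n)$, where $N$ is the sum of the lengths of the words in the input.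
   Context: **Graphs of groups.** A directed graph has vertices, edges, and initial/terminal maps $i,t$ from edges to vertices; for an edge $e$ the symbol $e^{-1}$ denotes the reversed edge, $i(e^{-1})=t(e)$, $t(e^{-1})=i(e)$. A path is a sequence $e_1^{\epsilon_1}\cdots e_p^{\epsilon_p}$ ($\epsilon_j=\pm1$) with $t(e_{j-1}^{\epsilon_{j-1}})=i(e_j^{\epsilon_j})$. A graph of groups $\mathbb A$ over $A$ assigns a group $\mathbb A_w$ to each vertex $w$, a group $\mathbb A_e$ to each edge $e$, and monomorphisms $i_e:\mathbb A_e\to\mathbb A_{i(e)}$, $t_e:\mathbb A_e\to\mathbb A_{t(e)}$. **Presentation.** For each vertex $w$ fix a finite tuple $\mathscr G_w$ of symbols generating $\mathbb A_w$ (all symbols distinct) and a finite presentation $\mathbb A_w=\langle\mathscr G_w\mid R_w\rangle$. For each edge $e$ and each $h\in\mathbb A_e$ fix a word $W(t_e(h))$ in $\mathscr G_{t(e)}^{\pm1}$ representing $t_e(h)$ and a word $V(i_e(h))$ in $\mathscr G_{i(e)}^{\pm1}$ representing $i_e(h)$. Put $X=\mathrm{Edges}(A)\cup\bigcup_w\mathscr G_w$ and $R=\{e\,W(t_e(h))\,e^{-1}\,V(i_e(h))^{-1}: e\in \mathrm{Edges}(A),h\in\mathbb A_e\}\cup\bigcup_w R_w$. The Bass group is $\mathrm{Bass}(\mathbb A)=\langle X\mid R\rangle$. Let $\epsilon:(X^{\pm1})^*\to\mathrm{Bass}(\mathbb A)$ be the evaluation map sending a word to the product of its letters. A word $W$ represents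 an element $g$ if $\epsilon(W)=g$. **Fundamental group.** $\pi_1(\mathbb A,v)\le\mathrm{Bass}(\mathbb A)$ is the subgroup generated by the elements $a_0e_1^{\epsilon_1}a_1\cdots e_p^{\epsilon_p}a_p$ where $e_1^{\epsilon_1}\cdots e_p^{\epsilon_p}$ is a (possibly empty) loop at $v$ in $A$, $a_0\in\mathbb A_v$ and $a_j\in\mathbb A_{t(e_j^{\epsilon_j})}$. **Reduced words.** A word is cancellable if it is of the form $eWe^{-1}$ with $e\in\mathrm{Edges}(A)$, $W\in(\mathscr G_{t(e)}^{\pm1})^*$, $\epsilon(W)\in t_e(\mathbb A_e)$, or $e^{-1}Ve$ with $V\in(\mathscr G_{i(e)}^{\pm1})^*$, $\epsilon(V)\in i_e(\mathbb A_e)$. A word is reduced if it is freely reduced (no subword $xx^{-1}$ or $x^{-1}x$) and has no cancellable subword. **Labelled graphs.** In a directed $X$-labelled graph every edge $f$ has a label $\mu(f)\in X$; the label of a path $f_1^{\epsilon_1}\cdots f_p^{\epsilon_p}$ is $\mu(f_1)^{\epsilon_1}\cdots\mu(f_p)^{\epsilon_p}$. A fold identifies two distinct edges with the same label and the same initial vertex, or with the same label and the same terminal vertex (identifying also their other endpoints). $\Gamma_w$ denotes the $X$-labelled Cayley graph of $\mathbb A_w$ with respect to $\mathscr G_w$. **The folding algorithm**, on input $(W_1,\dots,W_n)$: (1) For each $W_i$ make a linear labelled directed graph along which $W_i$ can be read, and identify all the endpoints of these linear graphs to obtain a bouquet $\mathcal A_0$ with basepoint $v_0$. (2) Vertex saturation: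 for each vertex $z$ of $\mathcal A_0$, if $z$ is adjacent to an edge with a label in $\mathscr G_w$, set $[z]=w$ and attach a copy of $\Gamma_{[z]}$ to $z$; if $z$ is adjacent to an edge $f$ with $t(f)=z$ or $i(f)=z$ and label $e\in\mathrm{Edges}(A)$, attach a copy of $\Gamma_{t(e)}$ or $\Gamma_{i(e)}$, respectively, to $z$. Result: $\mathcal A_1$. (3) Edge saturation: for each edge $f$ of $\mathcal A_1$ with label $e\in\mathrm{Edges}(A)$ and each relation $r=eW(t_e(h))e^{-1}V(i_e(h))^{-1}$ involving $e$ in $R$, attach at $i(f)$ a loop with label $r$. Result: $\mathcal A_2$. (4) Perform folds on $\mathcal A_2$ (by a fast Stallings folding algorithm) until none is possible; the result is $\mathcal A_F$, and the image of $v_0$ is again called $v_0$. **Running time** is the count of pointer operations and operations on integers of uniformly bounded size; $\log^*(n)=\min\{m: n\le 2^*(m)\}$ with $2^*(0)=1$, $2^*(n+1)=2^{2^*(n)}$. The constant in $O(\cdot)$ depends on the fixed $\mathbb A$ and its presentation.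
   Formalization: "Any reduced word U" is restricted to words u_0 e_1 u_1…e_p u_p along loops at v (otherwise false: a relator xx of another vertex group represents 1 but is not readable); a copy of Γ_v is always attached at v_0, which the claim needs, e.g., when all W_i are empty. *)

theory Defs
  imports
    "HOL-Algebra.Generated_Groups"
    "HOL-Library.Sublist"
    "HOL-Library.Landau_Symbols"
    "Graph_Theory.Digraph"
begin

section \<open>Words and group presentations\<close>

text \<open>A signed letter \<open>(x, True)\<close> stands for \<open>x\<close> and \<open>(x, False)\<close> for its formal inverse.\<close>

type_synonym 'x word = "('x \<times> bool) list"

definition words :: "'x set \<Rightarrow> 'x word set" where
  "words X = lists (X \<times> UNIV)"

definition inv_word :: "'x word \<Rightarrow> 'x word" where
  "inv_word u = rev (map (\<lambda>(x, b). (x, \<not> b)) u)"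

definition freely_reduced :: "'x word \<Rightarrow> bool" where
  "freely_reduced u \<longleftrightarrow> \<not> (\<exists>x b. sublist [(x, b), (x, \<not> b)] u)"

inductive_set pres_rel :: "'x set \<Rightarrow> 'x word set \<Rightarrow> 'x word rel"
  for X :: "'x set" and R :: "'x word set" where
  refl: "u \<in> words X \<Longrightarrow> (u, u) \<in> pres_rel X R"
| sym: "(u, u') \<in> pres_rel X R \<Longrightarrow> (u', u) \<in> pres_rel X R"
| trans: "(u, u') \<in> pres_rel X R \<Longrightarrow> (u', u'') \<in> pres_rel X R \<Longrightarrow> (u, u'') \<in> pres_rel X R"
| cancel: "p \<in> words X \<Longrightarrow> q \<in> words X \<Longrightarrow> x \<in> X \<Longrightarrow>
    (p @ [(x, b), (x, \<not> b)] @ q, p @ q) \<in> pres_rel X R"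
| relator: "p \<in> words X \<Longrightarrow> q \<in> words X \<Longrightarrow> r \<in> R \<Longrightarrow> r \<in> words X \<Longrightarrow>
    (p @ r @ q, p @ q) \<in> pres_rel X R"

definition word_class :: "'x set \<Rightarrow> 'x word set \<Rightarrow> 'x word \<Rightarrow> 'x word set" where
  "word_class X R u = pres_rel X R `` {u}"

definition presented_group :: "'x set \<Rightarrow> 'x word set \<Rightarrow> 'x word set monoid" where
  "presented_group X R =
     \<lparr> carrier = words X // pres_rel X R,
       mult = (\<lambda>c d. \<Union>u\<in>c. \<Union>u'\<in>d. word_class X R (u @ u')),
       one = word_class X R [] \<rparr>"

text \<open>
  \<open>G = \<langle>X | R\<rangle>\<close>, where the symbol \<open>x\<close> names the element \<open>val x\<close> of \<open>G\<close>; distinct symbols may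
  name the same element.
\<close>

definition is_presentation ::
    "('x \<Rightarrow> 'g) \<Rightarrow> 'x set \<Rightarrow> 'x word set \<Rightarrow> 'g monoid \<Rightarrow> bool" where
  "is_presentation val X R G \<longleftrightarrow> R \<subseteq> words X \<and>
     (\<exists>\<phi> \<in> iso (presented_group X R) G. \<forall>x\<in>X. \<phi> (word_class X R [(x, True)]) = val x)"

fun eval_word :: "'g monoid \<Rightarrow> ('x \<Rightarrow> 'g) \<Rightarrow> 'x word \<Rightarrow> 'g" where
  "eval_word G val [] = \<one>\<^bsub>G\<^esub>"
| "eval_word G val ((x, b) # u) =
     (if b then val x else inv\<^bsub>G\<^esub> val x) \<otimes>\<^bsub>G\<^esub> eval_word G val u"


section \<open>Graphs of groups\<close>

text \<open>The initial vertex of an edge is its tail, the terminal vertex its head.\<close>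

record ('v, 'e, 'g, 'h) graph_of_groups =
  dgraph :: "('v, 'e) pre_digraph"
  vgroup :: "'v \<Rightarrow> 'g monoid"
  egroup :: "'e \<Rightarrow> 'h monoid"
  imap :: "'e \<Rightarrow> 'h \<Rightarrow> 'g"
  tmap :: "'e \<Rightarrow> 'h \<Rightarrow> 'g"

definition is_graph_of_groups :: "('v, 'e, 'g, 'h, 'z) graph_of_groups_scheme \<Rightarrow> bool" where
  "is_graph_of_groups A \<longleftrightarrow>
     wf_digraph (dgraph A) \<and>
     (\<forall>w \<in> verts (dgraph A). group (vgroup A w)) \<and>
     (\<forall>e \<in> arcs (dgraph A). group (egroup A e) \<and>
        imap A e \<in> mon (egroup A e) (vgroup A (tail (dgraph A) e)) \<and>
        tmap A e \<in> mon (egroup A e) (vgroup A (head (dgraph A) e)))"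

text \<open>
  The chosen presentation data: \<open>gens A w\<close> is the tuple of symbols of the vertex \<open>w\<close>, \<open>gen_val\<close>
  the element named by a symbol, \<open>tword A e h\<close> the word \<open>W(t_e(h))\<close> and \<open>iword A e h\<close> the word
  \<open>V(i_e(h))\<close>.
\<close>

record ('v, 'e, 'g, 'h, 's) presented_gog = "('v, 'e, 'g, 'h) graph_of_groups" +
  gens :: "'v \<Rightarrow> 's list"
  gen_val :: "'s \<Rightarrow> 'g"
  rels :: "'v \<Rightarrow> 's word set"
  tword :: "'e \<Rightarrow> 'h \<Rightarrow> 's word"
  iword :: "'e \<Rightarrow> 'h \<Rightarrow> 's word"

definition is_presented_gog :: "('v, 'e, 'g, 'h, 's) presented_gog \<Rightarrow> bool" where
  "is_presented_gog A \<longleftrightarrow>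
     is_graph_of_groups A \<and>
     (\<forall>w \<in> verts (dgraph A). distinct (gens A w) \<and> finite (rels A w) \<and>
        is_presentation (gen_val A) (set (gens A w)) (rels A w) (vgroup A w)) \<and>
     (\<forall>w \<in> verts (dgraph A). \<forall>w' \<in> verts (dgraph A).
        w \<noteq> w' \<longrightarrow> set (gens A w) \<inter> set (gens A w') = {}) \<and>
     (\<forall>e \<in> arcs (dgraph A). \<forall>h \<in> carrier (egroup A e).
        tword A e h \<in> words (set (gens A (head (dgraph A) e))) \<and>
        eval_word (vgroup A (head (dgraph A) e)) (gen_val A) (tword A e h) = tmap A e h \<and>
        iword A e h \<in> words (set (gens A (tail (dgraph A) e))) \<and>
        eval_word (vgroup A (tail (dgraph A) e)) (gen_val A) (iword A e h) = imap A e h)"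

datatype ('e, 's) letter = Edge 'e | Gen 's

definition gen_word :: "'s word \<Rightarrow> ('e, 's) letter word" where
  "gen_word = map (\<lambda>(s, b). (Gen s, b))"

definition alphabet :: "('v, 'e, 'g, 'h, 's) presented_gog \<Rightarrow> ('e, 's) letter set" where
  "alphabet A = Edge ` arcs (dgraph A) \<union> (\<Union>w \<in> verts (dgraph A). Gen ` set (gens A w))"

definition edge_rel ::
    "('v, 'e, 'g, 'h, 's) presented_gog \<Rightarrow> 'e \<Rightarrow> 'h \<Rightarrow> ('e, 's) letter word" where
  "edge_rel A e h = [(Edge e, True)] @ gen_word (tword A e h) @ [(Edge e, False)] @
     inv_word (gen_word (iword A e h))"

definition relators ::
    "('v, 'e, 'g, 'h, 's) presented_gog \<Rightarrow> ('e, 's) letter word set" where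
  "relators A = {edge_rel A e h | e h. e \<in> arcs (dgraph A) \<and> h \<in> carrier (egroup A e)} \<union>
     (\<Union>w \<in> verts (dgraph A). gen_word ` rels A w)"

definition Bass ::
    "('v, 'e, 'g, 'h, 's) presented_gog \<Rightarrow> ('e, 's) letter word set monoid" where
  "Bass A = presented_group (alphabet A) (relators A)"

definition bass_eval ::
    "('v, 'e, 'g, 'h, 's) presented_gog \<Rightarrow> ('e, 's) letter word \<Rightarrow> ('e, 's) letter word set" where
  "bass_eval A u = word_class (alphabet A) (relators A) u"

text \<open>
  The canonical map of the vertex group at \<open>w\<close> to the Bass group. The value does not depend on the
  chosen word, because the relators of the vertex group are relators of the Bass group.
\<close>

definition vertex_elt ::
    "('v, 'e, 'g, 'h, 's) presented_gog \<Rightarrow> 'v \<Rightarrow> 'g \<Rightarrow> ('e, 's) letter word set" where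
  "vertex_elt A w a = bass_eval A (gen_word
     (SOME u. u \<in> words (set (gens A w)) \<and> eval_word (vgroup A w) (gen_val A) u = a))"


section \<open>The fundamental group and reduced words\<close>

definition oinit :: "('v, 'e) pre_digraph \<Rightarrow> 'e \<times> bool \<Rightarrow> 'v" where
  "oinit D d = (if snd d then tail D (fst d) else head D (fst d))"

definition oterm :: "('v, 'e) pre_digraph \<Rightarrow> 'e \<times> bool \<Rightarrow> 'v" where
  "oterm D d = (if snd d then head D (fst d) else tail D (fst d))"

fun edge_path :: "('v, 'e) pre_digraph \<Rightarrow> 'v \<Rightarrow> ('e \<times> bool) list \<Rightarrow> 'v \<Rightarrow> bool" where
  "edge_path D w [] w' \<longleftrightarrow> w \<in> verts D \<and> w = w'"
| "edge_path D w (d # ds) w' \<longleftrightarrow>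
     fst d \<in> arcs D \<and> oinit D d = w \<and> edge_path D (oterm D d) ds w'"

fun path_elt :: "('v, 'e, 'g, 'h, 's) presented_gog \<Rightarrow> ('e, 's) letter word set \<Rightarrow>
    (('e \<times> bool) \<times> 'g) list \<Rightarrow> ('e, 's) letter word set" where
  "path_elt A c [] = c"
| "path_elt A c ((d, a) # ds) = path_elt A
     (c \<otimes>\<^bsub>Bass A\<^esub> bass_eval A [(Edge (fst d), snd d)]
        \<otimes>\<^bsub>Bass A\<^esub> vertex_elt A (oterm (dgraph A) d) a) ds"

definition pi1 :: "('v, 'e, 'g, 'h, 's) presented_gog \<Rightarrow> 'v \<Rightarrow> ('e, 's) letter word set set" where
  "pi1 A v = generate (Bass A)
     {path_elt A (vertex_elt A v a0) ds | a0 ds.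
        a0 \<in> carrier (vgroup A v) \<and> edge_path (dgraph A) v (map fst ds) v \<and>
        (\<forall>(d, a) \<in> set ds. a \<in> carrier (vgroup A (oterm (dgraph A) d)))}"

text \<open>
  \<open>gog_path A w U w'\<close>: the word \<open>U\<close> has the shape \<open>u\<^sub>0 e\<^sub>1 u\<^sub>1 \<dots> e\<^sub>p u\<^sub>p\<close> of the products
  that define the fundamental group, that is, the \<open>e\<^sub>i\<close> form a path from \<open>w\<close> to \<open>w'\<close> and each
  \<open>u\<^sub>i\<close> is a word in the symbols of the vertex that the path has reached. A reduced word that
  represents an element of the fundamental group need not have this shape: it may contain a relator
  of a vertex group to which the path has not led.
\<close>

inductive gog_path ::
    "('v, 'e, 'g, 'h, 's) presented_gog \<Rightarrow> 'v \<Rightarrow> ('e, 's) letter word \<Rightarrow> 'v \<Rightarrow> bool"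
  for A :: "('v, 'e, 'g, 'h, 's) presented_gog" where
  nil: "w \<in> verts (dgraph A) \<Longrightarrow> gog_path A w [] w"
| gen: "s \<in> set (gens A w) \<Longrightarrow> gog_path A w U w' \<Longrightarrow> gog_path A w ((Gen s, b) # U) w'"
| edge: "e \<in> arcs (dgraph A) \<Longrightarrow> gog_path A (oterm (dgraph A) (e, b)) U w' \<Longrightarrow>
    gog_path A (oinit (dgraph A) (e, b)) ((Edge e, b) # U) w'"

definition cancellable ::
    "('v, 'e, 'g, 'h, 's) presented_gog \<Rightarrow> ('e, 's) letter word \<Rightarrow> bool" where
  "cancellable A c \<longleftrightarrow> (\<exists>e \<in> arcs (dgraph A).
     (\<exists>u \<in> words (set (gens A (head (dgraph A) e))).
        c = [(Edge e, True)] @ gen_word u @ [(Edge e, False)] \<and>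
        bass_eval A (gen_word u) \<in>
          vertex_elt A (head (dgraph A) e) ` tmap A e ` carrier (egroup A e)) \<or>
     (\<exists>u \<in> words (set (gens A (tail (dgraph A) e))).
        c = [(Edge e, False)] @ gen_word u @ [(Edge e, True)] \<and>
        bass_eval A (gen_word u) \<in>
          vertex_elt A (tail (dgraph A) e) ` imap A e ` carrier (egroup A e)))"

definition reduced ::
    "('v, 'e, 'g, 'h, 's) presented_gog \<Rightarrow> ('e, 's) letter word \<Rightarrow> bool" where
  "reduced A U \<longleftrightarrow> freely_reduced U \<and> \<not> (\<exists>c. sublist c U \<and> cancellable A c)"


section \<open>Based labelled graphs and folds\<close>

record ('n, 'f, 'x) lgraph = "('n, 'f) pre_digraph" +
  lab :: "'f \<Rightarrow> 'x"
  base :: 'n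

inductive reads :: "('n, 'f, 'x) lgraph \<Rightarrow> 'n \<Rightarrow> 'x word \<Rightarrow> 'n \<Rightarrow> bool"
  for \<Gamma> :: "('n, 'f, 'x) lgraph" where
  nil: "p \<in> verts \<Gamma> \<Longrightarrow> reads \<Gamma> p [] p"
| forward: "f \<in> arcs \<Gamma> \<Longrightarrow> reads \<Gamma> (head \<Gamma> f) u q \<Longrightarrow>
    reads \<Gamma> (tail \<Gamma> f) ((lab \<Gamma> f, True) # u) q"
| backward: "f \<in> arcs \<Gamma> \<Longrightarrow> reads \<Gamma> (tail \<Gamma> f) u q \<Longrightarrow>
    reads \<Gamma> (head \<Gamma> f) ((lab \<Gamma> f, False) # u) q"

text \<open>Remove the edge \<open>g\<close> and identify the vertex \<open>z\<close> with the vertex \<open>y\<close>.\<close>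

definition merge :: "('n, 'f, 'x) lgraph \<Rightarrow> 'f \<Rightarrow> 'n \<Rightarrow> 'n \<Rightarrow> ('n, 'f, 'x) lgraph" where
  "merge \<Gamma> g z y = (let \<sigma> = (\<lambda>p. if p = z then y else p) in
     \<lparr> verts = \<sigma> ` verts \<Gamma>, arcs = arcs \<Gamma> - {g},
       tail = \<sigma> \<circ> tail \<Gamma>, head = \<sigma> \<circ> head \<Gamma>, lab = lab \<Gamma>, base = \<sigma> (base \<Gamma>) \<rparr>)"

definition fold_step :: "('n, 'f, 'x) lgraph \<Rightarrow> ('n, 'f, 'x) lgraph \<Rightarrow> bool" where
  "fold_step \<Gamma> \<Gamma>' \<longleftrightarrow> (\<exists>f \<in> arcs \<Gamma>. \<exists>g \<in> arcs \<Gamma>. f \<noteq> g \<and> lab \<Gamma> f = lab \<Gamma> g \<and>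
     (tail \<Gamma> f = tail \<Gamma> g \<and> \<Gamma>' = merge \<Gamma> g (head \<Gamma> g) (head \<Gamma> f) \<or>
      head \<Gamma> f = head \<Gamma> g \<and> \<Gamma>' = merge \<Gamma> g (tail \<Gamma> g) (tail \<Gamma> f)))"


section \<open>The folding algorithm\<close>

text \<open>
  Endpoints of the edge carrying the \<open>j\<close>-th letter of \<open>r\<close> in a linear graph along which \<open>r\<close> is
  read; \<open>pt j\<close> is the vertex reached after \<open>j\<close> letters.
\<close>

definition line_tail :: "'x word \<Rightarrow> (nat \<Rightarrow> 'n) \<Rightarrow> nat \<Rightarrow> 'n" where
  "line_tail r pt j = (if snd (r ! j) then pt j else pt (Suc j))"

definition line_head :: "'x word \<Rightarrow> (nat \<Rightarrow> 'n) \<Rightarrow> nat \<Rightarrow> 'n" where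
  "line_head r pt j = (if snd (r ! j) then pt (Suc j) else pt j)"

subsection \<open>The bouquet\<close>

datatype bouquet_node = Base | Inner nat nat

definition bouquet_pt :: "'x word list \<Rightarrow> nat \<Rightarrow> nat \<Rightarrow> bouquet_node" where
  "bouquet_pt Ws i j = (if j = 0 \<or> j = length (Ws ! i) then Base else Inner i j)"

definition bouquet :: "'x word list \<Rightarrow> (bouquet_node, nat \<times> nat, 'x) lgraph" where
  "bouquet Ws =
     \<lparr> verts = insert Base {bouquet_pt Ws i j | i j. i < length Ws \<and> j \<le> length (Ws ! i)},
       arcs = {(i, j). i < length Ws \<and> j < length (Ws ! i)},
       tail = (\<lambda>(i, j). line_tail (Ws ! i) (bouquet_pt Ws i) j),
       head = (\<lambda>(i, j). line_head (Ws ! i) (bouquet_pt Ws i) j),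
       lab = (\<lambda>(i, j). fst (Ws ! i ! j)),
       base = Base \<rparr>"

subsection \<open>Vertex saturation\<close>

text \<open>
  \<open>node_type A v \<Gamma> z w\<close>: a copy of the Cayley graph of the vertex group at \<open>w\<close> is to be attached
  at \<open>z\<close>. The base point always has type \<open>v\<close>, also if no edge is adjacent to it.
\<close>

definition node_type :: "('v, 'e, 'g, 'h, 's) presented_gog \<Rightarrow> 'v \<Rightarrow>
    ('n, 'f, ('e, 's) letter) lgraph \<Rightarrow> 'n \<Rightarrow> 'v \<Rightarrow> bool" where
  "node_type A v \<Gamma> z w \<longleftrightarrow> z \<in> verts \<Gamma> \<and> w \<in> verts (dgraph A) \<and>
     ((\<exists>f \<in> arcs \<Gamma>. (tail \<Gamma> f = z \<or> head \<Gamma> f = z) \<and> lab \<Gamma> f \<in> Gen ` set (gens A w)) \<or>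
      (\<exists>f \<in> arcs \<Gamma>. \<exists>e. lab \<Gamma> f = Edge e \<and>
         (head \<Gamma> f = z \<and> w = head (dgraph A) e \<or> tail \<Gamma> f = z \<and> w = tail (dgraph A) e)) \<or>
      z = base \<Gamma> \<and> w = v)"

datatype ('n, 'v, 'g) cay_node = OldNode 'n | CayNode 'n 'v 'g
datatype ('n, 'f, 'v, 'g, 's) cay_arc = OldArc 'f | CayArc 'n 'v 'g 's

text \<open>The copies are attached at the vertex \<open>\<one>\<close> of the Cayley graph.\<close>

definition cay_pt :: "('v, 'e, 'g, 'h, 's) presented_gog \<Rightarrow> 'n \<Rightarrow> 'v \<Rightarrow> 'g \<Rightarrow>
    ('n, 'v, 'g) cay_node" where
  "cay_pt A z w a = (if a = \<one>\<^bsub>vgroup A w\<^esub> then OldNode z else CayNode z w a)"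

definition vertex_saturate :: "('v, 'e, 'g, 'h, 's) presented_gog \<Rightarrow> 'v \<Rightarrow>
    ('n, 'f, ('e, 's) letter) lgraph \<Rightarrow>
    (('n, 'v, 'g) cay_node, ('n, 'f, 'v, 'g, 's) cay_arc, ('e, 's) letter) lgraph" where
  "vertex_saturate A v \<Gamma> =
     \<lparr> verts = OldNode ` verts \<Gamma> \<union>
         {cay_pt A z w a | z w a. node_type A v \<Gamma> z w \<and> a \<in> carrier (vgroup A w)},
       arcs = OldArc ` arcs \<Gamma> \<union>
         {CayArc z w a s | z w a s. node_type A v \<Gamma> z w \<and> a \<in> carrier (vgroup A w) \<and>
            s \<in> set (gens A w)},
       tail = (\<lambda>k. case k of OldArc f \<Rightarrow> OldNode (tail \<Gamma> f)
                 | CayArc z w a s \<Rightarrow> cay_pt A z w a),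
       head = (\<lambda>k. case k of OldArc f \<Rightarrow> OldNode (head \<Gamma> f)
                 | CayArc z w a s \<Rightarrow> cay_pt A z w (a \<otimes>\<^bsub>vgroup A w\<^esub> gen_val A s)),
       lab = (\<lambda>k. case k of OldArc f \<Rightarrow> lab \<Gamma> f | CayArc z w a s \<Rightarrow> Gen s),
       base = OldNode (base \<Gamma>) \<rparr>"

subsection \<open>Edge saturation\<close>

datatype ('n, 'f, 'h) loop_node = PrevNode 'n | LoopNode 'f 'h nat
datatype ('f, 'h) loop_arc = PrevArc 'f | LoopArc 'f 'h nat

definition arc_rel :: "('v, 'e, 'g, 'h, 's) presented_gog \<Rightarrow>
    ('n, 'f, ('e, 's) letter) lgraph \<Rightarrow> 'f \<Rightarrow> 'h \<Rightarrow> ('e, 's) letter word" where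
  "arc_rel A \<Gamma> f h = (case lab \<Gamma> f of Edge e \<Rightarrow> edge_rel A e h | Gen s \<Rightarrow> [])"

definition loop_index :: "('v, 'e, 'g, 'h, 's) presented_gog \<Rightarrow>
    ('n, 'f, ('e, 's) letter) lgraph \<Rightarrow> ('f \<times> 'h) set" where
  "loop_index A \<Gamma> =
     {(f, h). f \<in> arcs \<Gamma> \<and> (\<exists>e. lab \<Gamma> f = Edge e \<and> h \<in> carrier (egroup A e))}"

definition loop_pt :: "('v, 'e, 'g, 'h, 's) presented_gog \<Rightarrow>
    ('n, 'f, ('e, 's) letter) lgraph \<Rightarrow> 'f \<Rightarrow> 'h \<Rightarrow> nat \<Rightarrow> ('n, 'f, 'h) loop_node" where
  "loop_pt A \<Gamma> f h j =
     (if j = 0 \<or> j = length (arc_rel A \<Gamma> f h) then PrevNode (tail \<Gamma> f) else LoopNode f h j)"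

definition edge_saturate :: "('v, 'e, 'g, 'h, 's) presented_gog \<Rightarrow>
    ('n, 'f, ('e, 's) letter) lgraph \<Rightarrow>
    (('n, 'f, 'h) loop_node, ('f, 'h) loop_arc, ('e, 's) letter) lgraph" where
  "edge_saturate A \<Gamma> =
     \<lparr> verts = PrevNode ` verts \<Gamma> \<union>
         {loop_pt A \<Gamma> f h j | f h j. (f, h) \<in> loop_index A \<Gamma> \<and> j \<le> length (arc_rel A \<Gamma> f h)},
       arcs = PrevArc ` arcs \<Gamma> \<union>
         {LoopArc f h j | f h j. (f, h) \<in> loop_index A \<Gamma> \<and> j < length (arc_rel A \<Gamma> f h)},
       tail = (\<lambda>k. case k of PrevArc f \<Rightarrow> PrevNode (tail \<Gamma> f)
                 | LoopArc f h j \<Rightarrow> line_tail (arc_rel A \<Gamma> f h) (loop_pt A \<Gamma> f h) j),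
       head = (\<lambda>k. case k of PrevArc f \<Rightarrow> PrevNode (head \<Gamma> f)
                 | LoopArc f h j \<Rightarrow> line_head (arc_rel A \<Gamma> f h) (loop_pt A \<Gamma> f h) j),
       lab = (\<lambda>k. case k of PrevArc f \<Rightarrow> lab \<Gamma> f | LoopArc f h j \<Rightarrow> fst (arc_rel A \<Gamma> f h ! j)),
       base = PrevNode (base \<Gamma>) \<rparr>"

subsection \<open>Folding\<close>

type_synonym ('v, 'g, 's) sat_arc = "(bouquet_node, nat \<times> nat, 'v, 'g, 's) cay_arc"

type_synonym ('v, 'e, 'g, 'h, 's) out_graph =
  "(((bouquet_node, 'v, 'g) cay_node, ('v, 'g, 's) sat_arc, 'h) loop_node,
    (('v, 'g, 's) sat_arc, 'h) loop_arc, ('e, 's) letter) lgraph"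

text \<open>The order of the folds is left open, so the algorithm is a relation.\<close>

definition folding_output :: "('v, 'e, 'g, 'h, 's) presented_gog \<Rightarrow> 'v \<Rightarrow>
    ('e, 's) letter word list \<Rightarrow> ('v, 'e, 'g, 'h, 's) out_graph \<Rightarrow> bool" where
  "folding_output A v Ws \<Gamma> \<longleftrightarrow>
     fold_step\<^sup>*\<^sup>* (edge_saturate A (vertex_saturate A v (bouquet Ws))) \<Gamma> \<and>
     \<not> (\<exists>\<Gamma>'. fold_step \<Gamma> \<Gamma>')"

definition folding_input :: "('v, 'e, 'g, 'h, 's) presented_gog \<Rightarrow> 'v \<Rightarrow>
    ('e, 's) letter word list \<Rightarrow> bool" where
  "folding_input A v Ws \<longleftrightarrow> (\<forall>W \<in> set Ws. W \<in> words (alphabet A) \<and> bass_eval A W \<in> pi1 A v)"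


section \<open>Running time\<close>

subsection \<open>A pointer machine\<close>

text \<open>
  A value is the null pointer, a pointer to a memory record, or an integer. A program mentions
  only finitely many registers and record fields. Pointers can be copied, compared for equality
  and dereferenced; there is no pointer arithmetic. Each operation and each test takes one unit of
  time. An operation that produces an integer beyond the bound \<open>B\<close> gets stuck.
\<close>

datatype val = Null | Ref nat | Num int

record mstate =
  regs :: "nat \<Rightarrow> val"
  heap :: "nat \<Rightarrow> nat \<Rightarrow> val"
  free :: nat

datatype test = Equal nat nat | Less nat nat

datatype com =
    SetNull nat
  | SetNum nat int
  | Copy nat nat
  | New nat
  | Load nat nat nat
  | Store nat nat nat
  | Add nat nat nat
  | Sub nat nat nat
  | Seq com com
  | Cond test com com
  | While test com

fun test_holds :: "test \<Rightarrow> mstate \<Rightarrow> bool" where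
  "test_holds (Equal x y) s \<longleftrightarrow> regs s x = regs s y"
| "test_holds (Less x y) s \<longleftrightarrow> (\<exists>k l. regs s x = Num k \<and> regs s y = Num l \<and> k < l)"

definition set_reg :: "mstate \<Rightarrow> nat \<Rightarrow> val \<Rightarrow> mstate" where
  "set_reg s x a = s\<lparr>regs := (regs s)(x := a)\<rparr>"

text \<open>\<open>exec B c s t s'\<close>: run from \<open>s\<close>, the program \<open>c\<close> halts in \<open>s'\<close> after \<open>t\<close> units of time.\<close>

inductive exec :: "int \<Rightarrow> com \<Rightarrow> mstate \<Rightarrow> nat \<Rightarrow> mstate \<Rightarrow> bool" for B :: int where
  SetNull: "exec B (SetNull x) s 1 (set_reg s x Null)"
| SetNum: "\<bar>k\<bar> \<le> B \<Longrightarrow> exec B (SetNum x k) s 1 (set_reg s x (Num k))"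
| Copy: "exec B (Copy x y) s 1 (set_reg s x (regs s y))"
| New: "exec B (New x) s 1
    ((set_reg s x (Ref (free s)))\<lparr>heap := (heap s)(free s := (\<lambda>_. Null)), free := Suc (free s)\<rparr>)"
| Load: "regs s y = Ref p \<Longrightarrow> exec B (Load x y n) s 1 (set_reg s x (heap s p n))"
| Store: "regs s x = Ref p \<Longrightarrow>
    exec B (Store x n y) s 1 (s\<lparr>heap := (heap s)(p := (heap s p)(n := regs s y))\<rparr>)"
| Add: "regs s y = Num k \<Longrightarrow> regs s z = Num l \<Longrightarrow> \<bar>k + l\<bar> \<le> B \<Longrightarrow>
    exec B (Add x y z) s 1 (set_reg s x (Num (k + l)))"
| Sub: "regs s y = Num k \<Longrightarrow> regs s z = Num l \<Longrightarrow> \<bar>k - l\<bar> \<le> B \<Longrightarrow>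
    exec B (Sub x y z) s 1 (set_reg s x (Num (k - l)))"
| Seq: "exec B c s t s' \<Longrightarrow> exec B c' s' t' s'' \<Longrightarrow> exec B (Seq c c') s (t + t') s''"
| CondTrue: "test_holds b s \<Longrightarrow> exec B c s t s' \<Longrightarrow> exec B (Cond b c c') s (Suc t) s'"
| CondFalse: "\<not> test_holds b s \<Longrightarrow> exec B c' s t s' \<Longrightarrow> exec B (Cond b c c') s (Suc t) s'"
| WhileFalse: "\<not> test_holds b s \<Longrightarrow> exec B (While b c) s 1 s"
| WhileTrue: "test_holds b s \<Longrightarrow> exec B c s t s' \<Longrightarrow> exec B (While b c) s' t' s'' \<Longrightarrow>
    exec B (While b c) s (Suc (t + t')) s''"

subsection \<open>Input and output in memory\<close>

text \<open>
  The input is a linked list starting in register 0, with one record per letter: field 0 holds the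
  number of the letter, field 1 its sign, field 2 marks the last letter of a word, and field 3
  points to the next record. An empty word occupies no record, so the input has size \<open>N\<close>, the sum
  of the lengths of the words, also if the tuple contains empty words (whose linear graphs consist
  of the base point only).
\<close>

definition marked :: "'x word \<Rightarrow> (('x \<times> bool) \<times> bool) list" where
  "marked W = map (\<lambda>j. (W ! j, Suc j = length W)) [0..<length W]"

definition total_length :: "'x word list \<Rightarrow> nat" where
  "total_length Ws = sum_list (map length Ws)"

definition input_state :: "('x \<Rightarrow> nat) \<Rightarrow> 'x word list \<Rightarrow> mstate" where
  "input_state code Ws = (let L = concat (map marked Ws); N = length L in
     \<lparr> regs = (\<lambda>x. if x = 0 \<and> 0 < N then Ref 0 else Null),
       heap = (\<lambda>p n. if p < N then
           (if n = 0 then Num (int (code (fst (fst (L ! p)))))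
            else if n = 1 then Num (of_bool (snd (fst (L ! p))))
            else if n = 2 then Num (of_bool (snd (L ! p)))
            else if n = 3 \<and> Suc p < N then Ref (Suc p)
            else Null)
         else Null),
       free = N \<rparr>)"

text \<open>
  The memory represents a folded based graph: there is one record for each vertex, the base point
  being in register 0, and for a letter with number \<open>k\<close> the fields \<open>2k\<close> and \<open>2k + 1\<close> of a vertex
  point along the outgoing and against the incoming edge with this label, if there is one.
\<close>

definition represents_graph ::
    "('x \<Rightarrow> nat) \<Rightarrow> 'x set \<Rightarrow> mstate \<Rightarrow> ('n, 'f, 'x) lgraph \<Rightarrow> bool" where
  "represents_graph code X s \<Gamma> \<longleftrightarrow> (\<exists>adr. inj_on adr (verts \<Gamma>) \<and>
     (\<forall>p \<in> verts \<Gamma>. adr p < free s) \<and>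
     regs s 0 = Ref (adr (base \<Gamma>)) \<and>
     (\<forall>f \<in> arcs \<Gamma>.
        heap s (adr (tail \<Gamma> f)) (2 * code (lab \<Gamma> f)) = Ref (adr (head \<Gamma> f)) \<and>
        heap s (adr (head \<Gamma> f)) (2 * code (lab \<Gamma> f) + 1) = Ref (adr (tail \<Gamma> f))) \<and>
     (\<forall>p \<in> verts \<Gamma>. \<forall>x \<in> X.
        ((\<nexists>f. f \<in> arcs \<Gamma> \<and> lab \<Gamma> f = x \<and> tail \<Gamma> f = p) \<longrightarrow> heap s (adr p) (2 * code x) = Null) \<and>
        ((\<nexists>f. f \<in> arcs \<Gamma> \<and> lab \<Gamma> f = x \<and> head \<Gamma> f = p) \<longrightarrow> heap s (adr p) (2 * code x + 1) = Null)))"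

subsection \<open>The iterated logarithm\<close>

fun tower :: "nat \<Rightarrow> nat" where
  "tower 0 = 1"
| "tower (Suc n) = 2 ^ tower n"

definition log_star :: "nat \<Rightarrow> nat" where
  "log_star n = (LEAST m. n \<le> tower m)"

end

theory Submission
  imports Defs "HOL-Real_Asymp.Real_Asymp"
begin

text \<open>
  Membership. A folded graph with the label-preserving universal property of the saturated bouquet
  reads \<open>u\<close> from the base point exactly as a deterministic automaton would. Mapping the output to
  the Schreier coset graph of the subgroup \<open>H\<close> in the Bass group shows that only elements of \<open>H\<close> are
  read as loops. Conversely the saturated parts of the graph let every reduction step of a word be
  followed by its label, so that with a word for an element of \<open>H\<close> all reduced words for this
  element are read; that two reduced words for the same element have matching edge letters is the
  normal form theorem, obtained from van der Waerden's action of the Bass group on reduced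
  sequences of syllables.

  Time. It suffices to build any graph which has the same universal property. The program reads the
  input once, attaches at each letter the finitely many loops which encode the saturations (a graph
  that is folded contains a Cayley graph at a vertex iff it contains certain loops there), and merges
  vertices by union by rank with path halving; edges of merged vertices are reinserted from a
  worklist. Each union pays for itself through the potential of its new non-root, and the finds cost
  \<open>O(log* N)\<close> amortised, which gives the bound.
\<close>

section \<open>Groups given by generators and relators\<close>

section \<open>Words and presentations\<close>

text \<open>The graph \<open>\<Gamma>\<close> of the statement arises from an unspecified order of
  folds, whereas the program merges records in an order of its own. The two are never compared fold
  by fold. An arbitrary output is fixed before the run, and a ghost map from records to its vertices
  shows that each merge is forced; conversely the saturated graph maps to the graph left in memory,
  and this map survives the folds. Both maps fix the base point and every vertex is reachable, so
  the ghost map inverts the second one.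

  Graphs are therefore treated as edge relations that are deterministic in both directions, and
  saturation is rephrased by loops, a form that makes sense for cosets, for \<open>\<Gamma>\<close>
  and in memory alike.

  For reading, the difficulty is that two words for one element differ by elements of edge groups
  moved across edges. The relator loops give every edge a parallel edge for each element of its edge
  group, and reading follows these.

  The bound on integers forbids numerical ranks. Comparing unary ranks costs the smaller rank, so a
  further potential, linear in the number of nodes, covers the comparisons.\<close>

lemma words_Nil [simp]: "[] \<in> words X"
  and words_Cons [simp]: "a # u \<in> words X \<longleftrightarrow> fst a \<in> X \<and> u \<in> words X"
  and words_append [simp]: "u @ u' \<in> words X \<longleftrightarrow> u \<in> words X \<and> u' \<in> words X"
  by (auto simp: words_def mem_Times_iff)

lemma inv_word_Nil [simp]: "inv_word [] = []"
  and inv_word_Cons [simp]: "inv_word ((x, b) # u) = inv_word u @ [(x, \<not> b)]"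
  and inv_word_append [simp]: "inv_word (u @ u') = inv_word u' @ inv_word u"
  by (auto simp: inv_word_def)

lemma inv_word_words [simp]: "inv_word u \<in> words X \<longleftrightarrow> u \<in> words X"
  by (induction u) auto

lemma inv_word_inv_word [simp]: "inv_word (inv_word u) = u"
  by (induction u) auto

lemma pres_rel_words: "(u, u') \<in> pres_rel X R \<Longrightarrow> u \<in> words X \<and> u' \<in> words X"
  by (induction rule: pres_rel.induct) auto

lemma equiv_pres_rel: "equiv (words X) (pres_rel X R)"
  by (rule equivI)
    (auto simp: refl_on_def sym_def trans_def dest: pres_rel_words
      intro: pres_rel.refl pres_rel.sym pres_rel.trans)

lemma pres_rel_context:
  assumes "(u, u') \<in> pres_rel X R" "p \<in> words X" "q \<in> words X"
  shows "(p @ u @ q, p @ u' @ q) \<in> pres_rel X R"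
  using assms
proof (induction rule: pres_rel.induct)
  case (cancel p' q' x b)
  then show ?case
    using pres_rel.cancel[of "p @ p'" X "q' @ q" x b R] by simp
next
  case (relator p' q' r)
  then show ?case
    using pres_rel.relator[of "p @ p'" X "q' @ q" r R] by simp
qed (auto intro: pres_rel.intros)

lemma pres_rel_append:
  assumes "(u, u') \<in> pres_rel X R" "(w, w') \<in> pres_rel X R"
  shows "(u @ w, u' @ w') \<in> pres_rel X R"
  using pres_rel_context[OF assms(1), of "[]" w] pres_rel_context[OF assms(2), of u' "[]"]
    assms[THEN pres_rel_words] by (auto intro: pres_rel.trans)

lemma pres_rel_inv_right: "u \<in> words X \<Longrightarrow> (u @ inv_word u, []) \<in> pres_rel X R"
proof (induction u)
  case (Cons a u)
  obtain x b where a: "a = (x, b)" by force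
  have "([a] @ (u @ inv_word u) @ [(x, \<not> b)], [a] @ [] @ [(x, \<not> b)]) \<in> pres_rel X R"
    by (rule pres_rel_context) (use Cons a in auto)
  moreover have "([] @ [(x, b), (x, \<not> b)] @ [], [] @ []) \<in> pres_rel X R"
    by (rule pres_rel.cancel) (use Cons a in auto)
  ultimately show ?case using a by (auto intro: pres_rel.trans)
qed (auto intro: pres_rel.refl)

lemma pres_rel_inv_left: "u \<in> words X \<Longrightarrow> (inv_word u @ u, []) \<in> pres_rel X R"
  using pres_rel_inv_right[of "inv_word u" X R] by simp

lemma word_class_eq_iff:
  "u \<in> words X \<Longrightarrow> u' \<in> words X \<Longrightarrow>
     word_class X R u = word_class X R u' \<longleftrightarrow> (u, u') \<in> pres_rel X R"
  unfolding word_class_def using equiv_pres_rel eq_equiv_class_iff by metis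

lemma carrier_presented: "carrier (presented_group X R) = word_class X R ` words X"
  by (auto simp: presented_group_def quotient_def word_class_def)

lemma word_class_carrier [simp]: "u \<in> words X \<Longrightarrow> word_class X R u \<in> carrier (presented_group X R)"
  by (auto simp: carrier_presented)

lemma one_presented: "\<one>\<^bsub>presented_group X R\<^esub> = word_class X R []"
  by (simp add: presented_group_def)

text \<open>The product of classes is a union over all pairs of representatives. Compatibility of
  the congruence with concatenation makes all the united sets equal, so the union is a single
  class.\<close>

lemma mult_presented:
  assumes "u \<in> words X" "u' \<in> words X"
  shows "word_class X R u \<otimes>\<^bsub>presented_group X R\<^esub> word_class X R u' = word_class X R (u @ u')"
proof -
  have mem: "w \<in> word_class X R u \<longleftrightarrow> (u, w) \<in> pres_rel X R" for u w
    by (auto simp: word_class_def)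
  have "word_class X R (w @ w') = word_class X R (u @ u')"
    if "w \<in> word_class X R u" "w' \<in> word_class X R u'" for w w'
    using that assms pres_rel_append[of u w X R u' w']
    by (subst word_class_eq_iff) (auto simp: mem dest: pres_rel_words intro: pres_rel.sym)
  moreover have "u \<in> word_class X R u" "u' \<in> word_class X R u'"
    using assms by (auto simp: mem intro: pres_rel.refl)
  ultimately have "(\<Union>w\<in>word_class X R u. \<Union>w'\<in>word_class X R u'. word_class X R (w @ w'))
      = word_class X R (u @ u')"
    by (intro SUP_eq_const) blast+
  then show ?thesis
    by (simp add: presented_group_def)
qed

lemma group_presented: "group (presented_group X R)"
proof (rule groupI)
  fix c assume "c \<in> carrier (presented_group X R)"
  then obtain u where u: "u \<in> words X" "c = word_class X R u"
    by (auto simp: carrier_presented)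
  show "\<exists>d\<in>carrier (presented_group X R). d \<otimes>\<^bsub>presented_group X R\<^esub> c = \<one>\<^bsub>presented_group X R\<^esub>"
    by (rule bexI[of _ "word_class X R (inv_word u)"])
      (use u in \<open>auto simp: mult_presented one_presented word_class_eq_iff intro: pres_rel_inv_left\<close>)
qed (auto simp: carrier_presented mult_presented one_presented)

lemma inv_presented:
  assumes "u \<in> words X"
  shows "inv\<^bsub>presented_group X R\<^esub> word_class X R u = word_class X R (inv_word u)"
  using assms by (intro group.inv_equality[OF group_presented])
    (auto simp: mult_presented one_presented word_class_eq_iff intro: pres_rel_inv_left)

context
  fixes G :: "'g monoid" (structure)
  assumes group_G: "group G"
begin

interpretation group G by (rule group_G)

lemma eval_word_closed [simp]:
  assumes "\<And>x. x \<in> X \<Longrightarrow> val x \<in> carrier G"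
  shows "u \<in> words X \<Longrightarrow> eval_word G val u \<in> carrier G"
  using assms by (induction u) auto

lemma eval_word_append:
  assumes "\<And>x. x \<in> X \<Longrightarrow> val x \<in> carrier G" "u \<in> words X" "u' \<in> words X"
  shows "eval_word G val (u @ u') = eval_word G val u \<otimes> eval_word G val u'"
  using assms(2,3) by (induction u) (auto simp: m_assoc assms(1) eval_word_closed[OF assms(1)])

lemma eval_word_inv:
  assumes "\<And>x. x \<in> X \<Longrightarrow> val x \<in> carrier G" "u \<in> words X"
  shows "eval_word G val (inv_word u) = inv (eval_word G val u)"
  using assms(2)
proof (induction u)
  case (Cons a u)
  then show ?case
    by (cases a) (auto simp: eval_word_append[OF assms(1)] assms(1) inv_mult_group
        eval_word_closed[OF assms(1)])
qed auto

text \<open>A homomorphism preserves inverses, so its values on the positive letters determine it on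
  all words.\<close>

lemma eval_word_hom:
  assumes "\<phi> \<in> hom (presented_group X R) G"
    and "\<And>x. x \<in> X \<Longrightarrow> \<phi> (word_class X R [(x, True)]) = val x" and "u \<in> words X"
  shows "\<phi> (word_class X R u) = eval_word G val u"
proof -
  interpret P: group "presented_group X R" by (rule group_presented)
  interpret h: group_hom "presented_group X R" G \<phi>
    by (unfold_locales) (rule assms(1))
  show ?thesis using assms(3)
  proof (induction u)
    case Nil
    then show ?case using h.hom_one by (simp add: one_presented)
  next
    case (Cons a u)
    obtain x b where a: "a = (x, b)" by force
    have "\<phi> (word_class X R [a]) = (if b then val x else inv val x)"
    proof (cases b)
      case False
      have "\<phi> (word_class X R (inv_word [(x, True)])) = inv \<phi> (word_class X R [(x, True)])"
        using Cons.prems a by (subst inv_presented[symmetric]) (auto intro!: h.hom_inv)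
      then show ?thesis using assms(2)[of x] Cons.prems a False by simp
    qed (use assms(2)[of x] Cons.prems a in auto)
    moreover have "word_class X R (a # u)
        = word_class X R [a] \<otimes>\<^bsub>presented_group X R\<^esub> word_class X R u"
      using Cons.prems by (simp add: mult_presented)
    ultimately show ?case using Cons a by simp
  qed
qed

text \<open>Extracts from the isomorphism what is used afterwards: symbols name elements, every
  element is named by a word, and equality of values is derivability from the relators.\<close>

lemma presentation_facts:
  assumes "is_presentation val X R G"
  shows "x \<in> X \<Longrightarrow> val x \<in> carrier G"
    and "a \<in> carrier G \<Longrightarrow> \<exists>u\<in>words X. eval_word G val u = a"
    and "u \<in> words X \<Longrightarrow> u' \<in> words X \<Longrightarrow>
      eval_word G val u = eval_word G val u' \<longleftrightarrow> (u, u') \<in> pres_rel X R"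
proof -
  obtain \<phi> where \<phi>: "\<phi> \<in> iso (presented_group X R) G"
      "\<And>x. x \<in> X \<Longrightarrow> \<phi> (word_class X R [(x, True)]) = val x"
    using assms by (auto simp: is_presentation_def)
  have h: "\<phi> \<in> hom (presented_group X R) G"
    and bij: "bij_betw \<phi> (carrier (presented_group X R)) (carrier G)"
    using \<phi>(1) by (auto simp: iso_def)
  note ev = eval_word_hom[OF h \<phi>(2)]
  show "x \<in> X \<Longrightarrow> val x \<in> carrier G"
    using h \<phi>(2)[of x] hom_in_carrier[of \<phi> "presented_group X R" G "word_class X R [(x, True)]"] by simp
  show "a \<in> carrier G \<Longrightarrow> \<exists>u\<in>words X. eval_word G val u = a"
    using bij ev unfolding bij_betw_def
    by (auto simp: carrier_presented image_image) (metis imageE)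
  show "eval_word G val u = eval_word G val u' \<longleftrightarrow> (u, u') \<in> pres_rel X R"
    if "u \<in> words X" "u' \<in> words X"
    using that bij ev inj_on_eq_iff[of \<phi> "carrier (presented_group X R)"] word_class_eq_iff
    unfolding bij_betw_def by (metis word_class_carrier)
qed

end

section \<open>Normal forms for the Bass group\<close>

section \<open>The Bass group acts on normal forms\<close>

text \<open>A state is a stack whose head is the most recent syllable, since words act letter by
  letter starting with the first. Vertex syllables record their vertex because a word over the whole
  alphabet need not follow a path of the graph of groups.\<close>

datatype ('v, 'e, 'g) syllable = VS 'v 'g | ES "'e \<times> bool"

abbreviation flip :: "'e \<times> bool \<Rightarrow> 'e \<times> bool" where
  "flip d \<equiv> (fst d, \<not> snd d)"

lemma gen_word_simps [simp]:
  "gen_word [] = []" "gen_word ((s, b) # u) = (Gen s, b) # gen_word u"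
  "gen_word (u @ u') = gen_word u @ gen_word u'"
  by (auto simp: gen_word_def)

lemma inv_word_gen_word: "inv_word (gen_word u) = gen_word (inv_word u)"
  by (induction u) auto

locale gog =
  fixes A :: "('v, 'e, 'g, 'h, 's) presented_gog" and v :: 'v
  assumes presented: "is_presented_gog A"
    and fin_digraph: "fin_digraph (dgraph A)"
    and finite_vgroup: "w \<in> verts (dgraph A) \<Longrightarrow> finite (carrier (vgroup A w))"
    and v_vert: "v \<in> verts (dgraph A)"
begin

abbreviation "V \<equiv> verts (dgraph A)"
abbreviation "Es \<equiv> arcs (dgraph A)"
abbreviation "gs w \<equiv> set (gens A w)"
abbreviation "val \<equiv> gen_val A"
abbreviation "ev w \<equiv> eval_word (vgroup A w) (gen_val A)"
abbreviation "X \<equiv> alphabet A"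
abbreviation "src \<equiv> oinit (dgraph A)"
abbreviation "tgt d \<equiv> src (flip d)"
abbreviation "Eg d \<equiv> egroup A (fst d)"

text \<open>For an oriented edge \<open>d\<close> this is the embedding of the edge group at its
  initial vertex; \<open>om d\<close> is the one at its terminal vertex. Every later statement about
  \<open>d\<close> thus covers \<open>e\<close> and its inverse at once.\<close>

definition im :: "'e \<times> bool \<Rightarrow> 'h \<Rightarrow> 'g" where
  "im d = (if snd d then imap A (fst d) else tmap A (fst d))"

abbreviation "om d \<equiv> im (flip d)"

lemma oterm_eq: "oterm (dgraph A) d = tgt d"
  by (simp add: oterm_def oinit_def)

lemma src_vert [simp]: "fst d \<in> Es \<Longrightarrow> src d \<in> V"
  using fin_digraph by (auto simp: oinit_def fin_digraph_def wf_digraph_def)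

lemma head_tail_vert [simp]: "e \<in> Es \<Longrightarrow> head (dgraph A) e \<in> V" "e \<in> Es \<Longrightarrow> tail (dgraph A) e \<in> V"
  using fin_digraph by (auto simp: fin_digraph_def wf_digraph_def)

lemma finite_V: "finite V" and finite_Es: "finite Es"
  using fin_digraph by (auto simp: fin_digraph.finite_verts fin_digraph.finite_arcs)

lemma group_vgroup: "w \<in> V \<Longrightarrow> group (vgroup A w)"
  and group_egroup: "e \<in> Es \<Longrightarrow> group (egroup A e)"
  using presented by (auto simp: is_presented_gog_def is_graph_of_groups_def)

lemma im_hom: "fst d \<in> Es \<Longrightarrow> group_hom (Eg d) (vgroup A (src d)) (im d)"
  and im_inj: "fst d \<in> Es \<Longrightarrow> inj_on (im d) (carrier (Eg d))"
proof -
  have "im d \<in> mon (Eg d) (vgroup A (src d))" if "fst d \<in> Es"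
    using presented that unfolding is_presented_gog_def is_graph_of_groups_def
    by (cases "snd d") (simp_all add: im_def oinit_def)
  then show "fst d \<in> Es \<Longrightarrow> group_hom (Eg d) (vgroup A (src d)) (im d)"
    and "fst d \<in> Es \<Longrightarrow> inj_on (im d) (carrier (Eg d))"
    using group_vgroup[of "src d"] group_egroup[of "fst d"]
    by (simp_all add: mon_def group_hom_def group_hom_axioms_def)
qed

lemma im_closed [simp]: "fst d \<in> Es \<Longrightarrow> h \<in> carrier (Eg d) \<Longrightarrow> im d h \<in> carrier (vgroup A (src d))"
  by (rule group_hom.hom_closed[OF im_hom])

lemma om_closed [simp]: "fst d \<in> Es \<Longrightarrow> h \<in> carrier (Eg d) \<Longrightarrow> om d h \<in> carrier (vgroup A (tgt d))"
  using im_closed[of "flip d"] by simp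

text \<open>The edge group embeds in a finite vertex group; hence only finitely many relator loops
  belong to each edge letter.\<close>

lemma finite_egroup: "e \<in> Es \<Longrightarrow> finite (carrier (egroup A e))"
  using im_inj[of "(e, True)"] im_closed[of "(e, True)"] finite_vgroup[of "src (e, True)"]
  by (intro inj_on_finite[of "im (e, True)" _ "carrier (vgroup A (src (e, True)))"]) auto

lemma presentation: "w \<in> V \<Longrightarrow> is_presentation val (gs w) (rels A w) (vgroup A w)"
  using presented by (auto simp: is_presented_gog_def)

lemma rels_words: "w \<in> V \<Longrightarrow> r \<in> rels A w \<Longrightarrow> r \<in> words (gs w)"
  using presentation by (auto simp: is_presentation_def)

lemma val_closed: "w \<in> V \<Longrightarrow> s \<in> gs w \<Longrightarrow> val s \<in> carrier (vgroup A w)"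
  and ev_surj: "w \<in> V \<Longrightarrow> a \<in> carrier (vgroup A w) \<Longrightarrow> \<exists>u\<in>words (gs w). ev w u = a"
  and ev_eq_iff: "w \<in> V \<Longrightarrow> u \<in> words (gs w) \<Longrightarrow> u' \<in> words (gs w) \<Longrightarrow>
    ev w u = ev w u' \<longleftrightarrow> (u, u') \<in> pres_rel (gs w) (rels A w)"
  using presentation_facts[OF group_vgroup presentation] by blast+

lemma ev_closed [simp]: "w \<in> V \<Longrightarrow> u \<in> words (gs w) \<Longrightarrow> ev w u \<in> carrier (vgroup A w)"
  using eval_word_closed[OF group_vgroup, of w "gs w" val u] val_closed by blast

lemma ev_append: "w \<in> V \<Longrightarrow> u \<in> words (gs w) \<Longrightarrow> u' \<in> words (gs w) \<Longrightarrow>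
    ev w (u @ u') = ev w u \<otimes>\<^bsub>vgroup A w\<^esub> ev w u'"
  using eval_word_append[OF group_vgroup, of w "gs w" val u u'] val_closed by blast

lemma ev_inv: "w \<in> V \<Longrightarrow> u \<in> words (gs w) \<Longrightarrow>
    ev w (inv_word u) = inv\<^bsub>vgroup A w\<^esub> ev w u"
  using eval_word_inv[OF group_vgroup, of w "gs w" val u] val_closed by blast

lemma gens_vertex_unique: "w \<in> V \<Longrightarrow> w' \<in> V \<Longrightarrow> s \<in> gs w \<Longrightarrow> s \<in> gs w' \<Longrightarrow> w = w'"
  using presented unfolding is_presented_gog_def by blast

definition hword :: "'e \<times> bool \<Rightarrow> 'h \<Rightarrow> 's word" where
  "hword d h = (if snd d then iword A (fst d) h else tword A (fst d) h)"

lemma hword: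
  assumes "fst d \<in> Es" "h \<in> carrier (Eg d)"
  shows "hword d h \<in> words (gs (src d))" "ev (src d) (hword d h) = im d h"
  using presented assms by (auto simp: is_presented_gog_def hword_def im_def oinit_def)

lemma edge_rel_eq: "edge_rel A e h = [(Edge e, True)] @ gen_word (hword (e, False) h) @
     [(Edge e, False)] @ inv_word (gen_word (hword (e, True) h))"
  by (simp add: edge_rel_def hword_def)

lemma Edge_in_X [simp]: "Edge e \<in> X \<longleftrightarrow> e \<in> Es"
  by (auto simp: alphabet_def)

lemma Gen_in_X: "Gen s \<in> X \<longleftrightarrow> (\<exists>w\<in>V. s \<in> gs w)"
  by (auto simp: alphabet_def)

lemma gen_word_in_X [simp]: "w \<in> V \<Longrightarrow> u \<in> words (gs w) \<Longrightarrow> gen_word u \<in> words X"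
  by (induction u) (auto simp: Gen_in_X)

lemma edge_rel_words: "e \<in> Es \<Longrightarrow> h \<in> carrier (egroup A e) \<Longrightarrow> edge_rel A e h \<in> words X"
  using hword[of "(e, True)" h] hword[of "(e, False)" h]
  by (auto simp: edge_rel_eq oinit_def gen_word_in_X[of "head (dgraph A) e"]
      gen_word_in_X[of "tail (dgraph A) e"])

lemma relators_words: "r \<in> relators A \<Longrightarrow> r \<in> words X"
  using rels_words by (auto simp: relators_def edge_rel_words)

subsection \<open>Coset representatives\<close>

text \<open>Left coset representatives of the image of the edge group. The trivial coset gets the
  identity, so that an element of the image leaves no syllable in front of an edge and a
  backtracking pair of edges becomes adjacent.\<close>

definition crep :: "'e \<times> bool \<Rightarrow> 'g \<Rightarrow> 'g" where
  "crep d a = (if a \<in> im d ` carrier (Eg d) then \<one>\<^bsub>vgroup A (src d)\<^esub>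
     else SOME r. r \<in> carrier (vgroup A (src d)) \<and>
       (\<exists>h\<in>carrier (Eg d). a = r \<otimes>\<^bsub>vgroup A (src d)\<^esub> im d h))"

definition cpart :: "'e \<times> bool \<Rightarrow> 'g \<Rightarrow> 'h" where
  "cpart d a = (SOME h. h \<in> carrier (Eg d) \<and> a = crep d a \<otimes>\<^bsub>vgroup A (src d)\<^esub> im d h)"

context
  fixes d :: "'e \<times> bool" assumes d: "fst d \<in> Es"
begin

interpretation G: group "vgroup A (src d)" using d by (simp add: group_vgroup)
interpretation H: group "Eg d" using d by (simp add: group_egroup)
interpretation i: group_hom "Eg d" "vgroup A (src d)" "im d" using d by (rule im_hom)

lemma crep_mult:
  assumes "a \<in> carrier (vgroup A (src d))" "h \<in> carrier (Eg d)"
  shows "crep d (a \<otimes>\<^bsub>vgroup A (src d)\<^esub> im d h) = crep d a"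
proof -
  let ?b = "a \<otimes>\<^bsub>vgroup A (src d)\<^esub> im d h"
  \<comment> \<open>The predicate inside \<open>SOME\<close> describes the coset, so it suffices
    that \<open>a\<close> and its product with \<open>im d h\<close> satisfy it for the same
    \<open>r\<close>.\<close>
  have *: "\<exists>k\<in>carrier (Eg d). ?b = r \<otimes>\<^bsub>vgroup A (src d)\<^esub> im d k"
    if "r \<in> carrier (vgroup A (src d))" "k \<in> carrier (Eg d)" "a = r \<otimes>\<^bsub>vgroup A (src d)\<^esub> im d k" for r k
    using that assms by (intro bexI[of _ "k \<otimes>\<^bsub>Eg d\<^esub> h"]) (auto simp: G.m_assoc)
  have **: "\<exists>k\<in>carrier (Eg d). a = r \<otimes>\<^bsub>vgroup A (src d)\<^esub> im d k"
    if "r \<in> carrier (vgroup A (src d))" "k \<in> carrier (Eg d)" "?b = r \<otimes>\<^bsub>vgroup A (src d)\<^esub> im d k" for r k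
  proof (intro bexI[of _ "k \<otimes>\<^bsub>Eg d\<^esub> inv\<^bsub>Eg d\<^esub> h"])
    have "a = ?b \<otimes>\<^bsub>vgroup A (src d)\<^esub> im d (inv\<^bsub>Eg d\<^esub> h)"
      using assms by (simp add: G.m_assoc)
    then show "a = r \<otimes>\<^bsub>vgroup A (src d)\<^esub> im d (k \<otimes>\<^bsub>Eg d\<^esub> inv\<^bsub>Eg d\<^esub> h)"
      using that assms by (simp add: G.m_assoc)
  qed (use that assms in auto)
  have im1: "a \<in> im d ` carrier (Eg d) \<longleftrightarrow> (\<exists>k\<in>carrier (Eg d). a = \<one>\<^bsub>vgroup A (src d)\<^esub> \<otimes>\<^bsub>vgroup A (src d)\<^esub> im d k)"
    and im2: "?b \<in> im d ` carrier (Eg d) \<longleftrightarrow> (\<exists>k\<in>carrier (Eg d). ?b = \<one>\<^bsub>vgroup A (src d)\<^esub> \<otimes>\<^bsub>vgroup A (src d)\<^esub> im d k)"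
    by (auto simp: image_iff)
  have "?b \<in> im d ` carrier (Eg d) \<longleftrightarrow> a \<in> im d ` carrier (Eg d)"
    unfolding im1 im2 using * ** by blast
  moreover have "(r \<in> carrier (vgroup A (src d)) \<and> (\<exists>k\<in>carrier (Eg d). ?b = r \<otimes>\<^bsub>vgroup A (src d)\<^esub> im d k)) =
     (r \<in> carrier (vgroup A (src d)) \<and> (\<exists>k\<in>carrier (Eg d). a = r \<otimes>\<^bsub>vgroup A (src d)\<^esub> im d k))" for r
    using * ** by blast
  ultimately show ?thesis
    by (simp add: crep_def)
qed

lemma crep_cpart:
  assumes "a \<in> carrier (vgroup A (src d))"
  shows "crep d a \<in> carrier (vgroup A (src d))" "cpart d a \<in> carrier (Eg d)"
    "a = crep d a \<otimes>\<^bsub>vgroup A (src d)\<^esub> im d (cpart d a)"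
proof -
  have ex: "\<exists>r. r \<in> carrier (vgroup A (src d)) \<and>
       (\<exists>h\<in>carrier (Eg d). a = r \<otimes>\<^bsub>vgroup A (src d)\<^esub> im d h)"
    using assms by (intro exI[of _ a] conjI bexI[of _ "\<one>\<^bsub>Eg d\<^esub>"]) auto
  have c: "crep d a \<in> carrier (vgroup A (src d)) \<and>
       (\<exists>h\<in>carrier (Eg d). a = crep d a \<otimes>\<^bsub>vgroup A (src d)\<^esub> im d h)"
    using someI_ex[OF ex] by (auto simp: crep_def image_iff)
  then show "crep d a \<in> carrier (vgroup A (src d))" by blast
  have "cpart d a \<in> carrier (Eg d) \<and> a = crep d a \<otimes>\<^bsub>vgroup A (src d)\<^esub> im d (cpart d a)"
    unfolding cpart_def by (rule someI_ex) (use c in blast)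
  then show "cpart d a \<in> carrier (Eg d)" "a = crep d a \<otimes>\<^bsub>vgroup A (src d)\<^esub> im d (cpart d a)" by blast+
qed

lemma cpart_eq:
  assumes "r \<in> carrier (vgroup A (src d))" "crep d r = r" "h \<in> carrier (Eg d)"
  shows "crep d (r \<otimes>\<^bsub>vgroup A (src d)\<^esub> im d h) = r" "cpart d (r \<otimes>\<^bsub>vgroup A (src d)\<^esub> im d h) = h"
proof -
  let ?b = "r \<otimes>\<^bsub>vgroup A (src d)\<^esub> im d h"
  show *: "crep d ?b = r" using assms crep_mult by simp
  have "cpart d ?b \<in> carrier (Eg d)" "?b = r \<otimes>\<^bsub>vgroup A (src d)\<^esub> im d (cpart d ?b)"
    using crep_cpart[of ?b] * assms by auto
  then show "cpart d ?b = h"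
    using assms im_inj[OF d] by (auto dest!: inj_onD)
qed

lemma crep_idem:
  assumes "a \<in> carrier (vgroup A (src d))"
  shows "crep d (crep d a) = crep d a"
  using crep_mult[of "crep d a" "cpart d a"] crep_cpart[OF assms] by simp

lemma crep_one: "crep d \<one>\<^bsub>vgroup A (src d)\<^esub> = \<one>\<^bsub>vgroup A (src d)\<^esub>"
  using imageI[OF H.one_closed, of "im d"] unfolding crep_def by simp

lemma crep_im: "h \<in> carrier (Eg d) \<Longrightarrow> crep d (im d h) = \<one>\<^bsub>vgroup A (src d)\<^esub>"
  and cpart_im: "h \<in> carrier (Eg d) \<Longrightarrow> cpart d (im d h) = h"
  using cpart_eq[of "\<one>\<^bsub>vgroup A (src d)\<^esub>" h] crep_one by auto

end

subsection \<open>States and the action of letters\<close>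

fun split :: "'v \<Rightarrow> ('v, 'e, 'g) syllable list \<Rightarrow> ('v, 'e, 'g) syllable list \<times> 'g" where
  "split w (VS w' a # \<sigma>) = (if w' = w then (\<sigma>, a) else (VS w' a # \<sigma>, \<one>\<^bsub>vgroup A w\<^esub>))"
| "split w \<sigma> = (\<sigma>, \<one>\<^bsub>vgroup A w\<^esub>)"

definition join :: "'v \<Rightarrow> ('v, 'e, 'g) syllable list \<Rightarrow> 'g \<Rightarrow> ('v, 'e, 'g) syllable list" where
  "join w \<sigma> a = (if a = \<one>\<^bsub>vgroup A w\<^esub> then \<sigma> else VS w a # \<sigma>)"

fun no_top :: "'v \<Rightarrow> ('v, 'e, 'g) syllable list \<Rightarrow> bool" where
  "no_top w (VS w' a # \<sigma>) \<longleftrightarrow> w' \<noteq> w"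
| "no_top w \<sigma> \<longleftrightarrow> True"

text \<open>The condition under which appending \<open>d\<close> undoes the last edge:
  \<open>r\<close> is the representative of the vertex element, so \<open>r = 1\<close> says that
  this element lies in the image of the edge group.\<close>

definition pinch :: "'e \<times> bool \<Rightarrow> ('v, 'e, 'g) syllable list \<Rightarrow> 'g \<Rightarrow> bool" where
  "pinch d \<sigma> r \<longleftrightarrow> r = \<one>\<^bsub>vgroup A (src d)\<^esub> \<and> (\<exists>\<rho>. \<sigma> = ES (flip d) # \<rho>)"

fun valid :: "('v, 'e, 'g) syllable list \<Rightarrow> bool" where
  "valid [] \<longleftrightarrow> True"
| "valid (VS w a # \<sigma>) \<longleftrightarrow>
     w \<in> V \<and> a \<in> carrier (vgroup A w) \<and> a \<noteq> \<one>\<^bsub>vgroup A w\<^esub> \<and> valid \<sigma> \<and> no_top w \<sigma>"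
| "valid (ES d # \<sigma>) \<longleftrightarrow> fst d \<in> Es \<and> valid \<sigma> \<and>
     crep d (snd (split (src d) \<sigma>)) = snd (split (src d) \<sigma>) \<and>
     \<not> pinch d (fst (split (src d) \<sigma>)) (snd (split (src d) \<sigma>))"

definition act_vertex :: "'v \<Rightarrow> 'g \<Rightarrow> ('v, 'e, 'g) syllable list \<Rightarrow> ('v, 'e, 'g) syllable list" where
  "act_vertex w b \<sigma> = join w (fst (split w \<sigma>)) (snd (split w \<sigma>) \<otimes>\<^bsub>vgroup A w\<^esub> b)"

text \<open>The edge relation reads \<open>im d h * d = d * om d h\<close>. The vertex element is
  split into a representative, which stays in front of \<open>d\<close>, and an edge group part,
  which crosses to the other side.\<close>

definition act_edge :: "'e \<times> bool \<Rightarrow> ('v, 'e, 'g) syllable list \<Rightarrow> ('v, 'e, 'g) syllable list" where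
  "act_edge d \<sigma> = (let (\<sigma>', a) = split (src d) \<sigma> in
     if pinch d \<sigma>' (crep d a) then act_vertex (tgt d) (om d (cpart d a)) (tl \<sigma>')
     else join (tgt d) (ES d # join (src d) \<sigma>' (crep d a)) (om d (cpart d a)))"

lemma split_join: "no_top w \<sigma> \<Longrightarrow> split w (join w \<sigma> a) = (\<sigma>, a)"
  by (cases "(w, \<sigma>)" rule: split.cases) (auto simp: join_def)

lemma split_obtain:
  assumes "valid \<sigma>" "w \<in> V"
  obtains \<sigma>' a where "\<sigma> = join w \<sigma>' a" "no_top w \<sigma>'" "valid \<sigma>'" "a \<in> carrier (vgroup A w)"
proof -
  interpret group "vgroup A w" using assms by (simp add: group_vgroup)
  show ?thesis
  proof (cases "no_top w \<sigma>")
    case True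
    then show ?thesis using that[of \<sigma> "\<one>\<^bsub>vgroup A w\<^esub>"] assms by (simp add: join_def)
  next
    case False
    then obtain a \<sigma>' where "\<sigma> = VS w a # \<sigma>'"
      by (cases "(w, \<sigma>)" rule: no_top.cases) auto
    then show ?thesis using that[of \<sigma>' a] assms by (simp add: join_def)
  qed
qed

lemma valid_join:
  "valid \<sigma> \<Longrightarrow> no_top w \<sigma> \<Longrightarrow> a \<in> carrier (vgroup A w) \<Longrightarrow> w \<in> V \<Longrightarrow> valid (join w \<sigma> a)"
  by (simp add: join_def)

lemma act_vertex_join:
  "no_top w \<sigma> \<Longrightarrow> act_vertex w b (join w \<sigma> a) = join w \<sigma> (a \<otimes>\<^bsub>vgroup A w\<^esub> b)"
  by (simp add: act_vertex_def split_join)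

lemma valid_act_vertex:
  assumes "valid \<sigma>" "w \<in> V" "b \<in> carrier (vgroup A w)"
  shows "valid (act_vertex w b \<sigma>)"
proof -
  interpret group "vgroup A w" using assms by (simp add: group_vgroup)
  from split_obtain[OF assms(1,2)] show ?thesis
    by (metis act_vertex_join assms(2,3) m_closed valid_join)
qed

lemma act_vertex_mult:
  assumes "valid \<sigma>" "w \<in> V" "b \<in> carrier (vgroup A w)" "c \<in> carrier (vgroup A w)"
  shows "act_vertex w c (act_vertex w b \<sigma>) = act_vertex w (b \<otimes>\<^bsub>vgroup A w\<^esub> c) \<sigma>"
proof -
  interpret group "vgroup A w" using assms by (simp add: group_vgroup)
  from split_obtain[OF assms(1,2)] show ?thesis
    by (metis act_vertex_join assms(3,4) m_assoc)
qed

lemma act_vertex_one: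
  assumes "valid \<sigma>" "w \<in> V"
  shows "act_vertex w \<one>\<^bsub>vgroup A w\<^esub> \<sigma> = \<sigma>"
proof -
  interpret group "vgroup A w" using assms by (simp add: group_vgroup)
  from split_obtain[OF assms(1,2)] show ?thesis
    by (metis act_vertex_join r_one)
qed

lemma valid_ES_join:
  assumes "valid \<sigma>" "no_top (src d) \<sigma>" "r \<in> carrier (vgroup A (src d))" "fst d \<in> Es"
  shows "valid (ES d # join (src d) \<sigma> r) \<longleftrightarrow> crep d r = r \<and> \<not> pinch d \<sigma> r"
  using assms by (auto simp: split_join valid_join)

lemma act_edge_push:
  assumes "no_top (src d) \<sigma>" "fst d \<in> Es" "r \<in> carrier (vgroup A (src d))" "crep d r = r"
    "h \<in> carrier (Eg d)" "\<not> pinch d \<sigma> r"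
  shows "act_edge d (join (src d) \<sigma> (r \<otimes>\<^bsub>vgroup A (src d)\<^esub> im d h))
    = join (tgt d) (ES d # join (src d) \<sigma> r) (om d h)"
  using assms by (simp add: act_edge_def split_join cpart_eq)

lemma act_edge_pinch:
  assumes "fst d \<in> Es" "h \<in> carrier (Eg d)"
  shows "act_edge d (join (src d) (ES (flip d) # \<rho>) (im d h)) = act_vertex (tgt d) (om d h) \<rho>"
  using assms by (simp add: act_edge_def split_join crep_im cpart_im pinch_def)

text \<open>The two shapes of a state in front of \<open>d\<close>, with the coset decomposition
  already made; the laws of the action below are checked on these shapes.\<close>

lemma act_edge_cases:
  assumes "valid \<sigma>" "fst d \<in> Es"
  obtains
    (push) \<sigma>' r h where "\<sigma> = join (src d) \<sigma>' (r \<otimes>\<^bsub>vgroup A (src d)\<^esub> im d h)"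
      "no_top (src d) \<sigma>'" "valid \<sigma>'" "r \<in> carrier (vgroup A (src d))" "crep d r = r"
      "h \<in> carrier (Eg d)" "\<not> pinch d \<sigma>' r"
  | (pinch) \<rho> h where "\<sigma> = join (src d) (ES (flip d) # \<rho>) (im d h)"
      "valid (ES (flip d) # \<rho>)" "h \<in> carrier (Eg d)"
proof -
  interpret group "vgroup A (src d)" using assms by (simp add: group_vgroup)
  obtain \<sigma>' a where *: "\<sigma> = join (src d) \<sigma>' a" "no_top (src d) \<sigma>'" "valid \<sigma>'"
      "a \<in> carrier (vgroup A (src d))"
    using split_obtain[OF assms(1), of "src d"] assms(2) by auto
  note c = crep_cpart[OF assms(2) *(4)] crep_idem[OF assms(2) *(4)]
  show ?thesis
  proof (cases "pinch d \<sigma>' (crep d a)")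
    case True
    then obtain \<rho> where "\<sigma>' = ES (flip d) # \<rho>" "crep d a = \<one>\<^bsub>vgroup A (src d)\<^esub>"
      by (auto simp: pinch_def)
    then show ?thesis using pinch[of \<rho> "cpart d a"] * c assms(2) by simp
  next
    case False
    then show ?thesis using push[of \<sigma>' "crep d a" "cpart d a"] * c by simp
  qed
qed

lemma valid_act_edge:
  assumes "valid \<sigma>" "fst d \<in> Es"
  shows "valid (act_edge d \<sigma>)"
  using assms
proof (cases rule: act_edge_cases)
  case (push \<sigma>' r h)
  then show ?thesis
    using assms act_edge_push[of d \<sigma>' r h] valid_ES_join[of \<sigma>' d r] src_vert[of "flip d"]
      om_closed[of d h]
    by (auto intro!: valid_join simp del: valid.simps)
next
  case (pinch \<rho> h)
  then show ?thesis
    using assms act_edge_pinch[of d h \<rho>] src_vert[of "flip d"] om_closed[of d h]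
    by (auto intro!: valid_act_vertex)
qed

text \<open>A pushed edge is pinched by its inverse. After a pinch the inverse is pushed again: the
  vertex element before the removed edge was a representative without pinch, because the old state
  was valid.\<close>

lemma act_edge_flip:
  assumes "valid \<sigma>" "fst d \<in> Es"
  shows "act_edge (flip d) (act_edge d \<sigma>) = \<sigma>"
  using assms
proof (cases rule: act_edge_cases)
  case (push \<sigma>' r h)
  then have "act_edge d \<sigma> = join (tgt d) (ES d # join (src d) \<sigma>' r) (om d h)"
    using assms act_edge_push by simp
  then show ?thesis
    using act_edge_pinch[of "flip d" h "join (src d) \<sigma>' r"] push assms
    by (simp add: act_vertex_join)
next
  case (pinch \<rho> h)
  let ?d = "flip d"
  have d': "fst ?d \<in> Es" using assms by simp
  obtain \<rho>' r where \<rho>: "\<rho> = join (src ?d) \<rho>' r" "no_top (src ?d) \<rho>'" "valid \<rho>'"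
      "r \<in> carrier (vgroup A (src ?d))"
    using split_obtain[of \<rho> "src ?d"] pinch assms by auto
  then have r: "crep ?d r = r" "\<not> pinch ?d \<rho>' r"
    using pinch(2) valid_ES_join[of \<rho>' ?d r] assms by auto
  have "act_edge d \<sigma> = join (src ?d) \<rho>' (r \<otimes>\<^bsub>vgroup A (src ?d)\<^esub> im ?d h)"
    using pinch \<rho> assms by (simp add: act_edge_pinch act_vertex_join)
  then show ?thesis
    using act_edge_push[of ?d \<rho>' r h] pinch \<rho> r assms by simp
qed

text \<open>The edge relators in terms of the action: an element of the edge group may be applied
  before the edge or, on the far side, after it.\<close>

lemma act_edge_equivariant:
  assumes "valid \<sigma>" "fst d \<in> Es" "k \<in> carrier (Eg d)"
  shows "act_edge d (act_vertex (src d) (im d k) \<sigma>) = act_vertex (tgt d) (om d k) (act_edge d \<sigma>)"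
proof -
  interpret G: group "vgroup A (src d)" using assms by (simp add: group_vgroup)
  interpret H: group "Eg d" using assms by (simp add: group_egroup)
  interpret i: group_hom "Eg d" "vgroup A (src d)" "im d" using assms by (simp add: im_hom)
  interpret o: group_hom "Eg d" "vgroup A (tgt d)" "om d" using im_hom[of "flip d"] assms by simp
  from assms(1,2) show ?thesis
  proof (cases rule: act_edge_cases)
    case (push \<sigma>' r h)
    have "act_vertex (src d) (im d k) \<sigma> = join (src d) \<sigma>' (r \<otimes>\<^bsub>vgroup A (src d)\<^esub> im d (h \<otimes>\<^bsub>Eg d\<^esub> k))"
      using push assms by (simp add: act_vertex_join G.m_assoc)
    then show ?thesis
      using act_edge_push[of d \<sigma>' r "h \<otimes>\<^bsub>Eg d\<^esub> k"] act_edge_push[of d \<sigma>' r h] push assms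
      by (simp add: act_vertex_join)
  next
    case (pinch \<rho> h)
    have "act_vertex (src d) (im d k) \<sigma> = join (src d) (ES (flip d) # \<rho>) (im d (h \<otimes>\<^bsub>Eg d\<^esub> k))"
      using pinch assms by (simp add: act_vertex_join)
    then show ?thesis
      using pinch assms act_vertex_mult[of \<rho> "tgt d" "om d h" "om d k"]
        act_edge_pinch[of d "h \<otimes>\<^bsub>Eg d\<^esub> k" \<rho>]
      by (simp add: act_edge_pinch)
  qed
qed

definition vert_of :: "'s \<Rightarrow> 'v" where
  "vert_of s = (THE w. w \<in> V \<and> s \<in> gs w)"

lemma vert_of: "w \<in> V \<Longrightarrow> s \<in> gs w \<Longrightarrow> vert_of s = w"
  unfolding vert_of_def using gens_vertex_unique by blast

fun act :: "('e, 's) letter \<times> bool \<Rightarrow> ('v, 'e, 'g) syllable list \<Rightarrow> ('v, 'e, 'g) syllable list" where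
  "act (Gen s, b) = act_vertex (vert_of s) (if b then val s else inv\<^bsub>vgroup A (vert_of s)\<^esub> val s)"
| "act (Edge e, b) = act_edge (e, b)"

definition acts :: "('e, 's) letter word \<Rightarrow> ('v, 'e, 'g) syllable list \<Rightarrow> ('v, 'e, 'g) syllable list" where
  "acts = fold act"

lemma acts_simps [simp]:
  "acts [] \<sigma> = \<sigma>" "acts (l # u) \<sigma> = acts u (act l \<sigma>)" "acts (u @ u') \<sigma> = acts u' (acts u \<sigma>)"
  by (auto simp: acts_def)

lemma valid_act:
  assumes "fst l \<in> X" "valid \<sigma>"
  shows "valid (act l \<sigma>)"
proof (cases l)
  case (Pair x b)
  show ?thesis
  proof (cases x)
    case (Edge e)
    then show ?thesis using assms Pair by (simp add: valid_act_edge)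
  next
    case (Gen s)
    then obtain w where w: "w \<in> V" "s \<in> gs w" using assms Pair by (auto simp: Gen_in_X)
    interpret group "vgroup A w" using w by (simp add: group_vgroup)
    show ?thesis using assms(2) w val_closed[OF w]
      by (simp add: Pair Gen vert_of[OF w] valid_act_vertex)
  qed
qed

lemma valid_acts: "u \<in> words X \<Longrightarrow> valid \<sigma> \<Longrightarrow> valid (acts u \<sigma>)"
  by (induction u arbitrary: \<sigma>) (auto simp: valid_act)

lemma act_cancel:
  assumes "x \<in> X" "valid \<sigma>"
  shows "act (x, \<not> b) (act (x, b) \<sigma>) = \<sigma>"
proof (cases x)
  case (Edge e)
  then show ?thesis using assms act_edge_flip[of \<sigma> "(e, b)"] by simp
next
  case (Gen s)
  then obtain w where w: "w \<in> V" "s \<in> gs w" using assms by (auto simp: Gen_in_X)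
  interpret group "vgroup A w" using w by (simp add: group_vgroup)
  show ?thesis using assms Gen w vert_of[OF w] val_closed[OF w]
    by (auto simp: act_vertex_mult act_vertex_one)
qed

lemma acts_gen_word:
  assumes "w \<in> V" "u \<in> words (gs w)" "valid \<sigma>"
  shows "acts (gen_word u) \<sigma> = act_vertex w (ev w u) \<sigma>"
  using assms(2,3)
proof (induction u arbitrary: \<sigma>)
  case Nil
  then show ?case using assms by (simp add: act_vertex_one)
next
  case (Cons l u)
  interpret group "vgroup A w" using assms by (simp add: group_vgroup)
  obtain s b where l: "l = (s, b)" by force
  then have "s \<in> gs w" "u \<in> words (gs w)" using Cons by auto
  then show ?case
    using Cons l assms(1) vert_of[of w s] val_closed[of w s]
    by (auto simp: act_vertex_mult valid_act_vertex)
qed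

lemma acts_edge_rel:
  assumes "e \<in> Es" "h \<in> carrier (egroup A e)" "valid \<sigma>"
  shows "acts (edge_rel A e h) \<sigma> = \<sigma>"
proof -
  let ?d = "(e, True)" and ?d' = "(e, False)"
  interpret group "vgroup A (src ?d)" using assms by (simp add: group_vgroup)
  note [simp] = acts_gen_word[OF src_vert[of ?d]] acts_gen_word[OF src_vert[of ?d']]
    hword[of ?d h] hword[of ?d' h] ev_inv
  have "acts (edge_rel A e h) \<sigma> = act_vertex (src ?d) (inv\<^bsub>vgroup A (src ?d)\<^esub> im ?d h)
      (act_edge ?d' (act_vertex (src ?d') (im ?d' h) (act_edge ?d \<sigma>)))"
    using assms im_closed[of ?d' h]
    by (simp add: edge_rel_eq inv_word_gen_word valid_act_edge valid_act_vertex)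
  also have "act_vertex (src ?d') (im ?d' h) (act_edge ?d \<sigma>)
      = act_edge ?d (act_vertex (src ?d) (im ?d h) \<sigma>)"
    using act_edge_equivariant[of \<sigma> ?d h] assms by simp
  also have "act_edge ?d' \<dots> = act_vertex (src ?d) (im ?d h) \<sigma>"
    using act_edge_flip[of "act_vertex (src ?d) (im ?d h) \<sigma>" ?d] assms im_closed[of ?d h]
    by (simp add: valid_act_vertex)
  also have "act_vertex (src ?d) (inv\<^bsub>vgroup A (src ?d)\<^esub> im ?d h) \<dots> = \<sigma>"
    using assms im_closed[of ?d h] by (simp add: act_vertex_mult act_vertex_one)
  finally show ?thesis .
qed

text \<open>All relators act trivially on valid states, so the state reached from the empty one
  depends only on the element of the Bass group. This is the form in which the normal form theorem
  enters.\<close>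

lemma acts_pres_rel:
  assumes "(u, u') \<in> pres_rel X (relators A)" "valid \<sigma>"
  shows "acts u \<sigma> = acts u' \<sigma>"
  using assms
proof (induction arbitrary: \<sigma> rule: pres_rel.induct)
  case (cancel p q x b)
  then show ?case by (simp add: act_cancel valid_acts)
next
  case (relator p q r)
  have "acts r \<tau> = \<tau>" if \<tau>: "valid \<tau>" for \<tau>
  proof (cases "\<exists>e\<in>Es. \<exists>h\<in>carrier (egroup A e). r = edge_rel A e h")
    case True
    then show ?thesis using \<tau> acts_edge_rel by auto
  next
    case False
    then obtain w r' where r: "w \<in> V" "r' \<in> rels A w" "r = gen_word r'"
      using relator by (auto simp: relators_def)
    have "ev w r' = ev w []"
      using r rels_words[OF r(1,2)] pres_rel.relator[of "[]" "gs w" "[]" r' "rels A w"]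
      by (subst ev_eq_iff) auto
    then show ?thesis using r rels_words[OF r(1,2)] \<tau> by (simp add: acts_gen_word act_vertex_one)
  qed
  then show ?case using relator by (simp add: valid_acts)
qed auto

end

section \<open>Paths, morphisms and folds of labelled graphs\<close>

section \<open>Reading words in labelled graphs\<close>

text \<open>The step relation is a parameter, so that plain reading, reading along edges with
  attached loops and typed reading are instances, connected by \<open>path_mono\<close>.\<close>

fun path :: "('l \<Rightarrow> 'm \<Rightarrow> 'm \<Rightarrow> bool) \<Rightarrow> 'm \<Rightarrow> 'l list \<Rightarrow> 'm \<Rightarrow> bool" where
  "path P p [] q \<longleftrightarrow> p = q"
| "path P p (l # u) q \<longleftrightarrow> (\<exists>p'. P l p p' \<and> path P p' u q)"

lemma path_append: "path P p (u @ u') q \<longleftrightarrow> (\<exists>p'. path P p u p' \<and> path P p' u' q)"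
  by (induction u arbitrary: p) auto

lemma path_mono:
  "path P p u q \<Longrightarrow> (\<And>l p q. l \<in> set u \<Longrightarrow> P l p q \<Longrightarrow> Q l p q) \<Longrightarrow> path Q p u q"
  by (induction u arbitrary: p) (auto, blast)

text \<open>Passes to a sequence of vertices indexed by positions, the form in which bouquets and
  relator loops are built.\<close>

lemma path_pts:
  "path P p u q \<longleftrightarrow> (\<exists>pt. pt 0 = p \<and> pt (length u) = q \<and>
     (\<forall>j<length u. P (u ! j) (pt j) (pt (Suc j))))"
proof (induction u arbitrary: p)
  case Nil
  then show ?case by auto
next
  case (Cons l u)
  show ?case
  proof
    assume "path P p (l # u) q"
    then obtain p' where "P l p p'" "path P p' u q" by auto
    moreover from this(2) obtain pt where "pt 0 = p'" "pt (length u) = q"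
        "\<forall>j<length u. P (u ! j) (pt j) (pt (Suc j))"
      unfolding Cons by blast
    ultimately show "\<exists>pt. pt 0 = p \<and> pt (length (l # u)) = q \<and>
        (\<forall>j<length (l # u). P ((l # u) ! j) (pt j) (pt (Suc j)))"
      by (intro exI[of _ "case_nat p pt"]) (auto simp: less_Suc_eq_0_disj nth_Cons')
  next
    assume "\<exists>pt. pt 0 = p \<and> pt (length (l # u)) = q \<and>
        (\<forall>j<length (l # u). P ((l # u) ! j) (pt j) (pt (Suc j)))"
    then obtain pt where pt: "pt 0 = p" "pt (length (l # u)) = q"
        "\<And>j. j < length (l # u) \<Longrightarrow> P ((l # u) ! j) (pt j) (pt (Suc j))" by blast
    have "path P (pt (Suc 0)) u q"
      unfolding Cons using pt(2) pt(3)[of "Suc j" for j] by (intro exI[of _ "pt \<circ> Suc"]) auto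
    then show "path P p (l # u) q" using pt(1) pt(3)[of 0] by auto
  qed
qed

lemma path_take:
  assumes "\<forall>j<length u. P (u ! j) (pt j) (pt (Suc j))" "j \<le> length u"
  shows "path P (pt 0) (take j u) (pt j)"
  unfolding path_pts using assms by (intro exI[of _ pt]) auto

definition go :: "('m \<Rightarrow> 'x \<Rightarrow> 'm \<Rightarrow> bool) \<Rightarrow> 'x \<times> bool \<Rightarrow> 'm \<Rightarrow> 'm \<Rightarrow> bool" where
  "go E l p q = (if snd l then E p (fst l) q else E q (fst l) p)"

lemma go_simps [simp]: "go E (x, True) p q = E p x q" "go E (x, False) p q = E q x p"
  by (auto simp: go_def)

abbreviation run :: "('m \<Rightarrow> 'x \<Rightarrow> 'm \<Rightarrow> bool) \<Rightarrow> 'm \<Rightarrow> 'x word \<Rightarrow> 'm \<Rightarrow> bool" where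
  "run E \<equiv> path (go E)"

text \<open>Since \<open>go\<close> also traverses edges backwards, this is determinism in both
  directions, which is foldedness expressed by the edge relation.\<close>

definition det :: "('m \<Rightarrow> 'x \<Rightarrow> 'm \<Rightarrow> bool) \<Rightarrow> bool" where
  "det E \<longleftrightarrow> (\<forall>l p q q'. go E l p q \<longrightarrow> go E l p q' \<longrightarrow> q = q')"

lemma detD: "det E \<Longrightarrow> go E l p q \<Longrightarrow> go E l p q' \<Longrightarrow> q = q'"
  unfolding det_def by blast

lemma det_iff: "det E \<longleftrightarrow> (\<forall>p x q q'. E p x q \<longrightarrow> E p x q' \<longrightarrow> q = q') \<and>
    (\<forall>p x q q'. E q x p \<longrightarrow> E q' x p \<longrightarrow> q = q')" (is "_ \<longleftrightarrow> ?F \<and> ?B")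
proof
  assume "det E"
  then show "?F \<and> ?B"
    using detD[of E "(x, True)" for x] detD[of E "(x, False)" for x] by (auto simp: go_def)
qed (auto simp: det_def go_def)

lemma path_det:
  "(\<And>l p q q'. P l p q \<Longrightarrow> P l p q' \<Longrightarrow> q = q') \<Longrightarrow> path P p u q \<Longrightarrow> path P p u q' \<Longrightarrow> q = q'"
  by (induction u arbitrary: p) (auto, metis)

lemma run_det: "det E \<Longrightarrow> run E p u q \<Longrightarrow> run E p u q' \<Longrightarrow> q = q'"
  using path_det[of "go E"] detD by metis

lemma run_inv_word: "run E p (inv_word u) q \<longleftrightarrow> run E q u p"
proof (induction u arbitrary: p q)
  case (Cons l u)
  then show ?case by (cases l) (auto simp: path_append go_def)
qed auto

definition edge_of :: "('n, 'f, 'x, 'z) lgraph_scheme \<Rightarrow> 'n \<Rightarrow> 'x \<Rightarrow> 'n \<Rightarrow> bool" where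
  "edge_of \<Gamma> p x q \<longleftrightarrow> (\<exists>f\<in>arcs \<Gamma>. tail \<Gamma> f = p \<and> head \<Gamma> f = q \<and> lab \<Gamma> f = x)"

lemma reads_iff: "reads \<Gamma> p u q \<longleftrightarrow> run (edge_of \<Gamma>) p u q \<and> q \<in> verts \<Gamma>"
proof
  show "reads \<Gamma> p u q \<Longrightarrow> run (edge_of \<Gamma>) p u q \<and> q \<in> verts \<Gamma>"
    by (induction rule: reads.induct) (auto simp: edge_of_def)
next
  show "run (edge_of \<Gamma>) p u q \<and> q \<in> verts \<Gamma> \<Longrightarrow> reads \<Gamma> p u q"
  proof (induction u arbitrary: p)
    case (Cons l u)
    then obtain p' where p': "go (edge_of \<Gamma>) l p p'" "reads \<Gamma> p' u q" by auto
    obtain x b where l: "l = (x, b)" by force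
    show ?case using p' unfolding l
      by (cases b) (auto simp: edge_of_def intro: reads.intros)
  qed (auto intro: reads.intros)
qed

subsection \<open>Graph morphisms and folds\<close>

text \<open>The target is a mere edge relation, because cosets and memory records have no named
  edges.\<close>

definition graph_hom :: "('n \<Rightarrow> 'm) \<Rightarrow> ('n, 'f, 'x) lgraph \<Rightarrow> ('m \<Rightarrow> 'x \<Rightarrow> 'm \<Rightarrow> bool) \<Rightarrow> bool" where
  "graph_hom \<theta> \<Gamma> E \<longleftrightarrow> (\<forall>f\<in>arcs \<Gamma>. E (\<theta> (tail \<Gamma> f)) (lab \<Gamma> f) (\<theta> (head \<Gamma> f)))"

lemma graph_hom_run:
  assumes "graph_hom \<theta> \<Gamma> E" "run (edge_of \<Gamma>) p u q"
  shows "run E (\<theta> p) u (\<theta> q)"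
  using assms(2)
proof (induction u arbitrary: p)
  case (Cons l u)
  then obtain p' where "go (edge_of \<Gamma>) l p p'" "run E (\<theta> p') u (\<theta> q)" by auto
  moreover from this(1) have "go E l (\<theta> p) (\<theta> p')" using assms(1)
    by (auto simp: go_def edge_of_def graph_hom_def split: if_splits)
  ultimately show ?case by auto
qed auto

text \<open>Determinism of the target forces the two vertices merged by a fold to have the same
  image. As \<open>merge\<close> keeps one of the two names, the same vertex map works before and
  after the fold.\<close>

lemma fold_step_graph_hom:
  assumes "fold_step \<Gamma> \<Gamma>'" "graph_hom \<theta> \<Gamma> E" "det E"
  shows "graph_hom \<theta> \<Gamma>' E \<and> \<theta> (base \<Gamma>') = \<theta> (base \<Gamma>)"
proof -
  have merge: "graph_hom \<theta> (merge \<Gamma> g z y) E \<and> \<theta> (base (merge \<Gamma> g z y)) = \<theta> (base \<Gamma>)"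
    if "\<theta> z = \<theta> y" for g z y
  proof -
    have "\<theta> (if p = z then y else p) = \<theta> p" for p using that by simp
    then show ?thesis
      using assms(2) by (simp add: merge_def Let_def graph_hom_def del: if_split)
  qed
  obtain f g where fg: "f \<in> arcs \<Gamma>" "g \<in> arcs \<Gamma>" "lab \<Gamma> f = lab \<Gamma> g"
     "tail \<Gamma> f = tail \<Gamma> g \<and> \<Gamma>' = merge \<Gamma> g (head \<Gamma> g) (head \<Gamma> f) \<or>
      head \<Gamma> f = head \<Gamma> g \<and> \<Gamma>' = merge \<Gamma> g (tail \<Gamma> g) (tail \<Gamma> f)"
    using assms(1) unfolding fold_step_def by blast
  have "E (\<theta> (tail \<Gamma> f)) (lab \<Gamma> f) (\<theta> (head \<Gamma> f))" "E (\<theta> (tail \<Gamma> g)) (lab \<Gamma> f) (\<theta> (head \<Gamma> g))"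
    using assms(2) fg unfolding graph_hom_def by auto
  then have "tail \<Gamma> f = tail \<Gamma> g \<Longrightarrow> \<theta> (head \<Gamma> g) = \<theta> (head \<Gamma> f)"
    "head \<Gamma> f = head \<Gamma> g \<Longrightarrow> \<theta> (tail \<Gamma> g) = \<theta> (tail \<Gamma> f)"
    using assms(3) unfolding det_iff by metis+
  then show ?thesis using fg(4) merge by metis
qed

lemma folds_graph_hom:
  assumes "fold_step\<^sup>*\<^sup>* \<Gamma> \<Gamma>'" "graph_hom \<theta> \<Gamma> E" "det E"
  shows "graph_hom \<theta> \<Gamma>' E \<and> \<theta> (base \<Gamma>') = \<theta> (base \<Gamma>)"
  using assms(1)
proof (induction rule: rtranclp_induct)
  case (step y z)
  then show ?case using fold_step_graph_hom[of y z \<theta> E] assms(3) by simp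
qed (use assms in auto)

text \<open>Only the edge relation is compared, not the arcs: a fold deletes an arc, but the
  remaining one has the same image.\<close>

definition quotient_map :: "('n \<Rightarrow> 'm) \<Rightarrow> ('n, 'f, 'x) lgraph \<Rightarrow> ('m, 'k, 'x) lgraph \<Rightarrow> bool" where
  "quotient_map \<psi> \<Gamma> \<Gamma>' \<longleftrightarrow> \<psi> (base \<Gamma>) = base \<Gamma>' \<and> verts \<Gamma>' = \<psi> ` verts \<Gamma> \<and>
     (\<forall>p x q. edge_of \<Gamma>' p x q \<longleftrightarrow>
        (\<exists>f\<in>arcs \<Gamma>. \<psi> (tail \<Gamma> f) = p \<and> \<psi> (head \<Gamma> f) = q \<and> lab \<Gamma> f = x))"

lemma quotient_map_trans:
  assumes "quotient_map \<psi> \<Gamma> \<Gamma>'" "quotient_map \<chi> \<Gamma>' \<Gamma>''"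
  shows "quotient_map (\<chi> \<circ> \<psi>) \<Gamma> \<Gamma>''"
proof -
  have "edge_of \<Gamma>'' p x q \<longleftrightarrow>
      (\<exists>f\<in>arcs \<Gamma>'. \<chi> (tail \<Gamma>' f) = p \<and> \<chi> (head \<Gamma>' f) = q \<and> lab \<Gamma>' f = x)" for p x q
    using assms(2) by (simp add: quotient_map_def)
  then have "edge_of \<Gamma>'' p x q \<longleftrightarrow> (\<exists>p' q'. edge_of \<Gamma>' p' x q' \<and> \<chi> p' = p \<and> \<chi> q' = q)" for p x q
    unfolding edge_of_def[of \<Gamma>'] by auto
  moreover have "edge_of \<Gamma>' p x q \<longleftrightarrow>
      (\<exists>f\<in>arcs \<Gamma>. \<psi> (tail \<Gamma> f) = p \<and> \<psi> (head \<Gamma> f) = q \<and> lab \<Gamma> f = x)" for p x q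
    using assms(1) unfolding quotient_map_def by blast
  ultimately have "edge_of \<Gamma>'' p x q \<longleftrightarrow>
      (\<exists>f\<in>arcs \<Gamma>. \<chi> (\<psi> (tail \<Gamma> f)) = p \<and> \<chi> (\<psi> (head \<Gamma> f)) = q \<and> lab \<Gamma> f = x)" for p x q
    by (simp only:) metis
  then show ?thesis
    using assms unfolding quotient_map_def by (simp add: image_image)
qed

lemma fold_step_quotient:
  assumes "fold_step \<Gamma> \<Gamma>'"
  shows "\<exists>\<psi>. quotient_map \<psi> \<Gamma> \<Gamma>'"
proof -
  obtain f g z y where fg: "f \<in> arcs \<Gamma>" "g \<in> arcs \<Gamma>" "f \<noteq> g" "lab \<Gamma> f = lab \<Gamma> g"
     "\<Gamma>' = merge \<Gamma> g z y"
     "tail \<Gamma> f = tail \<Gamma> g \<and> z = head \<Gamma> g \<and> y = head \<Gamma> f \<or>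
      head \<Gamma> f = head \<Gamma> g \<and> z = tail \<Gamma> g \<and> y = tail \<Gamma> f"
    using assms unfolding fold_step_def by blast
  define \<sigma> where "\<sigma> = (\<lambda>p. if p = z then y else p)"
  have m: "verts \<Gamma>' = \<sigma> ` verts \<Gamma>" "arcs \<Gamma>' = arcs \<Gamma> - {g}" "tail \<Gamma>' = \<sigma> \<circ> tail \<Gamma>"
    "head \<Gamma>' = \<sigma> \<circ> head \<Gamma>" "lab \<Gamma>' = lab \<Gamma>" "base \<Gamma>' = \<sigma> (base \<Gamma>)"
    by (auto simp: fg(5) merge_def Let_def \<sigma>_def)
  have "\<sigma> (tail \<Gamma> f) = \<sigma> (tail \<Gamma> g)" "\<sigma> (head \<Gamma> f) = \<sigma> (head \<Gamma> g)"
    using fg(6) by (auto simp: \<sigma>_def)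
  then have "(\<exists>k\<in>arcs \<Gamma> - {g}. \<sigma> (tail \<Gamma> k) = p \<and> \<sigma> (head \<Gamma> k) = q \<and> lab \<Gamma> k = x) \<longleftrightarrow>
    (\<exists>k\<in>arcs \<Gamma>. \<sigma> (tail \<Gamma> k) = p \<and> \<sigma> (head \<Gamma> k) = q \<and> lab \<Gamma> k = x)" for p x q
    using fg(1-4) by (metis DiffE DiffI singletonD)
  then have "quotient_map \<sigma> \<Gamma> \<Gamma>'"
    unfolding quotient_map_def edge_of_def m by simp
  then show ?thesis by blast
qed

lemma quotient_map_id: "quotient_map (\<lambda>p. p) \<Gamma> \<Gamma>"
  by (auto simp: quotient_map_def edge_of_def)

lemma folds_quotient: "fold_step\<^sup>*\<^sup>* \<Gamma> \<Gamma>' \<Longrightarrow> \<exists>\<psi>. quotient_map \<psi> \<Gamma> \<Gamma>'"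
proof (induction rule: rtranclp_induct)
  case base
  then show ?case using quotient_map_id by blast
next
  case (step y z)
  then show ?case using fold_step_quotient quotient_map_trans by blast
qed

lemma quotient_graph_hom: "quotient_map \<psi> \<Gamma> \<Gamma>' \<Longrightarrow> graph_hom \<psi> \<Gamma> (edge_of \<Gamma>')"
  by (auto simp: quotient_map_def graph_hom_def)

lemma folds_terminate:
  "finite (arcs \<Gamma>) \<Longrightarrow> \<exists>\<Gamma>'. fold_step\<^sup>*\<^sup>* \<Gamma> \<Gamma>' \<and> \<not> (\<exists>\<Gamma>''. fold_step \<Gamma>' \<Gamma>'')"
proof (induction "card (arcs \<Gamma>)" arbitrary: \<Gamma> rule: less_induct)
  case less
  show ?case
  proof (cases "\<exists>\<Gamma>'. fold_step \<Gamma> \<Gamma>'")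
    case True
    then obtain \<Gamma>' where \<Gamma>': "fold_step \<Gamma> \<Gamma>'" by blast
    then obtain g where "g \<in> arcs \<Gamma>" "arcs \<Gamma>' = arcs \<Gamma> - {g}"
      by (auto simp: fold_step_def merge_def Let_def)
    then have "card (arcs \<Gamma>') < card (arcs \<Gamma>)" "finite (arcs \<Gamma>')"
      using less.prems card_Diff1_less[of "arcs \<Gamma>" g] by simp_all
    then show ?thesis using less.hyps[of \<Gamma>'] \<Gamma>' by (meson converse_rtranclp_into_rtranclp)
  qed blast
qed

lemma folded_det:
  assumes "\<not> (\<exists>\<Gamma>'. fold_step \<Gamma> \<Gamma>')"
  shows "det (edge_of \<Gamma>)"
proof -
  have "f = g" if "f \<in> arcs \<Gamma>" "g \<in> arcs \<Gamma>" "lab \<Gamma> f = lab \<Gamma> g"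
    "tail \<Gamma> f = tail \<Gamma> g \<or> head \<Gamma> f = head \<Gamma> g" for f g
    using assms that unfolding fold_step_def by blast
  then show ?thesis
    unfolding det_iff edge_of_def by (intro conjI allI impI; elim bexE conjE) metis+
qed

section \<open>Cayley graphs at vertices and the universal property of saturation\<close>

section \<open>Saturated graphs\<close>

context gog
begin

text \<open>A homomorphic image of the Cayley graph rooted at \<open>p\<close>. It need not be
  injective, since folding may identify vertices of an attached copy.\<close>

definition cay :: "('m \<Rightarrow> ('e, 's) letter \<Rightarrow> 'm \<Rightarrow> bool) \<Rightarrow> 'v \<Rightarrow> 'm \<Rightarrow> ('g \<Rightarrow> 'm) \<Rightarrow> bool" where
  "cay E w p \<kappa> \<longleftrightarrow> \<kappa> \<one>\<^bsub>vgroup A w\<^esub> = p \<and>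
     (\<forall>a\<in>carrier (vgroup A w). \<forall>s\<in>gs w. E (\<kappa> a) (Gen s) (\<kappa> (a \<otimes>\<^bsub>vgroup A w\<^esub> val s)))"

definition vtype :: "('m \<Rightarrow> ('e, 's) letter \<Rightarrow> 'm \<Rightarrow> bool) \<Rightarrow> 'v \<Rightarrow> 'm \<Rightarrow> bool" where
  "vtype E w p \<longleftrightarrow> (\<exists>\<kappa>. cay E w p \<kappa>)"

text \<open>Lets a group element move a vertex without choosing a word for it; in a deterministic
  graph the result is unique by \<open>step_unique\<close>.\<close>

definition step :: "('m \<Rightarrow> ('e, 's) letter \<Rightarrow> 'm \<Rightarrow> bool) \<Rightarrow> 'v \<Rightarrow> 'g \<Rightarrow> 'm \<Rightarrow> 'm \<Rightarrow> bool" where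
  "step E w a p q \<longleftrightarrow> (\<exists>\<kappa>. cay E w p \<kappa> \<and> \<kappa> a = q)"

abbreviation sval :: "'v \<Rightarrow> 's \<times> bool \<Rightarrow> 'g" where
  "sval w l \<equiv> (if snd l then val (fst l) else inv\<^bsub>vgroup A w\<^esub> val (fst l))"

context
  fixes E :: "'m \<Rightarrow> ('e, 's) letter \<Rightarrow> 'm \<Rightarrow> bool" and w assumes w: "w \<in> V"
begin

interpretation G: group "vgroup A w" using w by (rule group_vgroup)

lemma cay_shift:
  assumes "cay E w p \<kappa>" "a \<in> carrier (vgroup A w)"
  shows "cay E w (\<kappa> a) (\<lambda>b. \<kappa> (a \<otimes>\<^bsub>vgroup A w\<^esub> b))"
  using assms val_closed[OF w] by (auto simp: cay_def G.m_assoc[symmetric])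

lemma cay_go:
  assumes "cay E w p \<kappa>" "a \<in> carrier (vgroup A w)" "s \<in> gs w"
  shows "go E (Gen s, b) (\<kappa> a) (\<kappa> (a \<otimes>\<^bsub>vgroup A w\<^esub> sval w (s, b)))"
proof (cases b)
  case False
  have "E (\<kappa> (a \<otimes>\<^bsub>vgroup A w\<^esub> inv\<^bsub>vgroup A w\<^esub> val s)) (Gen s)
     (\<kappa> (a \<otimes>\<^bsub>vgroup A w\<^esub> inv\<^bsub>vgroup A w\<^esub> val s \<otimes>\<^bsub>vgroup A w\<^esub> val s))"
    using assms val_closed[OF w assms(3)] by (simp add: cay_def)
  then show ?thesis
    using assms val_closed[OF w assms(3)] False by (simp add: go_def G.m_assoc)
qed (use assms in \<open>auto simp: cay_def go_def\<close>)

text \<open>A Cayley graph looks the same from each of its vertices, so every vertex passed on the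
  way is again the root of one; this is recorded along the path.\<close>

lemma cay_run_typed:
  assumes "cay E w p \<kappa>" "u \<in> words (gs w)"
  shows "path (\<lambda>l p q. go E l p q \<and> vtype E w p \<and> vtype E w q \<and> fst l \<in> Gen ` gs w)
    p (gen_word u) (\<kappa> (ev w u))"
  using assms
proof (induction u arbitrary: p \<kappa>)
  case Nil
  then show ?case by (simp add: cay_def)
next
  case (Cons l u)
  obtain s b where l: "l = (s, b)" by force
  have s: "s \<in> gs w" "u \<in> words (gs w)" using Cons l by auto
  have sv: "sval w l \<in> carrier (vgroup A w)" using s val_closed[OF w] l by auto
  have p: "\<kappa> \<one>\<^bsub>vgroup A w\<^esub> = p" using Cons by (simp add: cay_def)
  have go: "go E (Gen s, b) p (\<kappa> (sval w l))"
    using cay_go[OF Cons.prems(1) _ s(1), of "\<one>\<^bsub>vgroup A w\<^esub>" b] p l sv by (cases b) auto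
  note c = cay_shift[OF Cons.prems(1) sv]
  have "vtype E w p" "vtype E w (\<kappa> (sval w l))"
    using Cons.prems(1) c unfolding vtype_def by blast+
  with go Cons.IH[OF c s(2)] l s show ?case
    by (auto intro!: exI[of _ "\<kappa> (sval w l)"])
qed

lemma cay_run: "cay E w p \<kappa> \<Longrightarrow> u \<in> words (gs w) \<Longrightarrow> run E p (gen_word u) (\<kappa> (ev w u))"
  by (rule path_mono[OF cay_run_typed]) auto

lemma step_run: "u \<in> words (gs w) \<Longrightarrow> step E w (ev w u) p q \<Longrightarrow> run E p (gen_word u) q"
  unfolding step_def using cay_run by blast

lemma step_vtype:
  assumes "step E w a p q" "a \<in> carrier (vgroup A w)"
  shows "vtype E w p" "vtype E w q"
  using assms cay_shift unfolding step_def vtype_def by blast+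

lemma vtype_step: "vtype E w p \<Longrightarrow> \<exists>q. step E w a p q"
  unfolding vtype_def step_def by blast

lemma step_one: "vtype E w p \<Longrightarrow> step E w \<one>\<^bsub>vgroup A w\<^esub> p p"
  unfolding vtype_def step_def cay_def by blast

lemma step_go:
  assumes "step E w (sval w (s, b)) p q" "s \<in> gs w"
  shows "go E (Gen s, b) p q"
  using step_run[of "[(s, b)]" p q] assms val_closed[OF w, of s] by (cases b) auto

context
  assumes det: "det E"
begin

lemma step_unique:
  assumes "step E w a p q" "step E w a p q'" "a \<in> carrier (vgroup A w)"
  shows "q = q'"
  using ev_surj[OF w assms(3)] assms(1,2) step_run run_det[OF det] by blast

lemma step_mult:
  assumes "step E w a p q" "step E w b q r" "a \<in> carrier (vgroup A w)" "b \<in> carrier (vgroup A w)"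
  shows "step E w (a \<otimes>\<^bsub>vgroup A w\<^esub> b) p r"
proof -
  obtain \<kappa> where \<kappa>: "cay E w p \<kappa>" "\<kappa> a = q" using assms(1) by (auto simp: step_def)
  then have "step E w b q (\<kappa> (a \<otimes>\<^bsub>vgroup A w\<^esub> b))"
    using cay_shift[OF \<kappa>(1) assms(3)] unfolding step_def by blast
  then have "r = \<kappa> (a \<otimes>\<^bsub>vgroup A w\<^esub> b)" using step_unique assms by blast
  then show ?thesis using \<kappa> by (auto simp: step_def)
qed

lemma step_inv:
  assumes "step E w a p q" "a \<in> carrier (vgroup A w)"
  shows "step E w (inv\<^bsub>vgroup A w\<^esub> a) q p"
proof -
  obtain r where r: "step E w (inv\<^bsub>vgroup A w\<^esub> a) q r"
    using step_vtype[OF assms] vtype_step by blast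
  then have "step E w \<one>\<^bsub>vgroup A w\<^esub> p r"
    using step_mult[OF assms(1) r] assms(2) by simp
  then have "r = p" using step_one[OF step_vtype(1)[OF assms]] step_unique by blast
  then show ?thesis using r by simp
qed

lemma step_split:
  assumes "step E w (a \<otimes>\<^bsub>vgroup A w\<^esub> b) p r" "a \<in> carrier (vgroup A w)" "b \<in> carrier (vgroup A w)"
  obtains q where "step E w a p q" "step E w b q r"
proof -
  have "vtype E w p" using step_vtype assms by blast
  then obtain q where q: "step E w a p q" using vtype_step by blast
  then obtain r' where r': "step E w b q r'" using step_vtype[OF q assms(2)] vtype_step by blast
  then have "r = r'" using step_mult[OF q r'] assms step_unique by blast
  then show ?thesis using that q r' by blast
qed

lemma vtype_go_step:
  assumes "vtype E w p" "go E (Gen s, b) p q" "s \<in> gs w"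
  shows "step E w (sval w (s, b)) p q"
proof -
  obtain r where r: "step E w (sval w (s, b)) p r" using vtype_step assms by blast
  then have "q = r" using step_go assms detD[OF det] by blast
  then show ?thesis using r by simp
qed

end

end

subsection \<open>Gadgets\<close>

text \<open>The identity gets the empty word, so that the vertex which the loops below assign to it
  is the root itself.\<close>

definition wd :: "'v \<Rightarrow> 'g \<Rightarrow> 's word" where
  "wd w a = (if a = \<one>\<^bsub>vgroup A w\<^esub> then [] else SOME u. u \<in> words (gs w) \<and> ev w u = a)"

lemma wd:
  assumes "w \<in> V" "a \<in> carrier (vgroup A w)"
  shows "wd w a \<in> words (gs w)" "ev w (wd w a) = a"
proof -
  have "wd w a \<in> words (gs w) \<and> ev w (wd w a) = a"
  proof (cases "a = \<one>\<^bsub>vgroup A w\<^esub>")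
    case False
    have "\<exists>u. u \<in> words (gs w) \<and> ev w u = a" using ev_surj[OF assms] by blast
    from someI_ex[OF this] False show ?thesis by (simp add: wd_def)
  qed (simp add: wd_def)
  then show "wd w a \<in> words (gs w)" "ev w (wd w a) = a" by auto
qed

text \<open>The loop that goes to \<open>a\<close> by its chosen word, crosses one edge and returns
  by the chosen word of the far end, as for Schreier generators.\<close>

definition cay_loop :: "'v \<Rightarrow> 'g \<Rightarrow> 's \<Rightarrow> 's word" where
  "cay_loop w a s = wd w a @ [(s, True)] @ inv_word (wd w (a \<otimes>\<^bsub>vgroup A w\<^esub> val s))"

definition cay_loops :: "'v \<Rightarrow> ('e, 's) letter word set" where
  "cay_loops w = {gen_word (cay_loop w a s) | a s. a \<in> carrier (vgroup A w) \<and> s \<in> gs w}"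

lemma cay_loop:
  assumes "w \<in> V" "a \<in> carrier (vgroup A w)" "s \<in> gs w"
  shows "cay_loop w a s \<in> words (gs w)" "ev w (cay_loop w a s) = \<one>\<^bsub>vgroup A w\<^esub>"
proof -
  interpret G: group "vgroup A w" using assms(1) by (rule group_vgroup)
  note wds = wd[OF assms(1,2)] wd[of w "a \<otimes>\<^bsub>vgroup A w\<^esub> val s"] val_closed[OF assms(1,3)]
  show "cay_loop w a s \<in> words (gs w)" using assms wds by (simp add: cay_loop_def)
  show "ev w (cay_loop w a s) = \<one>\<^bsub>vgroup A w\<^esub>"
    using assms wds by (simp add: cay_loop_def ev_append ev_inv G.m_assoc[symmetric])
qed

text \<open>Determinism lets the chosen word of \<open>a\<close> define the vertex belonging to
  \<open>a\<close>; the loop for \<open>a\<close> and \<open>s\<close> then says exactly that an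
  edge \<open>s\<close> joins the right vertices. An attached Cayley graph is thereby replaced by
  loops, which a program can insert one by one.\<close>

lemma vtype_iff_loops:
  assumes "w \<in> V" "det E"
  shows "vtype E w p \<longleftrightarrow> (\<forall>r\<in>cay_loops w. run E p r p)"
proof
  assume "vtype E w p"
  then have "step E w \<one>\<^bsub>vgroup A w\<^esub> p p" by (rule step_one[OF assms(1)])
  moreover have "run E p (gen_word (cay_loop w a s)) p"
    if "step E w \<one>\<^bsub>vgroup A w\<^esub> p p" "a \<in> carrier (vgroup A w)" "s \<in> gs w" for a s
    using step_run[OF assms(1), of "cay_loop w a s" E p p] cay_loop[OF assms(1) that(2,3)] that(1)
    by simp
  ultimately show "\<forall>r\<in>cay_loops w. run E p r p"
    unfolding cay_loops_def by blast
next
  assume loops: "\<forall>r\<in>cay_loops w. run E p r p"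
  interpret G: group "vgroup A w" using assms(1) by (rule group_vgroup)
  show "vtype E w p"
  proof (cases "gs w = {}")
    case True
    then show ?thesis by (auto simp: vtype_def cay_def intro: exI[of _ "\<lambda>_. p"])
  next
    case False
    define \<kappa> where "\<kappa> a = (THE q. run E p (gen_word (wd w a)) q)" for a
    have \<kappa>I: "\<kappa> a = q" if "run E p (gen_word (wd w a)) q" for a q
      unfolding \<kappa>_def using that run_det[OF assms(2)] by blast
    have "E (\<kappa> a) (Gen s) (\<kappa> (a \<otimes>\<^bsub>vgroup A w\<^esub> val s))"
      if a: "a \<in> carrier (vgroup A w)" "s \<in> gs w" for a s
    proof -
      have "run E p (gen_word (cay_loop w a s)) p" using loops a by (auto simp: cay_loops_def)
      then obtain q q' where "run E p (gen_word (wd w a)) q" "E q (Gen s) q'"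
          "run E p (gen_word (wd w (a \<otimes>\<^bsub>vgroup A w\<^esub> val s))) q'"
        by (auto simp: cay_loop_def path_append go_def run_inv_word inv_word_gen_word[symmetric])
      then show ?thesis using \<kappa>I by metis
    qed
    moreover have "\<kappa> \<one>\<^bsub>vgroup A w\<^esub> = p" using \<kappa>I by (simp add: wd_def)
    ultimately show ?thesis by (auto simp: vtype_def cay_def intro: exI[of _ \<kappa>])
  qed
qed

fun tail_loops :: "('e, 's) letter \<Rightarrow> ('e, 's) letter word set" where
  "tail_loops (Gen s) = cay_loops (vert_of s)"
| "tail_loops (Edge e) = cay_loops (tail (dgraph A) e) \<union> edge_rel A e ` carrier (egroup A e)"

fun head_loops :: "('e, 's) letter \<Rightarrow> ('e, 's) letter word set" where
  "head_loops (Gen s) = cay_loops (vert_of s)"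
| "head_loops (Edge e) = cay_loops (head (dgraph A) e)"

text \<open>An edge together with all that saturation attaches at its ends, expressed by loops. The
  relators of an edge letter start with this letter, so they are loops at the tail.\<close>

definition gadget :: "('m \<Rightarrow> ('e, 's) letter \<Rightarrow> 'm \<Rightarrow> bool) \<Rightarrow> 'm \<Rightarrow> ('e, 's) letter \<Rightarrow> 'm \<Rightarrow> bool" where
  "gadget E p x q \<longleftrightarrow> E p x q \<and> (\<forall>r\<in>tail_loops x. run E p r p) \<and> (\<forall>r\<in>head_loops x. run E q r q)"

lemma gadget_iff:
  assumes "det E"
  shows "s \<in> gs w \<Longrightarrow> w \<in> V \<Longrightarrow> gadget E p (Gen s) q \<longleftrightarrow> E p (Gen s) q \<and> vtype E w p \<and> vtype E w q"
    and "e \<in> Es \<Longrightarrow> gadget E p (Edge e) q \<longleftrightarrow> E p (Edge e) q \<and>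
      vtype E (tail (dgraph A) e) p \<and> vtype E (head (dgraph A) e) q \<and>
      (\<forall>h\<in>carrier (egroup A e). run E p (edge_rel A e h) p)"
  using assms by (auto simp: gadget_def vert_of vtype_iff_loops)

lemma words_X_nth: "W \<in> words X \<Longrightarrow> j < length W \<Longrightarrow> fst (W ! j) \<in> X"
  using nth_mem[of j W] by (auto simp: words_def in_lists_conv_set mem_Times_iff)

definition saturated_graph where
  "saturated_graph Ws = edge_saturate A (vertex_saturate A v (bouquet Ws))"

text \<open>The map is built layer by layer: the input paths give the bouquet, roots of Cayley
  graphs extend it over the attached copies, and relator loops extend it over the rest. Both the
  coset graph and the final memory are compared with an output through this map.\<close>

theorem saturated_graph_hom:
  assumes det: "det E" and Ws: "\<And>W. W \<in> set Ws \<Longrightarrow> W \<in> words X"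
    and base: "vtype E v b" and good: "\<And>W. W \<in> set Ws \<Longrightarrow> path (go (gadget E)) b W b"
  shows "\<exists>\<theta>. graph_hom \<theta> (saturated_graph Ws) E \<and> \<theta> (base (saturated_graph Ws)) = b"
proof -
  let ?B = "bouquet Ws" and ?S = "vertex_saturate A v (bouquet Ws)"
  have "\<forall>i. \<exists>pt. i < length Ws \<longrightarrow> pt 0 = b \<and> pt (length (Ws ! i)) = b \<and>
      (\<forall>j<length (Ws ! i). go (gadget E) (Ws ! i ! j) (pt j) (pt (Suc j)))"
  proof
    fix i
    show "\<exists>pt. i < length Ws \<longrightarrow> pt 0 = b \<and> pt (length (Ws ! i)) = b \<and>
      (\<forall>j<length (Ws ! i). go (gadget E) (Ws ! i ! j) (pt j) (pt (Suc j)))"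
      using good[of "Ws ! i"] unfolding path_pts by (cases "i < length Ws") auto
  qed
  then obtain pt where pt: "\<And>i. i < length Ws \<Longrightarrow> pt i 0 = b \<and> pt i (length (Ws ! i)) = b \<and>
      (\<forall>j<length (Ws ! i). go (gadget E) (Ws ! i ! j) (pt i j) (pt i (Suc j)))"
    by metis
  define \<beta> where "\<beta> z = (case z of Base \<Rightarrow> b | Inner i j \<Rightarrow> pt i j)" for z
  have \<beta>_pt: "\<beta> (bouquet_pt Ws i j) = pt i j" if "i < length Ws" for i j
    using pt[OF that] by (auto simp: \<beta>_def bouquet_pt_def)
  have arc: "gadget E (\<beta> (tail ?B f)) (lab ?B f) (\<beta> (head ?B f)) \<and> lab ?B f \<in> X"
    if "f \<in> arcs ?B" for f
  proof -
    obtain i j where f: "f = (i, j)" "i < length Ws" "j < length (Ws ! i)"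
      using \<open>f \<in> arcs ?B\<close> by (auto simp: bouquet_def)
    then have "go (gadget E) (Ws ! i ! j) (pt i j) (pt i (Suc j))" using pt by blast
    then show ?thesis
      using f Ws words_X_nth[of "Ws ! i" j]
      by (auto simp: bouquet_def line_tail_def line_head_def \<beta>_pt go_def)
  qed
  have typed: "vtype E w (\<beta> z)" if "node_type A v ?B z w" for z w
  proof -
    note nt = that
    have w: "w \<in> V" using nt by (simp add: node_type_def)
    consider f where "f \<in> arcs ?B" "tail ?B f = z \<or> head ?B f = z" "lab ?B f \<in> Gen ` gs w"
      | f e where "f \<in> arcs ?B" "lab ?B f = Edge e"
          "head ?B f = z \<and> w = head (dgraph A) e \<or> tail ?B f = z \<and> w = tail (dgraph A) e"
      | "z = base ?B" "w = v"
      using nt unfolding node_type_def by blast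
    then show ?thesis
    proof cases
      case 1
      then show ?thesis using arc[OF 1(1)] gadget_iff(1)[OF det _ w] by auto
    next
      case 2
      then show ?thesis using arc[OF 2(1)] gadget_iff(2)[OF det] by auto
    next
      case 3
      then show ?thesis using base by (simp add: bouquet_def \<beta>_def)
    qed
  qed
  define \<kappa> where "\<kappa> z w = (SOME \<kappa>. cay E w (\<beta> z) \<kappa>)" for z w
  have \<kappa>: "cay E w (\<beta> z) (\<kappa> z w)" if "node_type A v ?B z w" for z w
    unfolding \<kappa>_def using typed[OF that] unfolding vtype_def by (rule someI_ex)
  define \<theta>1 where "\<theta>1 n = (case n of OldNode z \<Rightarrow> \<beta> z | CayNode z w a \<Rightarrow> \<kappa> z w a)" for n
  have \<theta>1_pt: "\<theta>1 (cay_pt A z w a) = \<kappa> z w a" if "node_type A v ?B z w" for z w a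
    using \<kappa>[OF that] by (auto simp: \<theta>1_def cay_pt_def cay_def)
  \<comment> \<open>Cayley copies carry only generator labels, so each edge letter comes from the
    bouquet, where its gadget provides the relator loops.\<close>
  have arc1: "E (\<theta>1 (tail ?S k)) (lab ?S k) (\<theta>1 (head ?S k)) \<and>
      (\<forall>e. lab ?S k = Edge e \<longrightarrow> e \<in> Es \<and> gadget E (\<theta>1 (tail ?S k)) (Edge e) (\<theta>1 (head ?S k)))"
    if "k \<in> arcs ?S" for k
  proof (cases k)
    case (OldArc f)
    then have "f \<in> arcs ?B" using that by (auto simp: vertex_saturate_def)
    from arc[OF this] OldArc show ?thesis
      by (auto simp: vertex_saturate_def \<theta>1_def gadget_def)
  next
    case (CayArc z w a s)
    then have z: "node_type A v ?B z w" "a \<in> carrier (vgroup A w)" "s \<in> gs w"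
      using that by (auto simp: vertex_saturate_def)
    then show ?thesis
      using CayArc \<kappa>[OF z(1)] by (simp add: vertex_saturate_def \<theta>1_pt cay_def)
  qed
  have "\<forall>f h. \<exists>pt. (f, h) \<in> loop_index A ?S \<longrightarrow>
      pt 0 = \<theta>1 (tail ?S f) \<and> pt (length (arc_rel A ?S f h)) = \<theta>1 (tail ?S f) \<and>
      (\<forall>j<length (arc_rel A ?S f h). go E (arc_rel A ?S f h ! j) (pt j) (pt (Suc j)))"
  proof (intro allI)
    fix f h
    have "path (go E) (\<theta>1 (tail ?S f)) (arc_rel A ?S f h) (\<theta>1 (tail ?S f))"
      if fh: "(f, h) \<in> loop_index A ?S"
    proof -
      obtain e where f: "f \<in> arcs ?S" "lab ?S f = Edge e" "h \<in> carrier (egroup A e)"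
        using fh by (auto simp: loop_index_def)
      then have "e \<in> Es" "gadget E (\<theta>1 (tail ?S f)) (Edge e) (\<theta>1 (head ?S f))"
        using arc1 by auto
      then show ?thesis
        using f gadget_iff(2)[OF det, THEN iffD1] by (simp add: arc_rel_def)
    qed
    then show "\<exists>pt. (f, h) \<in> loop_index A ?S \<longrightarrow>
      pt 0 = \<theta>1 (tail ?S f) \<and> pt (length (arc_rel A ?S f h)) = \<theta>1 (tail ?S f) \<and>
      (\<forall>j<length (arc_rel A ?S f h). go E (arc_rel A ?S f h ! j) (pt j) (pt (Suc j)))"
      unfolding path_pts by blast
  qed
  then obtain lp where lp: "\<And>f h. (f, h) \<in> loop_index A ?S \<Longrightarrow>
      lp f h 0 = \<theta>1 (tail ?S f) \<and> lp f h (length (arc_rel A ?S f h)) = \<theta>1 (tail ?S f) \<and>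
      (\<forall>j<length (arc_rel A ?S f h). go E (arc_rel A ?S f h ! j) (lp f h j) (lp f h (Suc j)))"
    by metis
  define \<theta> where "\<theta> n = (case n of PrevNode z \<Rightarrow> \<theta>1 z | LoopNode f h j \<Rightarrow> lp f h j)" for n
  have \<theta>_pt: "\<theta> (loop_pt A ?S f h j) = lp f h j" if "(f, h) \<in> loop_index A ?S" for f h j
    using lp[OF that] by (auto simp: \<theta>_def loop_pt_def)
  have "graph_hom \<theta> (saturated_graph Ws) E"
    unfolding graph_hom_def
  proof
    fix k assume k: "k \<in> arcs (saturated_graph Ws)"
    show "E (\<theta> (tail (saturated_graph Ws) k)) (lab (saturated_graph Ws) k) (\<theta> (head (saturated_graph Ws) k))"
    proof (cases k)
      case (PrevArc f)
      then show ?thesis using k arc1[of f]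
        by (auto simp: saturated_graph_def edge_saturate_def \<theta>_def)
    next
      case (LoopArc f h j)
      then have fh: "(f, h) \<in> loop_index A ?S" "j < length (arc_rel A ?S f h)"
        using k by (auto simp: saturated_graph_def edge_saturate_def)
      then show ?thesis using LoopArc lp[OF fh(1)] \<theta>_pt[OF fh(1)]
        by (auto simp: saturated_graph_def edge_saturate_def line_tail_def line_head_def go_def)
    qed
  qed
  moreover have "\<theta> (base (saturated_graph Ws)) = b"
    by (simp add: saturated_graph_def edge_saturate_def vertex_saturate_def bouquet_def \<theta>_def \<theta>1_def \<beta>_def)
  ultimately show ?thesis by blast
qed

end

section \<open>Transport of edges by edge groups in folded graphs\<close>

context gog
begin

lemma im_one: "fst d \<in> Es \<Longrightarrow> im d \<one>\<^bsub>Eg d\<^esub> = \<one>\<^bsub>vgroup A (src d)\<^esub>"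
  using group_hom.hom_one[OF im_hom] by blast

lemma im_mult: "fst d \<in> Es \<Longrightarrow> h \<in> carrier (Eg d) \<Longrightarrow> k \<in> carrier (Eg d) \<Longrightarrow>
    im d (h \<otimes>\<^bsub>Eg d\<^esub> k) = im d h \<otimes>\<^bsub>vgroup A (src d)\<^esub> im d k"
  using group_hom.hom_mult[OF im_hom] by blast

lemma im_inv: "fst d \<in> Es \<Longrightarrow> h \<in> carrier (Eg d) \<Longrightarrow>
    im d (inv\<^bsub>Eg d\<^esub> h) = inv\<^bsub>vgroup A (src d)\<^esub> im d h"
  using group_hom.hom_inv[OF im_hom] by blast

lemma src_simps [simp]: "src (e, True) = tail (dgraph A) e" "src (e, False) = head (dgraph A) e"
  by (auto simp: oinit_def)

text \<open>Each element of the edge group carries the edge to a parallel edge with the same label;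
  this is the trace of the relators that survives folding.\<close>

definition edge_typed where
  "edge_typed E p e q \<longleftrightarrow> e \<in> Es \<and> vtype E (src (e, True)) p \<and> vtype E (src (e, False)) q \<and>
     (\<forall>h\<in>carrier (egroup A e). \<exists>p' q'. step E (src (e, True)) (im (e, True) h) p p' \<and>
        step E (src (e, False)) (im (e, False) h) q q' \<and> E p' (Edge e) q')"

text \<open>A local form of saturation that holds along all edges of an output, including those that
  come from Cayley graphs and relator loops. It allows reading to follow the action on
  states.\<close>

definition tame :: "('m \<Rightarrow> ('e, 's) letter \<Rightarrow> 'm \<Rightarrow> bool) \<Rightarrow> bool" where
  "tame E \<longleftrightarrow> det E \<and>
     (\<forall>p s q w. E p (Gen s) q \<longrightarrow> w \<in> V \<longrightarrow> s \<in> gs w \<longrightarrow> vtype E w p \<and> vtype E w q) \<and>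
     (\<forall>p e q. E p (Edge e) q \<longrightarrow> edge_typed E p e q)"

context
  fixes E :: "'m \<Rightarrow> ('e, 's) letter \<Rightarrow> 'm \<Rightarrow> bool" and e p0 q0
  assumes det: "det E" and e: "e \<in> Es" and gadget: "gadget E p0 (Edge e) q0"
begin

text \<open>The relator is read from \<open>p0\<close>. Its first letter must lead to
  \<open>q0\<close> by determinism, and its two generator words lead where the edge group element
  moves \<open>q0\<close> and \<open>p0\<close>, so its second edge letter is the parallel
  edge.\<close>

lemma gadget_loop:
  assumes h: "h \<in> carrier (egroup A e)"
  shows "\<exists>p1 q1. step E (src (e, True)) (im (e, True) h) p0 p1 \<and>
    step E (src (e, False)) (im (e, False) h) q0 q1 \<and> E p1 (Edge e) q1"
proof -
  note g = gadget_iff(2)[OF det e, THEN iffD1, OF gadget]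
  have V: "tail (dgraph A) e \<in> V" "head (dgraph A) e \<in> V" using e by auto
  have hw: "hword (e, True) h \<in> words (gs (tail (dgraph A) e))"
    "hword (e, False) h \<in> words (gs (head (dgraph A) e))"
    "ev (tail (dgraph A) e) (hword (e, True) h) = im (e, True) h"
    "ev (head (dgraph A) e) (hword (e, False) h) = im (e, False) h"
    using hword[of "(e, True)" h] hword[of "(e, False)" h] e h by simp_all
  obtain q0' q1 p1 where r: "E p0 (Edge e) q0'" "run E q0' (gen_word (hword (e, False) h)) q1"
      "E p1 (Edge e) q1" "run E p0 (gen_word (hword (e, True) h)) p1"
    using g h by (auto simp: edge_rel_eq path_append run_inv_word)
  have "q0' = q0" using g r(1) detD[OF det, of "(Edge e, True)" p0] by auto
  moreover obtain p' q' where s: "step E (tail (dgraph A) e) (im (e, True) h) p0 p'"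
      "step E (head (dgraph A) e) (im (e, False) h) q0 q'"
    using g vtype_step[OF V(1), of E p0 "im (e, True) h"] vtype_step[OF V(2), of E q0 "im (e, False) h"]
    by auto
  ultimately have "p' = p1" "q' = q1"
    using r step_run[OF V(1) hw(1), of E p0 p'] step_run[OF V(2) hw(2), of E q0 q'] hw(3,4)
      run_det[OF det] by auto
  then show ?thesis using s r(3) by auto
qed

text \<open>Both edge letters of a relator are translates of the original edge: the first by the
  identity, the second by \<open>h\<close>. Hence edges on attached loops can be transported just
  like the original one.\<close>

definition loop_type where
  "loop_type l p q \<longleftrightarrow> go E l p q \<and> (case fst l of
     Gen s \<Rightarrow> \<forall>w\<in>V. s \<in> gs w \<longrightarrow> vtype E w p \<and> vtype E w q
   | Edge e' \<Rightarrow> e' = e \<and> (\<exists>k\<in>carrier (egroup A e).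
       step E (src (e, True)) (im (e, True) k) p0 (if snd l then p else q) \<and>
       step E (src (e, False)) (im (e, False) k) q0 (if snd l then q else p)))"

lemma loop_typed:
  assumes h: "h \<in> carrier (egroup A e)"
  shows "path loop_type p0 (edge_rel A e h) p0"
proof -
  note g = gadget_iff(2)[OF det e, THEN iffD1, OF gadget]
  interpret H: group "egroup A e" using e by (rule group_egroup)
  have V: "tail (dgraph A) e \<in> V" "head (dgraph A) e \<in> V" using e by auto
  have hw: "hword (e, True) h \<in> words (gs (tail (dgraph A) e))"
    "hword (e, False) h \<in> words (gs (head (dgraph A) e))"
    "ev (tail (dgraph A) e) (hword (e, True) h) = im (e, True) h"
    "ev (head (dgraph A) e) (hword (e, False) h) = im (e, False) h"
    using hword[of "(e, True)" h] hword[of "(e, False)" h] e h by simp_all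
  obtain p1 q1 where s: "step E (tail (dgraph A) e) (im (e, True) h) p0 p1"
     "step E (head (dgraph A) e) (im (e, False) h) q0 q1" "E p1 (Edge e) q1"
    using gadget_loop[OF h] by auto
  have gen: "path loop_type p (gen_word u) q"
    if u: "w \<in> V" "u \<in> words (gs w)" "step E w (ev w u) p q" for w u p q
  proof -
    obtain \<kappa> where "cay E w p \<kappa>" "\<kappa> (ev w u) = q" using u(3) by (auto simp: step_def)
    then have "path (\<lambda>l p q. go E l p q \<and> vtype E w p \<and> vtype E w q \<and> fst l \<in> Gen ` gs w) p (gen_word u) q"
      using cay_run_typed[OF u(1) _ u(2), of E p \<kappa>] by simp
    then show ?thesis
    proof (rule path_mono)
      fix l p q assume l: "go E l p q \<and> vtype E w p \<and> vtype E w q \<and> fst l \<in> Gen ` gs w"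
      then obtain s where s: "fst l = Gen s" "s \<in> gs w" by auto
      have "w' = w" if "w' \<in> V" "s \<in> gs w'" for w'
        using gens_vertex_unique[OF u(1) that(1) s(2) that(2)] by simp
      then show "loop_type l p q"
        using l s by (auto simp: loop_type_def)
    qed
  qed
  have "step E (tail (dgraph A) e) \<one>\<^bsub>vgroup A (tail (dgraph A) e)\<^esub> p0 p0"
    "step E (head (dgraph A) e) \<one>\<^bsub>vgroup A (head (dgraph A) e)\<^esub> q0 q0"
    using g step_one V by auto
  then have 1: "loop_type (Edge e, True) p0 q0"
    using g e im_one[of "(e, True)"] im_one[of "(e, False)"]
    by (auto simp: loop_type_def intro!: bexI[of _ "\<one>\<^bsub>egroup A e\<^esub>"])
  have 2: "path loop_type q0 (gen_word (hword (e, False) h)) q1"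
    using gen[OF V(2) hw(2)] s hw by simp
  have 3: "loop_type (Edge e, False) q1 p1"
    using s h by (auto simp: loop_type_def)
  have "step E (tail (dgraph A) e) (inv\<^bsub>vgroup A (tail (dgraph A) e)\<^esub> im (e, True) h) p1 p0"
    using step_inv[OF V(1) det s(1)] im_closed[of "(e, True)" h] e h by simp
  then have 4: "path loop_type p1 (inv_word (gen_word (hword (e, True) h))) p0"
    unfolding inv_word_gen_word using hw V by (intro gen[OF V(1)]) (simp_all add: ev_inv)
  show ?thesis
    unfolding edge_rel_eq path_append using 1 2 3 4 by auto
qed

text \<open>The translate by \<open>k\<close> is moved by \<open>h\<close> to the place where the
  original is moved by \<open>k * h\<close>; splitting the latter movement yields the
  former.\<close>

lemma gadget_edge_typed:
  assumes k: "k \<in> carrier (egroup A e)"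
    and p: "step E (src (e, True)) (im (e, True) k) p0 p"
    and q: "step E (src (e, False)) (im (e, False) k) q0 q"
  shows "edge_typed E p e q"
proof -
  interpret H: group "egroup A e" using e by (rule group_egroup)
  have V: "tail (dgraph A) e \<in> V" "head (dgraph A) e \<in> V" using e by auto
  note c = im_closed[of "(e, True)"] im_closed[of "(e, False)"]
  have "\<exists>p' q'. step E (src (e, True)) (im (e, True) h) p p' \<and>
        step E (src (e, False)) (im (e, False) h) q q' \<and> E p' (Edge e) q'"
    if h: "h \<in> carrier (egroup A e)" for h
  proof -
    obtain p' q' where
      s: "step E (tail (dgraph A) e) (im (e, True) (k \<otimes>\<^bsub>egroup A e\<^esub> h)) p0 p'"
        "step E (head (dgraph A) e) (im (e, False) (k \<otimes>\<^bsub>egroup A e\<^esub> h)) q0 q'" "E p' (Edge e) q'"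
      using gadget_loop[of "k \<otimes>\<^bsub>egroup A e\<^esub> h"] h k by auto
    obtain p1 where p1: "step E (tail (dgraph A) e) (im (e, True) k) p0 p1"
        "step E (tail (dgraph A) e) (im (e, True) h) p1 p'"
      using step_split[OF V(1) det, of "im (e, True) k" "im (e, True) h" p0 p'] s(1) c h k e
        im_mult[of "(e, True)" k h] by auto
    obtain q1 where q1: "step E (head (dgraph A) e) (im (e, False) k) q0 q1"
        "step E (head (dgraph A) e) (im (e, False) h) q1 q'"
      using step_split[OF V(2) det, of "im (e, False) k" "im (e, False) h" q0 q'] s(2) c h k e
        im_mult[of "(e, False)" k h] by auto
    have "p1 = p" "q1 = q"
      using step_unique[OF V(1) det p1(1), of p] step_unique[OF V(2) det q1(1), of q] p q c e k by auto
    then show ?thesis using p1 q1 s by auto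
  qed
  moreover have "vtype E (src (e, True)) p" "vtype E (src (e, False)) q"
    using step_vtype(2)[OF V(1), of E "im (e, True) k" p0 p] p
      step_vtype(2)[OF V(2), of E "im (e, False) k" q0 q] q c e k by auto
  ultimately show ?thesis using e by (simp add: edge_typed_def)
qed

end

lemma bouquet_simps:
  "base (bouquet Ws) = Base"
  "(i, j) \<in> arcs (bouquet Ws) \<longleftrightarrow> i < length Ws \<and> j < length (Ws ! i)"
  "tail (bouquet Ws) (i, j) = line_tail (Ws ! i) (bouquet_pt Ws i) j"
  "head (bouquet Ws) (i, j) = line_head (Ws ! i) (bouquet_pt Ws i) j"
  "lab (bouquet Ws) (i, j) = fst (Ws ! i ! j)"
  by (auto simp: bouquet_def)

text \<open>An output enters only as a deterministic quotient of the saturated graph. Each of its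
  edges is the image of an arc of the bouquet, of a Cayley copy or of a relator loop; the three
  kinds are typed by their gadgets, by shifting the root and by \<open>loop_type\<close>.\<close>

theorem output_facts:
  fixes \<Gamma> :: "('n, 'f, ('e, 's) letter) lgraph"
  defines "E \<equiv> edge_of \<Gamma>"
  assumes Ws: "\<And>W. W \<in> set Ws \<Longrightarrow> W \<in> words X"
    and quot: "quotient_map \<psi> (saturated_graph Ws) \<Gamma>" and det: "det E"
  shows "tame E" and "vtype E v (base \<Gamma>)"
    and "\<And>W. W \<in> set Ws \<Longrightarrow> path (go (gadget E)) (base \<Gamma>) W (base \<Gamma>)"
    and "\<And>p. p \<in> verts \<Gamma> \<Longrightarrow> \<exists>U. run E (base \<Gamma>) U p"
proof -
  let ?B = "bouquet Ws" and ?S = "vertex_saturate A v (bouquet Ws)" and ?T = "saturated_graph Ws"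
  have T: "?T = edge_saturate A ?S" by (simp add: saturated_graph_def)
  define \<beta> where "\<beta> z = \<psi> (PrevNode (OldNode z))" for z
  define \<kappa> where "\<kappa> z w a = \<psi> (PrevNode (cay_pt A z w a))" for z w a
  define lp where "lp f h j = \<psi> (loop_pt A ?S (OldArc f) h j)" for f h j
  have hom: "E (\<psi> (tail ?T k)) (lab ?T k) (\<psi> (head ?T k))" if "k \<in> arcs ?T" for k
    using quotient_graph_hom[OF quot] that by (auto simp: graph_hom_def E_def)
  have base: "\<beta> Base = base \<Gamma>"
    using quot by (simp add: quotient_map_def \<beta>_def T edge_saturate_def vertex_saturate_def bouquet_def)
  have arcB: "E (\<beta> (tail ?B f)) (lab ?B f) (\<beta> (head ?B f))" if "f \<in> arcs ?B" for f
    using hom[of "PrevArc (OldArc f)"] that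
    by (simp add: T edge_saturate_def vertex_saturate_def \<beta>_def)
  have labX: "lab ?B f \<in> X" if f: "f \<in> arcs ?B" for f
    using f Ws words_X_nth by (cases f) (auto simp: bouquet_simps)
  have cay: "cay E w (\<beta> z) (\<kappa> z w)" if z: "node_type A v ?B z w" for z w
    unfolding cay_def
  proof (intro conjI ballI)
    show "\<kappa> z w \<one>\<^bsub>vgroup A w\<^esub> = \<beta> z" by (simp add: \<kappa>_def \<beta>_def cay_pt_def)
    fix a s assume a: "a \<in> carrier (vgroup A w)" "s \<in> gs w"
    have "PrevArc (CayArc z w a s) \<in> arcs ?T"
      using z a by (simp add: T edge_saturate_def vertex_saturate_def)
    from hom[OF this] show "E (\<kappa> z w a) (Gen s) (\<kappa> z w (a \<otimes>\<^bsub>vgroup A w\<^esub> val s))"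
      by (simp add: T edge_saturate_def vertex_saturate_def \<kappa>_def)
  qed
  have vtype: "vtype E w (\<beta> z)" if "node_type A v ?B z w" for z w
    using cay[OF that] unfolding vtype_def by blast
  have tail_head: "tail ?B f \<in> verts ?B \<and> head ?B f \<in> verts ?B" if f: "f \<in> arcs ?B" for f
    using f by (cases f) (auto simp: bouquet_simps line_tail_def line_head_def,
        (fastforce simp: bouquet_def)+)
  have loop_index: "(OldArc f, h) \<in> loop_index A ?S \<longleftrightarrow>
      f \<in> arcs ?B \<and> (\<exists>e. lab ?B f = Edge e \<and> h \<in> carrier (egroup A e))" for f h
    by (auto simp: loop_index_def vertex_saturate_def)
  have arc_rel: "arc_rel A ?S (OldArc f) h = edge_rel A e h" if "lab ?B f = Edge e" for f e h
    using that by (simp add: arc_rel_def vertex_saturate_def)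
  have tailS: "tail ?S (OldArc f) = OldNode (tail ?B f)" for f
    by (simp add: vertex_saturate_def)
  have lp_ends: "lp f h 0 = \<beta> (tail ?B f)" "lp f h (length (edge_rel A e h)) = \<beta> (tail ?B f)"
    if "lab ?B f = Edge e" for f h e
    using that by (auto simp: lp_def loop_pt_def arc_rel \<beta>_def tailS)
  have lp_go: "go E (edge_rel A e h ! j) (lp f h j) (lp f h (Suc j))"
    if f: "f \<in> arcs ?B" "lab ?B f = Edge e" "h \<in> carrier (egroup A e)" "j < length (edge_rel A e h)" for f e h j
  proof -
    have "LoopArc (OldArc f) h j \<in> arcs ?T"
      using f by (simp add: T edge_saturate_def loop_index arc_rel)
    from hom[OF this] show ?thesis
      using f by (auto simp: T edge_saturate_def arc_rel line_tail_def line_head_def lp_def go_def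
          split: if_splits)
  qed
  have loop_run: "run E (\<beta> (tail ?B f)) (edge_rel A e h) (\<beta> (tail ?B f))"
    if f: "f \<in> arcs ?B" "lab ?B f = Edge e" "h \<in> carrier (egroup A e)" for f e h
    unfolding path_pts using lp_ends[OF f(2)] lp_go[OF f] by (intro exI[of _ "lp f h"]) auto
  have gad: "gadget E (\<beta> (tail ?B f)) (lab ?B f) (\<beta> (head ?B f))" if f: "f \<in> arcs ?B" for f
  proof (cases "lab ?B f")
    case (Gen s)
    then obtain w where w: "w \<in> V" "s \<in> gs w" using labX[OF f] by (auto simp: Gen_in_X)
    then have "node_type A v ?B (tail ?B f) w" "node_type A v ?B (head ?B f) w"
      using f Gen tail_head[OF f] by (auto simp: node_type_def)
    then show ?thesis using Gen w arcB[OF f] vtype gadget_iff(1)[OF det] by simp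
  next
    case (Edge e)
    then have e: "e \<in> Es" using labX[OF f] by simp
    then have "node_type A v ?B (tail ?B f) (tail (dgraph A) e)"
      "node_type A v ?B (head ?B f) (head (dgraph A) e)"
      using f Edge tail_head[OF f] by (auto simp: node_type_def)
    then show ?thesis
      using Edge e arcB[OF f] vtype gadget_iff(2)[OF det e] loop_run[OF f Edge] by simp
  qed
  have B_go: "go (gadget E) (Ws ! i ! j) (\<beta> (bouquet_pt Ws i j)) (\<beta> (bouquet_pt Ws i (Suc j)))"
    if "i < length Ws" "j < length (Ws ! i)" for i j
    using gad[of "(i, j)"] that
    by (auto simp: bouquet_simps line_tail_def line_head_def go_def split: if_splits)
  have pt0: "bouquet_pt Ws i 0 = Base" "bouquet_pt Ws i (length (Ws ! i)) = Base" for i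
    by (auto simp: bouquet_pt_def)
  show "path (go (gadget E)) (base \<Gamma>) W (base \<Gamma>)" if "W \<in> set Ws" for W
  proof -
    obtain i where "i < length Ws" "W = Ws ! i" using \<open>W \<in> set Ws\<close> by (auto simp: in_set_conv_nth)
    then show ?thesis
      unfolding path_pts using B_go pt0 base
      by (intro exI[of _ "\<lambda>j. \<beta> (bouquet_pt Ws i j)"]) auto
  qed
  have Base_type: "node_type A v ?B Base v"
    using v_vert by (simp add: node_type_def bouquet_def)
  show "vtype E v (base \<Gamma>)" using vtype[OF Base_type] base by simp
  have reachB: "\<exists>U. run E (base \<Gamma>) U (\<beta> z)" if z: "z \<in> verts ?B" for z
  proof (cases "z = Base")
    case True
    then show ?thesis using base by (intro exI[of _ "[]"]) simp
  next
    case False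
    then obtain i j where ij: "i < length Ws" "j \<le> length (Ws ! i)" "z = bouquet_pt Ws i j"
      using z by (auto simp: bouquet_def)
    have "path (go (gadget E)) (\<beta> (bouquet_pt Ws i 0)) (take j (Ws ! i)) (\<beta> (bouquet_pt Ws i j))"
      using ij B_go by (intro path_take) auto
    then have "run E (base \<Gamma>) (take j (Ws ! i)) (\<beta> z)"
      using ij base pt0 by (auto simp: go_def gadget_def elim!: path_mono split: if_splits)
    then show ?thesis by blast
  qed
  have reach_trans: "\<exists>U. run E (base \<Gamma>) U q" if "\<exists>U. run E (base \<Gamma>) U p" "run E p U' q" for p q U'
    using that path_append by metis
  show "\<exists>U. run E (base \<Gamma>) U p" if p: "p \<in> verts \<Gamma>" for p
  proof -
    obtain n where n: "n \<in> verts ?T" "p = \<psi> n" using p quot by (auto simp: quotient_map_def)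
    consider z where "n = PrevNode (OldNode z)" "z \<in> verts ?B"
      | z w a where "n = PrevNode (cay_pt A z w a)" "node_type A v ?B z w" "a \<in> carrier (vgroup A w)"
      | k h j where "n = loop_pt A ?S k h j" "(k, h) \<in> loop_index A ?S" "j \<le> length (arc_rel A ?S k h)"
      using n(1) by (auto simp: T edge_saturate_def vertex_saturate_def)
    then show ?thesis
    proof cases
      case 1
      then show ?thesis using reachB n(2) by (simp add: \<beta>_def)
    next
      case 2
      have w: "w \<in> V" "z \<in> verts ?B" using 2(2) by (auto simp: node_type_def)
      have "run E (\<beta> z) (gen_word (wd w a)) (\<kappa> z w a)"
        using cay_run[OF w(1) cay[OF 2(2)] wd(1)[OF w(1) 2(3)]] wd(2)[OF w(1) 2(3)] by simp
      then show ?thesis using reach_trans[OF reachB[OF w(2)]] 2 n(2) by (simp add: \<kappa>_def)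
    next
      case 3
      then obtain f e where f: "k = OldArc f" "f \<in> arcs ?B" "lab ?B f = Edge e" "h \<in> carrier (egroup A e)"
        by (cases k) (auto simp: loop_index_def vertex_saturate_def)
      have "run E (lp f h 0) (take j (edge_rel A e h)) (lp f h j)"
        using lp_go[OF f(2-4)] 3(3) f arc_rel by (intro path_take) auto
      then have "run E (\<beta> (tail ?B f)) (take j (edge_rel A e h)) p"
        using lp_ends[OF f(3)] 3 n(2) f(1) by (simp add: lp_def)
      then show ?thesis using reach_trans[OF reachB] tail_head[OF f(2)] by blast
    qed
  qed
  have arc_cases: "(case x of Gen s \<Rightarrow> \<forall>w\<in>V. s \<in> gs w \<longrightarrow> vtype E w p \<and> vtype E w q
     | Edge e \<Rightarrow> edge_typed E p e q)" if pq: "E p x q" for p x q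
  proof -
    obtain k where k: "k \<in> arcs ?T" "\<psi> (tail ?T k) = p" "\<psi> (head ?T k) = q" "lab ?T k = x"
      using quot pq unfolding quotient_map_def E_def by blast
    have gad_type: "(case lab ?B f of Gen s \<Rightarrow> \<forall>w\<in>V. s \<in> gs w \<longrightarrow> vtype E w (\<beta> (tail ?B f)) \<and> vtype E w (\<beta> (head ?B f))
     | Edge e \<Rightarrow> edge_typed E (\<beta> (tail ?B f)) e (\<beta> (head ?B f)))" if f: "f \<in> arcs ?B" for f
    proof (cases "lab ?B f")
      case (Gen s)
      then show ?thesis using gad[OF f] gadget_iff(1)[OF det] by auto
    next
      case (Edge e)
      then have e: "e \<in> Es" using labX[OF f] by simp
      interpret H: group "egroup A e" using e by (rule group_egroup)
      note g = gad[OF f, unfolded Edge]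
      have "step E (src (e, True)) (im (e, True) \<one>\<^bsub>egroup A e\<^esub>) (\<beta> (tail ?B f)) (\<beta> (tail ?B f))"
        "step E (src (e, False)) (im (e, False) \<one>\<^bsub>egroup A e\<^esub>) (\<beta> (head ?B f)) (\<beta> (head ?B f))"
        using g[unfolded gadget_iff(2)[OF det e]] step_one[of "tail (dgraph A) e" E "\<beta> (tail ?B f)"]
          step_one[of "head (dgraph A) e" E "\<beta> (head ?B f)"] e
          im_one[of "(e, True)"] im_one[of "(e, False)"] by auto
      from gadget_edge_typed[OF det e g H.one_closed this]
      have "edge_typed E (\<beta> (tail ?B f)) e (\<beta> (head ?B f))" .
      then show ?thesis using Edge by simp
    qed
    consider f where "k = PrevArc (OldArc f)" "f \<in> arcs ?B"
      | z w a s where "k = PrevArc (CayArc z w a s)" "node_type A v ?B z w"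
          "a \<in> carrier (vgroup A w)" "s \<in> gs w"
      | f h j e where "k = LoopArc (OldArc f) h j" "f \<in> arcs ?B" "lab ?B f = Edge e"
          "h \<in> carrier (egroup A e)" "j < length (edge_rel A e h)"
    proof (cases k)
      case (PrevArc k')
      then show ?thesis using k(1) that(1,2)
        by (cases k') (auto simp: T edge_saturate_def vertex_saturate_def)
    next
      case (LoopArc k' h j)
      then have k': "(k', h) \<in> loop_index A ?S" "j < length (arc_rel A ?S k' h)"
        using k(1) by (auto simp: T edge_saturate_def)
      then obtain f e where f: "k' = OldArc f" "f \<in> arcs ?B" "lab ?B f = Edge e" "h \<in> carrier (egroup A e)"
        by (cases k') (auto simp: loop_index_def vertex_saturate_def)
      then show ?thesis using that(3)[of f h j e] LoopArc k' arc_rel by auto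
    qed
    then show ?thesis
    proof cases
      case 1
      then have pqx: "p = \<beta> (tail ?B f)" "q = \<beta> (head ?B f)" "x = lab ?B f"
        using k by (auto simp: T edge_saturate_def vertex_saturate_def \<beta>_def)
      show ?thesis unfolding pqx by (rule gad_type[OF 1(2)])
    next
      case 2
      then have pqx: "p = \<kappa> z w a" "q = \<kappa> z w (a \<otimes>\<^bsub>vgroup A w\<^esub> val s)" "x = Gen s"
        using k by (auto simp: T edge_saturate_def vertex_saturate_def \<kappa>_def)
      have w: "w \<in> V" using 2 by (simp add: node_type_def)
      interpret G: group "vgroup A w" using w by (rule group_vgroup)
      have "vtype E w p" "vtype E w q"
        using cay_shift[OF w cay[OF 2(2)] 2(3)] val_closed[OF w 2(4)] pqx 2(3)
          cay_shift[OF w cay[OF 2(2)], of "a \<otimes>\<^bsub>vgroup A w\<^esub> val s"]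
        unfolding vtype_def by blast+
      then show ?thesis using pqx gens_vertex_unique[OF w _ 2(4)] by auto
    next
      case 3
      have e: "e \<in> Es" using labX[OF 3(2)] 3(3) by simp
      note g = gad[OF 3(2), unfolded 3(3)]
      let ?L = "loop_type E e (\<beta> (tail ?B f)) (\<beta> (head ?B f))"
      obtain pt where pt: "pt 0 = \<beta> (tail ?B f)"
          "\<And>j. j < length (edge_rel A e h) \<Longrightarrow> ?L (edge_rel A e h ! j) (pt j) (pt (Suc j))"
        using loop_typed[OF det e g 3(4)] unfolding path_pts by auto
      \<comment> \<open>The typed path from \<open>loop_typed\<close> and the image of the attached
        loop start together, so determinism identifies them vertex by vertex.\<close>
      have "j \<le> length (edge_rel A e h) \<Longrightarrow> pt j = lp f h j" for j
      proof (induction j)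
        case 0
        then show ?case using pt lp_ends[OF 3(3)] by simp
      next
        case (Suc j)
        then have "go E (edge_rel A e h ! j) (lp f h j) (pt (Suc j))"
          using pt(2)[of j] by (auto simp: loop_type_def[OF det e g])
        then show ?case using lp_go[OF 3(2-4), of j] Suc detD[OF det] by auto
      qed
      then have L: "?L (edge_rel A e h ! j) (lp f h j) (lp f h (Suc j))"
        using pt(2)[OF 3(5)] 3(5) by simp
      let ?l = "edge_rel A e h ! j"
      have pqx: "x = fst ?l" "p = (if snd ?l then lp f h j else lp f h (Suc j))"
          "q = (if snd ?l then lp f h (Suc j) else lp f h j)"
        using k 3 arc_rel[OF 3(3)]
        by (auto simp: T edge_saturate_def lp_def line_tail_def line_head_def)
      show ?thesis
      proof (cases x)
        case (Gen s)
        then show ?thesis using L pqx by (auto simp: loop_type_def[OF det e g])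
      next
        case (Edge e')
        then obtain m where m: "e' = e" "m \<in> carrier (egroup A e)"
          "step E (src (e, True)) (im (e, True) m) (\<beta> (tail ?B f)) p"
          "step E (src (e, False)) (im (e, False) m) (\<beta> (head ?B f)) q"
          using L pqx by (auto simp: loop_type_def[OF det e g])
        then show ?thesis using gadget_edge_typed[OF det e g m(2-4)] Edge by simp
      qed
    qed
  qed
  show "tame E"
    unfolding tame_def using det arc_cases[of _ "Gen s" for s] arc_cases[of _ "Edge e" for e]
    by (intro conjI allI impI) auto
qed

end

section \<open>Reading normal forms, and the two directions of the membership criterion\<close>

section \<open>Membership in the subgroup\<close>

context gog
begin

subsection \<open>Reading states in a tame graph\<close>

abbreviation edge_letter :: "'e \<times> bool \<Rightarrow> ('e, 's) letter \<times> bool" where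
  "edge_letter d \<equiv> (Edge (fst d), snd d)"

text \<open>Reads a state from its oldest syllable on, hence the recursion into the tail first.
  Vertex syllables move by \<open>step\<close>, independently of words for their elements.\<close>

fun rd :: "('m \<Rightarrow> ('e, 's) letter \<Rightarrow> 'm \<Rightarrow> bool) \<Rightarrow> 'm \<Rightarrow> ('v, 'e, 'g) syllable list \<Rightarrow> 'm \<Rightarrow> bool" where
  "rd E p [] q \<longleftrightarrow> p = q"
| "rd E p (VS w a # \<sigma>) q \<longleftrightarrow> (\<exists>p'. rd E p \<sigma> p' \<and> step E w a p' q)"
| "rd E p (ES d # \<sigma>) q \<longleftrightarrow> (\<exists>p'. rd E p \<sigma> p' \<and> go E (edge_letter d) p' q)"

context
  fixes E :: "'m \<Rightarrow> ('e, 's) letter \<Rightarrow> 'm \<Rightarrow> bool"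
  assumes tame: "tame E"
begin

lemma det_E: "det E"
  using tame by (simp add: tame_def)

lemma gen_typed:
  assumes "go E (Gen s, b) p q" "w \<in> V" "s \<in> gs w"
  shows "vtype E w p" "step E w (sval w (s, b)) p q"
proof -
  have "\<forall>p s q w. E p (Gen s) q \<longrightarrow> w \<in> V \<longrightarrow> s \<in> gs w \<longrightarrow> vtype E w p \<and> vtype E w q"
    using tame by (simp add: tame_def)
  with assms show "vtype E w p" by (cases b) auto
  then show "step E w (sval w (s, b)) p q" using vtype_go_step[OF assms(2) det_E] assms by blast
qed

lemma edge_go_typed:
  assumes "go E (edge_letter d) p q"
  shows "fst d \<in> Es" "vtype E (src d) p" "vtype E (tgt d) q"
    "h \<in> carrier (Eg d) \<Longrightarrow> \<exists>p' q'. step E (src d) (im d h) p p' \<and> step E (tgt d) (om d h) q q' \<and>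
       go E (edge_letter d) p' q'"
proof -
  obtain e b where d: "d = (e, b)" by force
  have "\<forall>p e q. E p (Edge e) q \<longrightarrow> edge_typed E p e q"
    using tame by (simp add: tame_def)
  then have "if b then edge_typed E p e q else edge_typed E q e p"
    using assms d by (auto simp: go_def split: if_splits)
  then show "fst d \<in> Es" "vtype E (src d) p" "vtype E (tgt d) q"
    "h \<in> carrier (Eg d) \<Longrightarrow> \<exists>p' q'. step E (src d) (im d h) p p' \<and> step E (tgt d) (om d h) q q' \<and>
       go E (edge_letter d) p' q'"
    unfolding edge_typed_def d by (cases b; fastforce)+
qed

lemma rd_joinI:
  assumes "rd E p \<sigma> p'" "step E w a p' q" "w \<in> V"
  shows "rd E p (join w \<sigma> a) q"
proof (cases "a = \<one>\<^bsub>vgroup A w\<^esub>")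
  case True
  then have "p' = q" using assms(2) by (auto simp: step_def cay_def)
  then show ?thesis using True assms by (simp add: join_def)
qed (use assms in \<open>auto simp: join_def\<close>)

text \<open>\<open>join\<close> drops the identity, so the step by it has to be restored; this is
  possible at the root of a Cayley graph.\<close>

lemma rd_joinD:
  assumes "rd E p (join w \<sigma> a) q" "vtype E w q" "w \<in> V"
  obtains p' where "rd E p \<sigma> p'" "step E w a p' q"
proof (cases "a = \<one>\<^bsub>vgroup A w\<^esub>")
  case True
  then show ?thesis using that[of q] assms step_one[OF assms(3,2)] by (simp add: join_def)
qed (use assms that in \<open>auto simp: join_def\<close>)

lemma rd_act_vertex:
  assumes "valid \<sigma>" "w \<in> V" "b \<in> carrier (vgroup A w)" "rd E p \<sigma> q" "step E w b q q'"
  shows "rd E p (act_vertex w b \<sigma>) q'"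
proof -
  obtain \<sigma>' a where s: "\<sigma> = join w \<sigma>' a" "no_top w \<sigma>'" "a \<in> carrier (vgroup A w)"
    using split_obtain[OF assms(1,2)] by metis
  obtain p' where p': "rd E p \<sigma>' p'" "step E w a p' q"
    using rd_joinD[of p w \<sigma>' a q] assms s step_vtype by metis
  then have "step E w (a \<otimes>\<^bsub>vgroup A w\<^esub> b) p' q'"
    using step_mult[OF assms(2) det_E] assms s by blast
  then show ?thesis using rd_joinI p' s assms act_vertex_join by metis
qed

text \<open>When the action moves an edge group part across \<open>d\<close>, the reading moves to
  the parallel edge. In a pinch this parallel edge retraces the last edge of the state, and
  determinism brings the reading back to where that edge began.\<close>

lemma rd_act_edge:
  assumes "valid \<sigma>" "rd E p \<sigma> q" "go E (edge_letter d) q q'"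
  shows "rd E p (act_edge d \<sigma>) q'"
proof -
  note t = edge_go_typed[OF assms(3)]
  have V: "src d \<in> V" "tgt d \<in> V" using t(1) by auto
  interpret G: group "vgroup A (src d)" using V by (simp add: group_vgroup)
  interpret H: group "Eg d" using t(1) by (simp add: group_egroup)
  have shift: "\<exists>m m'. step E (src d) (im d h) m q \<and> step E (tgt d) (om d h) m' q' \<and>
      go E (edge_letter d) m m'" if h: "h \<in> carrier (Eg d)" for h
  proof -
    obtain m m' where m: "step E (src d) (im d (inv\<^bsub>Eg d\<^esub> h)) q m"
        "step E (tgt d) (om d (inv\<^bsub>Eg d\<^esub> h)) q' m'" "go E (edge_letter d) m m'"
      using t(4)[of "inv\<^bsub>Eg d\<^esub> h"] h by auto
    then show ?thesis
      using step_inv[OF V(1) det_E m(1)] step_inv[OF V(2) det_E m(2)] h t(1)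
        im_inv[of d "inv\<^bsub>Eg d\<^esub> h"] im_inv[of "flip d" "inv\<^bsub>Eg d\<^esub> h"] im_closed[of d] om_closed[of d]
      by auto
  qed
  from assms(1) t(1) show ?thesis
  proof (cases rule: act_edge_cases)
    case (push \<sigma>' r h)
    obtain p' where p': "rd E p \<sigma>' p'" "step E (src d) (r \<otimes>\<^bsub>vgroup A (src d)\<^esub> im d h) p' q"
      using rd_joinD[of p "src d" \<sigma>' "r \<otimes>\<^bsub>vgroup A (src d)\<^esub> im d h" q] assms(2) t V push by auto
    obtain m m' where m: "step E (src d) (im d h) m q" "step E (tgt d) (om d h) m' q'"
        "go E (edge_letter d) m m'"
      using shift[OF push(6)] by blast
    obtain n where n: "step E (src d) r p' n" "step E (src d) (im d h) n q"
      using step_split[OF V(1) det_E p'(2)] push t by auto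
    have "n = m"
      using step_inv[OF V(1) det_E n(2)] step_inv[OF V(1) det_E m(1)] push t
        step_unique[OF V(1) det_E] by (metis G.inv_closed im_closed)
    then have "rd E p (join (src d) \<sigma>' r) m" using rd_joinI p' n V by metis
    then have "rd E p (ES d # join (src d) \<sigma>' r) m'" using m by auto
    then show ?thesis
      using act_edge_push[OF push(2) t(1) push(4,5,6,7)] push(1) rd_joinI[OF _ m(2) V(2)] by metis
  next
    case (pinch \<rho> h)
    obtain p' where p': "rd E p (ES (flip d) # \<rho>) p'" "step E (src d) (im d h) p' q"
      using rd_joinD[of p "src d" "ES (flip d) # \<rho>" "im d h" q] assms(2) t V pinch by auto
    then obtain m0 where m0: "rd E p \<rho> m0" "go E (edge_letter (flip d)) m0 p'" by auto
    obtain m m' where m: "step E (src d) (im d h) m q" "step E (tgt d) (om d h) m' q'"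
        "go E (edge_letter d) m m'"
      using shift[OF pinch(3)] by blast
    have "p' = m"
      using step_inv[OF V(1) det_E p'(2)] step_inv[OF V(1) det_E m(1)] pinch t
        step_unique[OF V(1) det_E] by (metis G.inv_closed im_closed)
    moreover have "go E (edge_letter d) p' m0" using m0(2) by (cases d) (auto simp: go_def)
    ultimately have "m' = m0" using m(3) detD[OF det_E] by blast
    then have "rd E p (act_vertex (tgt d) (om d h) \<rho>) q'"
      using rd_act_vertex[of \<rho> "tgt d" "om d h" p m0 q'] pinch V m m0 t by auto
    then show ?thesis using act_edge_pinch[OF t(1) pinch(3)] pinch(1) by simp
  qed
qed

lemma rd_acts:
  assumes "run E q W q'" "W \<in> words X" "valid \<sigma>" "rd E p \<sigma> q"
  shows "rd E p (acts W \<sigma>) q'"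
  using assms
proof (induction W arbitrary: q \<sigma>)
  case (Cons l W)
  then obtain q1 where q1: "go E l q q1" "run E q1 W q'" by auto
  have "rd E p (act l \<sigma>) q1"
  proof (cases "fst l")
    case (Edge e)
    then show ?thesis using rd_act_edge[of \<sigma> p q "(e, snd l)" q1] Cons q1(1) by (cases l) auto
  next
    case (Gen s)
    then obtain w where w: "w \<in> V" "s \<in> gs w" using Cons by (auto simp: Gen_in_X)
    interpret group "vgroup A w" using w by (simp add: group_vgroup)
    obtain b where l: "l = (Gen s, b)" using Gen by (cases l) auto
    have "sval w (s, b) \<in> carrier (vgroup A w)" using val_closed[OF w] by auto
    then have "rd E p (act_vertex w (sval w (s, b)) \<sigma>) q1"
      using gen_typed(2)[OF _ w, of b q q1] q1(1) l Cons.prems w by (intro rd_act_vertex) auto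
    then show ?thesis using l vert_of[OF w] by (cases b) simp_all
  qed
  then show ?case using Cons q1 valid_act[of l \<sigma>] by auto
qed auto

end

subsection \<open>Reduced words\<close>

abbreviation beval where "beval \<equiv> bass_eval A"

lemma beval_eq_iff: "u \<in> words X \<Longrightarrow> u' \<in> words X \<Longrightarrow>
    beval u = beval u' \<longleftrightarrow> (u, u') \<in> pres_rel X (relators A)"
  by (simp add: bass_eval_def word_class_eq_iff)

lemma pres_rel_gen_word:
  assumes "w \<in> V" "(u, u') \<in> pres_rel (gs w) (rels A w)"
  shows "(gen_word u, gen_word u') \<in> pres_rel X (relators A)"
  using assms(2)
proof (induction rule: pres_rel.induct)
  case (cancel p q x b)
  then show ?case
    using pres_rel.cancel[of "gen_word p" X "gen_word q" "Gen x" b "relators A"] assms(1)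
    by (auto simp: Gen_in_X)
next
  case (relator p q r)
  then show ?case
    using pres_rel.relator[of "gen_word p" X "gen_word q" "gen_word r" "relators A"] assms(1)
    by (auto simp: relators_def)
qed (use assms(1) in \<open>auto intro: pres_rel.intros\<close>)

lemma beval_gen_word_cong:
  assumes "w \<in> V" "u \<in> words (gs w)" "u' \<in> words (gs w)" "ev w u = ev w u'"
  shows "beval (gen_word u) = beval (gen_word u')"
  using pres_rel_gen_word[OF assms(1)] ev_eq_iff[OF assms(1-3)] assms
  by (simp add: beval_eq_iff)

lemma vertex_elt_ev:
  assumes "w \<in> V" "u \<in> words (gs w)"
  shows "vertex_elt A w (ev w u) = beval (gen_word u)"
proof -
  have "\<exists>u'. u' \<in> words (gs w) \<and> ev w u' = ev w u" using assms by blast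
  from someI_ex[OF this] show ?thesis
    unfolding vertex_elt_def using beval_gen_word_cong[OF assms(1) _ assms(2)] by blast
qed

text \<open>With \<open>d\<close> as the closing edge letter, the two kinds of cancellable words
  become one.\<close>

lemma cancellable_iff:
  "cancellable A c \<longleftrightarrow> (\<exists>d u h. fst d \<in> Es \<and> u \<in> words (gs (src d)) \<and> h \<in> carrier (Eg d) \<and>
     c = edge_letter (flip d) # gen_word u @ [edge_letter d] \<and>
     beval (gen_word u) = vertex_elt A (src d) (im d h))" (is "_ \<longleftrightarrow> (\<exists>d. ?R d)")
proof -
  have T: "(\<exists>u\<in>words (gs (head (dgraph A) e)). c = [(Edge e, True)] @ gen_word u @ [(Edge e, False)] \<and>
      beval (gen_word u) \<in> vertex_elt A (head (dgraph A) e) ` tmap A e ` carrier (egroup A e)) \<longleftrightarrow>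
    (\<exists>u h. u \<in> words (gs (src (e, False))) \<and> h \<in> carrier (egroup A e) \<and>
     c = (Edge e, True) # gen_word u @ [(Edge e, False)] \<and>
     beval (gen_word u) = vertex_elt A (src (e, False)) (im (e, False) h))" for e
    by (auto simp: im_def)
  have F: "(\<exists>u\<in>words (gs (tail (dgraph A) e)). c = [(Edge e, False)] @ gen_word u @ [(Edge e, True)] \<and>
      beval (gen_word u) \<in> vertex_elt A (tail (dgraph A) e) ` imap A e ` carrier (egroup A e)) \<longleftrightarrow>
    (\<exists>u h. u \<in> words (gs (src (e, True))) \<and> h \<in> carrier (egroup A e) \<and>
     c = (Edge e, False) # gen_word u @ [(Edge e, True)] \<and>
     beval (gen_word u) = vertex_elt A (src (e, True)) (im (e, True) h))" for e
    by (auto simp: im_def)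
  show ?thesis
    unfolding cancellable_def T F split_paired_Ex ex_bool_eq by simp blast
qed

lemma gog_path_verts: "gog_path A w U w' \<Longrightarrow> w \<in> V \<and> w' \<in> V"
proof (induction rule: gog_path.induct)
  case (edge e b U w')
  then show ?case using src_vert[of "(e, b)"] by simp
qed auto

lemma gog_path_Nil: "gog_path A w [] w' \<longleftrightarrow> w \<in> V \<and> w = w'"
  by (auto intro: gog_path.intros elim: gog_path.cases)

lemma gog_path_Gen: "gog_path A w ((Gen s, b) # U) w' \<longleftrightarrow> s \<in> gs w \<and> gog_path A w U w'"
  by (auto intro: gog_path.intros elim: gog_path.cases)

lemma gog_path_Edge: "gog_path A w ((Edge e, b) # U) w' \<longleftrightarrow>
    e \<in> Es \<and> w = src (e, b) \<and> gog_path A (tgt (e, b)) U w'"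
  using oterm_eq[of "(e, b)"]
  by (auto intro: gog_path.intros elim: gog_path.cases)

lemma gog_path_append: "gog_path A w (U @ U') w' \<longleftrightarrow> (\<exists>w1. gog_path A w U w1 \<and> gog_path A w1 U' w')"
proof (induction U arbitrary: w)
  case Nil
  then show ?case using gog_path_verts by (auto simp: gog_path_Nil)
next
  case (Cons l U)
  obtain x b where "l = (x, b)" by force
  then show ?case using Cons by (cases x) (auto simp: gog_path_Gen gog_path_Edge)
qed

lemma gog_path_gen_word: "w \<in> V \<Longrightarrow> gog_path A w (gen_word u) w' \<longleftrightarrow> u \<in> words (gs w) \<and> w = w'"
  by (induction u) (auto simp: gog_path_Nil gog_path_Gen)

lemma gog_path_inv: "gog_path A w U w' \<Longrightarrow> gog_path A w' (inv_word U) w"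
proof (induction rule: gog_path.induct)
  case (nil w)
  then show ?case by (simp add: gog_path_Nil)
next
  case (gen s w U w' b)
  then show ?case using gog_path_verts[OF gen(2)]
    by (auto simp: gog_path_append gog_path_Gen gog_path_Nil)
next
  case (edge e b U w')
  then show ?case using src_vert[of "(e, b)"] oterm_eq[of "(e, b)"]
    by (auto simp: gog_path_append gog_path_Edge gog_path_Nil)
qed

lemma gog_path_words: "gog_path A w U w' \<Longrightarrow> U \<in> words X"
proof (induction rule: gog_path.induct)
  case (gen s w U w' b)
  then show ?case using gog_path_verts[OF gen(2)] by (auto simp: Gen_in_X)
qed auto

lemma reduced_appendD:
  assumes "reduced A (U @ U')"
  shows "reduced A U"
proof -
  have "sublist c U \<Longrightarrow> sublist c (U @ U')" for c
    unfolding sublist_def by (metis append.assoc)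
  then show ?thesis using assms unfolding reduced_def freely_reduced_def by blast
qed

lemma reduced_no_cancel: "reduced A U \<Longrightarrow> U = P @ c @ Q \<Longrightarrow> \<not> cancellable A c"
  unfolding reduced_def by (metis sublist_appendI)

text \<open>Remembers what happened since the last edge letter: the vertex element on top consists
  of the edge group part that crossed this edge and of the generators read afterwards. It links a
  pinch of the state to a cancellable subword.\<close>

definition top_shape :: "('v, 'e, 'g) syllable list \<Rightarrow> 'g \<Rightarrow> ('e, 's) letter word \<Rightarrow> 'v \<Rightarrow> bool" where
  "top_shape \<tau> a U w \<longleftrightarrow> (\<tau> = [] \<and> w = v \<or>
     (\<exists>d \<tau>' U1 u h. \<tau> = ES d # \<tau>' \<and> U = U1 @ edge_letter d # gen_word u \<and> w = tgt d \<and>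
        u \<in> words (gs w) \<and> h \<in> carrier (Eg d) \<and> fst d \<in> Es \<and>
        a = om d h \<otimes>\<^bsub>vgroup A w\<^esub> ev w u))"

text \<open>A reduced path never triggers a pinch, so its edges are exactly those of its state; the
  vertex elements can then be moved back across the edges.\<close>

lemma reduced_state:
  assumes "tame E" "vtype E v p" "gog_path A v U w" "reduced A U"
  shows "\<exists>\<tau> a. acts U [] = join w \<tau> a \<and> no_top w \<tau> \<and> a \<in> carrier (vgroup A w) \<and> valid \<tau> \<and>
      top_shape \<tau> a U w \<and> (\<forall>q. rd E p (join w \<tau> a) q \<longrightarrow> run E p U q \<and> vtype E w q)"
  using assms(3,4)
proof (induction U arbitrary: w rule: rev_induct)
  case Nil
  then have w: "w \<in> V" "w = v" by (auto simp: gog_path_Nil)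
  interpret group "vgroup A w" using w by (simp add: group_vgroup)
  show ?case
    by (rule exI[of _ "[]"], rule exI[of _ "\<one>\<^bsub>vgroup A w\<^esub>"])
      (use w one_closed assms(2) in \<open>auto simp: join_def top_shape_def\<close>)
next
  case (snoc l U)
  note det = det_E[OF assms(1)]
  obtain w0 where w0: "gog_path A v U w0" "gog_path A w0 [l] w"
    using snoc.prems(1) unfolding gog_path_append by blast
  have V0: "w0 \<in> V" using gog_path_verts[OF w0(1)] by blast
  interpret G0: group "vgroup A w0" using V0 by (rule group_vgroup)
  obtain \<tau> a where IH: "acts U [] = join w0 \<tau> a" "no_top w0 \<tau>" "a \<in> carrier (vgroup A w0)"
      "valid \<tau>" "top_shape \<tau> a U w0"
      "\<And>q. rd E p (join w0 \<tau> a) q \<Longrightarrow> run E p U q \<and> vtype E w0 q"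
    using snoc.IH[OF w0(1) reduced_appendD[OF snoc.prems(2)]] by blast
  show ?case
  proof (cases "fst l")
    case (Gen s)
    then obtain b where l: "l = (Gen s, b)" by (cases l) auto
    then have s: "s \<in> gs w0" "w = w0" using w0(2) by (auto simp: gog_path_Gen gog_path_Nil)
    let ?b = "sval w0 (s, b)"
    have bc: "?b \<in> carrier (vgroup A w0)" using val_closed[OF V0 s(1)] by auto
    have new: "acts (U @ [l]) [] = join w0 \<tau> (a \<otimes>\<^bsub>vgroup A w0\<^esub> ?b)"
      using IH(1,2) l vert_of[OF V0 s(1)] by (simp add: act_vertex_join)
    have shape: "top_shape \<tau> (a \<otimes>\<^bsub>vgroup A w0\<^esub> ?b) (U @ [l]) w0"
    proof (cases "\<tau> = []")
      case False
      then obtain d \<tau>' U1 u h where t: "\<tau> = ES d # \<tau>'" "U = U1 @ edge_letter d # gen_word u"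
          "w0 = tgt d" "u \<in> words (gs w0)" "h \<in> carrier (Eg d)" "fst d \<in> Es"
          "a = om d h \<otimes>\<^bsub>vgroup A w0\<^esub> ev w0 u"
        using IH(5) by (auto simp: top_shape_def)
      have "ev w0 (u @ [(s, b)]) = ev w0 u \<otimes>\<^bsub>vgroup A w0\<^esub> ?b"
        using t(4) s V0 val_closed[OF V0 s(1)] ev_append[OF V0 t(4), of "[(s, b)]"] by auto
      then show ?thesis
        unfolding top_shape_def
        using t l s G0.m_assoc[of "om d h" "ev w0 u" ?b] bc om_closed[of d h] V0
        by (intro disjI2 exI[of _ d] exI[of _ \<tau>'] exI[of _ U1] exI[of _ "u @ [(s, b)]"] exI[of _ h])
          simp_all
    qed (use IH(5) in \<open>auto simp: top_shape_def\<close>)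
    have "run E p (U @ [l]) q \<and> vtype E w0 q" if q: "rd E p (join w0 \<tau> (a \<otimes>\<^bsub>vgroup A w0\<^esub> ?b)) q" for q
    proof -
      have tq: "vtype E w0 q"
      proof (cases "a \<otimes>\<^bsub>vgroup A w0\<^esub> ?b = \<one>\<^bsub>vgroup A w0\<^esub>")
        case True
        then have r: "rd E p \<tau> q" using q by (simp add: join_def)
        show ?thesis
        proof (cases "\<tau> = []")
          case True
          then show ?thesis using r assms(2) IH(5) by (auto simp: top_shape_def)
        next
          case False
          then obtain d \<tau>' where "\<tau> = ES d # \<tau>'" "w0 = tgt d" using IH(5) by (auto simp: top_shape_def)
          then show ?thesis using r edge_go_typed(3)[OF assms(1)] by auto
        qed
      next
        case False
        then obtain p' where "step E w0 (a \<otimes>\<^bsub>vgroup A w0\<^esub> ?b) p' q" using q by (auto simp: join_def)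
        from step_vtype(2)[OF V0 this] G0.m_closed[OF IH(3) bc] show ?thesis by simp
      qed
      obtain p' where p': "rd E p \<tau> p'" "step E w0 (a \<otimes>\<^bsub>vgroup A w0\<^esub> ?b) p' q"
        using rd_joinD[OF assms(1) q tq V0] by blast
      obtain q' where q': "step E w0 a p' q'" "step E w0 ?b q' q"
        using step_split[OF V0 det p'(2) IH(3) bc] by blast
      have "run E p U q'" using IH(6) rd_joinI[OF assms(1) p'(1) q'(1) V0] by blast
      moreover have "go E (Gen s, b) q' q" using step_go[OF V0 q'(2) s(1)] .
      ultimately show ?thesis using tq l by (auto simp: path_append)
    qed
    then show ?thesis
      using new IH shape bc s(2) by (intro exI[of _ \<tau>] exI[of _ "a \<otimes>\<^bsub>vgroup A w0\<^esub> ?b"]) auto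
  next
    case (Edge e)
    then obtain b where lb: "l = (Edge e, b)" by (cases l) auto
    define d where "d = (e, b)"
    have l: "l = edge_letter d" using lb by (simp add: d_def)
    have dw: "fst d \<in> Es" "w0 = src d" "w = tgt d"
      using w0(2) lb by (auto simp: gog_path_Edge gog_path_Nil d_def)
    interpret H: group "Eg d" using dw(1) by (rule group_egroup)
    interpret i: group_hom "Eg d" "vgroup A (src d)" "im d" using dw(1) by (rule im_hom)
    have V1: "tgt d \<in> V" using dw(1) by simp
    define r h where "r = crep d a" and "h = cpart d a"
    have rh: "r \<in> carrier (vgroup A (src d))" "h \<in> carrier (Eg d)" "a = r \<otimes>\<^bsub>vgroup A (src d)\<^esub> im d h"
        "crep d r = r"
      using crep_cpart[OF dw(1)] crep_idem[OF dw(1)] IH(3) dw(2) by (auto simp: r_def h_def)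
    \<comment> \<open>In a pinch the vertex element would be \<open>im d h\<close>. By
      \<open>top_shape\<close> it is also \<open>im d k\<close> times the value of the generators
      since the last edge, so this value lies in the image of the edge group and a subword is
      cancellable.\<close>
    have np: "\<not> pinch d \<tau> r"
    proof
      assume "pinch d \<tau> r"
      then obtain \<rho> where \<rho>: "r = \<one>\<^bsub>vgroup A (src d)\<^esub>" "\<tau> = ES (flip d) # \<rho>" by (auto simp: pinch_def)
      then obtain U1 u k where t: "U = U1 @ edge_letter (flip d) # gen_word u"
          "u \<in> words (gs w0)" "k \<in> carrier (Eg d)" "a = im d k \<otimes>\<^bsub>vgroup A w0\<^esub> ev w0 u"
        using IH(5) by (auto simp: top_shape_def)
      have "a = im d h" using rh \<rho> by simp
      then have "ev w0 u = inv\<^bsub>vgroup A w0\<^esub> im d k \<otimes>\<^bsub>vgroup A w0\<^esub> im d h"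
        using t V0 dw rh by (metis G0.inv_solve_left ev_closed i.hom_closed)
      also have "\<dots> = im d (inv\<^bsub>Eg d\<^esub> k \<otimes>\<^bsub>Eg d\<^esub> h)"
        using t dw rh by simp
      finally have "beval (gen_word u) = vertex_elt A (src d) (im d (inv\<^bsub>Eg d\<^esub> k \<otimes>\<^bsub>Eg d\<^esub> h))"
        using vertex_elt_ev[OF V0 t(2)] dw(2) by simp
      then have "cancellable A (edge_letter (flip d) # gen_word u @ [edge_letter d])"
        unfolding cancellable_iff using dw t rh by blast
      moreover have "U @ [l] = U1 @ (edge_letter (flip d) # gen_word u @ [edge_letter d]) @ []"
        using t(1) l by simp
      ultimately show False using reduced_no_cancel[OF snoc.prems(2)] by blast
    qed
    let ?\<tau> = "ES d # join (src d) \<tau> r"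
    have new: "acts (U @ [l]) [] = join w ?\<tau> (om d h)"
      using IH(1,2) lb act_edge_push[OF _ dw(1) rh(1,4,2) np] dw rh(3) by (simp add: d_def)
    have val: "valid ?\<tau>"
      using valid_ES_join[OF IH(4) _ rh(1) dw(1)] IH(2) dw(2) rh(4) np by blast
    have omc: "om d h \<in> carrier (vgroup A w)" using dw rh(2) by simp
    interpret G1: group "vgroup A w" using V1 dw by (simp add: group_vgroup)
    have shape: "top_shape ?\<tau> (om d h) (U @ [l]) w"
      unfolding top_shape_def using l dw rh(2) G1.r_one[OF omc]
      by (intro disjI2 exI[of _ d] exI[of _ "join (src d) \<tau> r"] exI[of _ U] exI[of _ "[]"] exI[of _ h]) auto
    have "run E p (U @ [l]) q \<and> vtype E w q" if q: "rd E p (join w ?\<tau> (om d h)) q" for q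
    proof -
      have tq: "vtype E w q"
      proof (cases "om d h = \<one>\<^bsub>vgroup A w\<^esub>")
        case True
        then show ?thesis using q dw edge_go_typed(3)[OF assms(1)] by (auto simp: join_def)
      next
        case False
        then obtain p' where "step E w (om d h) p' q" using q by (auto simp: join_def)
        moreover have "w \<in> V" using V1 dw by simp
        ultimately show ?thesis using step_vtype(2) omc by metis
      qed
      obtain q1 where q1: "rd E p ?\<tau> q1" "step E w (om d h) q1 q"
        using rd_joinD[OF assms(1) q tq] V1 dw by blast
      then obtain q0 where q0: "rd E p (join (src d) \<tau> r) q0" "go E (edge_letter d) q0 q1" by auto
      \<comment> \<open>The reading of the state crosses \<open>d\<close> before
        \<open>om d h\<close> is applied. The edge parallel to it by \<open>h\<close> starts where
        \<open>a\<close> leads, since \<open>a\<close> is \<open>r * im d h\<close>, and so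
        \<open>d\<close> can be read directly after \<open>U\<close>.\<close>
      obtain q0' q1' where q': "step E (src d) (im d h) q0 q0'" "step E w (om d h) q1 q1'"
          "go E (edge_letter d) q0' q1'"
        using edge_go_typed(4)[OF assms(1) q0(2) rh(2)] dw by auto
      have "q1' = q" using step_unique[OF _ det q'(2) q1(2) omc] V1 dw by blast
      obtain p' where p': "rd E p \<tau> p'" "step E (src d) r p' q0"
        using rd_joinD[OF assms(1) q0(1) edge_go_typed(2)[OF assms(1) q0(2)]] dw V0 by blast
      have "step E w0 a p' q0'"
        using step_mult[OF _ det p'(2) q'(1) rh(1)] rh dw V0 by auto
      then have "run E p U q0'" using IH(6) rd_joinI[OF assms(1) p'(1) _ V0] by blast
      then show ?thesis using q'(3) \<open>q1' = q\<close> tq l by (auto simp: path_append)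
    qed
    then show ?thesis
      using new val shape omc by (intro exI[of _ ?\<tau>] exI[of _ "om d h"]) auto
  qed
qed

text \<open>\<open>W\<close> and \<open>U\<close> lead to the same state. Reading passes from
  \<open>W\<close> to this state by following the action, and from the state to the reduced word
  \<open>U\<close> by \<open>reduced_state\<close>.\<close>

theorem reduced_readable:
  assumes tame: "tame E" and p: "vtype E v p" and U: "gog_path A v U v" "reduced A U"
    and W: "W \<in> words X" "run E p W q" and eq: "beval U = beval W"
  shows "run E p U q"
proof -
  obtain \<tau> a where s: "acts U [] = join v \<tau> a"
      "\<And>q. rd E p (join v \<tau> a) q \<Longrightarrow> run E p U q \<and> vtype E v q"
    using reduced_state[OF tame p U] by blast
  have "acts U [] = acts W []"
    using acts_pres_rel[of U W "[]"] eq W gog_path_words[OF U(1)] by (simp add: beval_eq_iff)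
  moreover have "rd E p (acts W []) q"
    using rd_acts[OF tame W(2,1), of "[]" p] by simp
  ultimately show ?thesis using s by simp
qed


subsection \<open>Existence of reduced representatives\<close>

interpretation Bass: group "Bass A"
  unfolding Bass_def by (rule group_presented)

lemma beval_carrier [simp]: "u \<in> words X \<Longrightarrow> beval u \<in> carrier (Bass A)"
  by (simp add: Bass_def bass_eval_def)

lemma beval_append: "u \<in> words X \<Longrightarrow> u' \<in> words X \<Longrightarrow> beval (u @ u') = beval u \<otimes>\<^bsub>Bass A\<^esub> beval u'"
  by (simp add: Bass_def bass_eval_def mult_presented)

lemma beval_Nil: "beval [] = \<one>\<^bsub>Bass A\<^esub>"
  by (simp add: Bass_def bass_eval_def one_presented)

lemma beval_inv: "u \<in> words X \<Longrightarrow> beval (inv_word u) = inv\<^bsub>Bass A\<^esub> beval u"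
  by (simp add: Bass_def bass_eval_def inv_presented)

lemma path_elt_gog_path:
  assumes "gog_path A v U w" "edge_path (dgraph A) w (map fst ds) w'"
    and "\<forall>(d, a) \<in> set ds. a \<in> carrier (vgroup A (oterm (dgraph A) d))"
  shows "\<exists>U'. gog_path A v U' w' \<and> beval U' = path_elt A (beval U) ds"
  using assms
proof (induction ds arbitrary: U w)
  case (Cons da ds)
  obtain d a where da: "da = (d, a)" by (cases da)
  have d: "fst d \<in> Es" "w = src d" "edge_path (dgraph A) (tgt d) (map fst ds) w'"
      "a \<in> carrier (vgroup A (tgt d))"
    using Cons.prems da by (auto simp: oterm_eq)
  obtain u where u: "u \<in> words (gs (tgt d))" "ev (tgt d) u = a" using ev_surj d by (metis src_vert fst_conv)
  let ?U = "U @ [edge_letter d] @ gen_word u"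
  have tv: "tgt d \<in> V" using d by simp
  have g: "gog_path A v ?U (tgt d)"
    using Cons.prems(1) d u tv
    by (auto simp: gog_path_append gog_path_Edge gog_path_Nil gog_path_gen_word)
  then have "\<exists>U'. gog_path A v U' w' \<and> beval U' = path_elt A (beval ?U) ds"
    using Cons.IH[of ?U "tgt d"] d Cons.prems(3) da by auto
  moreover have "beval ?U = beval U \<otimes>\<^bsub>Bass A\<^esub> beval [edge_letter d]
      \<otimes>\<^bsub>Bass A\<^esub> vertex_elt A (oterm (dgraph A) d) a"
    using gog_path_words[OF Cons.prems(1)] d u vertex_elt_ev[OF tv u(1)] gen_word_in_X[OF tv u(1)]
      beval_append[of U "[edge_letter d] @ gen_word u"] beval_append[of "[edge_letter d]" "gen_word u"]
    by (simp add: Bass.m_assoc oterm_eq)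
  ultimately show ?case by (simp add: da)
qed auto

text \<open>Words of path shape from \<open>v\<close> to \<open>v\<close> are closed under
  concatenation and inversion, and so they represent the whole generated subgroup.\<close>

lemma pi1_gog_path: "g \<in> pi1 A v \<Longrightarrow> \<exists>U. gog_path A v U v \<and> beval U = g"
  unfolding pi1_def
proof (induction rule: generate.induct)
  case one
  show ?case using v_vert beval_Nil by (intro exI[of _ "[]"]) (simp add: gog_path_Nil)
next
  have *: "\<exists>U. gog_path A v U v \<and> beval U = h"
    if h: "h \<in> {path_elt A (vertex_elt A v a0) ds | a0 ds.
        a0 \<in> carrier (vgroup A v) \<and> edge_path (dgraph A) v (map fst ds) v \<and>
        (\<forall>(d, a) \<in> set ds. a \<in> carrier (vgroup A (oterm (dgraph A) d)))}" for h
  proof -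
    obtain a0 ds where a: "h = path_elt A (vertex_elt A v a0) ds" "a0 \<in> carrier (vgroup A v)"
        "edge_path (dgraph A) v (map fst ds) v"
        "\<forall>(d, a) \<in> set ds. a \<in> carrier (vgroup A (oterm (dgraph A) d))"
      using h by blast
    obtain u where u: "u \<in> words (gs v)" "ev v u = a0" using ev_surj[OF v_vert a(2)] by blast
    then show ?thesis
      using path_elt_gog_path[of "gen_word u" v ds v] a v_vert vertex_elt_ev[OF v_vert u(1)]
      by (simp add: gog_path_gen_word)
  qed
  case (incl h)
  then show ?case by (rule *)
  case (inv h)
  then obtain U where "gog_path A v U v" "beval U = h" using * by blast
  then show ?case
    using gog_path_inv beval_inv[OF gog_path_words] by (intro exI[of _ "inv_word U"]) auto
next
  case (eng h1 h2)
  then obtain U1 U2 where "gog_path A v U1 v" "beval U1 = h1" "gog_path A v U2 v" "beval U2 = h2" by blast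
  then show ?case
    using beval_append[OF gog_path_words gog_path_words]
    by (intro exI[of _ "U1 @ U2"]) (auto simp: gog_path_append)
qed

lemma beval_context:
  assumes "beval u = beval u'" "u \<in> words X" "u' \<in> words X" "p \<in> words X" "q \<in> words X"
  shows "beval (p @ u @ q) = beval (p @ u' @ q)"
  using assms pres_rel_context by (simp add: beval_eq_iff)

text \<open>The relator gives the case of one orientation; conjugating it by the edge letter gives
  the other.\<close>

lemma beval_edge_rel:
  assumes "fst d \<in> Es" "h \<in> carrier (Eg d)"
  shows "beval (edge_letter (flip d) # gen_word (hword d h) @ [edge_letter d])
    = beval (gen_word (hword (flip d) h))"
proof -
  obtain e b where d: "d = (e, b)" by force
  let ?T = "gen_word (hword (e, False) h)" and ?I = "gen_word (hword (e, True) h)"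
  have e: "e \<in> Es" "h \<in> carrier (egroup A e)" using assms d by auto
  have W: "?T \<in> words X" "?I \<in> words X"
    using hword[of "(e, True)" h] hword[of "(e, False)" h] e
      gen_word_in_X[of "head (dgraph A) e"] gen_word_in_X[of "tail (dgraph A) e"] by auto
  let ?e = "beval [(Edge e, True)]"
  have c: "?e \<in> carrier (Bass A)" "beval ?T \<in> carrier (Bass A)" "beval ?I \<in> carrier (Bass A)"
    using e W by auto
  have i: "beval [(Edge e, False)] = inv\<^bsub>Bass A\<^esub> ?e"
    using beval_inv[of "[(Edge e, True)]"] e by simp
  have rel: "edge_rel A e h \<in> relators A" using e by (auto simp: relators_def)
  have "beval (edge_rel A e h) = \<one>\<^bsub>Bass A\<^esub>"
    unfolding beval_Nil[symmetric]
    using pres_rel.relator[of "[]" X "[]" "edge_rel A e h" "relators A"] relators_words[OF rel] rel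
    by (subst beval_eq_iff) auto
  moreover have "beval (edge_rel A e h) = ?e \<otimes>\<^bsub>Bass A\<^esub> beval ?T \<otimes>\<^bsub>Bass A\<^esub> inv\<^bsub>Bass A\<^esub> ?e
      \<otimes>\<^bsub>Bass A\<^esub> inv\<^bsub>Bass A\<^esub> beval ?I"
    unfolding edge_rel_eq using e W
      beval_append[of "[(Edge e, True)]" "?T @ [(Edge e, False)] @ inv_word ?I"]
      beval_append[of ?T "[(Edge e, False)] @ inv_word ?I"]
      beval_append[of "[(Edge e, False)]" "inv_word ?I"]
    by (simp add: i beval_inv Bass.m_assoc)
  ultimately have r: "?e \<otimes>\<^bsub>Bass A\<^esub> beval ?T \<otimes>\<^bsub>Bass A\<^esub> inv\<^bsub>Bass A\<^esub> ?e = beval ?I"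
    using c by (metis Bass.inv_closed Bass.inv_equality Bass.inv_inv Bass.m_closed)
  show ?thesis
  proof (cases b)
    case False
    then show ?thesis
      using d r e W beval_append[of "[(Edge e, True)]" "?T @ [(Edge e, False)]"]
        beval_append[of ?T "[(Edge e, False)]"] c
      by (simp add: i Bass.m_assoc)
  next
    case True
    have "inv\<^bsub>Bass A\<^esub> ?e \<otimes>\<^bsub>Bass A\<^esub> beval ?I \<otimes>\<^bsub>Bass A\<^esub> ?e = beval ?T"
      using c by (simp add: r[symmetric] Bass.m_assoc[symmetric])
        (simp add: Bass.m_assoc)
    then show ?thesis
      using d True e W beval_append[of "[(Edge e, False)]" "?I @ [(Edge e, True)]"]
        beval_append[of ?I "[(Edge e, True)]"] c
      by (simp add: i Bass.m_assoc)
  qed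
qed

definition edge_count :: "('e, 's) letter word \<Rightarrow> nat" where
  "edge_count U = length (filter (\<lambda>l. fst l \<in> range Edge) U)"

lemma edge_count_simps [simp]:
  "edge_count [] = 0" "edge_count (l # U) = (if fst l \<in> range Edge then 1 else 0) + edge_count U"
  "edge_count (U @ U') = edge_count U + edge_count U'" "edge_count (gen_word u) = 0"
  by (auto simp: edge_count_def gen_word_def filter_empty_conv)

text \<open>Removing a cancellable subword may lengthen a word but lowers the number of edges.\<close>

lemma reduced_exists:
  assumes "gog_path A v U v"
  shows "\<exists>U'. gog_path A v U' v \<and> reduced A U' \<and> beval U' = beval U"
  using assms
proof (induction U rule: wf_induct_rule[OF wf_measures[of "[edge_count, length]"]])
  case (1 U)
  note UX = gog_path_words[OF 1(2)]
  have smaller: ?case if U': "gog_path A v U' v" "beval U' = beval U"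
      "edge_count U' < edge_count U \<or> edge_count U' = edge_count U \<and> length U' < length U" for U'
    using 1(1)[of U'] U' by auto
  show ?case
  proof (cases "reduced A U")
    case False
    then consider x b where "sublist [(x, b), (x, \<not> b)] U" | c where "sublist c U" "cancellable A c"
      unfolding reduced_def freely_reduced_def by blast
    then show ?thesis
    proof cases
      case (1 x b)
      then obtain p q where U: "U = p @ [(x, b), (x, \<not> b)] @ q" by (auto simp: sublist_def)
      obtain w1 w2 where w: "gog_path A v p w1" "gog_path A w1 [(x, b), (x, \<not> b)] w2" "gog_path A w2 q v"
        using \<open>gog_path A v U v\<close> unfolding U gog_path_append by blast
      have "w1 = w2" using w(2) by (cases x) (auto simp: gog_path_Gen gog_path_Edge gog_path_Nil)
      then have "gog_path A v (p @ q) v" using w gog_path_append by blast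
      moreover have "beval (p @ q) = beval U"
        using UX pres_rel.cancel[of p X q x b "relators A"] by (auto simp: U beval_eq_iff intro: pres_rel.sym)
      ultimately show ?thesis by (rule smaller) (auto simp: U)
    next
      case (2 c)
      then obtain d u h where c: "fst d \<in> Es" "u \<in> words (gs (src d))" "h \<in> carrier (Eg d)"
          "c = edge_letter (flip d) # gen_word u @ [edge_letter d]"
          "beval (gen_word u) = vertex_elt A (src d) (im d h)"
        unfolding cancellable_iff by blast
      obtain p q where U: "U = p @ c @ q" using 2(1) by (auto simp: sublist_def)
      obtain w1 w2 where w: "gog_path A v p w1" "gog_path A w1 c w2" "gog_path A w2 q v"
        using \<open>gog_path A v U v\<close> unfolding U gog_path_append by blast
      have sv: "src d \<in> V" "tgt d \<in> V" using c(1) by auto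
      have w12: "w1 = tgt d" "w2 = tgt d"
        using w(2) c(1) unfolding c(4)
        by (auto simp: gog_path_append gog_path_Edge gog_path_Nil gog_path_gen_word)
      \<comment> \<open>The chosen word for the same edge group element on the other side of the
        edge. It belongs to the vertex where the removed subword starts and ends, so the path shape
        is kept.\<close>
      let ?u = "gen_word (hword (flip d) h)"
      have hw: "hword d h \<in> words (gs (src d))" "ev (src d) (hword d h) = im d h"
        "hword (flip d) h \<in> words (gs (tgt d))"
        using hword[OF c(1,3)] hword[of "flip d" h] c by auto
      have "beval (gen_word u) = beval (gen_word (hword d h))"
        using vertex_elt_ev[OF sv(1) hw(1)] hw(2) c(5) by simp
      then have "beval c = beval (edge_letter (flip d) # gen_word (hword d h) @ [edge_letter d])"
        using beval_context[of "gen_word u" "gen_word (hword d h)" "[edge_letter (flip d)]" "[edge_letter d]"]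
          c sv hw by (simp add: gen_word_in_X[OF sv(1)])
      also have "\<dots> = beval ?u" by (rule beval_edge_rel[OF c(1,3)])
      finally have "beval (p @ ?u @ q) = beval U"
        using beval_context[of c ?u p q] UX hw gen_word_in_X[OF sv(2)] by (simp add: U)
      moreover have "gog_path A v (p @ ?u @ q) v"
        using w w12 hw sv gog_path_gen_word[OF sv(2)] unfolding gog_path_append by blast
      ultimately show ?thesis by (intro smaller[of "p @ ?u @ q"]) (auto simp: U c(4))
    qed
  qed (use 1(2) in blast)
qed

subsection \<open>The Schreier graph\<close>

text \<open>All subsets of the Bass group serve as vertices, so that determinism is the
  invertibility of right multiplication, without reference to a subgroup.\<close>

definition schreier :: "('e, 's) letter word set set \<Rightarrow> ('e, 's) letter \<Rightarrow> ('e, 's) letter word set set \<Rightarrow> bool" where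
  "schreier c x c' \<longleftrightarrow> c \<subseteq> carrier (Bass A) \<and> x \<in> X \<and> c' = c #>\<^bsub>Bass A\<^esub> beval [(x, True)]"

lemma schreier_go:
  assumes "c \<subseteq> carrier (Bass A)" "fst l \<in> X"
  shows "go schreier l c c' \<longleftrightarrow> c' \<subseteq> carrier (Bass A) \<and> c' = c #>\<^bsub>Bass A\<^esub> beval [l]"
proof -
  obtain x b where l: "l = (x, b)" by force
  let ?g = "beval [(x, True)]"
  have g: "?g \<in> carrier (Bass A)" "beval [(x, False)] = inv\<^bsub>Bass A\<^esub> ?g"
    using assms l beval_inv[of "[(x, True)]"] by auto
  show ?thesis
  proof (cases b)
    case True
    then show ?thesis using assms l Bass.r_coset_subset_G[OF assms(1) g(1)] by (auto simp: schreier_def)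
  next
    case False
    have "c = c' #>\<^bsub>Bass A\<^esub> ?g \<longleftrightarrow> c' = c #>\<^bsub>Bass A\<^esub> inv\<^bsub>Bass A\<^esub> ?g"
      if "c' \<subseteq> carrier (Bass A)"
      using that assms g by (auto simp: Bass.coset_mult_assoc)
    then show ?thesis using False assms g l by (auto simp: schreier_def)
  qed
qed

lemma det_schreier: "det schreier"
  unfolding det_def
proof (intro allI impI)
  fix l c c1 c2 assume *: "go schreier l c c1" "go schreier l c c2"
  then have "fst l \<in> X" by (auto simp: go_def schreier_def split: if_splits)
  moreover have "c \<subseteq> carrier (Bass A)"
  proof (cases "snd l")
    case False
    then have "c = c1 #>\<^bsub>Bass A\<^esub> beval [(fst l, True)]" "c1 \<subseteq> carrier (Bass A)"
      using * by (auto simp: go_def schreier_def)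
    then show ?thesis using Bass.r_coset_subset_G \<open>fst l \<in> X\<close> by auto
  qed (use * in \<open>auto simp: go_def schreier_def\<close>)
  ultimately show "c1 = c2" using * schreier_go by simp
qed

lemma schreier_run:
  assumes "c \<subseteq> carrier (Bass A)" "u \<in> words X"
  shows "run schreier c u c' \<longleftrightarrow> c' = c #>\<^bsub>Bass A\<^esub> beval u"
  using assms
proof (induction u arbitrary: c)
  case Nil
  then show ?case by (auto simp: beval_Nil)
next
  case (Cons l u)
  let ?d = "c #>\<^bsub>Bass A\<^esub> beval [l]"
  have d: "?d \<subseteq> carrier (Bass A)"
    using Cons.prems by (intro Bass.r_coset_subset_G) auto
  have "beval (l # u) = beval [l] \<otimes>\<^bsub>Bass A\<^esub> beval u"
    using beval_append[of "[l]" u] Cons.prems by simp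
  then have "?d #>\<^bsub>Bass A\<^esub> beval u = c #>\<^bsub>Bass A\<^esub> beval (l # u)"
    using Cons.prems by (simp add: Bass.coset_mult_assoc)
  then show ?case using Cons d schreier_go[OF Cons.prems(1)] by auto
qed

lemma cay_loops_trivial:
  assumes "w \<in> V" "r \<in> cay_loops w"
  shows "r \<in> words X" "beval r = \<one>\<^bsub>Bass A\<^esub>"
proof -
  obtain a s where r: "r = gen_word (cay_loop w a s)" "a \<in> carrier (vgroup A w)" "s \<in> gs w"
    using assms(2) by (auto simp: cay_loops_def)
  note c = cay_loop[OF assms(1) r(2,3)]
  show "r \<in> words X" using r c assms(1) by simp
  show "beval r = \<one>\<^bsub>Bass A\<^esub>"
    using beval_gen_word_cong[OF assms(1) c(1), of "[]"] c(2) r(1) by (simp add: beval_Nil)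
qed

lemma edge_rel_trivial:
  assumes "e \<in> Es" "h \<in> carrier (egroup A e)"
  shows "beval (edge_rel A e h) = \<one>\<^bsub>Bass A\<^esub>"
proof -
  have rel: "edge_rel A e h \<in> relators A" using assms by (auto simp: relators_def)
  show ?thesis
    unfolding beval_Nil[symmetric]
    using pres_rel.relator[of "[]" X "[]" "edge_rel A e h" "relators A"] relators_words[OF rel] rel
    by (subst beval_eq_iff) auto
qed

lemma loops_trivial:
  assumes "x \<in> X" "r \<in> tail_loops x \<union> head_loops x"
  shows "r \<in> words X \<and> beval r = \<one>\<^bsub>Bass A\<^esub>"
proof (cases x)
  case (Gen s)
  then obtain w where "w \<in> V" "s \<in> gs w" using assms by (auto simp: Gen_in_X)
  then show ?thesis using assms Gen cay_loops_trivial vert_of by auto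
next
  case (Edge e)
  then have "e \<in> Es" using assms by simp
  then show ?thesis
    using assms Edge cay_loops_trivial[OF head_tail_vert(1)] cay_loops_trivial[OF head_tail_vert(2)]
      edge_rel_trivial edge_rel_words by auto
qed

lemma schreier_loop:
  "c \<subseteq> carrier (Bass A) \<Longrightarrow> r \<in> words X \<Longrightarrow> beval r = \<one>\<^bsub>Bass A\<^esub> \<Longrightarrow> run schreier c r c"
  by (simp add: schreier_run)

text \<open>The attached loops spell trivial elements of the Bass group and are therefore closed at
  every vertex of this graph.\<close>

lemma schreier_gadget:
  assumes "schreier c x c'"
  shows "gadget schreier c x c'"
proof -
  have c: "c \<subseteq> carrier (Bass A)" "x \<in> X" "c' \<subseteq> carrier (Bass A)"
    using assms Bass.r_coset_subset_G by (auto simp: schreier_def)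
  then show ?thesis
    using assms loops_trivial schreier_loop by (auto simp: gadget_def)
qed

theorem output_sound:
  assumes out: "folding_output A v Ws \<Gamma>" and Ws: "\<And>W. W \<in> set Ws \<Longrightarrow> W \<in> words X"
    and U: "U \<in> words X" "reads \<Gamma> (base \<Gamma>) U (base \<Gamma>)"
  shows "beval U \<in> generate (Bass A) (beval ` set Ws)"
proof -
  let ?H = "generate (Bass A) (beval ` set Ws)"
  have sub: "beval ` set Ws \<subseteq> carrier (Bass A)" using Ws by auto
  have H: "subgroup ?H (Bass A)" by (rule Bass.generate_is_subgroup[OF sub])
  have Hc: "?H \<subseteq> carrier (Bass A)" using H by (rule subgroup.subset)
  have "path (go (gadget schreier)) ?H W ?H" if W: "W \<in> set Ws" for W
  proof -
    have "beval W \<in> ?H" using W by (auto intro: generate.incl)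
    then have "run schreier ?H W ?H"
      using schreier_run[OF Hc Ws[OF W]] subgroup.rcos_const[OF H Bass.group_axioms] by simp
    then show ?thesis
      by (rule path_mono) (auto simp: go_def intro: schreier_gadget split: if_splits)
  qed
  moreover have "vtype schreier v ?H"
    using cay_loops_trivial[OF v_vert] schreier_loop[OF Hc]
    by (simp add: vtype_iff_loops[OF v_vert det_schreier])
  ultimately obtain \<theta> where \<theta>: "graph_hom \<theta> (saturated_graph Ws) schreier"
      "\<theta> (base (saturated_graph Ws)) = ?H"
    using saturated_graph_hom[OF det_schreier Ws] by blast
  have "fold_step\<^sup>*\<^sup>* (saturated_graph Ws) \<Gamma>"
    using out by (simp add: folding_output_def saturated_graph_def)
  from folds_graph_hom[OF this \<theta>(1) det_schreier] \<theta>(2)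
  have "graph_hom \<theta> \<Gamma> schreier" "\<theta> (base \<Gamma>) = ?H" by auto
  then have "run schreier ?H U ?H"
    using graph_hom_run[of \<theta> \<Gamma> schreier "base \<Gamma>" U "base \<Gamma>"] U(2) by (simp add: reads_iff)
  then have "?H #>\<^bsub>Bass A\<^esub> beval U = ?H" using schreier_run[OF Hc U(1)] by simp
  then show ?thesis using Bass.coset_join1[OF _ _ H] U(1) by simp
qed

lemma output_base: "folding_output A v Ws \<Gamma> \<Longrightarrow> base \<Gamma> \<in> verts \<Gamma>"
proof -
  assume "folding_output A v Ws \<Gamma>"
  then have "fold_step\<^sup>*\<^sup>* (saturated_graph Ws) \<Gamma>"
    by (simp add: folding_output_def saturated_graph_def)
  from folds_quotient[OF this] obtain \<psi> where "quotient_map \<psi> (saturated_graph Ws) \<Gamma>" ..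
  then show ?thesis
    by (auto simp: quotient_map_def saturated_graph_def edge_saturate_def vertex_saturate_def
        bouquet_def image_iff)
qed

theorem output_complete:
  assumes out: "folding_output A v Ws \<Gamma>" and Ws: "\<And>W. W \<in> set Ws \<Longrightarrow> W \<in> words X"
    and g: "g \<in> generate (Bass A) (beval ` set Ws)"
    and U: "gog_path A v U v" "reduced A U" "beval U = g"
  shows "reads \<Gamma> (base \<Gamma>) U (base \<Gamma>)"
proof -
  let ?E = "edge_of \<Gamma>" and ?b = "base \<Gamma>"
  have det: "det ?E" using out by (intro folded_det) (simp add: folding_output_def)
  have "fold_step\<^sup>*\<^sup>* (saturated_graph Ws) \<Gamma>"
    using out by (simp add: folding_output_def saturated_graph_def)
  from folds_quotient[OF this] obtain \<psi> where q: "quotient_map \<psi> (saturated_graph Ws) \<Gamma>" ..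
  have facts: "tame ?E" "vtype ?E v ?b"
    "\<And>W. W \<in> set Ws \<Longrightarrow> path (go (gadget ?E)) ?b W ?b"
    using output_facts[OF Ws q det] by blast+
  have run: "run ?E ?b W ?b" if "W \<in> set Ws" for W
    using facts(3)[OF that] by (rule path_mono) (auto simp: go_def gadget_def split: if_splits)
  \<comment> \<open>The input words are loops at the base point, hence every element of the
    generated subgroup is spelled by some loop there, reduced or not.\<close>
  have "\<exists>W. W \<in> words X \<and> run ?E ?b W ?b \<and> beval W = g"
    using g
  proof (induction rule: generate.induct)
    case one
    then show ?case using beval_Nil by (intro exI[of _ "[]"]) simp
  next
    case (incl h)
    then show ?case using run Ws by blast
  next
    case (inv h)
    then obtain W where "W \<in> set Ws" "h = beval W" by blast
    then show ?case using run[of W] Ws[of W]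
      by (intro exI[of _ "inv_word W"]) (simp add: run_inv_word beval_inv)
  next
    case (eng h1 h2)
    then obtain W1 W2 where "W1 \<in> words X" "run ?E ?b W1 ?b" "beval W1 = h1"
      "W2 \<in> words X" "run ?E ?b W2 ?b" "beval W2 = h2" by blast
    then show ?case by (intro exI[of _ "W1 @ W2"]) (auto simp: beval_append path_append)
  qed
  then obtain W where "W \<in> words X" "run ?E ?b W ?b" "beval W = g" by blast
  then have "run ?E ?b U ?b"
    using reduced_readable[OF facts(1,2) U(1,2)] U(3) by blast
  then show ?thesis using output_base[OF out] by (simp add: reads_iff)
qed

lemma saturated_finite:
  assumes Ws: "\<And>W. W \<in> set Ws \<Longrightarrow> W \<in> words X"
  shows "finite (arcs (saturated_graph Ws))"
proof -
  let ?B = "bouquet Ws" and ?S = "vertex_saturate A v (bouquet Ws)"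
  have "arcs ?B = (SIGMA i:{..<length Ws}. {..<length (Ws ! i)})"
    by (auto simp: bouquet_def)
  then have fB: "finite (arcs ?B)" by simp
  have "verts ?B = insert Base ((\<lambda>(i, j). bouquet_pt Ws i j) ` (SIGMA i:{..<length Ws}. {..length (Ws ! i)}))"
    by (auto simp: bouquet_def image_iff)
  then have vB: "finite (verts ?B)" by simp
  have "arcs ?S \<subseteq> OldArc ` arcs ?B \<union> (\<lambda>(z, w, a, s). CayArc z w a s) `
      (SIGMA z:verts ?B. SIGMA w:V. carrier (vgroup A w) \<times> gs w)"
    by (auto simp: vertex_saturate_def node_type_def image_iff)
  then have fS: "finite (arcs ?S)"
    by (rule finite_subset) (use fB vB finite_V finite_vgroup in \<open>auto intro!: finite_SigmaI\<close>)
  have fin: "finite {h. (k, h) \<in> loop_index A ?S}" for k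
  proof (cases "\<exists>h. (k, h) \<in> loop_index A ?S")
    case True
    then obtain f e where f: "k = OldArc f" "f \<in> arcs ?B" "lab ?B f = Edge e"
      by (cases k) (auto simp: loop_index_def vertex_saturate_def)
    then obtain i j where "f = (i, j)" "i < length Ws" "j < length (Ws ! i)" by (cases f) (auto simp: bouquet_simps)
    then have "e \<in> Es" using f words_X_nth[OF Ws[OF nth_mem], of i j] by (simp add: bouquet_simps)
    moreover have "{h. (k, h) \<in> loop_index A ?S} \<subseteq> carrier (egroup A e)"
      using f by (auto simp: loop_index_def vertex_saturate_def)
    ultimately show ?thesis using finite_egroup finite_subset by blast
  qed simp
  have "arcs (saturated_graph Ws) \<subseteq> PrevArc ` arcs ?S \<union> (\<lambda>(k, h, j). LoopArc k h j) `
      (SIGMA k:arcs ?S. SIGMA h:{h. (k, h) \<in> loop_index A ?S}. {..<length (arc_rel A ?S k h)})"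
    by (auto simp: saturated_graph_def edge_saturate_def image_iff loop_index_def)
  then show ?thesis
    by (rule finite_subset) (use fS fin in \<open>auto intro!: finite_SigmaI\<close>)
qed

lemma folding_output_exists:
  assumes "\<And>W. W \<in> set Ws \<Longrightarrow> W \<in> words X"
  shows "\<exists>\<Gamma>. folding_output A v Ws \<Gamma>"
  using folds_terminate[OF saturated_finite[OF assms]]
  by (simp add: folding_output_def saturated_graph_def)

text \<open>A reduced word of path shape exists for every \<open>g\<close>, so the universal
  criterion is not vacuous. In the existential criterion any reduced word may be the witness,
  because soundness holds for all words over the alphabet.\<close>

theorem output_correct:
  assumes inp: "folding_input A v Ws" and out: "folding_output A v Ws \<Gamma>" and g: "g \<in> pi1 A v"
  shows "g \<in> generate (Bass A) (beval ` set Ws) \<longleftrightarrow>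
      (\<forall>U. gog_path A v U v \<and> reduced A U \<and> beval U = g \<longrightarrow> reads \<Gamma> (base \<Gamma>) U (base \<Gamma>))"
    and "g \<in> generate (Bass A) (beval ` set Ws) \<longleftrightarrow>
      (\<exists>U\<in>words X. reduced A U \<and> beval U = g \<and> reads \<Gamma> (base \<Gamma>) U (base \<Gamma>))"
proof -
  have Ws: "\<And>W. W \<in> set Ws \<Longrightarrow> W \<in> words X"
    using inp by (auto simp: folding_input_def)
  obtain U where U: "gog_path A v U v" "reduced A U" "beval U = g"
    using pi1_gog_path[OF g] reduced_exists by blast
  note complete = output_complete[OF out Ws] and sound = output_sound[OF out Ws]
  show "g \<in> generate (Bass A) (beval ` set Ws) \<longleftrightarrow>
      (\<forall>U. gog_path A v U v \<and> reduced A U \<and> beval U = g \<longrightarrow> reads \<Gamma> (base \<Gamma>) U (base \<Gamma>))"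
    using complete[of g] sound[of U] U gog_path_words by blast
  show "g \<in> generate (Bass A) (beval ` set Ws) \<longleftrightarrow>
      (\<exists>U\<in>words X. reduced A U \<and> beval U = g \<and> reads \<Gamma> (base \<Gamma>) U (base \<Gamma>))"
    using complete[of g U] sound U gog_path_words by blast
qed

end

section \<open>A calculus of running times for the pointer machine\<close>

section \<open>Programs of the pointer machine\<close>

text \<open>Total correctness with a postcondition on time and final state. The equations below make
  it a weakest precondition calculus in which straight-line code is evaluated by rewriting.\<close>

definition runs :: "int \<Rightarrow> com \<Rightarrow> mstate \<Rightarrow> (nat \<Rightarrow> mstate \<Rightarrow> bool) \<Rightarrow> bool" where
  "runs B c s Q \<longleftrightarrow> (\<exists>t s'. exec B c s t s' \<and> Q t s')"

lemma runs_SetNull: "runs B (SetNull x) s Q \<longleftrightarrow> Q 1 (set_reg s x Null)"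
  unfolding runs_def by (auto elim: exec.cases intro: exec.intros simp del: One_nat_def)

lemma runs_SetNum: "runs B (SetNum x k) s Q \<longleftrightarrow> \<bar>k\<bar> \<le> B \<and> Q 1 (set_reg s x (Num k))"
  unfolding runs_def by (auto elim: exec.cases intro: exec.intros simp del: One_nat_def)

lemma runs_Copy: "runs B (Copy x y) s Q \<longleftrightarrow> Q 1 (set_reg s x (regs s y))"
  unfolding runs_def by (auto elim: exec.cases intro: exec.intros simp del: One_nat_def)

lemma runs_New: "runs B (New x) s Q \<longleftrightarrow> Q 1 ((set_reg s x (Ref (free s)))
    \<lparr>heap := (heap s)(free s := (\<lambda>_. Null)), free := Suc (free s)\<rparr>)"
  unfolding runs_def by (auto elim: exec.cases intro: exec.intros simp del: One_nat_def)

lemma runs_Load: "runs B (Load x y n) s Q \<longleftrightarrow>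
    (\<exists>p. regs s y = Ref p \<and> Q 1 (set_reg s x (heap s p n)))"
  unfolding runs_def by (auto elim: exec.cases intro: exec.intros simp del: One_nat_def)

lemma runs_Store: "runs B (Store x n y) s Q \<longleftrightarrow>
    (\<exists>p. regs s x = Ref p \<and> Q 1 (s\<lparr>heap := (heap s)(p := (heap s p)(n := regs s y))\<rparr>))"
  unfolding runs_def by (auto elim: exec.cases intro: exec.intros simp del: One_nat_def)

lemma runs_Seq: "runs B (Seq c c') s Q \<longleftrightarrow>
    runs B c s (\<lambda>t s'. runs B c' s' (\<lambda>t' s''. Q (t + t') s''))"
  unfolding runs_def by (auto elim!: exec.cases[of B "Seq c c'"] intro: exec.intros)

lemma runs_Cond: "runs B (Cond b c c') s Q \<longleftrightarrow>
    (if test_holds b s then runs B c s (\<lambda>t. Q (Suc t)) else runs B c' s (\<lambda>t. Q (Suc t)))"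
  unfolding runs_def by (auto elim!: exec.cases[of B "Cond b c c'"] intro: exec.intros)

lemma runs_While: "runs B (While b c) s Q \<longleftrightarrow>
    (if test_holds b s
     then runs B c s (\<lambda>t s'. runs B (While b c) s' (\<lambda>t' s''. Q (Suc (t + t')) s''))
     else Q 1 s)"
proof (cases "test_holds b s")
  case True
  then show ?thesis
    unfolding runs_def by (auto elim!: exec.cases[of B "While b c" s]) (blast intro: exec.WhileTrue)
next
  case False
  then have "exec B (While b c) s t s' \<longleftrightarrow> t = 1 \<and> s' = s" for t s'
    by (auto elim!: exec.cases[of B "While b c" s] intro: exec.WhileFalse[of b s B c, simplified])
  then show ?thesis using False by (auto simp: runs_def)
qed

lemma runs_mono: "runs B c s P \<Longrightarrow> (\<And>t s'. P t s' \<Longrightarrow> Q t s') \<Longrightarrow> runs B c s Q"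
  unfolding runs_def by blast

lemma runs_SeqI: "runs B c s P \<Longrightarrow>
    (\<And>t s'. P t s' \<Longrightarrow> runs B c' s' (\<lambda>t' s''. Q (t + t') s'')) \<Longrightarrow> runs B (Seq c c') s Q"
  by (simp add: runs_Seq) (erule runs_mono)

lemma runs_WhileI: "test_holds b s \<Longrightarrow> runs B c s P \<Longrightarrow>
    (\<And>t s'. P t s' \<Longrightarrow> runs B (While b c) s' (\<lambda>t' s''. Q (Suc (t + t')) s'')) \<Longrightarrow>
    runs B (While b c) s Q"
  by (simp add: runs_While[of _ _ _ s]) (erule runs_mono)

lemmas runs_simps = runs_SetNull runs_SetNum runs_Copy runs_New runs_Load runs_Store runs_Seq runs_Cond

subsection \<open>The iterated logarithm\<close>

lemma less_tower: "n < tower n"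
proof (induction n)
  case (Suc n)
  then have "Suc n \<le> tower n" by simp
  also have "\<dots> < 2 ^ tower n" by (rule less_exp)
  finally show ?case by simp
qed simp

lemma le_tower_log_star: "n \<le> tower (log_star n)"
  unfolding log_star_def by (rule LeastI[of _ n]) (use less_tower[of n] in simp)

lemma log_star_le: "n \<le> tower m \<Longrightarrow> log_star n \<le> m"
  unfolding log_star_def by (rule Least_le)

lemma log_star_mono: "m \<le> n \<Longrightarrow> log_star m \<le> log_star n"
  using le_tower_log_star[of n] by (intro log_star_le) simp

lemma log_star_Suc_gt:
  assumes "log_star n = Suc l"
  shows "tower l < n"
  by (rule ccontr) (use log_star_le[of n l] assms in auto)

section \<open>Union-find with unary ranks, and its potentials\<close>

section \<open>Union-find with path halving\<close>

text \<open>Register 6 holds the null pointer and register 7 the number 1 throughout. The parent, rank,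
  stack and predecessor fields of a node come after the fields \<open>0, \<dots>, 2K - 1\<close> for its edges. A
  node of positive rank stores in its rank field the node whose linking last raised the rank; the
  chain of rank fields is therefore a unary representation of the rank, which makes it possible to
  compare ranks although the machine has no large integers.\<close>

definition neq_flag :: "nat \<Rightarrow> nat \<Rightarrow> nat \<Rightarrow> com" where
  "neq_flag r x y = Cond (Equal x y) (SetNull r) (Copy r 7)"

text \<open>One step of path halving: the node in register 10 is redirected to its grandparent,
  which then takes its place.\<close>

definition find_body :: "nat \<Rightarrow> com" where
  "find_body K = Seq (Load 11 11 (2 * K)) (Seq (Store 10 (2 * K) 11) (Seq (Copy 10 11)
     (Seq (Load 11 10 (2 * K)) (neq_flag 12 10 11))))"

text \<open>The loop has to run while a node differs from its parent, but a test can compare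
  pointers only for equality. \<open>neq_flag\<close> stores the outcome in a register that is
  compared with register 7.\<close>

definition find_prog :: "nat \<Rightarrow> com" where
  "find_prog K = Seq (Load 11 10 (2 * K)) (Seq (neq_flag 12 10 11) (While (Equal 12 7) (find_body K)))"

definition walk_flag :: com where
  "walk_flag = Cond (Equal 17 6) (SetNull 12) (Cond (Equal 18 6) (SetNull 12) (Copy 12 7))"

definition walk_prog :: "nat \<Rightarrow> com" where
  "walk_prog K = Seq walk_flag (While (Equal 12 7)
     (Seq (Load 17 17 (2 * K + 1)) (Seq (Load 18 18 (2 * K + 1)) walk_flag)))"

definition attach_child :: "nat \<Rightarrow> nat \<Rightarrow> nat \<Rightarrow> com" where
  "attach_child K y x = Seq (Store y (2 * K) x) (Seq (Store y (2 * K + 2) 3) (Copy 3 y))"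

text \<open>After the walk, register 18 is null iff the second rank is at most the first, and both
  17 and 18 are null iff the ranks agree. \<open>SetNull 6\<close> serves as the empty command,
  register 6 being null throughout.\<close>

definition link_prog :: "nat \<Rightarrow> com" where
  "link_prog K = Cond (Equal 18 6)
     (Seq (Cond (Equal 17 6) (Store 15 (2 * K + 1) 16) (SetNull 6)) (attach_child K 16 15))
     (attach_child K 15 16)"

definition union_prog :: "nat \<Rightarrow> com" where
  "union_prog K = Seq (Copy 10 15) (Seq (find_prog K) (Seq (Copy 15 10) (Seq (Copy 10 16)
     (Seq (find_prog K) (Seq (Copy 16 10) (Cond (Equal 15 16) (SetNull 6)
       (Seq (Load 17 15 (2 * K + 1)) (Seq (Load 18 16 (2 * K + 1)) (Seq (walk_prog K) (link_prog K))))))))))"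

text \<open>Ranks with the same \<open>log_star\<close> form a level; this is the first number above
  the level of \<open>r\<close>.\<close>

definition cap :: "nat \<Rightarrow> nat" where
  "cap r = Suc (tower (log_star r))"

type_synonym memory = "nat \<Rightarrow> nat \<Rightarrow> val"

locale memory_layout =
  fixes B :: int and K lo nmax :: nat
begin

abbreviation "nodes fr \<equiv> {lo..<fr}"

definition nonroots :: "memory \<Rightarrow> nat \<Rightarrow> nat set" where
  "nonroots hp fr = {a \<in> nodes fr. hp a (2 * K) \<noteq> Ref a}"

abbreviation "roots hp fr \<equiv> nodes fr - nonroots hp fr"

definition par :: "memory \<Rightarrow> nat \<Rightarrow> nat" where
  "par hp a = (case hp a (2 * K) of Ref b \<Rightarrow> b | _ \<Rightarrow> a)"

text \<open>\<open>rk\<close> and \<open>rep\<close> are ghost functions. The counting clause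
  expresses that each rise of a rank from \<open>r\<close> to \<open>r + 1\<close> uses up a root of
  rank \<open>r\<close>, whose rank is frozen from then on. It yields both the exponential decay of
  the number of nodes of high rank and the linear bound on the sum of ranks.\<close>

definition uf :: "memory \<Rightarrow> nat \<Rightarrow> (nat \<Rightarrow> nat) \<Rightarrow> (nat \<Rightarrow> nat) \<Rightarrow> bool" where
  "uf hp fr rk rep \<longleftrightarrow>
     (\<forall>a\<in>nodes fr. hp a (2 * K) = Ref (par hp a) \<and> par hp a \<in> nodes fr \<and> rep (par hp a) = rep a \<and>
        rep a \<in> nodes fr \<and> par hp (rep a) = rep a \<and> rk a \<le> rk (rep a) \<and>
        (if par hp a = a then rep a = a else rk a < rk (par hp a))) \<and>
     (\<forall>a\<in>nodes fr. if rk a = 0 then hp a (2 * K + 1) = Null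
        else \<exists>c\<in>nonroots hp fr. hp a (2 * K + 1) = Ref c \<and> rk a = Suc (rk c)) \<and>
     (\<forall>r. card {a \<in> nodes fr. r < rk a} \<le> card {a \<in> nonroots hp fr. rk a = r}) \<and>
     fr \<le> lo + nmax"

text \<open>Potentials here measure work already done and grow. A node contributes how far the rank
  of its parent has risen above its own rank, as long as this stays within its own level.\<close>

definition \<Phi>1 :: "memory \<Rightarrow> nat \<Rightarrow> (nat \<Rightarrow> nat) \<Rightarrow> nat" where
  "\<Phi>1 hp fr rk = (\<Sum>a\<in>nodes fr. min (rk (par hp a)) (cap (rk a)) - rk a)"

text \<open>Pays for linking: comparing unary ranks takes time proportional to the smaller rank,
  which is that of the new nonroot.\<close>

definition \<Phi>2 :: "memory \<Rightarrow> nat \<Rightarrow> (nat \<Rightarrow> nat) \<Rightarrow> nat" where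
  "\<Phi>2 hp fr rk = (\<Sum>a\<in>nonroots hp fr. Suc (rk a))"

abbreviation "G \<equiv> log_star nmax"

text \<open>By the counting clause at most half of the nodes of rank above \<open>r\<close> have
  rank above \<open>r + 1\<close>, since at least as many nonroots have rank exactly
  \<open>r + 1\<close>.\<close>

lemma rank_count:
  assumes "uf hp fr rk rep"
  shows "card {a \<in> nodes fr. r < rk a} * 2 ^ r \<le> nmax"
proof (induction r)
  case 0
  have "card {a \<in> nodes fr. 0 < rk a} \<le> card (nodes fr)" by (intro card_mono) auto
  then show ?case using assms by (auto simp: uf_def)
next
  case (Suc r)
  have "card {a \<in> nodes fr. Suc r < rk a} \<le> card {a \<in> nonroots hp fr. rk a = Suc r}"
    using assms by (auto simp: uf_def)
  also have "\<dots> \<le> card {a \<in> nodes fr. rk a = Suc r}"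
    by (intro card_mono) (auto simp: nonroots_def)
  finally have "card {a \<in> nodes fr. Suc r < rk a} + card {a \<in> nodes fr. Suc r < rk a}
      \<le> card {a \<in> nodes fr. rk a = Suc r} + card {a \<in> nodes fr. Suc r < rk a}" by simp
  also have "\<dots> = card ({a \<in> nodes fr. rk a = Suc r} \<union> {a \<in> nodes fr. Suc r < rk a})"
    by (intro card_Un_disjoint[symmetric]) auto
  also have "{a \<in> nodes fr. rk a = Suc r} \<union> {a \<in> nodes fr. Suc r < rk a} = {a \<in> nodes fr. r < rk a}"
    by auto
  finally have "2 * card {a \<in> nodes fr. Suc r < rk a} \<le> card {a \<in> nodes fr. r < rk a}" by simp
  then have "2 * card {a \<in> nodes fr. Suc r < rk a} * 2 ^ r \<le> card {a \<in> nodes fr. r < rk a} * 2 ^ r"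
    by (rule mult_le_mono1)
  also have "\<dots> \<le> nmax" by (rule Suc)
  finally show ?case by (simp only: power_Suc ac_simps)
qed

lemma rank_level:
  assumes "uf hp fr rk rep" "a \<in> nodes fr"
  shows "log_star (rk a) \<le> G"
proof (cases "rk a")
  case 0
  then show ?thesis by (simp add: log_star_le)
next
  case (Suc r)
  have "0 < card {a \<in> nodes fr. r < rk a}"
    by (subst card_gt_0_iff) (use assms Suc in auto)
  then have "1 * 2 ^ r \<le> card {a \<in> nodes fr. r < rk a} * 2 ^ r" by (intro mult_le_mono1) linarith
  then have "2 ^ r \<le> nmax" unfolding mult_1 using rank_count[OF assms(1), of r] by linarith
  moreover have "Suc r \<le> 2 ^ r" using less_exp[of r] by (simp only: Suc_le_eq)
  ultimately show ?thesis using Suc by (intro log_star_mono) simp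
qed

text \<open>Double counting: the sum of ranks is the sum over \<open>r\<close> of the numbers of
  nodes of rank above \<open>r\<close>, and each of these is at most the number of nonroots of rank
  exactly \<open>r\<close>.\<close>

lemma \<Phi>2_bound:
  assumes "uf hp fr rk rep"
  shows "\<Phi>2 hp fr rk \<le> 2 * nmax"
proof -
  have fin: "finite (nonroots hp fr)" by (simp add: nonroots_def)
  have "card (nonroots hp fr) \<le> card (nodes fr)"
    by (intro card_mono) (auto simp: nonroots_def)
  then have cn: "card (nonroots hp fr) \<le> nmax"
    using assms by (auto simp: uf_def)
  define m where "m = Suc (Max (rk ` nodes fr))"
  have m: "rk a < m" if "a \<in> nodes fr" for a using that by (auto simp: m_def less_Suc_eq_le)
  have "(\<Sum>a\<in>nodes fr. rk a) = (\<Sum>a\<in>nodes fr. \<Sum>r<m. of_bool (r < rk a))"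
  proof (rule sum.cong[OF HOL.refl])
    fix a assume "a \<in> nodes fr"
    then have "{r. r < m \<and> r < rk a} = {..<rk a}" using m by fastforce
    then show "rk a = (\<Sum>r<m. of_bool (r < rk a))"
      by (simp add: sum.If_cases of_bool_def Int_def lessThan_def conj_commute)
  qed
  also have "\<dots> = (\<Sum>r<m. \<Sum>a\<in>nodes fr. of_bool (r < rk a))" by (rule sum.swap)
  also have "\<dots> = (\<Sum>r<m. card {a \<in> nodes fr. r < rk a})"
    by (simp add: of_bool_def sum.If_cases Int_def)
  also have "\<dots> \<le> (\<Sum>r<m. card {a \<in> nonroots hp fr. rk a = r})"
    using assms by (intro sum_mono) (auto simp: uf_def)
  also have "\<dots> = card (\<Union>r\<in>{..<m}. {a \<in> nonroots hp fr. rk a = r})"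
    using fin by (intro card_UN_disjoint[symmetric]) auto
  also have "\<dots> \<le> card (nonroots hp fr)" using fin by (intro card_mono) auto
  finally have "(\<Sum>a\<in>nodes fr. rk a) \<le> nmax" using cn by simp
  moreover have "(\<Sum>a\<in>nonroots hp fr. rk a) \<le> (\<Sum>a\<in>nodes fr. rk a)"
    by (intro sum_mono2) (auto simp: nonroots_def)
  ultimately show ?thesis using cn by (simp add: \<Phi>2_def sum_Suc)
qed

text \<open>A level above 0 with ranks up to the tower number \<open>2 ^ m\<close> only contains ranks above \<open>m\<close>, hence
  at most \<open>n / 2 ^ m\<close> nodes.\<close>

lemma \<Phi>1_bound:
  assumes "uf hp fr rk rep"
  shows "\<Phi>1 hp fr rk \<le> nmax * (G + 2)"
proof -
  have cn: "card (nodes fr) \<le> nmax" using assms by (auto simp: uf_def)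
  have level: "card {a \<in> nodes fr. log_star (rk a) = l} * tower l \<le> nmax" for l
  proof (cases l)
    case 0
    have "card {a \<in> nodes fr. log_star (rk a) = 0} \<le> card (nodes fr)" by (intro card_mono) auto
    then show ?thesis using 0 cn by simp
  next
    case (Suc m)
    have "card {a \<in> nodes fr. log_star (rk a) = l} \<le> card {a \<in> nodes fr. tower m < rk a}"
      using Suc log_star_Suc_gt by (intro card_mono) auto
    then have "card {a \<in> nodes fr. log_star (rk a) = l} * tower l
       \<le> card {a \<in> nodes fr. tower m < rk a} * 2 ^ tower m"
      using Suc by simp
    then show ?thesis using rank_count[OF assms, of "tower m"] by simp
  qed
  have "\<Phi>1 hp fr rk \<le> (\<Sum>a\<in>nodes fr. cap (rk a))"
    unfolding \<Phi>1_def by (intro sum_mono) auto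
  also have "\<dots> = card (nodes fr) + (\<Sum>a\<in>nodes fr. tower (log_star (rk a)))"
    by (simp add: cap_def sum_Suc)
  also have "(\<Sum>a\<in>nodes fr. tower (log_star (rk a)))
      = (\<Sum>l\<in>{..G}. \<Sum>a\<in>{a \<in> nodes fr. log_star (rk a) = l}. tower (log_star (rk a)))"
    using rank_level[OF assms] by (intro sum.group[symmetric]) auto
  also have "\<dots> = (\<Sum>l\<in>{..G}. card {a \<in> nodes fr. log_star (rk a) = l} * tower l)"
    by (intro sum.cong) auto
  \<comment> \<open>The \<open>G + 1\<close> levels contribute at most \<open>nmax\<close> each; the
    successor in \<open>cap\<close> accounts for one more \<open>nmax\<close>.\<close>
  also have "\<dots> \<le> (\<Sum>l\<in>{..G}. nmax)" by (intro sum_mono level)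
  also have "card (nodes fr) + \<dots> \<le> nmax * (G + 2)" using cn by (simp add: algebra_simps)
  finally show ?thesis by simp
qed

subsection \<open>Find\<close>

definition find_frame :: "nat \<Rightarrow> memory \<Rightarrow> memory \<Rightarrow> bool" where
  "find_frame fr hp hp' \<longleftrightarrow> (\<forall>a k. k \<noteq> 2 * K \<or> a \<notin> nodes fr \<longrightarrow> hp' a k = hp a k) \<and>
     nonroots hp' fr = nonroots hp fr"

lemma find_frame_refl: "find_frame fr hp hp"
  by (simp add: find_frame_def)

lemma find_frame_trans: "find_frame fr hp hp' \<Longrightarrow> find_frame fr hp' hp'' \<Longrightarrow> find_frame fr hp hp''"
  by (simp add: find_frame_def)

abbreviation set_field :: "memory \<Rightarrow> nat \<Rightarrow> nat \<Rightarrow> val \<Rightarrow> memory" where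
  "set_field hp a k v \<equiv> hp(a := (hp a)(k := v))"

lemma par_set_parent: "par (set_field hp x (2 * K) (Ref z)) a = (if a = x then z else par hp a)"
  by (simp add: par_def)

text \<open>Redirecting to an ancestor of larger rank preserves the forest and can only raise parent
  ranks. \<open>\<Phi>1\<close> grows strictly if the grandparent differs from the parent and lies
  on the level of \<open>x\<close>; the other two cases are charged elsewhere.\<close>

lemma uf_halve:
  assumes uf: "uf hp fr rk rep" and x: "x \<in> nodes fr" "par hp x \<noteq> x"
  defines "z \<equiv> par hp (par hp x)"
  defines "hp' \<equiv> set_field hp x (2 * K) (Ref z)"
  shows "uf hp' fr rk rep" "find_frame fr hp hp'" "\<Phi>1 hp fr rk \<le> \<Phi>1 hp' fr rk"
    and "z \<in> nodes fr" "z \<noteq> x" "rep z = rep x" "rk x < rk z"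
    and "log_star (rk z) = log_star (rk x) \<Longrightarrow> par hp (par hp x) \<noteq> par hp x \<Longrightarrow>
      \<Phi>1 hp fr rk < \<Phi>1 hp' fr rk"
proof -
  let ?y = "par hp x"
  have y: "?y \<in> nodes fr" "rk x < rk ?y" "rep ?y = rep x"
    and z: "z \<in> nodes fr" "rk ?y \<le> rk z" "rep z = rep x"
    using uf x unfolding z_def uf_def by (simp_all, (metis order.refl less_imp_le)+)
  show "z \<in> nodes fr" "rep z = rep x" "rk x < rk z" using y z by auto
  then show zx: "z \<noteq> x" by auto
  have p': "par hp' a = (if a = x then z else par hp a)" for a
    by (simp add: hp'_def par_set_parent)
  have q': "hp' a (2 * K) = (if a = x then Ref z else hp a (2 * K))" for a
    by (simp add: hp'_def)
  have nr: "nonroots hp' fr = nonroots hp fr"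
    using zx x uf by (auto simp: nonroots_def hp'_def uf_def)
  show "find_frame fr hp hp'"
    using nr x by (auto simp: find_frame_def hp'_def)
  have F: "hp' a (2 * K) = Ref (par hp' a) \<and> par hp' a \<in> nodes fr \<and> rep (par hp' a) = rep a \<and>
        rep a \<in> nodes fr \<and> par hp' (rep a) = rep a \<and> rk a \<le> rk (rep a) \<and>
        (if par hp' a = a then rep a = a else rk a < rk (par hp' a))" if a: "a \<in> nodes fr" for a
  proof -
    have *: "hp a (2 * K) = Ref (par hp a) \<and> par hp a \<in> nodes fr \<and> rep (par hp a) = rep a \<and>
        rep a \<in> nodes fr \<and> par hp (rep a) = rep a \<and> rk a \<le> rk (rep a) \<and>
        (if par hp a = a then rep a = a else rk a < rk (par hp a))"
      using uf a unfolding uf_def by blast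
    then have "rep a \<noteq> x" using x by metis
    then show ?thesis
      using * y z zx by (cases "a = x") (simp_all add: p' q')
  qed
  have R: "hp' a (2 * K + 1) = hp a (2 * K + 1)" for a by (simp add: hp'_def)
  show "uf hp' fr rk rep"
    using uf F unfolding uf_def nr R by blast
  have le: "min (rk (par hp a)) (cap (rk a)) - rk a \<le> min (rk (par hp' a)) (cap (rk a)) - rk a" for a
    using z by (auto simp: p' intro!: diff_le_mono)
  show "\<Phi>1 hp fr rk \<le> \<Phi>1 hp' fr rk"
    unfolding \<Phi>1_def by (intro sum_mono le)
  show "\<Phi>1 hp fr rk < \<Phi>1 hp' fr rk"
    if l: "log_star (rk z) = log_star (rk x)" and "par hp ?y \<noteq> ?y"
  proof -
    have "rk ?y < rk z" using uf y(1) that(2) unfolding z_def uf_def by metis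
    moreover have "rk z < cap (rk x)"
      using le_tower_log_star[of "rk z"] l by (simp add: cap_def)
    ultimately have "min (rk (par hp x)) (cap (rk x)) - rk x < min (rk (par hp' x)) (cap (rk x)) - rk x"
      using y by (simp add: p')
    then show ?thesis
      unfolding \<Phi>1_def using x le by (intro sum_strict_mono_ex1) auto
  qed
qed

text \<open>An iteration takes 7 units. It is charged to \<open>\<Phi>1\<close> if it stays on the
  level and to \<open>G - log_star (rk x)\<close> if it climbs to a higher one. The 8 covers a last
  iteration at a child of the root together with the final test.\<close>

lemma find_loop:
  assumes "uf (heap s) (free s) rk rep" "x \<in> nodes (free s)" "regs s 10 = Ref x"
    "regs s 11 = Ref (par (heap s) x)" "regs s 7 = Num 1"
    "regs s 12 = (if par (heap s) x = x then Null else Num 1)"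
  shows "runs B (While (Equal 12 7) (find_body K)) s (\<lambda>t s'.
    uf (heap s') (free s') rk rep \<and> free s' = free s \<and> find_frame (free s) (heap s) (heap s') \<and>
    regs s' 10 = Ref (rep x) \<and> (\<forall>r. r \<notin> {10, 11, 12} \<longrightarrow> regs s' r = regs s r) \<and>
    t + 7 * \<Phi>1 (heap s) (free s) rk \<le> 7 * \<Phi>1 (heap s') (free s) rk + 7 * (G - log_star (rk x)) + 8)"
  using assms
proof (induction "rk (rep x) - rk x" arbitrary: s x rule: less_induct)
  case less
  note uf = less.prems(1)
  show ?case
  proof (cases "par (heap s) x = x")
    case True
    then have "rep x = x" using uf less.prems(2) unfolding uf_def by metis
    then show ?thesis
      using True less.prems by (subst runs_While) (simp add: find_frame_refl)
  next
    case False
    let ?y = "par (heap s) x"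
    let ?z = "par (heap s) ?y"
    let ?hp = "set_field (heap s) x (2 * K) (Ref ?z)"
    note h = uf_halve[OF uf less.prems(2) False]
    have y: "?y \<in> nodes (free s)" "heap s ?y (2 * K) = Ref ?z"
      using uf less.prems(2) unfolding uf_def by metis+
    have pz: "?hp ?z (2 * K) = Ref (par (heap s) ?z)" "par ?hp ?z = par (heap s) ?z"
      using h(4,5) uf unfolding uf_def by (auto simp: par_def)
    define s1 where "s1 = s\<lparr>heap := ?hp, regs := (regs s)(10 := Ref ?z, 11 := Ref (par ?hp ?z),
        12 := if par ?hp ?z = ?z then Null else Num 1)\<rparr>"
    have body: "runs B (find_body K) s (\<lambda>t s'. t = 6 \<and> s' = s1)"
      using less.prems y pz False h(5)
      by (cases "par ?hp ?z = ?z")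
        (simp_all add: find_body_def neq_flag_def runs_simps set_reg_def s1_def)
    have meas: "rk (rep ?z) - rk ?z < rk (rep x) - rk x"
    proof -
      have "rk ?z \<le> rk (rep ?z)" using uf h(4) unfolding uf_def by blast
      then show ?thesis using h(6,7) by simp
    qed
    have IH: "runs B (While (Equal 12 7) (find_body K)) s1 (\<lambda>t s'.
        uf (heap s') (free s') rk rep \<and> free s' = free s1 \<and> find_frame (free s1) (heap s1) (heap s') \<and>
        regs s' 10 = Ref (rep ?z) \<and> (\<forall>r. r \<notin> {10, 11, 12} \<longrightarrow> regs s' r = regs s1 r) \<and>
        t + 7 * \<Phi>1 (heap s1) (free s1) rk \<le> 7 * \<Phi>1 (heap s') (free s1) rk + 7 * (G - log_star (rk ?z)) + 8)"
      using less.prems h(1,4) by (intro less.hyps[OF meas]) (simp_all add: s1_def)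
    have lev: "log_star (rk x) \<le> log_star (rk ?z)" "log_star (rk ?z) \<le> G"
      using h(7) rank_level[OF uf h(4)] by (auto intro: log_star_mono)
    show ?thesis
    proof (cases "?z = ?y")
      case True
      \<comment> \<open>The parent was the root already, so the loop stops after this step.\<close>
      then have "par (heap s) ?z = ?z" by simp
      moreover from this have "rep ?z = ?z" using uf h(4) unfolding uf_def by metis
      ultimately have "runs B (While (Equal 12 7) (find_body K)) s1 (\<lambda>t s'. t = 1 \<and> s' = s1 \<and> rep x = ?z)"
        using less.prems h(6) by (subst runs_While) (simp add: s1_def pz(2))
      then show ?thesis
        using less.prems False h(1,2,3,6)
        by (intro runs_WhileI[OF _ body]) (auto elim!: runs_mono simp: s1_def)
    next
      case z: False
      then have "7 + 7 * \<Phi>1 (heap s) (free s) rk + 7 * (G - log_star (rk ?z))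
          \<le> 7 * \<Phi>1 ?hp (free s) rk + 7 * (G - log_star (rk x))"
        using h(3,8) lev by (cases "log_star (rk ?z) = log_star (rk x)") auto
      note arith = this
      show ?thesis
      proof (rule runs_WhileI[OF _ body])
        show "test_holds (Equal 12 7) s" using less.prems False by simp
        fix t :: nat and s' assume "t = 6 \<and> s' = s1"
        then have eqs: "t = 6" "s' = s1" by auto
        show "runs B (While (Equal 12 7) (find_body K)) s' (\<lambda>t' s''.
          uf (heap s'') (free s'') rk rep \<and> free s'' = free s \<and>
          find_frame (free s) (heap s) (heap s'') \<and> regs s'' 10 = Ref (rep x) \<and>
          (\<forall>r. r \<notin> {10, 11, 12} \<longrightarrow> regs s'' r = regs s r) \<and>
          Suc (t + t') + 7 * \<Phi>1 (heap s) (free s) rk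
            \<le> 7 * \<Phi>1 (heap s'') (free s) rk + 7 * (G - log_star (rk x)) + 8)"
          unfolding eqs
          by (rule runs_mono[OF IH])
            (use arith h(2,6) in \<open>auto simp: s1_def intro: find_frame_trans\<close>)
      qed
    qed
  qed
qed

end

section \<open>Comparison of unary ranks and linking of roots\<close>

context memory_layout
begin

context
  fixes hp :: memory and fr :: nat and rk rep :: "nat \<Rightarrow> nat" and a :: nat
  assumes uf: "uf hp fr rk rep" and a: "a \<in> nodes fr"
begin

lemma uf_par: "hp a (2 * K) = Ref (par hp a)" "par hp a \<in> nodes fr"
  and uf_rep_par: "rep (par hp a) = rep a"
  and uf_rep_node: "rep a \<in> nodes fr"
  and uf_par_rep: "par hp (rep a) = rep a"
  and uf_rk_rep: "rk a \<le> rk (rep a)"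
  and uf_root: "par hp a = a \<Longrightarrow> rep a = a"
  and uf_rk_par: "par hp a \<noteq> a \<Longrightarrow> rk a < rk (par hp a)"
  and uf_rank_Null: "rk a = 0 \<Longrightarrow> hp a (2 * K + 1) = Null"
  and uf_rank_Ref: "rk a \<noteq> 0 \<Longrightarrow> \<exists>c\<in>nonroots hp fr. hp a (2 * K + 1) = Ref c \<and> rk a = Suc (rk c)"
proof -
  have 1: "hp a (2 * K) = Ref (par hp a) \<and> par hp a \<in> nodes fr \<and> rep (par hp a) = rep a \<and>
        rep a \<in> nodes fr \<and> par hp (rep a) = rep a \<and> rk a \<le> rk (rep a) \<and>
        (if par hp a = a then rep a = a else rk a < rk (par hp a))"
    and 2: "if rk a = 0 then hp a (2 * K + 1) = Null
        else \<exists>c\<in>nonroots hp fr. hp a (2 * K + 1) = Ref c \<and> rk a = Suc (rk c)"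
    using uf a unfolding uf_def by blast+
  show "hp a (2 * K) = Ref (par hp a)" "par hp a \<in> nodes fr" "rep (par hp a) = rep a"
    "rep a \<in> nodes fr" "par hp (rep a) = rep a" "rk a \<le> rk (rep a)"
    "par hp a = a \<Longrightarrow> rep a = a" "par hp a \<noteq> a \<Longrightarrow> rk a < rk (par hp a)"
    using 1 by simp_all
  show "rk a = 0 \<Longrightarrow> hp a (2 * K + 1) = Null"
    "rk a \<noteq> 0 \<Longrightarrow> \<exists>c\<in>nonroots hp fr. hp a (2 * K + 1) = Ref c \<and> rk a = Suc (rk c)"
    using 2 by simp_all
qed

end

lemma uf_count: "uf hp fr rk rep \<Longrightarrow>
    card {a \<in> nodes fr. r < rk a} \<le> card {a \<in> nonroots hp fr. rk a = r}"
  unfolding uf_def by blast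

lemma uf_size: "uf hp fr rk rep \<Longrightarrow> fr \<le> lo + nmax"
  unfolding uf_def by blast

lemma uf_rep_idem: "uf hp fr rk rep \<Longrightarrow> a \<in> nodes fr \<Longrightarrow> rep (rep a) = rep a"
  using uf_root[of hp fr rk rep "rep a"] uf_par_rep uf_rep_node by blast

lemma nonroots_iff:
  assumes "uf hp fr rk rep" "a \<in> nodes fr"
  shows "a \<in> nonroots hp fr \<longleftrightarrow> rep a \<noteq> a" "a \<in> nonroots hp fr \<longleftrightarrow> par hp a \<noteq> a"
proof -
  show *: "a \<in> nonroots hp fr \<longleftrightarrow> par hp a \<noteq> a"
    using uf_par[OF assms] assms by (auto simp: nonroots_def)
  have "rep a \<noteq> a" if "par hp a \<noteq> a"
    using uf_rk_par[OF assms that] uf_rk_rep[OF assms(1) uf_par(2)[OF assms]] uf_rep_par[OF assms]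
    by auto
  then show "a \<in> nonroots hp fr \<longleftrightarrow> rep a \<noteq> a" using * uf_root[OF assms] by blast
qed

lemma nonroots_nodes: "a \<in> nonroots hp fr \<Longrightarrow> a \<in> nodes fr"
  by (simp add: nonroots_def)

lemma finite_nonroots [simp]: "finite (nonroots hp fr)"
  by (simp add: nonroots_def)

text \<open>A find takes 3 units before its loop and at most \<open>7 * G + 8\<close> in it beyond
  the growth of \<open>\<Phi>1\<close>; the constant is rounded up.\<close>

definition cF :: nat where "cF = 7 * G + 20"

lemma run_find:
  assumes uf: "uf (heap s) (free s) rk rep" and x: "x \<in> nodes (free s)" "regs s 10 = Ref x"
    and r7: "regs s 7 = Num 1"
  shows "runs B (find_prog K) s (\<lambda>t s'.
    uf (heap s') (free s') rk rep \<and> free s' = free s \<and> find_frame (free s) (heap s) (heap s') \<and>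
    regs s' 10 = Ref (rep x) \<and> (\<forall>r. r \<notin> {10, 11, 12} \<longrightarrow> regs s' r = regs s r) \<and>
    t + 7 * \<Phi>1 (heap s) (free s) rk \<le> 7 * \<Phi>1 (heap s') (free s) rk + cF)"
proof -
  let ?f = "if par (heap s) x = x then Null else Num 1"
  define s1 where "s1 = s\<lparr>regs := (regs s)(11 := Ref (par (heap s) x), 12 := ?f)\<rparr>"
  have init: "runs B (Seq (Load 11 10 (2 * K)) (neq_flag 12 10 11)) s (\<lambda>t s'. t = 3 \<and> s' = s1)"
    using uf_par[OF uf x(1)] x r7
    by (cases "par (heap s) x = x") (simp_all add: neq_flag_def runs_simps set_reg_def s1_def)
  have loop: "runs B (While (Equal 12 7) (find_body K)) s1 (\<lambda>t s'.
    uf (heap s') (free s') rk rep \<and> free s' = free s1 \<and> find_frame (free s1) (heap s1) (heap s') \<and>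
    regs s' 10 = Ref (rep x) \<and> (\<forall>r. r \<notin> {10, 11, 12} \<longrightarrow> regs s' r = regs s1 r) \<and>
    t + 7 * \<Phi>1 (heap s1) (free s1) rk \<le> 7 * \<Phi>1 (heap s') (free s1) rk + 7 * (G - log_star (rk x)) + 8)"
    by (rule find_loop) (use uf x r7 in \<open>auto simp: s1_def\<close>)
  have "runs B (Seq (Seq (Load 11 10 (2 * K)) (neq_flag 12 10 11)) (While (Equal 12 7) (find_body K))) s (\<lambda>t s'.
    uf (heap s') (free s') rk rep \<and> free s' = free s \<and> find_frame (free s) (heap s) (heap s') \<and>
    regs s' 10 = Ref (rep x) \<and> (\<forall>r. r \<notin> {10, 11, 12} \<longrightarrow> regs s' r = regs s r) \<and>
    t + 7 * \<Phi>1 (heap s) (free s) rk \<le> 7 * \<Phi>1 (heap s') (free s) rk + cF)"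
    by (rule runs_SeqI[OF init], elim conjE, hypsubst, rule runs_mono[OF loop])
      (auto simp: s1_def cF_def)
  then show ?thesis by (simp add: find_prog_def runs_Seq add.assoc)
qed

subsection \<open>Comparing ranks\<close>

definition rank_val :: "nat \<Rightarrow> (nat \<Rightarrow> nat) \<Rightarrow> val \<Rightarrow> nat \<Rightarrow> bool" where
  "rank_val fr rk w n \<longleftrightarrow> (if n = 0 then w = Null else \<exists>c\<in>nodes fr. w = Ref c \<and> n = Suc (rk c))"

lemma rank_val_field: "uf hp fr rk rep \<Longrightarrow> a \<in> nodes fr \<Longrightarrow> rank_val fr rk (hp a (2 * K + 1)) (rk a)"
  using uf_rank_Null[of hp fr rk rep a] uf_rank_Ref[of hp fr rk rep a] nonroots_nodes
  unfolding rank_val_def by (cases "rk a = 0") (simp, metis)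

lemma rank_val_eq_Null: "rank_val fr rk w n \<Longrightarrow> w = Null \<longleftrightarrow> n = 0"
  by (auto simp: rank_val_def split: if_splits)

text \<open>Both chains are shortened until one ends, so after \<open>min m n\<close> rounds the
  null registers reveal the comparison.\<close>

lemma walk_loop:
  assumes "uf (heap s) (free s) rk rep" "rank_val (free s) rk (regs s 17) m"
    "rank_val (free s) rk (regs s 18) n" "regs s 6 = Null" "regs s 7 = Num 1"
    "regs s 12 = (if m = 0 \<or> n = 0 then Null else Num 1)"
  shows "runs B (While (Equal 12 7) (Seq (Load 17 17 (2 * K + 1)) (Seq (Load 18 18 (2 * K + 1)) walk_flag))) s
    (\<lambda>t s'. heap s' = heap s \<and> free s' = free s \<and> (\<forall>r. r \<notin> {12, 17, 18} \<longrightarrow> regs s' r = regs s r) \<and>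
      (regs s' 17 = Null \<longleftrightarrow> m \<le> n) \<and> (regs s' 18 = Null \<longleftrightarrow> n \<le> m) \<and> t \<le> 6 * min m n + 1)"
  using assms
proof (induction m arbitrary: n s)
  case 0
  then show ?case by (subst runs_While) (auto simp: rank_val_eq_Null)
next
  case (Suc m)
  show ?case
  proof (cases n)
    case 0
    then show ?thesis using Suc.prems by (subst runs_While) (auto simp: rank_val_eq_Null)
  next
    case n: (Suc n')
    obtain c c' where c: "c \<in> nodes (free s)" "regs s 17 = Ref c" "m = rk c"
        and c': "c' \<in> nodes (free s)" "regs s 18 = Ref c'" "n' = rk c'"
      using Suc.prems n by (auto simp: rank_val_def)
    note rv = rank_val_field[OF Suc.prems(1) c(1)] rank_val_field[OF Suc.prems(1) c'(1)]
    define s1 where "s1 = s\<lparr>regs := (regs s)(17 := heap s c (2 * K + 1), 18 := heap s c' (2 * K + 1),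
        12 := if m = 0 \<or> n' = 0 then Null else Num 1)\<rparr>"
    have body: "runs B (Seq (Load 17 17 (2 * K + 1)) (Seq (Load 18 18 (2 * K + 1)) walk_flag)) s
        (\<lambda>t s'. t \<le> 5 \<and> s' = s1)"
      using Suc.prems c c' rank_val_eq_Null[OF rv(1)] rank_val_eq_Null[OF rv(2)]
      by (cases "m = 0"; cases "n' = 0") (simp_all add: walk_flag_def runs_simps set_reg_def s1_def)
    have IH: "runs B (While (Equal 12 7) (Seq (Load 17 17 (2 * K + 1)) (Seq (Load 18 18 (2 * K + 1)) walk_flag))) s1
      (\<lambda>t s'. heap s' = heap s1 \<and> free s' = free s1 \<and> (\<forall>r. r \<notin> {12, 17, 18} \<longrightarrow> regs s' r = regs s1 r) \<and>
        (regs s' 17 = Null \<longleftrightarrow> m \<le> n') \<and> (regs s' 18 = Null \<longleftrightarrow> n' \<le> m) \<and> t \<le> 6 * min m n' + 1)"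
      using Suc.prems rv c c' by (intro Suc.IH) (simp_all add: s1_def)
    show ?thesis
    proof (rule runs_WhileI[OF _ body])
      show "test_holds (Equal 12 7) s" using Suc.prems n by simp
      fix t :: nat and s' assume "t \<le> 5 \<and> s' = s1"
      then have t: "t \<le> 5" "s' = s1" by auto
      show "runs B (While (Equal 12 7) (Seq (Load 17 17 (2 * K + 1)) (Seq (Load 18 18 (2 * K + 1)) walk_flag))) s'
        (\<lambda>t' s''. heap s'' = heap s \<and> free s'' = free s \<and>
          (\<forall>r. r \<notin> {12, 17, 18} \<longrightarrow> regs s'' r = regs s r) \<and>
          (regs s'' 17 = Null \<longleftrightarrow> Suc m \<le> n) \<and> (regs s'' 18 = Null \<longleftrightarrow> n \<le> Suc m) \<and>
          Suc (t + t') \<le> 6 * min (Suc m) n + 1)"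
        unfolding t(2) by (rule runs_mono[OF IH]) (use t n in \<open>auto simp: s1_def\<close>)
    qed
  qed
qed

lemma run_walk:
  assumes uf: "uf (heap s) (free s) rk rep" and xy: "x \<in> nodes (free s)" "y \<in> nodes (free s)"
    and r: "regs s 17 = heap s x (2 * K + 1)" "regs s 18 = heap s y (2 * K + 1)"
      "regs s 6 = Null" "regs s 7 = Num 1"
  shows "runs B (walk_prog K) s
    (\<lambda>t s'. heap s' = heap s \<and> free s' = free s \<and> (\<forall>r. r \<notin> {12, 17, 18} \<longrightarrow> regs s' r = regs s r) \<and>
      (regs s' 17 = Null \<longleftrightarrow> rk x \<le> rk y) \<and> (regs s' 18 = Null \<longleftrightarrow> rk y \<le> rk x) \<and>
      t \<le> 6 * min (rk x) (rk y) + 4)"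
proof -
  note rv = rank_val_field[OF uf xy(1)] rank_val_field[OF uf xy(2)]
  define s1 where "s1 = s\<lparr>regs := (regs s)(12 := if rk x = 0 \<or> rk y = 0 then Null else Num 1)\<rparr>"
  have init: "runs B walk_flag s (\<lambda>t s'. t \<le> 3 \<and> s' = s1)"
    using r rank_val_eq_Null[OF rv(1)] rank_val_eq_Null[OF rv(2)]
    by (cases "rk x = 0"; cases "rk y = 0") (simp_all add: walk_flag_def runs_simps set_reg_def s1_def)
  have loop: "runs B (While (Equal 12 7) (Seq (Load 17 17 (2 * K + 1)) (Seq (Load 18 18 (2 * K + 1)) walk_flag))) s1
    (\<lambda>t s'. heap s' = heap s1 \<and> free s' = free s1 \<and> (\<forall>r. r \<notin> {12, 17, 18} \<longrightarrow> regs s' r = regs s1 r) \<and>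
      (regs s' 17 = Null \<longleftrightarrow> rk x \<le> rk y) \<and> (regs s' 18 = Null \<longleftrightarrow> rk y \<le> rk x) \<and>
      t \<le> 6 * min (rk x) (rk y) + 1)"
    by (rule walk_loop) (use uf rv r in \<open>auto simp: s1_def\<close>)
  show ?thesis
    unfolding walk_prog_def
    by (rule runs_SeqI[OF init], elim conjE, hypsubst, rule runs_mono[OF loop]) (auto simp: s1_def)
qed

subsection \<open>Linking\<close>

definition link_mem :: "memory \<Rightarrow> (nat \<Rightarrow> nat) \<Rightarrow> nat \<Rightarrow> nat \<Rightarrow> val \<Rightarrow> memory" where
  "link_mem hp rk x y w = (let hp1 = (if rk x = rk y then set_field hp x (2 * K + 1) (Ref y) else hp) in
     set_field (set_field hp1 y (2 * K) (Ref x)) y (2 * K + 2) w)"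

definition link_rk :: "(nat \<Rightarrow> nat) \<Rightarrow> nat \<Rightarrow> nat \<Rightarrow> nat \<Rightarrow> nat" where
  "link_rk rk x y = (if rk x = rk y then rk(x := Suc (rk x)) else rk)"

definition link_rep :: "(nat \<Rightarrow> nat) \<Rightarrow> nat \<Rightarrow> nat \<Rightarrow> nat \<Rightarrow> nat" where
  "link_rep rep x y a = (if rep a = y then x else rep a)"

context
  fixes hp :: memory and fr :: nat and rk rep :: "nat \<Rightarrow> nat" and x y :: nat and w :: val
  assumes uf: "uf hp fr rk rep" and x: "x \<in> nodes fr" "rep x = x" and y: "y \<in> nodes fr" "rep y = y"
    and neq: "x \<noteq> y" and le: "rk y \<le> rk x"
begin

lemma link_mem_simps:
  "(link_mem hp rk x y w) a (2 * K) = (if a = y then Ref x else hp a (2 * K))"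
  "(link_mem hp rk x y w) a (2 * K + 2) = (if a = y then w else hp a (2 * K + 2))"
  "(link_mem hp rk x y w) a (2 * K + 1) = (if a = x \<and> rk x = rk y then Ref y else hp a (2 * K + 1))"
  "k \<notin> {2 * K, 2 * K + 1, 2 * K + 2} \<Longrightarrow> (link_mem hp rk x y w) a k = hp a k"
  "a \<noteq> x \<Longrightarrow> a \<noteq> y \<Longrightarrow> (link_mem hp rk x y w) a = hp a"
  using neq by (auto simp: link_mem_def Let_def)

lemma link_par: "par (link_mem hp rk x y w) a = (if a = y then x else par hp a)"
  using link_mem_simps(1) by (simp add: par_def)

lemma x_par: "par hp x = x" "x \<notin> nonroots hp fr" and y_par: "par hp y = y" "y \<notin> nonroots hp fr"
  using uf_par_rep[OF uf x(1)] uf_par_rep[OF uf y(1)] nonroots_iff[OF uf x(1)] nonroots_iff[OF uf y(1)]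
    x(2) y(2) by simp_all

lemma link_nonroots: "nonroots (link_mem hp rk x y w) fr = insert y (nonroots hp fr)"
  using link_mem_simps(1) neq y by (auto simp: nonroots_def)

lemma link_rk_ge: "rk a \<le> (link_rk rk x y) a" and link_rk_other: "a \<noteq> x \<Longrightarrow> (link_rk rk x y) a = rk a"
  and link_rk_xy: "rk y < (link_rk rk x y) x"
  using le by (auto simp: link_rk_def)

lemma link_rk_nonroot: "a \<in> nonroots hp fr \<Longrightarrow> link_rk rk x y a = rk a"
  using x_par(2) link_rk_other[of a] by auto

lemma link_uf: "uf (link_mem hp rk x y w) fr (link_rk rk x y) (link_rep rep x y)"
  unfolding uf_def
proof (intro conjI ballI allI)
  fix a assume a: "a \<in> nodes fr"
  note ua = uf_par[OF uf a] uf_rep_par[OF uf a] uf_rep_node[OF uf a] uf_par_rep[OF uf a]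
    uf_rk_rep[OF uf a] uf_root[OF uf a] uf_rk_par[OF uf a]
  show "(link_mem hp rk x y w) a (2 * K) = Ref (par (link_mem hp rk x y w) a)"
    using ua link_mem_simps(1) by (simp add: link_par)
  show "par (link_mem hp rk x y w) a \<in> nodes fr" using ua x by (simp add: link_par)
  show "(link_rep rep x y) (par (link_mem hp rk x y w) a) = (link_rep rep x y) a"
    using ua x y neq by (simp add: link_par link_rep_def)
  show "(link_rep rep x y) a \<in> nodes fr" using ua x by (simp add: link_rep_def)
  show "par (link_mem hp rk x y w) ((link_rep rep x y) a) = (link_rep rep x y) a"
    using ua x_par neq by (simp add: link_par link_rep_def)
  show "(link_rk rk x y) a \<le> (link_rk rk x y) ((link_rep rep x y) a)"
  proof (cases "rep a = y")
    case True
    then have "a \<noteq> x" using x neq by auto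
    then show ?thesis using True ua link_rk_xy link_rk_other by (simp add: link_rep_def)
  next
    case False
    then show ?thesis using ua x link_rk_other[of a] link_rk_ge[of "rep a"]
      by (cases "a = x") (auto simp: link_rep_def)
  qed
  show "if par (link_mem hp rk x y w) a = a then (link_rep rep x y) a = a else (link_rk rk x y) a < (link_rk rk x y) (par (link_mem hp rk x y w) a)"
  proof (cases "a = y")
    case True
    then show ?thesis using neq link_rk_xy link_rk_other[of y] by (simp add: link_par)
  next
    case False
    show ?thesis
    proof (cases "par hp a = a")
      case True
      then show ?thesis using False ua by (simp add: link_par link_rep_def)
    next
      case par: False
      then have "a \<noteq> x" using x_par by auto
      then show ?thesis using False par ua link_rk_other[of a] link_rk_ge[of "par hp a"]
        by (simp add: link_par)
    qed
  qed
  show "if (link_rk rk x y) a = 0 then (link_mem hp rk x y w) a (2 * K + 1) = Null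
        else \<exists>c\<in>nonroots (link_mem hp rk x y w) fr. (link_mem hp rk x y w) a (2 * K + 1) = Ref c \<and> (link_rk rk x y) a = Suc ((link_rk rk x y) c)"
  proof (cases "a = x \<and> rk x = rk y")
    case True
    then show ?thesis
      using link_mem_simps(3)[of a] link_rk_other[of y] neq by (simp add: link_nonroots link_rk_def)
  next
    case False
    then have *: "(link_rk rk x y) a = rk a" "(link_mem hp rk x y w) a (2 * K + 1) = hp a (2 * K + 1)"
      using link_mem_simps(3)[of a] by (auto simp: link_rk_def)
    show ?thesis
      using link_rk_nonroot uf_rank_Null[OF uf a] uf_rank_Ref[OF uf a] * by (auto simp: link_nonroots)
  qed
next
  fix r
  \<comment> \<open>Only for equal ranks and \<open>r = rk y\<close> does \<open>x\<close> newly
    exceed \<open>r\<close>, and then \<open>y\<close> is a new nonroot of rank \<open>r\<close>: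
    both sides of the counting clause grow by one.\<close>
  let ?T = "{a \<in> nodes fr. r < rk a}" and ?N = "{a \<in> nonroots hp fr. rk a = r}"
  have N: "{a \<in> nonroots (link_mem hp rk x y w) fr. (link_rk rk x y) a = r} = ?N \<union> (if rk y = r then {y} else {})"
    using link_rk_other[of y] neq link_rk_nonroot by (auto simp: link_nonroots)
  have T: "{a \<in> nodes fr. r < (link_rk rk x y) a} \<subseteq> ?T \<union> (if rk y = r then {x} else {})"
    using le by (auto simp: link_rk_def split: if_splits)
  have "card {a \<in> nodes fr. r < (link_rk rk x y) a} \<le> card (?T \<union> (if rk y = r then {x} else {}))"
    using T by (intro card_mono) auto
  also have "\<dots> \<le> card ?T + (if rk y = r then 1 else 0)"
    using card_Un_le[of ?T "if rk y = r then {x} else {}"] by (auto split: if_splits)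
  also have "\<dots> \<le> card ?N + (if rk y = r then 1 else 0)"
    using uf_count[OF uf, of r] by simp
  also have "\<dots> = card (?N \<union> (if rk y = r then {y} else {}))"
    using y_par by (auto simp: card_insert_if)
  finally show "card {a \<in> nodes fr. r < (link_rk rk x y) a} \<le> card {a \<in> nonroots (link_mem hp rk x y w) fr. (link_rk rk x y) a = r}"
    by (simp only: N)
next
  show "fr \<le> lo + nmax" using uf_size[OF uf] .
qed

text \<open>Roots are their own parents and contribute 0, so raising the rank of a root loses
  nothing.\<close>

lemma link_\<Phi>1: "\<Phi>1 hp fr rk \<le> \<Phi>1 (link_mem hp rk x y w) fr (link_rk rk x y)"
  unfolding \<Phi>1_def
proof (rule sum_mono)
  fix a
  show "min (rk (par hp a)) (cap (rk a)) - rk a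
      \<le> min ((link_rk rk x y) (par (link_mem hp rk x y w) a)) (cap ((link_rk rk x y) a)) - (link_rk rk x y) a"
  proof (cases "a = x \<or> a = y")
    case False
    then show ?thesis
      using link_rk_other[of a] link_rk_ge[of "par hp a"] by (auto simp: link_par intro!: diff_le_mono)
  qed (use x_par y_par in auto)
qed

lemma link_\<Phi>2: "\<Phi>2 (link_mem hp rk x y w) fr (link_rk rk x y) = \<Phi>2 hp fr rk + Suc (rk y)"
proof -
  have "(\<Sum>a\<in>nonroots hp fr. Suc ((link_rk rk x y) a)) = (\<Sum>a\<in>nonroots hp fr. Suc (rk a))"
    using link_rk_nonroot by (intro sum.cong) auto
  then show ?thesis
    using y_par link_rk_other[of y] neq by (simp add: \<Phi>2_def link_nonroots)
qed

end

end

section \<open>Folding by merging records, with a ghost map to a fixed graph\<close>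

section \<open>The folding program\<close>

text \<open>Inserts one half edge at a root. If the root already has an edge with this key, the fold
  is performed by uniting the two targets.\<close>

definition put_prog :: "nat \<Rightarrow> nat \<Rightarrow> com" where
  "put_prog K k = Seq (Copy 10 20) (Seq (find_prog K) (Seq (Load 15 10 k) (Cond (Equal 15 6)
     (Store 10 k 21) (Seq (Copy 16 21) (union_prog K)))))"

text \<open>\<open>keyE\<close> is the edge relation of a fixed deterministic graph, indexed by
  record fields; the ghost map \<open>g\<close> will send records to its vertices. Determinism makes
  it legitimate to merge the targets of one field.\<close>

locale folding_machine = memory_layout B K lo nmax for B and K lo nmax :: nat +
  fixes ks :: "nat list" and keyE :: "nat \<Rightarrow> 'm \<Rightarrow> 'm \<Rightarrow> bool"
  assumes keys: "k \<in> set ks \<Longrightarrow> k < 2 * K"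
    and keyE_det: "keyE k p q \<Longrightarrow> keyE k p q' \<Longrightarrow> q = q'"
begin

fun wlist :: "memory \<Rightarrow> val \<Rightarrow> nat list \<Rightarrow> bool" where
  "wlist hp w [] \<longleftrightarrow> w = Null"
| "wlist hp w (y # ys) \<longleftrightarrow> w = Ref y \<and> wlist hp (hp y (2 * K + 2)) ys"

lemma wlist_cong: "(\<And>y. y \<in> set ys \<Longrightarrow> hp' y (2 * K + 2) = hp y (2 * K + 2)) \<Longrightarrow>
    wlist hp' w ys \<longleftrightarrow> wlist hp w ys"
  by (induction ys arbitrary: w) auto

text \<open>A demand \<open>(p, k, q)\<close> asks for an edge with key \<open>k\<close> from the class of \<open>p\<close> to the class of
  \<open>q\<close>. It may be met by the record of any active node of the class: a root, or a former root whose
  edges still have to be passed on.\<close>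

definition met :: "memory \<Rightarrow> (nat \<Rightarrow> nat) \<Rightarrow> nat set \<Rightarrow> nat \<times> nat \<times> nat \<Rightarrow> bool" where
  "met hp rep Act d \<longleftrightarrow> (case d of (p, k, q) \<Rightarrow> k < 2 * K \<and>
     (\<exists>y\<in>Act. rep y = rep p \<and> (\<exists>r. hp y k = Ref r \<and> rep r = rep q)))"

definition demanded :: "(nat \<Rightarrow> nat) \<Rightarrow> (nat \<times> nat \<times> nat) set \<Rightarrow> nat \<Rightarrow> nat \<Rightarrow> nat \<Rightarrow> bool" where
  "demanded rep D p k q \<longleftrightarrow> (\<exists>p' q'. (p', k, q') \<in> D \<and> rep p' = rep p \<and> rep q' = rep q)"

lemma met_mono:
  assumes "met hp rep Act d" "Act \<subseteq> Act'" "\<And>a b. rep a = rep b \<Longrightarrow> rep' a = rep' b"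
    and "\<And>a k r. k < 2 * K \<Longrightarrow> hp a k = Ref r \<Longrightarrow> a \<in> Act \<Longrightarrow> hp' a k = Ref r"
  shows "met hp' rep' Act' d"
proof -
  obtain p k q where d: "d = (p, k, q)" by (cases d) auto
  then obtain y r where y: "k < 2 * K" "y \<in> Act" "rep y = rep p" "hp y k = Ref r" "rep r = rep q"
    using assms(1) unfolding met_def by auto
  show ?thesis
    unfolding d met_def prod.case
    using y assms(2) assms(3)[OF y(3)] assms(3)[OF y(5)] assms(4)[OF y(1,4,2)] by blast
qed

lemma demanded_mono:
  assumes "demanded rep D a k r" "\<And>a b. rep a = rep b \<Longrightarrow> rep' a = rep' b" "D \<subseteq> D'"
  shows "demanded rep' D' a k r"
proof -
  obtain p q where "(p, k, q) \<in> D" "rep p = rep a" "rep q = rep r"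
    using assms(1) unfolding demanded_def by blast
  then show ?thesis
    using assms(2)[of p a] assms(2)[of q r] assms(3) unfolding demanded_def by blast
qed

text \<open>\<open>D\<close> is the set of demands made so far. A field holds nothing but a demand
  up to equivalence, and demands are true under \<open>g\<close>; the memory therefore identifies
  only records with the same image.\<close>

definition graph_inv where
  "graph_inv hp fr rep D g \<longleftrightarrow>
     (\<forall>a\<in>nodes fr. \<forall>k\<in>set ks. hp a k = Null \<or>
        (\<exists>r\<in>nodes fr. hp a k = Ref r \<and> demanded rep D a k r)) \<and>
     (\<forall>p k q. (p, k, q) \<in> D \<longrightarrow> p \<in> nodes fr \<and> q \<in> nodes fr \<and> k \<in> set ks \<and> keyE k (g p) (g q)) \<and>
     (\<forall>a\<in>nodes fr. g (rep a) = g a)"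

definition pred_inv :: "memory \<Rightarrow> nat \<Rightarrow> bool" where
  "pred_inv hp fr \<longleftrightarrow> (\<forall>a\<in>nodes fr. hp a (2 * K + 3) = (if a = lo then Null else Ref (a - 1)))"

text \<open>\<open>ys\<close> is the stack of former roots, and \<open>Z\<close> holds the record
  being emptied. Demands in \<open>S1\<close> may still rely on \<open>Z\<close>; those in
  \<open>S2\<close> are already met without it.\<close>

definition machine_inv where
  "machine_inv hp fr w rk rep ys D S1 S2 Z g \<longleftrightarrow> uf hp fr rk rep \<and> graph_inv hp fr rep D g \<and> pred_inv hp fr \<and>
     wlist hp w ys \<and> distinct ys \<and> set ys \<subseteq> nonroots hp fr \<and> Z \<subseteq> nonroots hp fr \<and>
     (\<forall>d\<in>S1. met hp rep (roots hp fr \<union> set ys \<union> Z) d) \<and>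
     (\<forall>d\<in>S2. met hp rep (roots hp fr \<union> set ys) d)"

text \<open>\<open>cP\<close> covers the three finds of an insertion and its overhead,
  \<open>cD\<close> the passing on of all fields of one former root.\<close>

definition cP :: nat where "cP = 3 * cF + 60"
definition cD :: nat where "cD = length ks * (cP + 10) + 20"

text \<open>A new nonroot enters the stack at once, so a union leaves the last term unchanged.
  Taking a record off the stack raises it by \<open>cD\<close>, which pays for passing on its edges.
  The factor 8 covers 6 units per rank compared and 7 for linking.\<close>

definition pot where
  "pot hp fr rk ys = 7 * \<Phi>1 hp fr rk + 8 * \<Phi>2 hp fr rk + cD * (card (nonroots hp fr) - length ys)"

lemma inv_find:
  assumes inv: "machine_inv hp fr w rk rep ys D S1 S2 Z g" and uf: "uf hp' fr rk rep"
    and frame: "find_frame fr hp hp'"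
  shows "machine_inv hp' fr w rk rep ys D S1 S2 Z g"
    and "pot hp' fr rk ys + 7 * \<Phi>1 hp fr rk = pot hp fr rk ys + 7 * \<Phi>1 hp' fr rk"
proof -
  have f: "k \<noteq> 2 * K \<Longrightarrow> hp' a k = hp a k" and nr: "nonroots hp' fr = nonroots hp fr" for a k
    using frame by (auto simp: find_frame_def)
  have fk: "k \<in> set ks \<Longrightarrow> hp' a k = hp a k" for a k using f keys by fastforce
  have met: "met hp' rep Act d = met hp rep Act d" for Act d
    using f by (auto simp: met_def split: prod.splits)
  show "machine_inv hp' fr w rk rep ys D S1 S2 Z g"
    using inv uf f wlist_cong[of ys hp' hp w]
    unfolding machine_inv_def graph_inv_def pred_inv_def nr met by (simp add: fk)
  show "pot hp' fr rk ys + 7 * \<Phi>1 hp fr rk = pot hp fr rk ys + 7 * \<Phi>1 hp' fr rk"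
    by (simp add: pot_def nr \<Phi>2_def)
qed

lemma inv_uf: "machine_inv hp fr w rk rep ys D S1 S2 Z g \<Longrightarrow> uf hp fr rk rep"
  by (simp add: machine_inv_def)

lemma graph_inv_g: "graph_inv hp fr rep D g \<Longrightarrow> a \<in> nodes fr \<Longrightarrow> g (rep a) = g a"
  by (simp add: graph_inv_def)

lemma demanded_keyE:
  assumes "graph_inv hp fr rep D g" "demanded rep D p k q" "p \<in> nodes fr" "q \<in> nodes fr"
  shows "k \<in> set ks" "keyE k (g p) (g q)"
proof -
  obtain p' q' where d: "(p', k, q') \<in> D" "rep p' = rep p" "rep q' = rep q"
    using assms(2) by (auto simp: demanded_def)
  then have *: "p' \<in> nodes fr" "q' \<in> nodes fr" "k \<in> set ks" "keyE k (g p') (g q')"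
    using assms(1) unfolding graph_inv_def by blast+
  moreover have "g p' = g p" "g q' = g q"
    using graph_inv_g[OF assms(1)] * d assms(3,4) by metis+
  ultimately show "k \<in> set ks" "keyE k (g p) (g q)" by auto
qed

lemma field_demanded:
  assumes "graph_inv hp fr rep D g" "a \<in> nodes fr" "k \<in> set ks" "hp a k = Ref r"
  shows "r \<in> nodes fr" "demanded rep D a k r"
  using assms unfolding graph_inv_def by force+

lemma inv_link:
  assumes inv: "machine_inv hp fr w rk rep ys D S1 S2 Z g"
    and x: "x \<in> nodes fr" "rep x = x" and y: "y \<in> nodes fr" "rep y = y"
    and neq: "x \<noteq> y" and le: "rk y \<le> rk x" and gxy: "g x = g y"
  defines "hp' \<equiv> link_mem hp rk x y w" and "rk' \<equiv> link_rk rk x y" and "rep' \<equiv> link_rep rep x y"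
  shows "machine_inv hp' fr (Ref y) rk' rep' (y # ys) D S1 S2 Z g"
    and "pot hp fr rk ys + 8 * Suc (rk y) \<le> pot hp' fr rk' (y # ys)"
    and "nonroots hp' fr = insert y (nonroots hp fr)"
    and "k < 2 * K \<Longrightarrow> hp' a k = hp a k" and "a < lo \<Longrightarrow> hp' a = hp a"
    and "rep a = rep b \<Longrightarrow> rep' a = rep' b" and "rep' x = rep' y"
proof -
  note uf = inv_uf[OF inv]
  note L = link_mem_simps[OF uf x y neq le, where w = w, folded hp'_def]
  note nrx = x_par[OF uf x y neq le] y_par[OF uf x y neq le]
  show nr: "nonroots hp' fr = insert y (nonroots hp fr)"
    unfolding hp'_def by (rule link_nonroots[OF uf x y neq le])
  show fld: "k < 2 * K \<Longrightarrow> hp' a k = hp a k" for a k using L(4) by simp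
  show "a < lo \<Longrightarrow> hp' a = hp a" for a using L(5)[of a] x y by auto
  show coarse: "rep a = rep b \<Longrightarrow> rep' a = rep' b" for a b by (simp add: rep'_def link_rep_def)
  show "rep' x = rep' y" using x y neq by (simp add: rep'_def link_rep_def)
  have i: "graph_inv hp fr rep D g" "pred_inv hp fr" "wlist hp w ys" "distinct ys"
      "set ys \<subseteq> nonroots hp fr" "Z \<subseteq> nonroots hp fr"
      "\<forall>d\<in>S1. met hp rep (roots hp fr \<union> set ys \<union> Z) d" "\<forall>d\<in>S2. met hp rep (roots hp fr \<union> set ys) d"
    using inv by (auto simp: machine_inv_def)
  have uf': "uf hp' fr rk' rep'"
    unfolding hp'_def rk'_def rep'_def by (rule link_uf[OF uf x y neq le])
  \<comment> \<open>\<open>y\<close> stops being a root and enters the stack, so the active records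
    remain the same and no demand is lost.\<close>
  have act: "roots hp' fr \<union> set (y # ys) = roots hp fr \<union> set ys"
    using nrx y by (auto simp: nr)
  have met: "met hp' rep' Act d" if "met hp rep Act d" for Act d
    by (rule met_mono[OF that subset_refl coarse]) (simp_all add: fld)
  have dem: "demanded rep D a k r \<Longrightarrow> demanded rep' D a k r" for a k r
    by (rule demanded_mono[OF _ coarse]) auto
  have fldk: "k \<in> set ks \<Longrightarrow> hp' a k = hp a k" for a k using keys fld by blast
  have "g (rep' a) = g a" if "a \<in> nodes fr" for a
    using graph_inv_g[OF i(1) that] gxy by (auto simp: rep'_def link_rep_def)
  moreover have "hp' a k = Null \<or> (\<exists>r\<in>nodes fr. hp' a k = Ref r \<and> demanded rep' D a k r)"
    if "a \<in> nodes fr" "k \<in> set ks" for a k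
    using i(1) that dem unfolding graph_inv_def fldk[OF that(2)] by blast
  ultimately have gi: "graph_inv hp' fr rep' D g"
    using i(1) unfolding graph_inv_def by blast
  have pi: "pred_inv hp' fr"
    using i(2) L(4)[of "2 * K + 3"] by (simp add: pred_inv_def)
  have "wlist hp' w ys = wlist hp w ys"
    using L(2) nrx i(5) by (intro wlist_cong) auto
  then have wl: "wlist hp' (Ref y) (y # ys)"
    using i(3) L(2)[of y] by simp
  show "machine_inv hp' fr (Ref y) rk' rep' (y # ys) D S1 S2 Z g"
    using uf' gi pi wl i(4-8) nrx met unfolding machine_inv_def act by (auto simp: nr)
  have "card (nonroots hp' fr) = Suc (card (nonroots hp fr))"
    using nrx by (simp add: nr)
  moreover have "\<Phi>1 hp fr rk \<le> \<Phi>1 hp' fr rk'" "\<Phi>2 hp' fr rk' = \<Phi>2 hp fr rk + Suc (rk y)"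
    unfolding hp'_def rk'_def using link_\<Phi>1[OF uf x y neq le] link_\<Phi>2[OF uf x y neq le] by auto
  ultimately show "pot hp fr rk ys + 8 * Suc (rk y) \<le> pot hp' fr rk' (y # ys)"
    by (simp add: pot_def)
qed

definition coarser :: "(nat \<Rightarrow> nat) \<Rightarrow> (nat \<Rightarrow> nat) \<Rightarrow> bool" where
  "coarser rep rep' \<longleftrightarrow> (\<forall>a b. rep a = rep b \<longrightarrow> rep' a = rep' b)"

definition union_post where
  "union_post s rk rep ys D S1 S2 Z g p q c t s' \<longleftrightarrow> (\<exists>rk' rep' ys'.
     machine_inv (heap s') (free s') (regs s' 3) rk' rep' ys' D S1 S2 Z g \<and> free s' = free s \<and>
     coarser rep rep' \<and> rep' p = rep' q \<and>
     (\<forall>a k. k < 2 * K \<longrightarrow> heap s' a k = heap s a k) \<and> (\<forall>a<lo. heap s' a = heap s a) \<and>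
     nonroots (heap s) (free s) \<subseteq> nonroots (heap s') (free s) \<and>
     roots (heap s) (free s) \<union> set ys \<subseteq> roots (heap s') (free s) \<union> set ys' \<and>
     (\<forall>r. r \<notin> {3, 10, 11, 12, 15, 16, 17, 18} \<longrightarrow> regs s' r = regs s r) \<and>
     t + pot (heap s) (free s) rk ys \<le> pot (heap s') (free s) rk' ys' + c)"

lemma union_post_weaken:
  assumes "union_post s rk rep ys D S1 S2 Z g p q c t s'" "heap s = heap s0" "free s = free s0"
    and "\<forall>r. r \<notin> {3, 10, 11, 12, 15, 16, 17, 18} \<longrightarrow> regs s r = regs s0 r" "t0 + c \<le> t + c0"
  shows "union_post s0 rk rep ys D S1 S2 Z g p q c0 t0 s'"
proof -
  obtain rk' rep' ys' where
    "machine_inv (heap s') (free s') (regs s' 3) rk' rep' ys' D S1 S2 Z g \<and> free s' = free s \<and>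
     coarser rep rep' \<and> rep' p = rep' q \<and>
     (\<forall>a k. k < 2 * K \<longrightarrow> heap s' a k = heap s a k) \<and> (\<forall>a<lo. heap s' a = heap s a) \<and>
     nonroots (heap s) (free s) \<subseteq> nonroots (heap s') (free s) \<and>
     roots (heap s) (free s) \<union> set ys \<subseteq> roots (heap s') (free s) \<union> set ys' \<and>
     (\<forall>r. r \<notin> {3, 10, 11, 12, 15, 16, 17, 18} \<longrightarrow> regs s' r = regs s r) \<and>
     t + pot (heap s) (free s) rk ys \<le> pot (heap s') (free s) rk' ys' + c"
    using assms(1) unfolding union_post_def by (elim exE) (rule that)
  then show ?thesis
    unfolding union_post_def using assms(2-)
    by (rule_tac exI[of _ rk'], rule_tac exI[of _ rep'], rule_tac exI[of _ ys']) simp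
qed

lemma run_link:
  assumes inv: "machine_inv (heap s) (free s) (regs s 3) rk rep ys D S1 S2 Z g"
    and x: "x \<in> nodes (free s)" "rep x = x" "regs s 15 = Ref x"
    and y: "y \<in> nodes (free s)" "rep y = y" "regs s 16 = Ref y" and neq: "x \<noteq> y" and gxy: "g x = g y"
    and r: "regs s 6 = Null" "regs s 17 = Null \<longleftrightarrow> rk x \<le> rk y" "regs s 18 = Null \<longleftrightarrow> rk y \<le> rk x"
  shows "runs B (link_prog K) s (\<lambda>t s'. union_post s rk rep ys D S1 S2 Z g x y 0
    (t + 6 * min (rk x) (rk y)) s')"
proof -
  have post: "union_post s rk rep ys D S1 S2 Z g x y 0 (t + 6 * min (rk x) (rk y)) s'"
    if ab: "a \<in> nodes (free s)" "rep a = a" "b \<in> nodes (free s)" "rep b = b" "a \<noteq> b" "rk b \<le> rk a"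
      "g a = g b" "{a, b} = {x, y}"
      and s': "heap s' = link_mem (heap s) rk a b (regs s 3)" "free s' = free s" "regs s' 3 = Ref b"
        "\<forall>r. r \<noteq> 3 \<longrightarrow> regs s' r = regs s r" and t: "t \<le> 7" for a b s' t
  proof -
    note L = inv_link[OF inv ab(1-7)]
    have act: "roots (heap s) (free s) \<union> set ys
        \<subseteq> roots (link_mem (heap s) rk a b (regs s 3)) (free s) \<union> set (b # ys)"
      using L(3) by auto
    have min: "min (rk x) (rk y) = rk b" using ab(6,8) by (auto simp: doubleton_eq_iff)
    have xy: "link_rep rep a b x = link_rep rep a b y"
      using L(7) ab(8) by (auto simp: doubleton_eq_iff)
    show ?thesis
      unfolding union_post_def s'
    proof (intro exI conjI)
      show "machine_inv (link_mem (heap s) rk a b (regs s 3)) (free s) (Ref b) (link_rk rk a b)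
          (link_rep rep a b) (b # ys) D S1 S2 Z g" by (rule L(1))
      show "nonroots (heap s) (free s) \<subseteq> nonroots (link_mem (heap s) rk a b (regs s 3)) (free s)"
        using L(3) by auto
      show "t + 6 * min (rk x) (rk y) + pot (heap s) (free s) rk ys \<le>
        pot (link_mem (heap s) rk a b (regs s 3)) (free s) (link_rk rk a b) (b # ys) + 0"
        using L(2) t unfolding min by simp
      show "coarser rep (link_rep rep a b)" using L(6) unfolding coarser_def by blast
    qed (use L(4,5) act xy s' in \<open>blast+\<close>)
  qed
  show ?thesis
  proof (cases "rk y \<le> rk x")
    case True
    have "runs B (link_prog K) s (\<lambda>t s'. t \<le> 7 \<and> heap s' = link_mem (heap s) rk x y (regs s 3) \<and>
        free s' = free s \<and> regs s' 3 = Ref y \<and> (\<forall>r. r \<noteq> 3 \<longrightarrow> regs s' r = regs s r))"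
      using x(3) y(3) r True neq
      by (cases "rk x = rk y")
        (simp_all add: link_prog_def attach_child_def runs_simps set_reg_def link_mem_def Let_def)
    then show ?thesis
      by (rule runs_mono) (rule post[OF x(1,2) y(1,2) neq True gxy]; blast)
  next
    case False
    then have le: "rk x \<le> rk y" "rk x \<noteq> rk y" by simp_all
    have "runs B (link_prog K) s (\<lambda>t s'. t \<le> 7 \<and> heap s' = link_mem (heap s) rk y x (regs s 3) \<and>
        free s' = free s \<and> regs s' 3 = Ref x \<and> (\<forall>r. r \<noteq> 3 \<longrightarrow> regs s' r = regs s r))"
      using x(3) y(3) r False neq le(2)
      by (simp add: link_prog_def attach_child_def runs_simps set_reg_def link_mem_def Let_def)
    then show ?thesis
      by (rule runs_mono) (rule post[OF y(1,2) x(1,2) neq[symmetric] le(1) gxy[symmetric]]; blast)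
  qed
qed

lemma find_frame_fields:
  assumes "find_frame fr hp hp'"
  shows "k < 2 * K \<Longrightarrow> hp' a k = hp a k" "a < lo \<Longrightarrow> hp' a = hp a"
  using assms by (auto simp: find_frame_def)

text \<open>The ghost state of the union-find structure survives a find unchanged, so that a union
  can be specified relative to the state before its two finds.\<close>

lemma run_find_inv:
  assumes inv: "machine_inv (heap s) (free s) (regs s 3) rk rep ys D S1 S2 Z g"
    and x: "x \<in> nodes (free s)" "regs s 10 = Ref x" and r7: "regs s 7 = Num 1"
  shows "runs B (find_prog K) s (\<lambda>t s'.
    machine_inv (heap s') (free s') (regs s' 3) rk rep ys D S1 S2 Z g \<and> free s' = free s \<and>
    find_frame (free s) (heap s) (heap s') \<and>
    regs s' 10 = Ref (rep x) \<and> (\<forall>r. r \<notin> {10, 11, 12} \<longrightarrow> regs s' r = regs s r) \<and>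
    t + pot (heap s) (free s) rk ys \<le> pot (heap s') (free s) rk ys + cF)"
proof (rule runs_mono[OF run_find[OF inv_uf[OF inv] x r7]], elim conjE, intro conjI)
  fix t s'
  assume *: "uf (heap s') (free s') rk rep" "free s' = free s" "find_frame (free s) (heap s) (heap s')"
    "\<forall>r. r \<notin> {10, 11, 12} \<longrightarrow> regs s' r = regs s r"
    "t + 7 * \<Phi>1 (heap s) (free s) rk \<le> 7 * \<Phi>1 (heap s') (free s) rk + cF"
  note i = inv_find[OF inv *(1)[unfolded *(2)] *(3)]
  show "machine_inv (heap s') (free s') (regs s' 3) rk rep ys D S1 S2 Z g"
    using i(1) * by simp
  show "t + pot (heap s) (free s) rk ys \<le> pot (heap s') (free s) rk ys + cF"
    using i(2) *(5) by simp
qed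

text \<open>\<open>g p = g q\<close> carries over to the representatives, so \<open>g\<close> stays
  constant on the united class. The time bound covers the two finds; walk and link are absorbed by
  the potential up to a constant.\<close>

lemma run_union:
  assumes inv: "machine_inv (heap s) (free s) (regs s 3) rk rep ys D S1 S2 Z g"
    and p: "p \<in> nodes (free s)" "regs s 15 = Ref p"
    and q: "q \<in> nodes (free s)" "regs s 16 = Ref q" and gpq: "g p = g q"
    and r: "regs s 6 = Null" "regs s 7 = Num 1"
  shows "runs B (union_prog K) s (union_post s rk rep ys D S1 S2 Z g p q (2 * cF + 30))"
proof -
  note uf = inv_uf[OF inv]
  have gi: "graph_inv (heap s) (free s) rep D g" using inv by (simp add: machine_inv_def)
  let ?R = "{3, 10, 11, 12, 15, 16, 17, 18}"
  define Q where "Q c x1 x2 = (\<lambda>t (s' :: mstate). machine_inv (heap s') (free s') (regs s' 3) rk rep ys D S1 S2 Z g \<and>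
    free s' = free s \<and> find_frame (free s) (heap s) (heap s') \<and> regs s' 15 = Ref x1 \<and> regs s' 16 = Ref x2 \<and>
    (\<forall>r. r \<notin> {10, 11, 12, 15, 16, 17, 18} \<longrightarrow> regs s' r = regs s r) \<and>
    t + pot (heap s) (free s) rk ys \<le> pot (heap s') (free s) rk ys + c)" for c x1 x2
  have 1: "runs B (Seq (Copy 10 15) (Seq (find_prog K) (Copy 15 10))) s (Q (cF + 2) (rep p) q)"
  proof -
    let ?s = "set_reg s 10 (Ref p)"
    have "runs B (find_prog K) ?s (\<lambda>t s'.
      machine_inv (heap s') (free s') (regs s' 3) rk rep ys D S1 S2 Z g \<and> free s' = free ?s \<and>
      find_frame (free ?s) (heap ?s) (heap s') \<and>
      regs s' 10 = Ref (rep p) \<and> (\<forall>r. r \<notin> {10, 11, 12} \<longrightarrow> regs s' r = regs ?s r) \<and>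
      t + pot (heap ?s) (free ?s) rk ys \<le> pot (heap s') (free ?s) rk ys + cF)"
      by (rule run_find_inv) (use inv p r in \<open>auto simp: set_reg_def\<close>)
    then show ?thesis
      using p q by (auto simp: runs_simps set_reg_def Q_def elim!: runs_mono)
  qed
  have 2: "runs B (Seq (Copy 10 16) (Seq (find_prog K) (Copy 16 10))) s1 (\<lambda>t' s'. Q (2 * cF + 4) (rep p) (rep q) (t + t') s')"
    if s1: "Q (cF + 2) (rep p) q t s1" for t s1
  proof -
    let ?s = "set_reg s1 10 (Ref q)"
    have "runs B (find_prog K) ?s (\<lambda>t s'.
      machine_inv (heap s') (free s') (regs s' 3) rk rep ys D S1 S2 Z g \<and> free s' = free ?s \<and>
      find_frame (free ?s) (heap ?s) (heap s') \<and>
      regs s' 10 = Ref (rep q) \<and> (\<forall>r. r \<notin> {10, 11, 12} \<longrightarrow> regs s' r = regs ?s r) \<and>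
      t + pot (heap ?s) (free ?s) rk ys \<le> pot (heap s') (free ?s) rk ys + cF)"
      by (rule run_find_inv) (use s1 q r in \<open>auto simp: set_reg_def Q_def\<close>)
    then show ?thesis
      using s1 by (auto simp: runs_simps set_reg_def Q_def elim!: runs_mono intro: find_frame_trans)
  qed
  have pre: "union_post s rk rep ys D S1 S2 Z g p q c (t + t') s''"
    if s1: "Q d (rep p) (rep q) t s1" and u: "union_post s1 rk rep ys D S1 S2 Z g (rep p) (rep q) e t' s''"
      and c: "d + e \<le> c" for d e t t' c s1 s''
  proof -
    obtain rk' rep' ys' where
      u: "machine_inv (heap s'') (free s'') (regs s'' 3) rk' rep' ys' D S1 S2 Z g" "free s'' = free s1"
        "coarser rep rep'" "rep' (rep p) = rep' (rep q)"
        "\<forall>a k. k < 2 * K \<longrightarrow> heap s'' a k = heap s1 a k" "\<forall>a<lo. heap s'' a = heap s1 a"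
        "nonroots (heap s1) (free s1) \<subseteq> nonroots (heap s'') (free s1)"
        "roots (heap s1) (free s1) \<union> set ys \<subseteq> roots (heap s'') (free s1) \<union> set ys'"
        "\<forall>r. r \<notin> {3, 10, 11, 12, 15, 16, 17, 18} \<longrightarrow> regs s'' r = regs s1 r"
        "t' + pot (heap s1) (free s1) rk ys \<le> pot (heap s'') (free s1) rk' ys' + e"
      using u unfolding union_post_def by blast
    have f: "free s1 = free s" "find_frame (free s) (heap s) (heap s1)"
      "\<forall>r. r \<notin> {10, 11, 12, 15, 16, 17, 18} \<longrightarrow> regs s1 r = regs s r"
      "t + pot (heap s) (free s) rk ys \<le> pot (heap s1) (free s) rk ys + d"
      using s1 by (auto simp: Q_def)
    have nr: "nonroots (heap s1) (free s) = nonroots (heap s) (free s)"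
      using f(2) by (simp add: find_frame_def)
    have rp: "rep' (rep p) = rep' p" "rep' (rep q) = rep' q"
      using u(3) uf_rep_idem[OF uf p(1)] uf_rep_idem[OF uf q(1)] unfolding coarser_def by blast+
    show ?thesis
      unfolding union_post_def
    proof (intro exI conjI)
      show "machine_inv (heap s'') (free s'') (regs s'' 3) rk' rep' ys' D S1 S2 Z g" by (rule u(1))
      show "\<forall>a k. k < 2 * K \<longrightarrow> heap s'' a k = heap s a k" "\<forall>a<lo. heap s'' a = heap s a"
        using u(5,6) find_frame_fields[OF f(2)] by simp_all
      show "nonroots (heap s) (free s) \<subseteq> nonroots (heap s'') (free s)"
        "roots (heap s) (free s) \<union> set ys \<subseteq> roots (heap s'') (free s) \<union> set ys'"
        using u(7,8) f(1) nr by simp_all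
      show "t + t' + pot (heap s) (free s) rk ys \<le> pot (heap s'') (free s) rk' ys' + c"
        using u(10) f(1,4) c by simp
      show "free s'' = free s" using u(2) f(1) by simp
      show "coarser rep rep'" by (rule u(3))
      show "rep' p = rep' q" using u(4) rp by simp
      show "\<forall>r. r \<notin> {3, 10, 11, 12, 15, 16, 17, 18} \<longrightarrow> regs s'' r = regs s r"
        using u(9) f(3) by simp
    qed
  qed
  have 3: "runs B (Cond (Equal 15 16) (SetNull 6)
       (Seq (Load 17 15 (2 * K + 1)) (Seq (Load 18 16 (2 * K + 1)) (Seq (walk_prog K) (link_prog K)))))
      s1 (\<lambda>t' s'. union_post s rk rep ys D S1 S2 Z g p q (2 * cF + 30) (t + t') s')"
    if s1: "Q (2 * cF + 4) (rep p) (rep q) t s1" for t s1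
  proof -
    have i: "machine_inv (heap s1) (free s1) (regs s1 3) rk rep ys D S1 S2 Z g" "free s1 = free s"
      "regs s1 15 = Ref (rep p)" "regs s1 16 = Ref (rep q)" "regs s1 6 = Null" "regs s1 7 = Num 1"
      using s1 r by (auto simp: Q_def)
    note uf1 = inv_uf[OF i(1)]
    have n: "rep p \<in> nodes (free s1)" "rep q \<in> nodes (free s1)" "rep (rep p) = rep p" "rep (rep q) = rep q"
      using uf_rep_node[OF uf] uf_rep_idem[OF uf] p q i(2) by simp_all
    have g: "g (rep p) = g (rep q)"
      using graph_inv_g[OF gi] p q gpq by simp
    show ?thesis
    proof (cases "rep p = rep q")
      case True
      let ?s = "set_reg s1 6 Null"
      have "coarser rep rep" by (simp add: coarser_def)
      then have "union_post s1 rk rep ys D S1 S2 Z g (rep p) (rep q) 2 2 ?s"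
        unfolding union_post_def
        by (intro exI[of _ rk] exI[of _ rep] exI[of _ ys]) (use i True in \<open>auto simp: set_reg_def\<close>)
      from pre[OF s1 this, of "2 * cF + 30"] show ?thesis
        using i True by (simp add: runs_simps)
    next
      case False
      let ?x = "rep p" and ?y = "rep q"
      let ?s = "s1\<lparr>regs := (regs s1)(17 := heap s1 ?x (2 * K + 1), 18 := heap s1 ?y (2 * K + 1))\<rparr>"
      have loads: "runs B (Seq (Load 17 15 (2 * K + 1)) (Load 18 16 (2 * K + 1))) s1 (\<lambda>t s'. t = 2 \<and> s' = ?s)"
        using i by (simp add: runs_simps set_reg_def)
      have walk: "runs B (walk_prog K) ?s
        (\<lambda>t s'. heap s' = heap ?s \<and> free s' = free ?s \<and> (\<forall>r. r \<notin> {12, 17, 18} \<longrightarrow> regs s' r = regs ?s r) \<and>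
          (regs s' 17 = Null \<longleftrightarrow> rk ?x \<le> rk ?y) \<and> (regs s' 18 = Null \<longleftrightarrow> rk ?y \<le> rk ?x) \<and>
          t \<le> 6 * min (rk ?x) (rk ?y) + 4)"
        by (rule run_walk) (use uf1 n i in auto)
      have link: "runs B (link_prog K) s2 (\<lambda>t' s'. union_post s1 rk rep ys D S1 S2 Z g ?x ?y 7 (3 + t + t') s')"
        if s2: "heap s2 = heap s1" "free s2 = free s1" "\<forall>r. r \<notin> {12, 17, 18} \<longrightarrow> regs s2 r = regs s1 r"
          "regs s2 17 = Null \<longleftrightarrow> rk ?x \<le> rk ?y" "regs s2 18 = Null \<longleftrightarrow> rk ?y \<le> rk ?x"
          "t \<le> 6 * min (rk ?x) (rk ?y) + 4" for t s2
      proof -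
        have "runs B (link_prog K) s2 (\<lambda>t' s'. union_post s2 rk rep ys D S1 S2 Z g ?x ?y 0
            (t' + 6 * min (rk ?x) (rk ?y)) s')"
          by (rule run_link) (use i n s2 False g in auto)
        then show ?thesis
        proof (rule runs_mono)
          fix t' s' assume "union_post s2 rk rep ys D S1 S2 Z g ?x ?y 0 (t' + 6 * min (rk ?x) (rk ?y)) s'"
          then show "union_post s1 rk rep ys D S1 S2 Z g ?x ?y 7 (3 + t + t') s'"
            by (rule union_post_weaken) (use s2 in auto)
        qed
      qed
      have "runs B (Seq (Seq (Load 17 15 (2 * K + 1)) (Load 18 16 (2 * K + 1))) (Seq (walk_prog K) (link_prog K))) s1
          (\<lambda>t'. union_post s1 rk rep ys D S1 S2 Z g ?x ?y 7 (Suc t'))"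
        apply (rule runs_SeqI[OF loads], elim conjE, hypsubst)
        apply (rule runs_SeqI[OF walk])
        apply (rule runs_mono[OF link])
        apply (auto simp: add.assoc numeral_3_eq_3)
        done
      then have "runs B (Seq (Load 17 15 (2 * K + 1)) (Seq (Load 18 16 (2 * K + 1)) (Seq (walk_prog K) (link_prog K)))) s1
          (\<lambda>t'. union_post s1 rk rep ys D S1 S2 Z g ?x ?y 7 (Suc t'))"
        by (simp add: runs_Seq add.assoc)
      moreover have pre': "union_post s rk rep ys D S1 S2 Z g p q (2 * cF + 30) (t + t') s''"
        if "union_post s1 rk rep ys D S1 S2 Z g ?x ?y 7 t' s''" for t' s''
        using pre[OF s1 that, of "2 * cF + 30"] by simp
      moreover have "\<not> test_holds (Equal 15 16) s1" using i False by simp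
      ultimately show ?thesis
        unfolding runs_Cond
        by (auto elim!: runs_mono dest!: pre')
    qed
  qed
  have "runs B (Seq (Seq (Copy 10 15) (Seq (find_prog K) (Copy 15 10))) (Seq (Seq (Copy 10 16) (Seq (find_prog K) (Copy 16 10)))
      (Cond (Equal 15 16) (SetNull 6)
       (Seq (Load 17 15 (2 * K + 1)) (Seq (Load 18 16 (2 * K + 1)) (Seq (walk_prog K) (link_prog K))))))) s
     (union_post s rk rep ys D S1 S2 Z g p q (2 * cF + 30))"
    by (rule runs_SeqI[OF 1], rule runs_SeqI[OF 2], assumption, drule 3, simp add: add.assoc)
  then show ?thesis by (simp add: union_prog_def runs_Seq add.assoc)
qed

end

definition pop_keys :: "nat \<Rightarrow> nat list \<Rightarrow> com" where
  "pop_keys K ks = foldr (\<lambda>k c. Seq (Seq (Load 21 29 k) (Cond (Equal 21 6) (SetNull 6)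
     (Seq (Copy 20 29) (put_prog K k)))) c) ks (SetNull 6)"

definition drain_prog :: "nat \<Rightarrow> nat list \<Rightarrow> com" where
  "drain_prog K ks = Seq (neq_flag 13 3 6) (While (Equal 13 7)
     (Seq (Copy 29 3) (Seq (Load 3 29 (2 * K + 2)) (Seq (pop_keys K ks) (neq_flag 13 3 6)))))"

text \<open>Each new record points to the one created before it, held in register 2. In the absence
  of pointer arithmetic, this chain lets the final pass visit all records.\<close>

definition new_prog :: "nat \<Rightarrow> nat \<Rightarrow> com" where
  "new_prog K x = Seq (New x) (Seq (Store x (2 * K) x) (Seq (Store x (2 * K + 3) 2) (Copy 2 x)))"

section \<open>Insertion of edges and draining of the stack\<close>

context folding_machine
begin

lemma machine_inv_met:
  assumes "machine_inv hp fr w rk rep ys D S1 S2 Z g" "met hp rep (roots hp fr \<union> set ys) d"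
  shows "machine_inv hp fr w rk rep ys D (insert d S1) (insert d S2) Z g"
proof -
  have "met hp rep (roots hp fr \<union> set ys \<union> Z) d"
    by (rule met_mono[OF assms(2)]) auto
  then show ?thesis using assms by (simp add: machine_inv_def)
qed

lemma machine_inv_set_field:
  assumes inv: "machine_inv hp fr w rk rep ys D S1 S2 Z g"
    and x: "x \<in> nodes fr" "rep x = x" "hp x k = Null" and k: "k \<in> set ks" and q: "q \<in> nodes fr"
    and dem: "demanded rep D x k q" and p: "rep p = x"
  defines "hp' \<equiv> set_field hp x k (Ref q)"
  shows "machine_inv hp' fr w rk rep ys D (insert (p, k, q) S1) (insert (p, k, q) S2) Z g"
    and "pot hp' fr rk ys = pot hp fr rk ys" and "nonroots hp' fr = nonroots hp fr" and "x \<notin> nonroots hp fr"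
proof -
  have i: "uf hp fr rk rep" "graph_inv hp fr rep D g" "pred_inv hp fr" "wlist hp w ys" "distinct ys"
      "set ys \<subseteq> nonroots hp fr" "Z \<subseteq> nonroots hp fr"
      "\<forall>d\<in>S1. met hp rep (roots hp fr \<union> set ys \<union> Z) d" "\<forall>d\<in>S2. met hp rep (roots hp fr \<union> set ys) d"
    using inv by (auto simp: machine_inv_def)
  have k2: "k < 2 * K" using keys k by blast
  then have f: "hp' a j = hp a j" if "j \<ge> 2 * K" for a j
    using that by (auto simp: hp'_def)
  show nr: "nonroots hp' fr = nonroots hp fr" by (simp add: nonroots_def f)
  have par: "par hp' = par hp" by (intro ext) (simp add: par_def f)
  show "pot hp' fr rk ys = pot hp fr rk ys" by (simp add: pot_def \<Phi>1_def \<Phi>2_def nr par)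
  show xr: "x \<notin> nonroots hp fr" using nonroots_iff(1)[OF i(1) x(1)] x(2) by simp
  have f01: "hp' a (2 * K) = hp a (2 * K)" "hp' a (2 * K + 1) = hp a (2 * K + 1)" for a
    by (rule f, simp)+
  have uf': "uf hp' fr rk rep" using i(1) unfolding uf_def par nr f01 .
  have met: "met hp' rep Act d" if "met hp rep Act d" for Act d
    by (rule met_mono[OF that]) (use x(3) in \<open>auto simp: hp'_def\<close>)
  have gi: "graph_inv hp' fr rep D g"
    unfolding graph_inv_def
  proof (intro conjI)
    show "\<forall>a\<in>nodes fr. \<forall>k\<in>set ks. hp' a k = Null \<or> (\<exists>r\<in>nodes fr. hp' a k = Ref r \<and> demanded rep D a k r)"
      using i(2) q dem unfolding graph_inv_def hp'_def by auto
    show "\<forall>p k q. (p, k, q) \<in> D \<longrightarrow> p \<in> nodes fr \<and> q \<in> nodes fr \<and> k \<in> set ks \<and> keyE k (g p) (g q)"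
      "\<forall>a\<in>nodes fr. g (rep a) = g a"
      using i(2) unfolding graph_inv_def by blast+
  qed
  have pi: "pred_inv hp' fr" using i(3) by (simp add: pred_inv_def f)
  have wl: "wlist hp' w ys" using i(4) wlist_cong[of ys hp' hp w] f by simp
  have "machine_inv hp' fr w rk rep ys D S1 S2 Z g"
    using uf' gi pi wl i(5-9) met by (auto simp: machine_inv_def nr)
  moreover have "met hp' rep (roots hp' fr \<union> set ys) (p, k, q)"
    using xr x(1,2) p k2 unfolding met_def prod.case nr
    by (intro conjI bexI[of _ x] exI[of _ q]) (auto simp: hp'_def)
  ultimately show "machine_inv hp' fr w rk rep ys D (insert (p, k, q) S1) (insert (p, k, q) S2) Z g"
    by (rule machine_inv_met)
qed

text \<open>Hides ranks, representatives and stack, and exposes only the potential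
  \<open>\<phi>\<close>, in terms of which the costs of consecutive programs add up.\<close>

definition state_inv where
  "state_inv (s :: mstate) D S1 S2 Z g \<phi> \<longleftrightarrow>
     (\<exists>rk rep ys. machine_inv (heap s) (free s) (regs s 3) rk rep ys D S1 S2 Z g \<and>
        \<phi> = pot (heap s) (free s) rk ys) \<and>
     regs s 6 = Null \<and> regs s 7 = Num 1 \<and> lo \<le> free s \<and>
     regs s 2 = (if free s = lo then Null else Ref (free s - 1))"

lemma state_invI:
  assumes "machine_inv (heap s) (free s) (regs s 3) rk rep ys D S1 S2 Z g"
    "regs s 6 = Null" "regs s 7 = Num 1" "lo \<le> free s"
    "regs s 2 = (if free s = lo then Null else Ref (free s - 1))"
  shows "state_inv s D S1 S2 Z g (pot (heap s) (free s) rk ys)"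
  unfolding state_inv_def using assms by blast

text \<open>The edge fields of former roots never change. A record taken off the stack can therefore
  be read field by field while its edges are inserted elsewhere.\<close>

definition frame :: "mstate \<Rightarrow> mstate \<Rightarrow> bool" where
  "frame s s' \<longleftrightarrow> free s' = free s \<and> (\<forall>a<lo. heap s' a = heap s a) \<and>
     (\<forall>a\<in>nonroots (heap s) (free s). a \<in> nonroots (heap s') (free s) \<and>
        (\<forall>k<2 * K. heap s' a k = heap s a k))"

lemma frame_trans: "frame s s' \<Longrightarrow> frame s' s'' \<Longrightarrow> frame s s''"
  by (simp add: frame_def)

lemma frame_refl: "heap s' = heap s \<Longrightarrow> free s' = free s \<Longrightarrow> frame s s'"
  by (simp add: frame_def)

lemma find_frame_frame:
  assumes "find_frame (free s) (heap s) (heap s')" "free s' = free s"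
  shows "frame s s'"
proof -
  have "nonroots (heap s') (free s) = nonroots (heap s) (free s)"
    using assms(1) by (simp add: find_frame_def)
  then show ?thesis
    unfolding frame_def by (intro conjI ballI allI impI)
      (simp_all add: assms(2) find_frame_fields[OF assms(1)])
qed

abbreviation scratch_regs :: "nat set" where
  "scratch_regs \<equiv> {3, 10, 11, 12, 15, 16, 17, 18}"

text \<open>The inserted edge is a recorded demand or stands in the record itself; in the latter
  case it is equivalent to a demand, so passing on edges creates nothing new.\<close>

lemma run_put:
  assumes J: "state_inv s D S1 S2 Z g \<phi>"
    and p: "p \<in> nodes (free s)" "regs s 20 = Ref p" and q: "q \<in> nodes (free s)" "regs s 21 = Ref q"
    and k: "k \<in> set ks" and d: "(p, k, q) \<in> D \<or> heap s p k = Ref q"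
  shows "runs B (put_prog K k) s (\<lambda>t s'. \<exists>\<phi>'.
    state_inv s' D (insert (p, k, q) S1) (insert (p, k, q) S2) Z g \<phi>' \<and> frame s s' \<and>
    (\<forall>r. r \<notin> scratch_regs \<longrightarrow> regs s' r = regs s r) \<and> t + \<phi> \<le> \<phi>' + cP)"
proof -
  obtain rk rep ys where inv: "machine_inv (heap s) (free s) (regs s 3) rk rep ys D S1 S2 Z g"
    and \<phi>: "\<phi> = pot (heap s) (free s) rk ys"
    and r: "regs s 6 = Null" "regs s 7 = Num 1" "lo \<le> free s"
      "regs s 2 = (if free s = lo then Null else Ref (free s - 1))"
    using J unfolding state_inv_def by blast
  note uf = inv_uf[OF inv]
  have gi: "graph_inv (heap s) (free s) rep D g" using inv by (simp add: machine_inv_def)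
  have k2: "k < 2 * K" using keys k by blast
  have dem: "demanded rep D p k q"
    using d field_demanded(2)[OF gi p(1) k] unfolding demanded_def by blast
  let ?x = "rep p"
  have x: "?x \<in> nodes (free s)" "rep ?x = ?x" "demanded rep D ?x k q"
    using uf_rep_node[OF uf p(1)] uf_rep_idem[OF uf p(1)] dem by (auto simp: demanded_def)
  define Q where "Q t (s' :: mstate) \<longleftrightarrow>
    machine_inv (heap s') (free s') (regs s' 3) rk rep ys D S1 S2 Z g \<and> free s' = free s \<and>
    find_frame (free s) (heap s) (heap s') \<and>
    regs s' 10 = Ref ?x \<and> (\<forall>r. r \<notin> {10, 11, 12} \<longrightarrow> regs s' r = regs s r) \<and>
    t + \<phi> \<le> pot (heap s') (free s) rk ys + cF + 1" for t s'
  have 1: "runs B (Seq (Copy 10 20) (find_prog K)) s Q"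
  proof -
    let ?s = "set_reg s 10 (Ref p)"
    have "runs B (find_prog K) ?s (\<lambda>t s'.
      machine_inv (heap s') (free s') (regs s' 3) rk rep ys D S1 S2 Z g \<and> free s' = free ?s \<and>
      find_frame (free ?s) (heap ?s) (heap s') \<and>
      regs s' 10 = Ref (rep p) \<and> (\<forall>r. r \<notin> {10, 11, 12} \<longrightarrow> regs s' r = regs ?s r) \<and>
      t + pot (heap ?s) (free ?s) rk ys \<le> pot (heap s') (free ?s) rk ys + cF)"
      by (rule run_find_inv) (use inv p r in \<open>auto simp: set_reg_def\<close>)
    then show ?thesis
      using p \<phi> by (auto simp: runs_simps set_reg_def Q_def elim!: runs_mono)
  qed
  let ?rest = "Seq (Load 15 10 k) (Cond (Equal 15 6) (Store 10 k 21) (Seq (Copy 16 21) (union_prog K)))"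
  let ?P = "\<lambda>t s'. \<exists>\<phi>'. state_inv s' D (insert (p, k, q) S1) (insert (p, k, q) S2) Z g \<phi>' \<and> frame s s' \<and>
      (\<forall>r. r \<notin> scratch_regs \<longrightarrow> regs s' r = regs s r) \<and> t + \<phi> \<le> \<phi>' + cP"
  have 2: "runs B ?rest s1 (\<lambda>t'. ?P (t + t'))" if s1: "Q t s1" for t s1
  proof -
    have i: "machine_inv (heap s1) (free s1) (regs s1 3) rk rep ys D S1 S2 Z g" "free s1 = free s"
      "find_frame (free s) (heap s) (heap s1)" "regs s1 10 = Ref ?x"
      "\<forall>r. r \<notin> {10, 11, 12} \<longrightarrow> regs s1 r = regs s r"
      "t + \<phi> \<le> pot (heap s1) (free s) rk ys + cF + 1"
      using s1 by (auto simp: Q_def)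
    note fr1 = find_frame_frame[OF i(3,2)]
    have gi1: "graph_inv (heap s1) (free s1) rep D g" using i(1) by (simp add: machine_inv_def)
    have x1: "?x \<in> nodes (free s1)" using x i(2) by simp
    show ?thesis
    proof (cases "heap s1 ?x k = Null")
      case True
      let ?hp = "set_field (heap s1) ?x k (Ref q)"
      let ?s = "s1\<lparr>regs := (regs s1)(15 := Null), heap := ?hp\<rparr>"
      have q1: "q \<in> nodes (free s1)" using q i(2) by simp
      note F = machine_inv_set_field[OF i(1) x1 x(2) True k q1 x(3) HOL.refl]
      have J': "state_inv ?s D (insert (p, k, q) S1) (insert (p, k, q) S2) Z g (pot (heap s1) (free s) rk ys)"
        using state_invI[of ?s rk rep ys] F(1,2) i r by simp
      have "frame s1 ?s"
        unfolding frame_def using F(3,4) x1 by auto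
      then have "frame s ?s" using fr1 frame_trans by blast
      then have "?P (t + 3) ?s"
        using J' i by (intro exI[of _ "pot (heap s1) (free s) rk ys"]) (auto simp: cP_def)
      then show ?thesis
        using True i q r by (auto simp: runs_simps set_reg_def)
    next
      case False
      then obtain r0 where r0: "r0 \<in> nodes (free s1)" "heap s1 ?x k = Ref r0" "demanded rep D ?x k r0"
        using gi1 x1 k unfolding graph_inv_def by blast
      let ?s = "s1\<lparr>regs := (regs s1)(15 := Ref r0, 16 := Ref q)\<rparr>"
      have "keyE k (g ?x) (g r0)" "keyE k (g ?x) (g q)"
        using demanded_keyE(2)[OF gi1 r0(3) x1 r0(1)] demanded_keyE(2)[OF gi x(3,1) q(1)] by auto
      \<comment> \<open>Both targets are reached from the same image by the same key, hence have the
        same image, and the union respects \<open>g\<close>.\<close>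
      then have gq: "g r0 = g q" by (rule keyE_det)
      have "runs B (union_prog K) ?s (union_post ?s rk rep ys D S1 S2 Z g r0 q (2 * cF + 30))"
        by (rule run_union) (use i r0 q gq r in auto)
      moreover have "?P (t + (3 + t')) s'" if u: "union_post ?s rk rep ys D S1 S2 Z g r0 q (2 * cF + 30) t' s'" for t' s'
      proof -
        obtain rk' rep' ys' where
          u: "machine_inv (heap s') (free s') (regs s' 3) rk' rep' ys' D S1 S2 Z g" "free s' = free ?s"
            "coarser rep rep'" "rep' r0 = rep' q"
            "\<forall>a k. k < 2 * K \<longrightarrow> heap s' a k = heap ?s a k" "\<forall>a<lo. heap s' a = heap ?s a"
            "nonroots (heap ?s) (free ?s) \<subseteq> nonroots (heap s') (free ?s)"
            "roots (heap ?s) (free ?s) \<union> set ys \<subseteq> roots (heap s') (free ?s) \<union> set ys'"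
            "\<forall>r. r \<notin> {3, 10, 11, 12, 15, 16, 17, 18} \<longrightarrow> regs s' r = regs ?s r"
            "t' + pot (heap ?s) (free ?s) rk ys \<le> pot (heap s') (free ?s) rk' ys' + (2 * cF + 30)"
          using u unfolding union_post_def by blast
        have "?x \<in> roots (heap s1) (free s1)"
          using nonroots_iff(1)[OF inv_uf[OF i(1)] x1] x(2) x1 by blast
        then have "?x \<in> roots (heap s') (free s') \<union> set ys'" using u(2,8) by auto
        moreover have "rep' ?x = rep' p" using u(3) x(2) unfolding coarser_def by blast
        ultimately have "met (heap s') rep' (roots (heap s') (free s') \<union> set ys') (p, k, q)"
          unfolding met_def prod.case using k2 u(4,5) r0(2)
          by (intro conjI bexI[of _ ?x] exI[of _ r0]) auto
        from machine_inv_met[OF u(1) this]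
        have J': "state_inv s' D (insert (p, k, q) S1) (insert (p, k, q) S2) Z g (pot (heap s') (free s) rk' ys')"
          using state_invI[of s' rk' rep' ys'] u(2,9) i r by simp
        have "frame s1 s'"
          unfolding frame_def using u(2,5-7) by auto
        then have "frame s s'" using fr1 frame_trans by blast
        then show ?thesis
          using J' i u(9,10) by (intro exI[of _ "pot (heap s') (free s) rk' ys'"]) (auto simp: cP_def)
      qed
      ultimately show ?thesis
        using False r0 i q r by (auto simp: runs_simps set_reg_def elim!: runs_mono simp: numeral_3_eq_3)
    qed
  qed
  have "runs B (Seq (Seq (Copy 10 20) (find_prog K)) ?rest) s ?P"
    by (rule runs_SeqI[OF 1]) (rule 2)
  then show ?thesis by (simp add: put_prog_def runs_Seq add.assoc)
qed

lemma state_inv_weaken: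
  assumes "state_inv s D S1 S2 Z g \<phi>" "S1' \<subseteq> S1" "S2' \<subseteq> S2"
  shows "state_inv s D S1' S2' Z g \<phi>"
proof -
  obtain rk rep ys where "machine_inv (heap s) (free s) (regs s 3) rk rep ys D S1 S2 Z g"
      "\<phi> = pot (heap s) (free s) rk ys"
    using assms(1) unfolding state_inv_def by blast
  moreover from this(1) have "machine_inv (heap s) (free s) (regs s 3) rk rep ys D S1' S2' Z g"
    using assms(2,3) unfolding machine_inv_def by blast
  ultimately show ?thesis
    using assms(1) state_invI unfolding state_inv_def by blast
qed

definition pot_max :: nat where
  "pot_max = 7 * (nmax * (G + 2)) + 16 * nmax + cD * nmax"

lemma pot_bound:
  assumes uf: "uf hp fr rk rep"
  shows "pot hp fr rk ys \<le> pot_max"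
proof -
  have "card (nonroots hp fr) \<le> card (nodes fr)"
    by (intro card_mono) (auto simp: nonroots_def)
  then have "card (nonroots hp fr) - length ys \<le> nmax"
    using uf_size[OF uf] by simp
  then have "cD * (card (nonroots hp fr) - length ys) \<le> cD * nmax" by (rule mult_le_mono2)
  then show ?thesis
    using \<Phi>1_bound[OF uf] \<Phi>2_bound[OF uf] unfolding pot_def pot_max_def by linarith
qed

lemma state_inv_pot: "state_inv s D S1 S2 Z g \<phi> \<Longrightarrow> \<phi> \<le> pot_max"
  unfolding state_inv_def using pot_bound inv_uf by blast

lemma state_inv_field:
  assumes "state_inv s D S1 S2 Z g \<phi>" "a \<in> nodes (free s)" "k \<in> set ks"
  shows "heap s a k = Null \<or> (\<exists>r\<in>nodes (free s). heap s a k = Ref r)"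
proof -
  obtain rk rep ys where "machine_inv (heap s) (free s) (regs s 3) rk rep ys D S1 S2 Z g"
    using assms(1) unfolding state_inv_def by blast
  then have "graph_inv (heap s) (free s) rep D g" by (simp add: machine_inv_def)
  then show ?thesis using assms(2,3) unfolding graph_inv_def by blast
qed

subsection \<open>Passing on the edges of former roots\<close>

lemma state_inv_pop:
  assumes J: "state_inv s D D {} {} g \<phi>" and ne: "regs s 3 \<noteq> Null"
  obtains y where "regs s 3 = Ref y" "y \<in> nonroots (heap s) (free s)"
    "state_inv (s\<lparr>regs := (regs s)(29 := Ref y, 3 := heap s y (2 * K + 2))\<rparr>) D D {} {y} g (\<phi> + cD)"
proof -
  obtain rk rep ys where inv: "machine_inv (heap s) (free s) (regs s 3) rk rep ys D D {} {} g"
    and \<phi>: "\<phi> = pot (heap s) (free s) rk ys"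
    and r: "regs s 6 = Null" "regs s 7 = Num 1" "lo \<le> free s"
      "regs s 2 = (if free s = lo then Null else Ref (free s - 1))"
    using J unfolding state_inv_def by blast
  obtain y zs where ys: "ys = y # zs" "regs s 3 = Ref y"
    using inv ne by (cases ys) (auto simp: machine_inv_def)
  have y: "y \<in> nonroots (heap s) (free s)" using inv ys by (auto simp: machine_inv_def)
  have eq: "roots (heap s) (free s) \<union> set ys \<union> {} = roots (heap s) (free s) \<union> set zs \<union> {y}"
    using ys by auto
  let ?s = "s\<lparr>regs := (regs s)(29 := Ref y, 3 := heap s y (2 * K + 2))\<rparr>"
  have "machine_inv (heap s) (free s) (heap s y (2 * K + 2)) rk rep zs D D {} {y} g"
    using inv y unfolding machine_inv_def eq by (auto simp: ys)
  then have J': "state_inv ?s D D {} {y} g (pot (heap s) (free s) rk zs)"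
    using state_invI[of ?s rk rep zs] r by simp
  have "length ys = card (set ys)" using inv by (simp add: machine_inv_def distinct_card)
  also have "\<dots> \<le> card (nonroots (heap s) (free s))"
    using inv by (intro card_mono) (auto simp: machine_inv_def)
  finally have "card (nonroots (heap s) (free s)) - length zs
      = Suc (card (nonroots (heap s) (free s)) - length ys)"
    using ys by simp
  then have "pot (heap s) (free s) rk zs = \<phi> + cD" by (simp add: pot_def \<phi>)
  then show ?thesis using that ys y J' by simp
qed

text \<open>A demand met by a field of \<open>y\<close> with target \<open>r\<close> is met
  elsewhere as soon as the edge from \<open>y\<close> to \<open>r\<close> is, because
  \<open>met\<close> speaks of classes only. Once all fields are passed on, \<open>y\<close> can be
  given up.\<close>

lemma state_inv_absorb:
  assumes J: "state_inv s D D S2 {y} g \<phi>"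
    and all: "\<And>k r. k \<in> set ks \<Longrightarrow> heap s y k = Ref r \<Longrightarrow> (y, k, r) \<in> S2"
  shows "state_inv s D D {} {} g \<phi>"
proof -
  obtain rk rep ys where inv: "machine_inv (heap s) (free s) (regs s 3) rk rep ys D D S2 {y} g"
    and \<phi>: "\<phi> = pot (heap s) (free s) rk ys"
    and r: "regs s 6 = Null" "regs s 7 = Num 1" "lo \<le> free s"
      "regs s 2 = (if free s = lo then Null else Ref (free s - 1))"
    using J unfolding state_inv_def by blast
  let ?A = "roots (heap s) (free s) \<union> set ys"
  have S1: "\<forall>d\<in>D. met (heap s) rep (?A \<union> {y}) d" and S2: "\<forall>d\<in>S2. met (heap s) rep ?A d"
    and gi: "graph_inv (heap s) (free s) rep D g"
    using inv by (auto simp: machine_inv_def)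
  have "met (heap s) rep ?A d" if dD: "d \<in> D" for d
  proof -
    obtain p k q where d: "d = (p, k, q)" by (cases d) auto
    have k: "k \<in> set ks" using gi dD d unfolding graph_inv_def by blast
    obtain z r where z: "z \<in> ?A \<union> {y}" "rep z = rep p" "heap s z k = Ref r" "rep r = rep q" "k < 2 * K"
      using bspec[OF S1 dD] unfolding d met_def prod.case by blast
    show ?thesis
    proof (cases "z = y")
      case True
      then have "(y, k, r) \<in> S2" using all k z by blast
      from bspec[OF S2 this] obtain z' r' where
        "z' \<in> ?A" "rep z' = rep y" "heap s z' k = Ref r'" "rep r' = rep r"
        unfolding met_def prod.case by blast
      then show ?thesis using z True unfolding d met_def by auto
    next
      case False
      then show ?thesis using z unfolding d met_def by auto
    qed
  qed
  then have "machine_inv (heap s) (free s) (regs s 3) rk rep ys D D {} {} g"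
    using inv unfolding machine_inv_def by simp
  from state_invI[OF this r] show ?thesis using \<phi> by simp
qed

lemma run_pop_keys:
  assumes "set ks' \<subseteq> set ks" "state_inv s D D S2 {y} g \<phi>" "y \<in> nonroots (heap s) (free s)" "regs s 29 = Ref y"
  shows "runs B (pop_keys K ks') s (\<lambda>t s'. \<exists>\<phi>' S2'. state_inv s' D D S2' {y} g \<phi>' \<and> S2 \<subseteq> S2' \<and>
    frame s s' \<and> (\<forall>k\<in>set ks'. \<forall>r. heap s y k = Ref r \<longrightarrow> (y, k, r) \<in> S2') \<and>
    (\<forall>r. r \<notin> scratch_regs \<union> {6, 20, 21} \<longrightarrow> regs s' r = regs s r) \<and>
    t + \<phi> \<le> \<phi>' + (length ks' * (cP + 10) + 1))"
  using assms
proof (induction ks' arbitrary: s S2 \<phi>)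
  case Nil
  have "state_inv (set_reg s 6 Null) D D S2 {y} g \<phi>"
    using Nil.prems(2) by (simp add: state_inv_def set_reg_def)
  then show ?case
    by (auto simp: pop_keys_def runs_simps set_reg_def intro!: frame_refl exI[of _ \<phi>] exI[of _ S2])
next
  case (Cons k ks')
  have y: "y \<in> nodes (free s)" using Cons.prems(3) nonroots_nodes by blast
  have k: "k \<in> set ks" using Cons.prems(1) by simp
  let ?P = "\<lambda>t s'. \<exists>\<phi>' S2'. state_inv s' D D S2' {y} g \<phi>' \<and> S2 \<subseteq> S2' \<and> frame s s' \<and>
     (\<forall>r. heap s y k = Ref r \<longrightarrow> (y, k, r) \<in> S2') \<and>
     (\<forall>r. r \<notin> scratch_regs \<union> {6, 20, 21} \<longrightarrow> regs s' r = regs s r) \<and> t + \<phi> \<le> \<phi>' + (cP + 10)"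
  have step: "runs B (Seq (Load 21 29 k) (Cond (Equal 21 6) (SetNull 6) (Seq (Copy 20 29) (put_prog K k)))) s ?P"
  proof (cases "heap s y k = Null")
    case True
    let ?s = "s\<lparr>regs := (regs s)(21 := Null, 6 := Null)\<rparr>"
    have "state_inv ?s D D S2 {y} g \<phi>" using Cons.prems(2) by (simp add: state_inv_def)
    moreover have "frame s ?s" by (rule frame_refl) simp_all
    moreover have "regs s 6 = Null" using Cons.prems(2) by (simp add: state_inv_def)
    ultimately show ?thesis
      using True Cons.prems(4)
      by (auto simp: runs_simps set_reg_def intro!: exI[of _ \<phi>] exI[of _ S2])
  next
    case False
    then obtain r where r: "r \<in> nodes (free s)" "heap s y k = Ref r"
      using state_inv_field[OF Cons.prems(2) y k] by blast
    let ?s = "s\<lparr>regs := (regs s)(21 := Ref r, 20 := Ref y)\<rparr>"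
    have J: "state_inv ?s D D S2 {y} g \<phi>" using Cons.prems(2) by (simp add: state_inv_def)
    have r6: "regs s 6 = Null" using Cons.prems(2) by (simp add: state_inv_def)
    have "runs B (put_prog K k) ?s (\<lambda>t s'. \<exists>\<phi>'.
      state_inv s' D (insert (y, k, r) D) (insert (y, k, r) S2) {y} g \<phi>' \<and> frame ?s s' \<and>
      (\<forall>r. r \<notin> scratch_regs \<longrightarrow> regs s' r = regs ?s r) \<and> t + \<phi> \<le> \<phi>' + cP)"
      by (rule run_put[OF J]) (use y r k in auto)
    then have "runs B (put_prog K k) ?s (\<lambda>t. ?P (t + 3))"
    proof (rule runs_mono)
      fix t s' assume "\<exists>\<phi>'. state_inv s' D (insert (y, k, r) D) (insert (y, k, r) S2) {y} g \<phi>' \<and> frame ?s s' \<and>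
        (\<forall>r. r \<notin> scratch_regs \<longrightarrow> regs s' r = regs ?s r) \<and> t + \<phi> \<le> \<phi>' + cP"
      then obtain \<phi>' where *: "state_inv s' D (insert (y, k, r) D) (insert (y, k, r) S2) {y} g \<phi>'" "frame ?s s'"
        "\<forall>r. r \<notin> scratch_regs \<longrightarrow> regs s' r = regs ?s r" "t + \<phi> \<le> \<phi>' + cP" by blast
      have "state_inv s' D D (insert (y, k, r) S2) {y} g \<phi>'"
        by (rule state_inv_weaken[OF *(1)]) auto
      moreover have "frame s s'" using *(2) by (simp add: frame_def)
      ultimately show "?P (t + 3) s'"
        using *(3,4) r(2) by (intro exI[of _ \<phi>'] exI[of _ "insert (y, k, r) S2"]) auto
    qed
    then show ?thesis
      using r r6 Cons.prems(4) by (auto simp: runs_simps set_reg_def elim!: runs_mono)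
  qed
  have "runs B (Seq (Seq (Load 21 29 k) (Cond (Equal 21 6) (SetNull 6) (Seq (Copy 20 29) (put_prog K k)))) (pop_keys K ks')) s
    (\<lambda>t s'. \<exists>\<phi>' S2'. state_inv s' D D S2' {y} g \<phi>' \<and> S2 \<subseteq> S2' \<and>
    frame s s' \<and> (\<forall>j\<in>set (k # ks'). \<forall>r. heap s y j = Ref r \<longrightarrow> (y, j, r) \<in> S2') \<and>
    (\<forall>r. r \<notin> scratch_regs \<union> {6, 20, 21} \<longrightarrow> regs s' r = regs s r) \<and>
    t + \<phi> \<le> \<phi>' + (length (k # ks') * (cP + 10) + 1))"
  proof (rule runs_SeqI[OF step])
    fix t s1 assume "?P t s1"
    then obtain \<phi>1 T where 1: "state_inv s1 D D T {y} g \<phi>1" "S2 \<subseteq> T" "frame s s1"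
     "\<forall>r. heap s y k = Ref r \<longrightarrow> (y, k, r) \<in> T"
     "\<forall>r. r \<notin> scratch_regs \<union> {6, 20, 21} \<longrightarrow> regs s1 r = regs s r" "t + \<phi> \<le> \<phi>1 + (cP + 10)" by blast
    have y1: "y \<in> nonroots (heap s1) (free s1)" "\<And>k. k < 2 * K \<Longrightarrow> heap s1 y k = heap s y k"
      using 1(3) Cons.prems(3) by (auto simp: frame_def)
    have same: "heap s1 y j = heap s y j" if "j \<in> set ks'" for j
      using y1(2)[of j] keys[of j] that Cons.prems(1) by auto
    show "runs B (pop_keys K ks') s1 (\<lambda>t' s'. \<exists>\<phi>' S2'. state_inv s' D D S2' {y} g \<phi>' \<and> S2 \<subseteq> S2' \<and>
      frame s s' \<and> (\<forall>j\<in>set (k # ks'). \<forall>r. heap s y j = Ref r \<longrightarrow> (y, j, r) \<in> S2') \<and>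
      (\<forall>r. r \<notin> scratch_regs \<union> {6, 20, 21} \<longrightarrow> regs s' r = regs s r) \<and>
      t + t' + \<phi> \<le> \<phi>' + (length (k # ks') * (cP + 10) + 1))"
    proof (rule runs_mono[OF Cons.IH[OF _ 1(1) y1(1)]])
      show "set ks' \<subseteq> set ks" using Cons.prems(1) by simp
      show "regs s1 29 = Ref y" using 1(5) Cons.prems(4) by simp
      fix t' s' assume "\<exists>\<phi>' S2'. state_inv s' D D S2' {y} g \<phi>' \<and> T \<subseteq> S2' \<and>
        frame s1 s' \<and> (\<forall>k\<in>set ks'. \<forall>r. heap s1 y k = Ref r \<longrightarrow> (y, k, r) \<in> S2') \<and>
        (\<forall>r. r \<notin> scratch_regs \<union> {6, 20, 21} \<longrightarrow> regs s' r = regs s1 r) \<and>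
        t' + \<phi>1 \<le> \<phi>' + (length ks' * (cP + 10) + 1)"
      then obtain \<phi>2 U where 2: "state_inv s' D D U {y} g \<phi>2" "T \<subseteq> U" "frame s1 s'"
        "\<forall>k\<in>set ks'. \<forall>r. heap s1 y k = Ref r \<longrightarrow> (y, k, r) \<in> U"
        "\<forall>r. r \<notin> scratch_regs \<union> {6, 20, 21} \<longrightarrow> regs s' r = regs s1 r"
        "t' + \<phi>1 \<le> \<phi>2 + (length ks' * (cP + 10) + 1)" by blast
      show "\<exists>\<phi>' S2'. state_inv s' D D S2' {y} g \<phi>' \<and> S2 \<subseteq> S2' \<and>
        frame s s' \<and> (\<forall>j\<in>set (k # ks'). \<forall>r. heap s y j = Ref r \<longrightarrow> (y, j, r) \<in> S2') \<and>
        (\<forall>r. r \<notin> scratch_regs \<union> {6, 20, 21} \<longrightarrow> regs s' r = regs s r) \<and>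
        t + t' + \<phi> \<le> \<phi>' + (length (k # ks') * (cP + 10) + 1)"
      proof (intro exI conjI)
        show "state_inv s' D D U {y} g \<phi>2" by (rule 2)
        show "S2 \<subseteq> U" using 1(2) 2(2) by blast
        show "frame s s'" using 1(3) 2(3) by (rule frame_trans)
        show "\<forall>j\<in>set (k # ks'). \<forall>r. heap s y j = Ref r \<longrightarrow> (y, j, r) \<in> U"
          using 1(4) 2(2,4) same by auto
        show "\<forall>r. r \<notin> scratch_regs \<union> {6, 20, 21} \<longrightarrow> regs s' r = regs s r"
          using 1(5) 2(5) by simp
        show "t + t' + \<phi> \<le> \<phi>2 + (length (k # ks') * (cP + 10) + 1)"
          using 1(6) 2(6) by (simp add: algebra_simps)
      qed
    qed
  qed
  then show ?case by (simp add: pop_keys_def runs_Seq add.assoc)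
qed

text \<open>Every round raises the potential by at least 2, and the potential is bounded by
  \<open>pot_max\<close>. This proves termination, although a round may push new records, and bounds
  the total time.\<close>

lemma run_drain_loop:
  assumes "state_inv s D D {} {} g \<phi>" "regs s 13 = (if regs s 3 = Null then Null else Num 1)"
  shows "runs B (While (Equal 13 7)
     (Seq (Copy 29 3) (Seq (Load 3 29 (2 * K + 2)) (Seq (pop_keys K ks) (neq_flag 13 3 6))))) s
    (\<lambda>t s'. \<exists>\<phi>'. state_inv s' D D {} {} g \<phi>' \<and> regs s' 3 = Null \<and> free s' = free s \<and>
      (\<forall>a<lo. heap s' a = heap s a) \<and> regs s' 1 = regs s 1 \<and> t + \<phi> \<le> \<phi>' + 1)"
  using assms
proof (induction "pot_max - \<phi>" arbitrary: s \<phi> rule: less_induct)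
  case less
  show ?case
  proof (cases "regs s 3 = Null")
    case True
    then show ?thesis using less.prems
      by (subst runs_While) (auto simp: state_inv_def)
  next
    case False
    obtain y where y: "regs s 3 = Ref y" "y \<in> nonroots (heap s) (free s)"
      "state_inv (s\<lparr>regs := (regs s)(29 := Ref y, 3 := heap s y (2 * K + 2))\<rparr>) D D {} {y} g (\<phi> + cD)"
      using state_inv_pop[OF less.prems(1) False] by blast
    let ?s = "s\<lparr>regs := (regs s)(29 := Ref y, 3 := heap s y (2 * K + 2))\<rparr>"
    let ?P = "\<lambda>t s'. \<exists>\<phi>'. state_inv s' D D {} {} g \<phi>' \<and> free s' = free s \<and>
      (\<forall>a<lo. heap s' a = heap s a) \<and> regs s' 1 = regs s 1 \<and>
      regs s' 13 = (if regs s' 3 = Null then Null else Num 1) \<and> t + \<phi> + 2 \<le> \<phi>'"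
    have pops: "runs B (pop_keys K ks) ?s (\<lambda>t s'. \<exists>\<phi>' S2'. state_inv s' D D S2' {y} g \<phi>' \<and> {} \<subseteq> S2' \<and>
      frame ?s s' \<and> (\<forall>k\<in>set ks. \<forall>r. heap ?s y k = Ref r \<longrightarrow> (y, k, r) \<in> S2') \<and>
      (\<forall>r. r \<notin> scratch_regs \<union> {6, 20, 21} \<longrightarrow> regs s' r = regs ?s r) \<and>
      t + (\<phi> + cD) \<le> \<phi>' + (length ks * (cP + 10) + 1))"
      by (rule run_pop_keys[OF _ y(3)]) (use y in auto)
    have "runs B (Seq (pop_keys K ks) (neq_flag 13 3 6)) ?s (\<lambda>t. ?P (t + 2))"
    proof (rule runs_SeqI[OF pops])
      fix t s1 assume "\<exists>\<phi>' S2'. state_inv s1 D D S2' {y} g \<phi>' \<and> {} \<subseteq> S2' \<and>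
        frame ?s s1 \<and> (\<forall>k\<in>set ks. \<forall>r. heap ?s y k = Ref r \<longrightarrow> (y, k, r) \<in> S2') \<and>
        (\<forall>r. r \<notin> scratch_regs \<union> {6, 20, 21} \<longrightarrow> regs s1 r = regs ?s r) \<and>
        t + (\<phi> + cD) \<le> \<phi>' + (length ks * (cP + 10) + 1)"
      then obtain \<phi>1 T where 1: "state_inv s1 D D T {y} g \<phi>1" "frame ?s s1"
        "\<forall>k\<in>set ks. \<forall>r. heap s y k = Ref r \<longrightarrow> (y, k, r) \<in> T"
        "\<forall>r. r \<notin> scratch_regs \<union> {6, 20, 21} \<longrightarrow> regs s1 r = regs ?s r"
        "t + (\<phi> + cD) \<le> \<phi>1 + (length ks * (cP + 10) + 1)" by auto
      have fr: "free s1 = free s" "\<forall>a<lo. heap s1 a = heap s a" "\<And>k. k \<in> set ks \<Longrightarrow> heap s1 y k = heap s y k"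
        using 1(2) y(2) keys by (auto simp: frame_def)
      have J: "state_inv s1 D D {} {} g \<phi>1"
        by (rule state_inv_absorb[OF 1(1)]) (use 1(3) fr(3) in auto)
      let ?s2 = "s1\<lparr>regs := (regs s1)(13 := if regs s1 3 = Null then Null else Num 1)\<rparr>"
      have "state_inv ?s2 D D {} {} g \<phi>1" using J by (simp add: state_inv_def)
      then have "?P (t + 4) ?s2"
        using fr 1(4,5) by (intro exI[of _ \<phi>1]) (auto simp: cD_def)
      moreover have "regs s1 6 = Null" "regs s1 7 = Num 1" using J by (auto simp: state_inv_def)
      ultimately show "runs B (neq_flag 13 3 6) s1 (\<lambda>t'. ?P (t + t' + 2))"
        by (cases "regs s1 3 = Null") (simp_all add: neq_flag_def runs_simps set_reg_def numeral_eq_Suc)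
    qed
    then have body: "runs B (Seq (Copy 29 3) (Seq (Load 3 29 (2 * K + 2)) (Seq (pop_keys K ks) (neq_flag 13 3 6)))) s ?P"
      unfolding runs_Seq[of B "Copy 29 3"] runs_Seq[of B "Load 3 29 (2 * K + 2)"] runs_Copy runs_Load
        set_reg_def
      using y(1) by (auto elim!: runs_mono)
    show ?thesis
    proof (rule runs_WhileI[OF _ body])
      show "test_holds (Equal 13 7) s" using less.prems False by (simp add: state_inv_def)
      fix t and s1 :: mstate assume "?P t s1"
      then obtain \<phi>1 where 1: "state_inv s1 D D {} {} g \<phi>1" "free s1 = free s"
        "\<forall>a<lo. heap s1 a = heap s a" "regs s1 1 = regs s 1"
        "regs s1 13 = (if regs s1 3 = Null then Null else Num 1)" "t + \<phi> + 2 \<le> \<phi>1" by blast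
      have "pot_max - \<phi>1 < pot_max - \<phi>" using 1(6) state_inv_pot[OF 1(1)] by simp
      from less.hyps[OF this 1(1,5)]
      show "runs B (While (Equal 13 7)
         (Seq (Copy 29 3) (Seq (Load 3 29 (2 * K + 2)) (Seq (pop_keys K ks) (neq_flag 13 3 6))))) s1
        (\<lambda>t' s'. \<exists>\<phi>'. state_inv s' D D {} {} g \<phi>' \<and> regs s' 3 = Null \<and> free s' = free s \<and>
          (\<forall>a<lo. heap s' a = heap s a) \<and> regs s' 1 = regs s 1 \<and> Suc (t + t') + \<phi> \<le> \<phi>' + 1)"
      proof (rule runs_mono)
        fix t' s' assume "\<exists>\<phi>'. state_inv s' D D {} {} g \<phi>' \<and> regs s' 3 = Null \<and> free s' = free s1 \<and>
          (\<forall>a<lo. heap s' a = heap s1 a) \<and> regs s' 1 = regs s1 1 \<and> t' + \<phi>1 \<le> \<phi>' + 1"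
        then show "\<exists>\<phi>'. state_inv s' D D {} {} g \<phi>' \<and> regs s' 3 = Null \<and> free s' = free s \<and>
          (\<forall>a<lo. heap s' a = heap s a) \<and> regs s' 1 = regs s 1 \<and> Suc (t + t') + \<phi> \<le> \<phi>' + 1"
          using 1 by auto
      qed
    qed
  qed
qed

lemma run_drain:
  assumes J: "state_inv s D D {} {} g \<phi>"
  shows "runs B (drain_prog K ks) s (\<lambda>t s'. \<exists>\<phi>'. state_inv s' D D {} {} g \<phi>' \<and> regs s' 3 = Null \<and>
    free s' = free s \<and> (\<forall>a<lo. heap s' a = heap s a) \<and> regs s' 1 = regs s 1 \<and> t + \<phi> \<le> \<phi>' + 3)"
proof -
  let ?s = "s\<lparr>regs := (regs s)(13 := if regs s 3 = Null then Null else Num 1)\<rparr>"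
  have r: "regs s 6 = Null" "regs s 7 = Num 1" using J by (auto simp: state_inv_def)
  have flag: "runs B (neq_flag 13 3 6) s (\<lambda>t s'. t = 2 \<and> s' = ?s)"
    using r by (cases "regs s 3 = Null") (simp_all add: neq_flag_def runs_simps set_reg_def)
  have "state_inv ?s D D {} {} g \<phi>" using J by (simp add: state_inv_def)
  note loop = run_drain_loop[OF this]
  show ?thesis
    unfolding drain_prog_def
    by (rule runs_SeqI[OF flag], elim conjE, hypsubst, rule runs_mono[OF loop]) auto
qed

subsection \<open>New nodes\<close>

text \<open>A fresh record is a root of rank 0 and adds nothing to the potential. Its image
  \<open>P\<close> can be prescribed freely, since no demand mentions it yet.\<close>

lemma run_new:
  assumes J: "state_inv s D D {} {} g \<phi>" and size: "free s < lo + nmax" and x: "x \<notin> {2, 3, 6, 7}"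
  shows "runs B (new_prog K x) s (\<lambda>t s'. t = 4 \<and> state_inv s' D D {} {} (g(free s := P)) \<phi> \<and>
    free s' = Suc (free s) \<and> regs s' = (regs s)(x := Ref (free s), 2 := Ref (free s)) \<and>
    (\<forall>a<free s. heap s' a = heap s a))"
proof -
  obtain rk rep ys where inv: "machine_inv (heap s) (free s) (regs s 3) rk rep ys D D {} {} g"
    and \<phi>: "\<phi> = pot (heap s) (free s) rk ys"
    and r: "regs s 6 = Null" "regs s 7 = Num 1" "lo \<le> free s"
      "regs s 2 = (if free s = lo then Null else Ref (free s - 1))"
    using J unfolding state_inv_def by blast
  let ?f = "free s" and ?f' = "Suc (free s)"
  define hp where "hp = heap s"
  define hp' where "hp' = hp(?f := (\<lambda>_. Null)(2 * K := Ref ?f, 2 * K + 3 := regs s 2))"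
  define rk' where "rk' = rk(?f := 0)"
  define rep' where "rep' = rep(?f := ?f)"
  define g' where "g' = g(?f := P)"
  have i: "uf hp ?f rk rep" "graph_inv hp ?f rep D g" "pred_inv hp ?f" "wlist hp (regs s 3) ys" "distinct ys"
      "set ys \<subseteq> nonroots hp ?f" "\<forall>d\<in>D. met hp rep (roots hp ?f \<union> set ys \<union> {}) d"
    using inv by (auto simp: machine_inv_def hp_def)
  note uf = i(1)
  have nodes: "nodes ?f' = insert ?f (nodes ?f)" using r(3) by auto
  have old: "hp' a = hp a" "rk' a = rk a" "rep' a = rep a" "g' a = g a" if "a \<in> nodes ?f" for a
    using that by (auto simp: hp'_def rk'_def rep'_def g'_def)
  have new: "hp' ?f (2 * K) = Ref ?f" "hp' ?f (2 * K + 1) = Null" "hp' ?f (2 * K + 3) = regs s 2"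
    "\<And>k. k < 2 * K \<Longrightarrow> hp' ?f k = Null" "rk' ?f = 0" "rep' ?f = ?f"
    by (auto simp: hp'_def rk'_def rep'_def)
  have par: "par hp' a = par hp a" if "a \<in> nodes ?f" for a using old(1)[OF that] by (simp add: par_def)
  have parn: "par hp' ?f = ?f" by (simp add: par_def new)
  have nr: "nonroots hp' ?f' = nonroots hp ?f"
    using old(1) new(1) unfolding nonroots_def nodes by auto
  have uf': "uf hp' ?f' rk' rep'"
    unfolding uf_def
  proof (intro conjI ballI allI)
    fix a assume "a \<in> nodes ?f'"
    then consider "a = ?f" | "a \<in> nodes ?f" unfolding nodes by blast
    note cs = this
    have in_nodes: "b \<in> nodes ?f \<Longrightarrow> b \<in> nodes ?f'" for b by auto
    show "hp' a (2 * K) = Ref (par hp' a)"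
      using cs by cases (simp_all add: new parn old par uf_par[OF uf])
    show "par hp' a \<in> nodes ?f'"
      using cs r(3) uf_par(2)[OF uf, of a] by cases (simp_all add: parn par)
    show "rep' (par hp' a) = rep' a"
      using cs by cases (simp_all add: parn par old(3) old(3)[OF uf_par(2)[OF uf]] uf_rep_par[OF uf])
    show "rep' a \<in> nodes ?f'"
      using cs r(3) uf_rep_node[OF uf, of a] by cases (simp_all add: new old)
    show "par hp' (rep' a) = rep' a"
      using cs by cases (simp_all add: new parn old par[OF uf_rep_node[OF uf]] uf_par_rep[OF uf])
    show "rk' a \<le> rk' (rep' a)"
      using cs by cases (simp_all add: new old old(2)[OF uf_rep_node[OF uf]] uf_rk_rep[OF uf])
    show "if par hp' a = a then rep' a = a else rk' a < rk' (par hp' a)"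
      using cs by cases (simp_all add: new parn old par old(2)[OF uf_par(2)[OF uf]] uf_root[OF uf] uf_rk_par[OF uf])
    show "if rk' a = 0 then hp' a (2 * K + 1) = Null
        else \<exists>c\<in>nonroots hp' ?f'. hp' a (2 * K + 1) = Ref c \<and> rk' a = Suc (rk' c)"
      using cs
    proof cases
      case 2
      show ?thesis
      proof (cases "rk a = 0")
        case True
        then show ?thesis using uf_rank_Null[OF uf 2] unfolding old(1,2)[OF 2] by simp
      next
        case False
        then obtain c where c: "c \<in> nonroots hp ?f" "hp a (2 * K + 1) = Ref c" "rk a = Suc (rk c)"
          using uf_rank_Ref[OF uf 2] by blast
        have "rk' c = rk c" using old(2)[OF nonroots_nodes[OF c(1)]] .
        then show ?thesis unfolding old(1,2)[OF 2] nr using c by auto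
      qed
    qed (simp add: new del: One_nat_def add_Suc_right)
  next
    fix n
    have "{a \<in> nodes ?f'. n < rk' a} = {a \<in> nodes ?f. n < rk a}"
      unfolding nodes using old(2) new(5) by auto
    moreover have "{a \<in> nonroots hp' ?f'. rk' a = n} = {a \<in> nonroots hp ?f. rk a = n}"
      unfolding nr using old(2) nonroots_nodes by auto
    ultimately show "card {a \<in> nodes ?f'. n < rk' a} \<le> card {a \<in> nonroots hp' ?f'. rk' a = n}"
      using uf_count[OF uf] by simp
  next
    show "?f' \<le> lo + nmax" using size by simp
  qed
  have Dn: "p \<in> nodes ?f \<and> q \<in> nodes ?f \<and> k \<in> set ks \<and> keyE k (g p) (g q)" if "(p, k, q) \<in> D" for p k q
    using i(2) that unfolding graph_inv_def by blast
  have dem: "demanded rep' D a k b"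
    if ab: "demanded rep D a k b" "a \<in> nodes ?f" "b \<in> nodes ?f" for a k b
  proof -
    obtain p q where d: "(p, k, q) \<in> D" "rep p = rep a" "rep q = rep b"
      using ab(1) unfolding demanded_def by blast
    then show ?thesis using Dn[OF d(1)] old(3) ab(2,3) unfolding demanded_def by metis
  qed
  have gi: "graph_inv hp' ?f' rep' D g'"
    unfolding graph_inv_def
  proof (intro conjI)
    show "\<forall>a\<in>nodes ?f'. \<forall>k\<in>set ks. hp' a k = Null \<or> (\<exists>r\<in>nodes ?f'. hp' a k = Ref r \<and> demanded rep' D a k r)"
    proof (intro ballI)
      fix a k assume a: "a \<in> nodes ?f'" and k: "k \<in> set ks"
      show "hp' a k = Null \<or> (\<exists>r\<in>nodes ?f'. hp' a k = Ref r \<and> demanded rep' D a k r)"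
      proof (cases "a = ?f")
        case True
        then show ?thesis using new(4) keys[OF k] by simp
      next
        case False
        then have a': "a \<in> nodes ?f" using a unfolding nodes by blast
        then have "hp a k = Null \<or> (\<exists>r\<in>nodes ?f. hp a k = Ref r \<and> demanded rep D a k r)"
          using i(2) k unfolding graph_inv_def by blast
        then show ?thesis
          unfolding old(1)[OF a'] nodes using dem[OF _ a'] by blast
      qed
    qed
    show "\<forall>p k q. (p, k, q) \<in> D \<longrightarrow> p \<in> nodes ?f' \<and> q \<in> nodes ?f' \<and> k \<in> set ks \<and> keyE k (g' p) (g' q)"
      using Dn old(4) by fastforce
    show "\<forall>a\<in>nodes ?f'. g' (rep' a) = g' a"
      unfolding nodes using old(3,4) uf_rep_node[OF uf] graph_inv_g[OF i(2)] new(6) by auto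
  qed
  have pi: "pred_inv hp' ?f'"
    unfolding pred_inv_def nodes using i(3) old(1) new(3) r(4) by (auto simp: pred_inv_def)
  have wl: "wlist hp' (regs s 3) ys"
    using i(4) wlist_cong[of ys hp' hp "regs s 3"] old(1) i(6) nonroots_nodes by fastforce
  have met: "met hp' rep' (roots hp' ?f' \<union> set ys \<union> {}) d" if dD: "d \<in> D" for d
  proof -
    obtain p k q where d: "d = (p, k, q)" by (cases d) auto
    obtain z b where z: "z \<in> roots hp ?f \<union> set ys" "rep z = rep p" "hp z k = Ref b" "rep b = rep q" "k < 2 * K"
      using bspec[OF i(7) dD] unfolding d met_def prod.case by blast
    have zn: "z \<in> nodes ?f" using z(1) i(6) nonroots_nodes by blast
    have pk: "p \<in> nodes ?f" "q \<in> nodes ?f" "k \<in> set ks" using Dn dD d by blast+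
    have bn: "b \<in> nodes ?f" using field_demanded(1)[OF i(2) zn pk(3) z(3)] .
    have "z \<in> roots hp' ?f' \<union> set ys" using z(1) unfolding nr nodes by blast
    then show ?thesis
      unfolding d met_def prod.case using z old[OF zn] old(3)[OF bn] old(3)[OF pk(1)] old(3)[OF pk(2)]
      by (intro conjI bexI[of _ z] exI[of _ b]) auto
  qed
  have inv': "machine_inv hp' ?f' (regs s 3) rk' rep' ys D D {} {} g'"
    using uf' gi pi wl i(5,6) met unfolding machine_inv_def by (auto simp: nr)
  have "\<Phi>1 hp' ?f' rk' = \<Phi>1 hp ?f rk"
  proof -
    have "(\<Sum>a\<in>nodes ?f. min (rk' (par hp' a)) (cap (rk' a)) - rk' a)
        = (\<Sum>a\<in>nodes ?f. min (rk (par hp a)) (cap (rk a)) - rk a)"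
      by (rule sum.cong[OF HOL.refl]) (simp add: par old old(2)[OF uf_par(2)[OF uf]])
    then show ?thesis unfolding \<Phi>1_def nodes by (simp add: new parn)
  qed
  moreover have "\<Phi>2 hp' ?f' rk' = \<Phi>2 hp ?f rk"
    unfolding \<Phi>2_def nr by (rule sum.cong[OF HOL.refl]) (use old(2) nonroots_nodes in auto)
  ultimately have pot: "pot hp' ?f' rk' ys = \<phi>" by (simp add: pot_def \<phi> hp_def nr[unfolded hp_def])
  let ?s = "s\<lparr>regs := (regs s)(x := Ref ?f, 2 := Ref ?f), heap := hp', free := ?f'\<rparr>"
  have "state_inv ?s D D {} {} g' (pot hp' ?f' rk' ys)"
    using state_invI[of ?s rk' rep' ys] inv' r x by simp
  then have J': "state_inv ?s D D {} {} g' \<phi>" by (simp only: pot)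
  have "runs B (new_prog K x) s (\<lambda>t s'. t = 4 \<and> s' = ?s)"
    using x by (simp add: new_prog_def runs_simps set_reg_def hp'_def hp_def)
  then show ?thesis
    by (rule runs_mono) (use J' in \<open>auto simp: g'_def hp'_def hp_def\<close>)
qed

end

section \<open>Programs that read the input and attach loops\<close>

subsection \<open>Building the graph\<close>

definition half_edge_prog :: "nat \<Rightarrow> nat \<Rightarrow> nat \<Rightarrow> nat \<Rightarrow> com" where
  "half_edge_prog K k x y = Seq (Copy 20 x) (Seq (Copy 21 y) (put_prog K k))"

definition edge_prog :: "nat \<Rightarrow> ('x \<Rightarrow> nat) \<Rightarrow> 'x \<times> bool \<Rightarrow> nat \<Rightarrow> nat \<Rightarrow> com" where
  "edge_prog K code l x y = (if snd l
     then Seq (half_edge_prog K (2 * code (fst l)) x y) (half_edge_prog K (2 * code (fst l) + 1) y x)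
     else Seq (half_edge_prog K (2 * code (fst l)) y x) (half_edge_prog K (2 * code (fst l) + 1) x y))"

text \<open>Register 24 holds the end point of the path, register 25 the point reached so far. The
  last letter closes the path without creating a record.\<close>

fun attach_prog :: "nat \<Rightarrow> ('x \<Rightarrow> nat) \<Rightarrow> 'x word \<Rightarrow> com" where
  "attach_prog K code [] = SetNull 6"
| "attach_prog K code [l] = edge_prog K code l 25 24"
| "attach_prog K code (l # l' # r) = Seq (new_prog K 26) (Seq (edge_prog K code l 25 26)
     (Seq (Copy 25 26) (attach_prog K code (l' # r))))"

definition loops_prog :: "nat \<Rightarrow> ('x \<Rightarrow> nat) \<Rightarrow> 'x word list \<Rightarrow> com" where
  "loops_prog K code rs = foldr (\<lambda>r c. Seq (Seq (Copy 25 24) (attach_prog K code r)) c) rs (SetNull 6)"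

definition letter_prog ::
    "nat \<Rightarrow> ('x \<Rightarrow> nat) \<Rightarrow> ('x \<Rightarrow> 'x word list) \<Rightarrow> ('x \<Rightarrow> 'x word list) \<Rightarrow> 'x \<times> bool \<Rightarrow> com" where
  "letter_prog K code tlo hlo l = (let a = (if snd l then 4 else 5); b = (if snd l then 5 else 4) in
     Seq (edge_prog K code (fst l, True) a b)
       (Seq (Copy 24 a) (Seq (loops_prog K code (tlo (fst l)))
         (Seq (Copy 24 b) (loops_prog K code (hlo (fst l)))))))"

text \<open>Record fields are named in the program text, so the number of a letter cannot address a
  field; it has to select a branch by comparison with the codes.\<close>

definition dispatch_prog ::
    "nat \<Rightarrow> ('x \<Rightarrow> nat) \<Rightarrow> ('x \<Rightarrow> 'x word list) \<Rightarrow> ('x \<Rightarrow> 'x word list) \<Rightarrow> 'x list \<Rightarrow> com" where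
  "dispatch_prog K code tlo hlo xs = foldr (\<lambda>x c. Seq (SetNum 34 (int (code x)))
     (Cond (Equal 31 34)
        (Cond (Equal 32 7) (letter_prog K code tlo hlo (x, True)) (letter_prog K code tlo hlo (x, False)))
        c)) xs (SetNull 6)"

definition read_prog ::
    "nat \<Rightarrow> ('x \<Rightarrow> nat) \<Rightarrow> ('x \<Rightarrow> 'x word list) \<Rightarrow> ('x \<Rightarrow> 'x word list) \<Rightarrow> 'x list \<Rightarrow> com" where
  "read_prog K code tlo hlo xs = Seq (Load 31 0 0) (Seq (Load 32 0 1) (Seq (Load 33 0 2)
     (Seq (Cond (Equal 33 7) (Copy 5 1) (new_prog K 5))
       (Seq (dispatch_prog K code tlo hlo xs) (Seq (Copy 4 5) (Seq (Load 0 0 3) (neq_flag 13 0 6)))))))"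

definition all_keys :: "('x \<Rightarrow> nat) \<Rightarrow> 'x list \<Rightarrow> nat list" where
  "all_keys code xs = concat (map (\<lambda>x. [2 * code x, 2 * code x + 1]) xs)"

lemma set_all_keys: "k \<in> set (all_keys code xs) \<longleftrightarrow>
    (\<exists>x\<in>set xs. k = 2 * code x \<or> k = 2 * code x + 1)"
  by (auto simp: all_keys_def)

text \<open>The gadget condition with arbitrary finite lists of loops per letter, which frees the
  analysis of the program from the graph of groups.\<close>

definition looped where
  "looped tlo hlo E p x q \<longleftrightarrow> E p x q \<and> (\<forall>r\<in>set (tlo x). run E p r p) \<and> (\<forall>r\<in>set (hlo x). run E q r q)"

text \<open>The letters of all input words in one list, with the last letter of each word marked; every
  marked letter leads back to \<open>b\<close>.\<close>

fun marked_path :: "('l \<Rightarrow> 'm \<Rightarrow> 'm \<Rightarrow> bool) \<Rightarrow> 'm \<Rightarrow> 'm \<Rightarrow> ('l \<times> bool) list \<Rightarrow> bool" where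
  "marked_path P b p [] \<longleftrightarrow> True"
| "marked_path P b p (lm # L) \<longleftrightarrow> (\<exists>q. P (fst lm) p q \<and> (snd lm \<longrightarrow> q = b) \<and> marked_path P b q L)"

lemma marked_Cons: "marked (l # W) = (l, W = []) # marked W"
proof (rule nth_equalityI)
  fix i assume "i < length (marked (l # W))"
  then show "marked (l # W) ! i = ((l, W = []) # marked W) ! i"
    by (cases i) (auto simp: marked_def simp del: upt_Suc)
qed (simp add: marked_def)

lemma marked_path_marked:
  "W \<noteq> [] \<Longrightarrow> marked_path P b p (marked W @ L) \<longleftrightarrow> path P p W b \<and> marked_path P b b L"
proof (induction W arbitrary: p)
  case (Cons l W)
  show ?case
  proof (cases "W = []")
    case True
    then show ?thesis by (auto simp: marked_Cons marked_def)
  next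
    case False
    then show ?thesis using Cons.IH by (auto simp: marked_Cons)
  qed
qed simp

text \<open>Empty words occupy no record and are closed paths anyway, so their absence from the list
  changes nothing.\<close>

lemma marked_path_concat:
  "marked_path P b b (concat (map marked Ws)) \<longleftrightarrow> (\<forall>W\<in>set Ws. path P b W b)"
proof (induction Ws)
  case (Cons W Ws)
  show ?case
  proof (cases "W = []")
    case True
    then show ?thesis using Cons by (simp add: marked_def)
  next
    case False
    then show ?thesis using Cons by (simp add: marked_path_marked)
  qed
qed simp

lemma set_reg_simps [simp]: "heap (set_reg s x w) = heap s" "free (set_reg s x w) = free s"
  "regs (set_reg s x w) y = (if y = x then w else regs s y)"
  by (auto simp: set_reg_def)

locale letter_machine = memory_layout B K lo nmax for B and K lo nmax :: nat +
  fixes xs :: "'x list" and code :: "'x \<Rightarrow> nat" and tlo hlo :: "'x \<Rightarrow> 'x word list"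
    and E :: "'m \<Rightarrow> 'x \<Rightarrow> 'm \<Rightarrow> bool"
  assumes inj_code: "inj_on code (set xs)" and det_E: "det E"
    and code_K: "x \<in> set xs \<Longrightarrow> code x < K" and code_B: "x \<in> set xs \<Longrightarrow> int (code x) \<le> B"
    and loops: "x \<in> set xs \<Longrightarrow> r \<in> set (tlo x) \<union> set (hlo x) \<Longrightarrow> r \<noteq> [] \<and> r \<in> words (set xs)"
begin

definition keyE :: "nat \<Rightarrow> 'm \<Rightarrow> 'm \<Rightarrow> bool" where
  "keyE k p q \<longleftrightarrow> (\<exists>x\<in>set xs. k = 2 * code x \<and> E p x q \<or> k = 2 * code x + 1 \<and> E q x p)"

lemma keyE_iff:
  assumes "x \<in> set xs"
  shows "keyE (2 * code x) p q \<longleftrightarrow> E p x q" "keyE (2 * code x + 1) p q \<longleftrightarrow> E q x p"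
proof -
  have "code x = code y \<longleftrightarrow> x = y" if "y \<in> set xs" for y
    using inj_on_eq_iff[OF inj_code assms that] .
  moreover have "2 * code x \<noteq> Suc (2 * code y)" "Suc (2 * code x) \<noteq> 2 * code y" for y
    by presburger+
  ultimately show "keyE (2 * code x) p q \<longleftrightarrow> E p x q" "keyE (2 * code x + 1) p q \<longleftrightarrow> E q x p"
    using assms unfolding keyE_def by auto
qed

abbreviation "ks \<equiv> all_keys code xs"

sublocale folding_machine B K lo nmax ks keyE
proof
  fix k assume "k \<in> set ks"
  then show "k < 2 * K" using code_K by (fastforce simp: set_all_keys)
next
  fix k p q q' assume *: "keyE k p q" "keyE k p q'"
  obtain x where x: "x \<in> set xs" "k = 2 * code x \<or> k = 2 * code x + 1"
    using *(1) by (auto simp: keyE_def)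
  have dE: "(E p x q \<longrightarrow> E p x q' \<longrightarrow> q = q') \<and> (E q x p \<longrightarrow> E q' x p \<longrightarrow> q = q')"
    using det_E unfolding det_iff by blast
  show "q = q'" using x(2)
  proof
    assume "k = 2 * code x"
    then show ?thesis using * dE keyE_iff(1)[OF x(1)] by simp
  next
    assume "k = 2 * code x + 1"
    then show ?thesis using * dE keyE_iff(2)[OF x(1)] by (simp only: simp_thms)
  qed
qed

abbreviation "bs s D g \<phi> \<equiv> state_inv s D D {} {} g \<phi>"

definition ED :: "(nat \<times> nat \<times> nat) set \<Rightarrow> nat \<Rightarrow> 'x \<Rightarrow> nat \<Rightarrow> bool" where
  "ED D p x q \<longleftrightarrow> x \<in> set xs \<and> (p, 2 * code x, q) \<in> D \<and> (q, 2 * code x + 1, p) \<in> D"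

lemma go_ED_mono: "go (ED D) l p q \<Longrightarrow> D \<subseteq> D' \<Longrightarrow> go (ED D') l p q"
  by (auto simp: go_def ED_def split: if_splits)

lemma run_ED_mono: "run (ED D) p r q \<Longrightarrow> D \<subseteq> D' \<Longrightarrow> run (ED D') p r q"
  by (erule path_mono) (rule go_ED_mono)

text \<open>A specification scheme for the building phase: \<open>W\<close> bounds the registers
  changed, \<open>m\<close> the records created and \<open>c\<close> the time beyond the growth of
  the potential. Demands only accumulate and the ghost map is kept on old records, so that earlier
  facts persist.\<close>

definition post where
  "post s D g \<phi> W m c Q t s' \<longleftrightarrow> (\<exists>\<phi>' D' g'. bs s' D' g' \<phi>' \<and> D \<subseteq> D' \<and> (\<forall>a<free s. g' a = g a) \<and>
     free s \<le> free s' \<and> free s' \<le> free s + m \<and> (\<forall>a<lo. heap s' a = heap s a) \<and>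
     (\<forall>r. r \<notin> W \<longrightarrow> regs s' r = regs s r) \<and> t + \<phi> \<le> \<phi>' + c \<and> Q D' g' s')"

lemma postI:
  assumes "bs s' D' g' \<phi>'" "D \<subseteq> D'" "\<forall>a<free s. g' a = g a" "free s \<le> free s'" "free s' \<le> free s + m"
    "\<forall>a<lo. heap s' a = heap s a" "\<forall>r. r \<notin> W \<longrightarrow> regs s' r = regs s r" "t + \<phi> \<le> \<phi>' + c" "Q D' g' s'"
  shows "post s D g \<phi> W m c Q t s'"
  using assms unfolding post_def by blast

text \<open>Bounds add along the syntax of the program, which is why later bounds are written as
  nested sums with summands 0.\<close>

lemma post_Seq:
  assumes W: "W1 \<subseteq> W" "W2 \<subseteq> W"
    and 1: "runs B c s (post s D g \<phi> W1 m n Q)"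
    and 2: "\<And>s1 D1 g1 \<phi>1. bs s1 D1 g1 \<phi>1 \<Longrightarrow> D \<subseteq> D1 \<Longrightarrow> \<forall>a<free s. g1 a = g a \<Longrightarrow> free s \<le> free s1 \<Longrightarrow>
      free s1 \<le> free s + m \<Longrightarrow> \<forall>a<lo. heap s1 a = heap s a \<Longrightarrow>
      \<forall>r. r \<notin> W1 \<longrightarrow> regs s1 r = regs s r \<Longrightarrow> Q D1 g1 s1 \<Longrightarrow>
      runs B c' s1 (post s1 D1 g1 \<phi>1 W2 m' n' Q')"
  shows "runs B (Seq c c') s (post s D g \<phi> W (m + m') (n + n') Q')"
proof (rule runs_SeqI[OF 1])
  fix t s1 assume "post s D g \<phi> W1 m n Q t s1"
  then obtain \<phi>1 D1 g1 where *: "bs s1 D1 g1 \<phi>1" "D \<subseteq> D1" "\<forall>a<free s. g1 a = g a" "free s \<le> free s1"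
      "free s1 \<le> free s + m" "\<forall>a<lo. heap s1 a = heap s a"
      "\<forall>r. r \<notin> W1 \<longrightarrow> regs s1 r = regs s r" "t + \<phi> \<le> \<phi>1 + n" "Q D1 g1 s1"
    unfolding post_def by blast
  show "runs B c' s1 (\<lambda>t'. post s D g \<phi> W (m + m') (n + n') Q' (t + t'))"
  proof (rule runs_mono[OF 2[OF *(1-7,9)]])
    fix t' s' assume "post s1 D1 g1 \<phi>1 W2 m' n' Q' t' s'"
    then obtain \<phi>2 D2 g2 where **: "bs s' D2 g2 \<phi>2" "D1 \<subseteq> D2" "\<forall>a<free s1. g2 a = g1 a" "free s1 \<le> free s'"
      "free s' \<le> free s1 + m'" "\<forall>a<lo. heap s' a = heap s1 a"
      "\<forall>r. r \<notin> W2 \<longrightarrow> regs s' r = regs s1 r" "t' + \<phi>1 \<le> \<phi>2 + n'" "Q' D2 g2 s'"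
      unfolding post_def by blast
    have "regs s' r = regs s r" if r: "r \<notin> W" for r
    proof -
      have "r \<notin> W1" "r \<notin> W2" using W r by blast+
      then show ?thesis using *(7) **(7) by simp
    qed
    then show "post s D g \<phi> W (m + m') (n + n') Q' (t + t') s'"
      by (intro postI[OF **(1)]) (use * ** in auto)
  qed
qed

lemma post_weaken:
  assumes "runs B c s (post s D g \<phi> W m n Q)" "W \<subseteq> W'" "m \<le> m'" "n \<le> n'"
    "\<And>D' g' s'. D \<subseteq> D' \<Longrightarrow> \<forall>r. r \<notin> W \<longrightarrow> regs s' r = regs s r \<Longrightarrow> Q D' g' s' \<Longrightarrow> Q' D' g' s'"
  shows "runs B c s (post s D g \<phi> W' m' n' Q')"
proof (rule runs_mono[OF assms(1)])
  fix t s' assume "post s D g \<phi> W m n Q t s'"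
  then obtain \<phi>2 D2 g2 where **: "bs s' D2 g2 \<phi>2" "D \<subseteq> D2" "\<forall>a<free s. g2 a = g a" "free s \<le> free s'"
      "free s' \<le> free s + m" "\<forall>a<lo. heap s' a = heap s a"
      "\<forall>r. r \<notin> W \<longrightarrow> regs s' r = regs s r" "t + \<phi> \<le> \<phi>2 + n" "Q D2 g2 s'"
    unfolding post_def by blast
  show "post s D g \<phi> W' m' n' Q' t s'"
    by (rule postI[OF **(1,2,3,4) _ **(6)]) (use ** assms(2-) in auto)
qed

lemma bs_regs:
  assumes "bs s D g \<phi>"
  shows "regs s 6 = Null" "regs s 7 = Num 1" "lo \<le> free s"
  using assms by (auto simp: state_inv_def)

lemma bs_set_reg:
  assumes "bs s D g \<phi>" "x \<notin> {2, 3, 6, 7}"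
  shows "bs (set_reg s x w) D g \<phi>"
  using assms by (simp add: state_inv_def set_reg_def)

lemma post_set_reg:
  assumes "bs s D g \<phi>" "x \<notin> {2, 3, 6, 7}" "x \<in> W" "t \<le> c" "Q D g (set_reg s x w)"
  shows "post s D g \<phi> W 0 c Q t (set_reg s x w)"
  by (rule postI[OF bs_set_reg[OF assms(1,2)]]) (use assms in auto)

lemma post_Copy:
  assumes "bs s D g \<phi>" "x \<notin> {2, 3, 6, 7}" "x \<in> W"
  shows "runs B (Copy x y) s (post s D g \<phi> W 0 1 (\<lambda>D' g' s'. D' = D \<and> g' = g \<and> s' = set_reg s x (regs s y)))"
  unfolding runs_Copy by (rule post_set_reg) (use assms in auto)

lemma post_SetNull6:
  assumes "bs s D g \<phi>" "6 \<in> W" "Q D g (set_reg s 6 Null)"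
  shows "runs B (SetNull 6) s (post s D g \<phi> W 0 1 Q)"
  unfolding runs_SetNull
  by (rule postI[of _ D g \<phi>]) (use assms in \<open>auto simp: state_inv_def\<close>)

text \<open>A demand that holds in the target graph is announced before it is met: it enters
  \<open>D\<close>, while the set of demands known to be met stays behind until the insertion is
  done.\<close>

lemma bs_insert:
  assumes J: "bs s D g \<phi>" and p: "p \<in> nodes (free s)" and q: "q \<in> nodes (free s)"
    and k: "k \<in> set ks" "keyE k (g p) (g q)"
  shows "state_inv s (insert (p, k, q) D) D {} {} g \<phi>"
proof -
  obtain rk rep ys where inv: "machine_inv (heap s) (free s) (regs s 3) rk rep ys D D {} {} g"
    and \<phi>: "\<phi> = pot (heap s) (free s) rk ys"
    and r: "regs s 6 = Null" "regs s 7 = Num 1" "lo \<le> free s"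
      "regs s 2 = (if free s = lo then Null else Ref (free s - 1))"
    using J unfolding state_inv_def by blast
  have gi: "graph_inv (heap s) (free s) rep D g" using inv by (simp add: machine_inv_def)
  have dem: "demanded rep (insert (p, k, q) D) a j b" if "demanded rep D a j b" for a j b
    using that unfolding demanded_def by blast
  have "graph_inv (heap s) (free s) rep (insert (p, k, q) D) g"
    unfolding graph_inv_def
  proof (intro conjI)
    show "\<forall>a\<in>nodes (free s). \<forall>j\<in>set ks. heap s a j = Null \<or>
        (\<exists>r\<in>nodes (free s). heap s a j = Ref r \<and> demanded rep (insert (p, k, q) D) a j r)"
      using gi dem unfolding graph_inv_def by blast
    show "\<forall>p' k' q'. (p', k', q') \<in> insert (p, k, q) D \<longrightarrow>
        p' \<in> nodes (free s) \<and> q' \<in> nodes (free s) \<and> k' \<in> set ks \<and> keyE k' (g p') (g q')"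
      using gi p q k unfolding graph_inv_def by blast
    show "\<forall>a\<in>nodes (free s). g (rep a) = g a" using gi unfolding graph_inv_def by blast
  qed
  then have "machine_inv (heap s) (free s) (regs s 3) rk rep ys (insert (p, k, q) D) D {} {} g"
    using inv by (simp add: machine_inv_def)
  from state_invI[OF this r] show ?thesis using \<phi> by simp
qed

lemma run_half_edge:
  assumes J: "bs s D g \<phi>" and p: "p \<in> nodes (free s)" "regs s x = Ref p"
    and q: "q \<in> nodes (free s)" "regs s y = Ref q" and xy: "x \<notin> scratch_regs \<union> {20, 21}" "y \<notin> scratch_regs \<union> {20, 21}"
    and k: "k \<in> set ks" "keyE k (g p) (g q)"
  shows "runs B (half_edge_prog K k x y) s (post s D g \<phi> (scratch_regs \<union> {20, 21}) 0 (cP + 2)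
    (\<lambda>D' g' s'. (p, k, q) \<in> D' \<and> g' = g))"
proof -
  let ?s = "s\<lparr>regs := (regs s)(20 := Ref p, 21 := Ref q)\<rparr>"
  have J': "state_inv ?s (insert (p, k, q) D) D {} {} g \<phi>"
    using bs_insert[OF J p(1) q(1) k] by (simp add: state_inv_def)
  have "runs B (put_prog K k) ?s (\<lambda>t s'. \<exists>\<phi>'.
    state_inv s' (insert (p, k, q) D) (insert (p, k, q) D) (insert (p, k, q) {}) {} g \<phi>' \<and> frame ?s s' \<and>
    (\<forall>r. r \<notin> scratch_regs \<longrightarrow> regs s' r = regs ?s r) \<and> t + \<phi> \<le> \<phi>' + cP)"
    by (rule run_put[OF J']) (use p q k in auto)
  then have "runs B (put_prog K k) ?s (\<lambda>t. post s D g \<phi> (scratch_regs \<union> {20, 21}) 0 (cP + 2)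
    (\<lambda>D' g' s'. (p, k, q) \<in> D' \<and> g' = g) (t + 2))"
  proof (rule runs_mono)
    fix t s' assume "\<exists>\<phi>'. state_inv s' (insert (p, k, q) D) (insert (p, k, q) D) (insert (p, k, q) {}) {} g \<phi>' \<and>
      frame ?s s' \<and> (\<forall>r. r \<notin> scratch_regs \<longrightarrow> regs s' r = regs ?s r) \<and> t + \<phi> \<le> \<phi>' + cP"
    then obtain \<phi>' where *: "state_inv s' (insert (p, k, q) D) (insert (p, k, q) D) (insert (p, k, q) {}) {} g \<phi>'"
      "frame ?s s'" "\<forall>r. r \<notin> scratch_regs \<longrightarrow> regs s' r = regs ?s r" "t + \<phi> \<le> \<phi>' + cP" by blast
    have "bs s' (insert (p, k, q) D) g \<phi>'" by (rule state_inv_weaken[OF *(1)]) auto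
    then show "post s D g \<phi> (scratch_regs \<union> {20, 21}) 0 (cP + 2)
      (\<lambda>D' g' s'. (p, k, q) \<in> D' \<and> g' = g) (t + 2) s'"
      by (rule postI) (use *(2-) in \<open>auto simp: frame_def\<close>)
  qed
  then show ?thesis
    using p q xy by (auto simp: half_edge_prog_def runs_simps set_reg_def numeral_2_eq_2 elim!: runs_mono)
qed

text \<open>Cost per letter of an attached loop: a new record, two half edges and a copy, rounded
  up.\<close>

abbreviation cE :: nat where "cE \<equiv> 2 * cP + 20"

lemma run_edge:
  assumes J: "bs s D g \<phi>" and p: "p \<in> nodes (free s)" "regs s x = Ref p"
    and q: "q \<in> nodes (free s)" "regs s y = Ref q" and xy: "x \<notin> scratch_regs \<union> {20, 21}" "y \<notin> scratch_regs \<union> {20, 21}"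
    and l: "fst l \<in> set xs" "go E l (g p) (g q)"
  shows "runs B (edge_prog K code l x y) s (post s D g \<phi> (scratch_regs \<union> {20, 21}) 0 (2 * cP + 4)
    (\<lambda>D' g' s'. go (ED D') l p q \<and> g' = g))"
proof -
  let ?c = "code (fst l)"
  have keys: "2 * ?c \<in> set ks" "2 * ?c + 1 \<in> set ks" using l(1) by (auto simp: set_all_keys)
  have edge: "runs B (Seq (half_edge_prog K (2 * ?c) x y) (half_edge_prog K (2 * ?c + 1) y x)) s
     (post s D g \<phi> (scratch_regs \<union> {20, 21}) (0 + 0) ((cP + 2) + (cP + 2))
     (\<lambda>D' g' s'. ED D' p (fst l) q \<and> g' = g))"
    if p: "p \<in> nodes (free s)" "regs s x = Ref p" and q: "q \<in> nodes (free s)" "regs s y = Ref q"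
      and xy: "x \<notin> scratch_regs \<union> {20, 21}" "y \<notin> scratch_regs \<union> {20, 21}"
      and Epq: "E (g p) (fst l) (g q)" for p q x y
  proof (rule post_Seq[OF subset_refl subset_refl run_half_edge[OF J p q xy keys(1)]])
    show "keyE (2 * ?c) (g p) (g q)" using Epq keyE_iff(1)[OF l(1)] by blast
    fix s1 D1 g1 \<phi>1 assume *: "bs s1 D1 g1 \<phi>1" "D \<subseteq> D1" "\<forall>a<free s. g1 a = g a" "free s \<le> free s1"
      "free s1 \<le> free s + 0" "\<forall>r. r \<notin> scratch_regs \<union> {20, 21} \<longrightarrow> regs s1 r = regs s r"
      "(p, 2 * ?c, q) \<in> D1 \<and> g1 = g"
    have "runs B (half_edge_prog K (2 * ?c + 1) y x) s1 (post s1 D1 g1 \<phi>1 (scratch_regs \<union> {20, 21}) 0 (cP + 2)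
        (\<lambda>D' g' s'. (q, 2 * ?c + 1, p) \<in> D' \<and> g' = g1))"
    proof (rule run_half_edge[OF *(1) _ _ _ _ xy(2,1) keys(2)])
      show "keyE (2 * ?c + 1) (g1 q) (g1 p)" using Epq keyE_iff(2)[OF l(1)] *(7) by blast
    qed (use * p q xy in auto)
    then show "runs B (half_edge_prog K (2 * ?c + 1) y x) s1 (post s1 D1 g1 \<phi>1 (scratch_regs \<union> {20, 21}) 0 (cP + 2)
        (\<lambda>D' g' s'. ED D' p (fst l) q \<and> g' = g))"
      by (rule post_weaken) (use * l(1) in \<open>auto simp: ED_def\<close>)
  qed
  show ?thesis
  proof (cases "snd l")
    case True
    then have "E (g p) (fst l) (g q)" using l(2) by (simp add: go_def)
    from edge[OF p q xy this] show ?thesis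
      using True unfolding edge_prog_def by (simp, elim post_weaken) (auto simp: go_def)
  next
    case False
    then have "E (g q) (fst l) (g p)" using l(2) by (simp add: go_def)
    from edge[OF q p xy(2,1) this] show ?thesis
      using False unfolding edge_prog_def by (simp, elim post_weaken) (auto simp: go_def)
  qed
qed

lemma post_new:
  assumes J: "bs s D g \<phi>" and size: "free s < lo + nmax" and x: "x \<notin> {2, 3, 6, 7}" "x \<in> W" "2 \<in> W"
  shows "runs B (new_prog K x) s (post s D g \<phi> W 1 4
    (\<lambda>D' g' s'. D' = D \<and> regs s' x = Ref (free s) \<and> g' (free s) = P \<and> free s' = Suc (free s)))"
proof (rule runs_mono[OF run_new[OF J size x(1), of P]])
  fix t :: nat and s' assume *: "t = 4 \<and> bs s' D (g(free s := P)) \<phi> \<and> free s' = Suc (free s) \<and>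
    regs s' = (regs s)(x := Ref (free s), 2 := Ref (free s)) \<and> (\<forall>a<free s. heap s' a = heap s a)"
  then have J': "bs s' D (g(free s := P)) \<phi>" by blast
  show "post s D g \<phi> W 1 4
    (\<lambda>D' g' s'. D' = D \<and> regs s' x = Ref (free s) \<and> g' (free s) = P \<and> free s' = Suc (free s)) t s'"
    by (rule postI[OF J']) (use * x bs_regs(3)[OF J] in auto)
qed

abbreviation attach_regs :: "nat set" where
  "attach_regs \<equiv> scratch_regs \<union> {2, 6, 20, 21, 25, 26}"

lemma run_attach:
  assumes "r \<noteq> []" "bs s D g \<phi>" "p \<in> nodes (free s)" "regs s 25 = Ref p" "z \<in> nodes (free s)" "regs s 24 = Ref z"
    "run E (g p) r (g z)" "r \<in> words (set xs)" "free s + length r \<le> lo + nmax"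
  shows "runs B (attach_prog K code r) s (post s D g \<phi> attach_regs (length r) (length r * cE)
    (\<lambda>D' g' s'. run (ED D') p r z))"
  using assms
proof (induction r arbitrary: s D g \<phi> p rule: induct_list012)
  case (2 l)
  have "runs B (edge_prog K code l 25 24) s (post s D g \<phi> (scratch_regs \<union> {20, 21}) 0 (2 * cP + 4)
    (\<lambda>D' g' s'. go (ED D') l p z \<and> g' = g))"
    by (rule run_edge) (use 2 in auto)
  then show ?case
    unfolding attach_prog.simps by (rule post_weaken) auto
next
  case (3 l l' r)
  \<comment> \<open>The path in the target graph supplies the image of the record to be
    created.\<close>
  obtain P where P: "go E l (g p) P" "run E P (l' # r) (g z)" using 3(9) by auto
  have "runs B (Seq (new_prog K 26) (Seq (edge_prog K code l 25 26)
     (Seq (Copy 25 26) (attach_prog K code (l' # r))))) s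
    (post s D g \<phi> attach_regs (1 + (0 + (0 + length (l' # r)))) (4 + ((2 * cP + 4) + (1 + length (l' # r) * cE)))
     (\<lambda>D' g' s'. run (ED D') p (l # l' # r) z))"
  proof (rule post_Seq[OF _ subset_refl post_new[OF 3(4), where P = P and W = "{2, 26}"]])
    fix s1 D1 g1 \<phi>1 assume 1: "bs s1 D1 g1 \<phi>1" "D \<subseteq> D1" "\<forall>a<free s. g1 a = g a" "free s \<le> free s1"
      "\<forall>r. r \<notin> {2, 26} \<longrightarrow> regs s1 r = regs s r"
      "D1 = D \<and> regs s1 26 = Ref (free s) \<and> g1 (free s) = P \<and> free s1 = Suc (free s)"
    have lo: "lo \<le> free s" using bs_regs(3)[OF 3(4)] .
    show "runs B (Seq (edge_prog K code l 25 26) (Seq (Copy 25 26) (attach_prog K code (l' # r)))) s1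
      (post s1 D1 g1 \<phi>1 attach_regs (0 + (0 + length (l' # r))) ((2 * cP + 4) + (1 + length (l' # r) * cE))
       (\<lambda>D' g' s'. run (ED D') p (l # l' # r) z))"
    proof (rule post_Seq[where ?W1.0 = "scratch_regs \<union> {20, 21}" and ?W2.0 = attach_regs])
      show "runs B (edge_prog K code l 25 26) s1 (post s1 D1 g1 \<phi>1 (scratch_regs \<union> {20, 21}) 0 (2 * cP + 4)
        (\<lambda>D' g' s'. go (ED D') l p (free s) \<and> g' = g1))"
        by (rule run_edge[OF 1(1)]) (use 1 3 lo P in auto)
      fix s2 D2 g2 \<phi>2 assume 2: "bs s2 D2 g2 \<phi>2" "D1 \<subseteq> D2" "free s1 \<le> free s2" "free s2 \<le> free s1 + 0"
        "\<forall>r. r \<notin> scratch_regs \<union> {20, 21} \<longrightarrow> regs s2 r = regs s1 r"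
        "go (ED D2) l p (free s) \<and> g2 = g1"
      show "runs B (Seq (Copy 25 26) (attach_prog K code (l' # r))) s2
        (post s2 D2 g2 \<phi>2 attach_regs (0 + length (l' # r)) (1 + length (l' # r) * cE)
         (\<lambda>D' g' s'. run (ED D') p (l # l' # r) z))"
      proof (rule post_Seq[where ?W2.0 = attach_regs, OF _ _ post_Copy[OF 2(1), where W = "{25}"]])
        fix s3 D3 g3 \<phi>3 assume h3: "bs s3 D3 g3 \<phi>3" "D2 \<subseteq> D3" "free s2 \<le> free s3" "free s3 \<le> free s2 + 0"
          "D3 = D2 \<and> g3 = g2 \<and> s3 = set_reg s2 25 (regs s2 26)"
        have "runs B (attach_prog K code (l' # r)) s3
          (post s3 D3 g3 \<phi>3 attach_regs (length (l' # r)) (length (l' # r) * cE)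
          (\<lambda>D' g' s'. run (ED D') (free s) (l' # r) z))"
          by (rule "3.IH"(2)[OF _ h3(1)]) (use 1 2 3 h3 lo P in auto)
        then show "runs B (attach_prog K code (l' # r)) s3
          (post s3 D3 g3 \<phi>3 attach_regs (length (l' # r)) (length (l' # r) * cE)
          (\<lambda>D' g' s'. run (ED D') p (l # l' # r) z))"
        proof (rule post_weaken)
          fix D' g' s' assume "D3 \<subseteq> D'" "run (ED D') (free s) (l' # r) z"
          moreover have "go (ED D') l p (free s)"
            using go_ED_mono[of D2 l p "free s" D'] 2(6) h3(5) \<open>D3 \<subseteq> D'\<close> by simp
          ultimately show "run (ED D') p (l # l' # r) z" by auto
        qed auto
      qed auto
    qed auto
  qed (use 3 in auto)
  then show ?case unfolding attach_prog.simps by (rule post_weaken) auto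
qed simp

end

definition final_keys :: "nat \<Rightarrow> nat list \<Rightarrow> com" where
  "final_keys K ks = foldr (\<lambda>k c. Seq (Seq (Load 10 30 k) (Cond (Equal 10 6) (SetNull 6)
     (Seq (find_prog K) (Store 30 k 10)))) c) ks (SetNull 6)"

definition final_prog :: "nat \<Rightarrow> nat list \<Rightarrow> com" where
  "final_prog K ks = Seq (Seq (Copy 30 2) (neq_flag 13 30 6))
     (Seq (While (Equal 13 7) (Seq (final_keys K ks) (Seq (Load 30 30 (2 * K + 3)) (neq_flag 13 30 6))))
       (Seq (Copy 10 1) (Seq (find_prog K) (Copy 0 10))))"

text \<open>The loops \<open>bl\<close> give the base point its vertex group, also when no input
  letter is adjacent to it.\<close>

definition build_prog where
  "build_prog K code tlo hlo bl xs = Seq (new_prog K 1) (Seq (Copy 4 1) (Seq (Copy 24 1)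
     (Seq (loops_prog K code bl) (Seq (neq_flag 13 0 6)
       (While (Equal 13 7) (read_prog K code tlo hlo xs))))))"

definition fold_prog where
  "fold_prog K code tlo hlo bl xs =
     Seq (Seq (SetNull 6) (Seq (SetNum 7 1) (Seq (SetNull 2) (SetNull 3))))
       (Seq (build_prog K code tlo hlo bl xs)
         (Seq (drain_prog K (all_keys code xs)) (final_prog K (all_keys code xs))))"

text \<open>The input lies below the address \<open>lo\<close> and records are created above it, so
  the list stays intact while the graph is built.\<close>

fun cells :: "('x \<Rightarrow> nat) \<Rightarrow> nat \<Rightarrow> memory \<Rightarrow> val \<Rightarrow> (('x \<times> bool) \<times> bool) list \<Rightarrow> bool" where
  "cells code lo hp w [] \<longleftrightarrow> w = Null"
| "cells code lo hp w (lm # L) \<longleftrightarrow> (\<exists>i<lo. w = Ref i \<and> hp i 0 = Num (int (code (fst (fst lm)))) \<and>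
     hp i 1 = Num (of_bool (snd (fst lm))) \<and> hp i 2 = Num (of_bool (snd lm)) \<and> cells code lo hp (hp i 3) L)"

lemma cells_cong: "\<forall>a<lo. hp' a = hp a \<Longrightarrow> cells code lo hp' w L \<longleftrightarrow> cells code lo hp w L"
  by (induction L arbitrary: w) auto

section \<open>Correctness and cost of the building phase\<close>

context letter_machine
begin

abbreviation "size_of rs \<equiv> sum_list (map length rs)"
abbreviation "loops_cost rs \<equiv> sum_list (map (\<lambda>r. length r * cE + 1) rs) + 1"

lemma run_loops:
  assumes "bs s D g \<phi>" "z \<in> nodes (free s)" "regs s 24 = Ref z" "free s + size_of rs \<le> lo + nmax"
    "\<And>r. r \<in> set rs \<Longrightarrow> r \<noteq> [] \<and> r \<in> words (set xs) \<and> run E (g z) r (g z)"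
  shows "runs B (loops_prog K code rs) s (post s D g \<phi> attach_regs (size_of rs) (loops_cost rs)
    (\<lambda>D' g' s'. \<forall>r\<in>set rs. run (ED D') z r z))"
  using assms
proof (induction rs arbitrary: s D g \<phi>)
  case Nil
  have "runs B (SetNull 6) s (post s D g \<phi> attach_regs 0 1 (\<lambda>D' g' s'. \<forall>r\<in>set []. run (ED D') z r z))"
    by (rule post_SetNull6[OF Nil(1)]) auto
  then show ?case by (simp add: loops_prog_def)
next
  case (Cons r rs)
  have "runs B (Seq (Seq (Copy 25 24) (attach_prog K code r)) (loops_prog K code rs)) s
    (post s D g \<phi> attach_regs ((0 + length r) + size_of rs) ((1 + length r * cE) + loops_cost rs)
    (\<lambda>D' g' s'. \<forall>r\<in>set (r # rs). run (ED D') z r z))"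
  proof (rule post_Seq[OF subset_refl subset_refl])
    show "runs B (Seq (Copy 25 24) (attach_prog K code r)) s
      (post s D g \<phi> attach_regs (0 + length r) (1 + length r * cE) (\<lambda>D' g' s'. run (ED D') z r z))"
    proof (rule post_Seq[where ?W2.0 = attach_regs, OF _ _ post_Copy[OF Cons.prems(1), where W = "{25}"]])
      fix s1 D1 g1 \<phi>1 assume 1: "bs s1 D1 g1 \<phi>1" "D1 = D \<and> g1 = g \<and> s1 = set_reg s 25 (regs s 24)"
      show "runs B (attach_prog K code r) s1 (post s1 D1 g1 \<phi>1 attach_regs (length r) (length r * cE)
        (\<lambda>D' g' s'. run (ED D') z r z))"
        by (rule run_attach[OF _ 1(1)]) (use 1 Cons.prems in auto)
    qed auto
    fix s1 D1 g1 \<phi>1 assume 1: "bs s1 D1 g1 \<phi>1" "\<forall>a<free s. g1 a = g a" "free s \<le> free s1"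
      "free s1 \<le> free s + (0 + length r)" "\<forall>r. r \<notin> attach_regs \<longrightarrow> regs s1 r = regs s r" "run (ED D1) z r z"
    have "runs B (loops_prog K code rs) s1 (post s1 D1 g1 \<phi>1 attach_regs (size_of rs) (loops_cost rs)
      (\<lambda>D' g' s'. \<forall>r\<in>set rs. run (ED D') z r z))"
      by (rule Cons.IH[OF 1(1)]) (use 1 Cons.prems in auto)
    then show "runs B (loops_prog K code rs) s1 (post s1 D1 g1 \<phi>1 attach_regs (size_of rs) (loops_cost rs)
      (\<lambda>D' g' s'. \<forall>r\<in>set (r # rs). run (ED D') z r z))"
      by (rule post_weaken) (use 1(6) run_ED_mono in auto)
  qed
  then show ?case by (simp add: loops_prog_def algebra_simps)
qed

abbreviation "letter_size x \<equiv> size_of (tlo x) + size_of (hlo x)"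
abbreviation "letter_cost x \<equiv> 2 * cP + loops_cost (tlo x) + loops_cost (hlo x) + 6"
abbreviation "letter_regs \<equiv> attach_regs \<union> {24}"

lemma looped_ED_mono: "looped tlo hlo (ED D) p x q \<Longrightarrow> D \<subseteq> D' \<Longrightarrow> looped tlo hlo (ED D') p x q"
  using run_ED_mono[of D _ _ _ D'] unfolding looped_def ED_def by blast

lemma run_letter:
  assumes J: "bs s D g \<phi>" and p: "p \<in> nodes (free s)" "regs s 4 = Ref p"
    and q: "q \<in> nodes (free s)" "regs s 5 = Ref q" and l: "fst l \<in> set xs" "go (looped tlo hlo E) l (g p) (g q)"
    and size: "free s + letter_size (fst l) \<le> lo + nmax"
  shows "runs B (letter_prog K code tlo hlo l) s (post s D g \<phi> letter_regs (letter_size (fst l))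
    (letter_cost (fst l)) (\<lambda>D' g' s'. go (looped tlo hlo (ED D')) l p q))"
proof -
  let ?x = "fst l"
  define a b where "a = (if snd l then 4 else 5 :: nat)" and "b = (if snd l then 5 else 4 :: nat)"
  define pa pb where "pa = (if snd l then p else q)" and "pb = (if snd l then q else p)"
  have ab: "a \<in> {4, 5}" "b \<in> {4, 5}" "regs s a = Ref pa" "regs s b = Ref pb"
    "pa \<in> nodes (free s)" "pb \<in> nodes (free s)"
    using p q by (auto simp: a_def b_def pa_def pb_def)
  have e: "looped tlo hlo E (g pa) ?x (g pb)" using l(2) by (auto simp: go_def pa_def pb_def)
  have "runs B (Seq (edge_prog K code (?x, True) a b)
       (Seq (Copy 24 a) (Seq (loops_prog K code (tlo ?x))
         (Seq (Copy 24 b) (loops_prog K code (hlo ?x)))))) s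
    (post s D g \<phi> letter_regs (0 + (0 + (size_of (tlo ?x) + (0 + size_of (hlo ?x)))))
      ((2 * cP + 4) + (1 + (loops_cost (tlo ?x) + (1 + loops_cost (hlo ?x)))))
      (\<lambda>D' g' s'. looped tlo hlo (ED D') pa ?x pb))"
  proof (rule post_Seq[where ?W1.0 = "scratch_regs \<union> {20, 21}" and ?W2.0 = letter_regs])
    show "runs B (edge_prog K code (?x, True) a b) s (post s D g \<phi> (scratch_regs \<union> {20, 21}) 0 (2 * cP + 4)
      (\<lambda>D' g' s'. go (ED D') (?x, True) pa pb \<and> g' = g))"
      by (rule run_edge[OF J]) (use ab l(1) e in \<open>auto simp: looped_def\<close>)
    fix s1 D1 g1 \<phi>1 assume 1: "bs s1 D1 g1 \<phi>1" "free s \<le> free s1" "free s1 \<le> free s + 0"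
      "\<forall>r. r \<notin> scratch_regs \<union> {20, 21} \<longrightarrow> regs s1 r = regs s r" "go (ED D1) (?x, True) pa pb \<and> g1 = g"
    show "runs B (Seq (Copy 24 a) (Seq (loops_prog K code (tlo ?x)) (Seq (Copy 24 b) (loops_prog K code (hlo ?x))))) s1
      (post s1 D1 g1 \<phi>1 letter_regs (0 + (size_of (tlo ?x) + (0 + size_of (hlo ?x))))
        (1 + (loops_cost (tlo ?x) + (1 + loops_cost (hlo ?x)))) (\<lambda>D' g' s'. looped tlo hlo (ED D') pa ?x pb))"
    proof (rule post_Seq[where ?W2.0 = letter_regs, OF _ _ post_Copy[OF 1(1), where W = "{24}"]])
      fix s2 D2 g2 \<phi>2 assume 2: "bs s2 D2 g2 \<phi>2"
        "D2 = D1 \<and> g2 = g1 \<and> s2 = set_reg s1 24 (regs s1 a)"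
      show "runs B (Seq (loops_prog K code (tlo ?x)) (Seq (Copy 24 b) (loops_prog K code (hlo ?x)))) s2
        (post s2 D2 g2 \<phi>2 letter_regs (size_of (tlo ?x) + (0 + size_of (hlo ?x)))
          (loops_cost (tlo ?x) + (1 + loops_cost (hlo ?x))) (\<lambda>D' g' s'. looped tlo hlo (ED D') pa ?x pb))"
      proof (rule post_Seq[where ?W1.0 = attach_regs and ?W2.0 = letter_regs])
        show "runs B (loops_prog K code (tlo ?x)) s2 (post s2 D2 g2 \<phi>2 attach_regs (size_of (tlo ?x))
          (loops_cost (tlo ?x)) (\<lambda>D' g' s'. \<forall>r\<in>set (tlo ?x). run (ED D') pa r pa))"
          by (rule run_loops[OF 2(1)]) (use 1 2 ab e size loops[OF l(1)] in \<open>auto simp: looped_def\<close>)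
        fix s3 D3 g3 \<phi>3 assume 3: "bs s3 D3 g3 \<phi>3" "D2 \<subseteq> D3" "\<forall>a<free s2. g3 a = g2 a" "free s2 \<le> free s3"
          "free s3 \<le> free s2 + size_of (tlo ?x)" "\<forall>r. r \<notin> attach_regs \<longrightarrow> regs s3 r = regs s2 r"
          "\<forall>r\<in>set (tlo ?x). run (ED D3) pa r pa"
        show "runs B (Seq (Copy 24 b) (loops_prog K code (hlo ?x))) s3
          (post s3 D3 g3 \<phi>3 letter_regs (0 + size_of (hlo ?x)) (1 + loops_cost (hlo ?x))
            (\<lambda>D' g' s'. looped tlo hlo (ED D') pa ?x pb))"
        proof (rule post_Seq[where ?W2.0 = letter_regs, OF _ _ post_Copy[OF 3(1), where W = "{24}"]])
          fix s4 D4 g4 \<phi>4 assume 4: "bs s4 D4 g4 \<phi>4"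
            "D4 = D3 \<and> g4 = g3 \<and> s4 = set_reg s3 24 (regs s3 b)"
          have "runs B (loops_prog K code (hlo ?x)) s4 (post s4 D4 g4 \<phi>4 attach_regs (size_of (hlo ?x))
            (loops_cost (hlo ?x)) (\<lambda>D' g' s'. \<forall>r\<in>set (hlo ?x). run (ED D') pb r pb))"
            by (rule run_loops[OF 4(1)]) (use 1 2 3 4 ab e size loops[OF l(1)] in \<open>auto simp: looped_def\<close>)
          then show "runs B (loops_prog K code (hlo ?x)) s4 (post s4 D4 g4 \<phi>4 letter_regs (size_of (hlo ?x))
            (loops_cost (hlo ?x)) (\<lambda>D' g' s'. looped tlo hlo (ED D') pa ?x pb))"
          proof (rule post_weaken)
            fix D' g' s' assume D': "D4 \<subseteq> D'" "\<forall>r\<in>set (hlo ?x). run (ED D') pb r pb"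
            have "ED D1 pa ?x pb" using 1(5) by simp
            then have "ED D' pa ?x pb" using D'(1) 2(2) 3(2) 4(2) unfolding ED_def by blast
            moreover have "D3 \<subseteq> D'" using D'(1) 4(2) by blast
            ultimately show "looped tlo hlo (ED D') pa ?x pb"
              using D'(2) 3(7) run_ED_mono unfolding looped_def by blast
          qed auto
        qed (use ab in auto)
      qed auto
    qed (use ab in auto)
  qed auto
  then have "runs B (letter_prog K code tlo hlo l) s (post s D g \<phi> letter_regs (0 + (0 + (size_of (tlo ?x) + (0 + size_of (hlo ?x)))))
      ((2 * cP + 4) + (1 + (loops_cost (tlo ?x) + (1 + loops_cost (hlo ?x)))))
      (\<lambda>D' g' s'. looped tlo hlo (ED D') pa ?x pb))"
    unfolding letter_prog_def Let_def a_def b_def .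
  then show ?thesis
    by (rule post_weaken) (auto simp: go_def pa_def pb_def)
qed

abbreviation "all_size ys \<equiv> sum_list (map (\<lambda>x. letter_size x) ys)"
abbreviation "all_cost ys \<equiv> sum_list (map (\<lambda>x. letter_cost x + 5) ys)"

text \<open>The bounds are summed over all letters although a single branch is taken; they hold
  whichever branch it is, so the bound per input letter is uniform. The 5 units per letter cover the
  comparisons.\<close>

lemma run_dispatch:
  assumes "bs s D g \<phi>" "p \<in> nodes (free s)" "regs s 4 = Ref p" "q \<in> nodes (free s)" "regs s 5 = Ref q"
    "go (looped tlo hlo E) l (g p) (g q)" "free s + all_size ys \<le> lo + nmax"
    "regs s 31 = Num (int (code (fst l)))" "regs s 32 = Num (of_bool (snd l))" "fst l \<in> set ys" "set ys \<subseteq> set xs"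
  shows "runs B (dispatch_prog K code tlo hlo ys) s (post s D g \<phi> (letter_regs \<union> {34}) (all_size ys)
    (all_cost ys) (\<lambda>D' g' s'. go (looped tlo hlo (ED D')) l p q))"
  using assms
proof (induction ys arbitrary: s)
  case (Cons y ys)
  let ?s = "set_reg s 34 (Num (int (code y)))"
  let ?Q = "\<lambda>D' g' s'. go (looped tlo hlo (ED D')) l p q"
  have J: "bs ?s D g \<phi>" using Cons.prems(1) by (rule bs_set_reg) simp
  have y: "y \<in> set xs" "\<bar>int (code y)\<bar> \<le> B" using Cons.prems(11) code_B[of y] by auto
  have eq: "code y = code (fst l) \<longleftrightarrow> y = fst l"
    using inj_on_eq_iff[OF inj_code y(1)] Cons.prems(10,11) by auto
  have lift: "post s D g \<phi> (letter_regs \<union> {34}) m' c' ?Q (t + k) s'"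
    if u: "post ?s D g \<phi> W m c ?Q t s'" and W: "W \<subseteq> letter_regs \<union> {34}" and k: "m \<le> m'" "c + k \<le> c'" for W m c t s' m' c' k
  proof -
    obtain \<phi>2 D2 g2 where **: "bs s' D2 g2 \<phi>2" "D \<subseteq> D2" "\<forall>a<free s. g2 a = g a" "free s \<le> free s'"
      "free s' \<le> free s + m" "\<forall>a<lo. heap s' a = heap s a"
      "\<forall>r. r \<notin> W \<longrightarrow> regs s' r = regs ?s r" "t + \<phi> \<le> \<phi>2 + c" "?Q D2 g2 s'"
      using u unfolding post_def set_reg_simps(1,2) by blast
    have "regs s' r = regs s r" if r: "r \<notin> letter_regs \<union> {34}" for r
    proof -
      have "r \<notin> W" "r \<noteq> 34" using r W by blast+
      then show ?thesis using **(7) by simp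
    qed
    then show ?thesis by (intro postI[OF **(1)]) (use ** k in auto)
  qed
  show ?case
  proof (cases "y = fst l")
    case True
    have "runs B (letter_prog K code tlo hlo l) ?s (post ?s D g \<phi> letter_regs (letter_size (fst l))
      (letter_cost (fst l)) ?Q)"
      by (rule run_letter[OF J]) (use Cons.prems True y in auto)
    then have "runs B (letter_prog K code tlo hlo l) ?s
      (\<lambda>t. post s D g \<phi> (letter_regs \<union> {34}) (all_size (y # ys)) (all_cost (y # ys)) ?Q (t + 3))"
      by (rule runs_mono) (rule lift, use True in auto)
    moreover have "l = (y, snd l)" using True by simp
    ultimately show ?thesis
      using Cons.prems(8,9) bs_regs[OF Cons.prems(1)] True y(2)
      by (cases "snd l") (simp_all add: dispatch_prog_def runs_Seq runs_SetNum runs_Cond numeral_3_eq_3)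
  next
    case False
    have "runs B (dispatch_prog K code tlo hlo ys) ?s (post ?s D g \<phi> (letter_regs \<union> {34}) (all_size ys)
      (all_cost ys) ?Q)"
      by (rule Cons.IH[OF J]) (use Cons.prems False in auto)
    then have IH: "runs B (dispatch_prog K code tlo hlo ys) ?s
      (\<lambda>t. post s D g \<phi> (letter_regs \<union> {34}) (all_size (y # ys)) (all_cost (y # ys)) ?Q (t + 2))"
      by (rule runs_mono) (rule lift, auto)
    have prog: "dispatch_prog K code tlo hlo (y # ys) = Seq (SetNum 34 (int (code y))) (Cond (Equal 31 34)
        (Cond (Equal 32 7) (letter_prog K code tlo hlo (y, True)) (letter_prog K code tlo hlo (y, False)))
        (dispatch_prog K code tlo hlo ys))"
      by (simp add: dispatch_prog_def)
    have "\<not> test_holds (Equal 31 34) ?s" using Cons.prems(8) False eq by simp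
    note nt = if_not_P[OF this]
    have "1 + Suc t = t + 2" for t :: nat by simp
    then show ?thesis
      unfolding prog runs_Seq[of B "SetNum x k" for x k] runs_SetNum runs_Cond nt using IH y(2) by simp
  qed
qed simp

lemma post_Load:
  assumes "bs s D g \<phi>" "x \<notin> {2, 3, 6, 7}" "x \<in> W" "regs s y = Ref a"
  shows "runs B (Load x y k) s (post s D g \<phi> W 0 1 (\<lambda>D' g' s'. D' = D \<and> g' = g \<and> s' = set_reg s x (heap s a k)))"
proof -
  have "post s D g \<phi> W 0 1 (\<lambda>D' g' s'. D' = D \<and> g' = g \<and> s' = set_reg s x (heap s a k)) 1 (set_reg s x (heap s a k))"
    by (rule post_set_reg) (use assms in auto)
  then show ?thesis unfolding runs_Load using assms(4) by blast
qed

lemma post_neq_flag: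
  assumes "bs s D g \<phi>" "x \<notin> {2, 3, 6, 7}" "x \<in> W"
  shows "runs B (neq_flag x y 6) s (post s D g \<phi> W 0 2
    (\<lambda>D' g' s'. D' = D \<and> g' = g \<and> s' = set_reg s x (if regs s y = Null then Null else Num 1)))"
proof -
  have "post s D g \<phi> W 0 2 (\<lambda>D' g' s'. D' = D \<and> g' = g \<and> s' = set_reg s x (if regs s y = Null then Null else Num 1))
      2 (set_reg s x (if regs s y = Null then Null else Num 1))"
    by (rule post_set_reg) (use assms in auto)
  then show ?thesis
    using bs_regs[OF assms(1)] by (cases "regs s y = Null") (simp_all add: neq_flag_def runs_simps numeral_2_eq_2)
qed

abbreviation "read_regs \<equiv> letter_regs \<union> {0, 4, 5, 13, 31, 32, 33, 34}"
abbreviation "read_size \<equiv> 1 + all_size xs"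
abbreviation "read_cost \<equiv> all_cost xs + 12"

text \<open>The image \<open>Q\<close> of the next vertex is prescribed by the path in the target
  graph. For a marked letter it is the image of the base record, which is then used instead of a new
  one.\<close>

lemma run_read:
  assumes J: "bs s D g \<phi>" and i: "i < lo" "regs s 0 = Ref i" "heap s i 0 = Num (int (code (fst l)))"
      "heap s i 1 = Num (of_bool (snd l))" "heap s i 2 = Num (of_bool m)"
    and b: "b \<in> nodes (free s)" "regs s 1 = Ref b" and p: "p \<in> nodes (free s)" "regs s 4 = Ref p"
    and l: "fst l \<in> set xs" "go (looped tlo hlo E) l (g p) Q" "m \<longrightarrow> Q = g b"
    and size: "free s + read_size \<le> lo + nmax"
  shows "runs B (read_prog K code tlo hlo xs) s (post s D g \<phi> read_regs read_size read_cost
    (\<lambda>D' g' s'. regs s' 0 = heap s i 3 \<and> regs s' 13 = (if heap s i 3 = Null then Null else Num 1) \<and>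
      (\<exists>q\<in>nodes (free s'). regs s' 4 = Ref q \<and> (m \<longrightarrow> q = b) \<and> g' q = Q \<and>
        go (looped tlo hlo (ED D')) l p q)))"
proof -
  let ?R = "\<lambda>D' g' s'. regs s' 0 = heap s i 3 \<and> regs s' 13 = (if heap s i 3 = Null then Null else Num 1) \<and>
      (\<exists>q\<in>nodes (free s'). regs s' 4 = Ref q \<and> (m \<longrightarrow> q = b) \<and> g' q = Q \<and>
        go (looped tlo hlo (ED D')) l p q)"
  let ?s = "set_reg (set_reg (set_reg s 31 (Num (int (code (fst l))))) 32 (Num (of_bool (snd l)))) 33 (Num (of_bool m))"
  have J1: "bs ?s D g \<phi>" by (intro bs_set_reg J) auto
  have lo: "lo \<le> free s" using bs_regs[OF J] by simp
  let ?tail = "Seq (dispatch_prog K code tlo hlo xs) (Seq (Copy 4 5) (Seq (Load 0 0 3) (neq_flag 13 0 6)))"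
  have "runs B (Seq (Cond (Equal 33 7) (Copy 5 1) (new_prog K 5)) ?tail) ?s
    (post ?s D g \<phi> read_regs (1 + (all_size xs + (0 + (0 + 0)))) (5 + (all_cost xs + (1 + (1 + 2)))) ?R)"
  proof (rule post_Seq[where ?W1.0 = "{2, 5}" and ?W2.0 = read_regs])
    show "runs B (Cond (Equal 33 7) (Copy 5 1) (new_prog K 5)) ?s (post ?s D g \<phi> {2, 5} 1 5
      (\<lambda>D' g' s'. D' = D \<and> (\<exists>q\<in>nodes (free s'). regs s' 5 = Ref q \<and> (m \<longrightarrow> q = b) \<and> g' q = Q)))"
      (is "runs B _ ?s (post ?s D g \<phi> _ _ _ ?C)")
    proof (cases m)
      case True
      have "post ?s D g \<phi> {2, 5} 0 5 ?C 2 (set_reg ?s 5 (Ref b))"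
        by (rule post_set_reg[OF J1]) (use True b l in auto)
      then have "post ?s D g \<phi> {2, 5} 1 5 ?C 2 (set_reg ?s 5 (Ref b))"
        unfolding post_def by fastforce
      then show ?thesis
        using True b bs_regs[OF J] by (simp add: runs_Cond runs_Copy numeral_2_eq_2)
    next
      case False
      have "runs B (new_prog K 5) ?s (post ?s D g \<phi> {2, 5} 1 4
        (\<lambda>D' g' s'. D' = D \<and> regs s' 5 = Ref (free ?s) \<and> g' (free ?s) = Q \<and> free s' = Suc (free ?s)))"
        by (rule post_new[OF J1]) (use size in auto)
      then have "runs B (new_prog K 5) ?s (\<lambda>t. post ?s D g \<phi> {2, 5} 1 5 ?C (Suc t))"
      proof (rule runs_mono)
        fix t s' assume "post ?s D g \<phi> {2, 5} 1 4
          (\<lambda>D' g' s'. D' = D \<and> regs s' 5 = Ref (free ?s) \<and> g' (free ?s) = Q \<and> free s' = Suc (free ?s)) t s'"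
        then obtain \<phi>2 D2 g2 where **: "bs s' D2 g2 \<phi>2" "D \<subseteq> D2" "\<forall>a<free ?s. g2 a = g a" "free ?s \<le> free s'"
          "free s' \<le> free ?s + 1" "\<forall>a<lo. heap s' a = heap ?s a"
          "\<forall>r. r \<notin> {2, 5} \<longrightarrow> regs s' r = regs ?s r" "t + \<phi> \<le> \<phi>2 + 4"
          "D2 = D \<and> regs s' 5 = Ref (free ?s) \<and> g2 (free ?s) = Q \<and> free s' = Suc (free ?s)"
          unfolding post_def by blast
        show "post ?s D g \<phi> {2, 5} 1 5 ?C (Suc t) s'"
          by (rule postI[OF **(1,2,3,4,5,6,7)]) (use **(8,9) False lo in auto)
      qed
      then show ?thesis using False bs_regs[OF J] by (simp add: runs_Cond)
    qed
    fix s1 D1 g1 \<phi>1 assume 1: "bs s1 D1 g1 \<phi>1" "D \<subseteq> D1" "\<forall>a<free ?s. g1 a = g a" "free ?s \<le> free s1"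
      "free s1 \<le> free ?s + 1" "\<forall>a<lo. heap s1 a = heap ?s a" "\<forall>r. r \<notin> {2, 5} \<longrightarrow> regs s1 r = regs ?s r"
      "D1 = D \<and> (\<exists>q\<in>nodes (free s1). regs s1 5 = Ref q \<and> (m \<longrightarrow> q = b) \<and> g1 q = Q)"
    then obtain q where q: "q \<in> nodes (free s1)" "regs s1 5 = Ref q" "m \<longrightarrow> q = b" "g1 q = Q" by blast
    show "runs B ?tail s1 (post s1 D1 g1 \<phi>1 read_regs (all_size xs + (0 + (0 + 0))) (all_cost xs + (1 + (1 + 2))) ?R)"
    proof (rule post_Seq[where ?W1.0 = "letter_regs \<union> {34}" and ?W2.0 = "{4, 0, 13}"])
      show "runs B (dispatch_prog K code tlo hlo xs) s1 (post s1 D1 g1 \<phi>1 (letter_regs \<union> {34}) (all_size xs)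
        (all_cost xs) (\<lambda>D' g' s'. go (looped tlo hlo (ED D')) l p q))"
        by (rule run_dispatch[OF 1(1)]) (use 1 q p l size in auto)
      fix s2 D2 g2 \<phi>2 assume 2: "bs s2 D2 g2 \<phi>2" "\<forall>a<free s1. g2 a = g1 a" "free s1 \<le> free s2"
        "\<forall>a<lo. heap s2 a = heap s1 a" "\<forall>r. r \<notin> letter_regs \<union> {34} \<longrightarrow> regs s2 r = regs s1 r"
        "go (looped tlo hlo (ED D2)) l p q"
      show "runs B (Seq (Copy 4 5) (Seq (Load 0 0 3) (neq_flag 13 0 6))) s2
        (post s2 D2 g2 \<phi>2 {4, 0, 13} (0 + (0 + 0)) (1 + (1 + 2)) ?R)"
      proof (rule post_Seq[where ?W2.0 = "{0, 13}", OF _ _ post_Copy[OF 2(1), where W = "{4}"]])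
        fix s3 D3 g3 \<phi>3 assume 3: "bs s3 D3 g3 \<phi>3" "D3 = D2 \<and> g3 = g2 \<and> s3 = set_reg s2 4 (regs s2 5)"
        have r0: "regs s3 0 = Ref i" "heap s3 i = heap s i" using 1 2 3 i by auto
        show "runs B (Seq (Load 0 0 3) (neq_flag 13 0 6)) s3 (post s3 D3 g3 \<phi>3 {0, 13} (0 + 0) (1 + 2) ?R)"
        proof (rule post_Seq[where ?W2.0 = "{13}", OF _ _ post_Load[OF 3(1), where W = "{0}" and a = i]])
          fix s4 D4 g4 \<phi>4 assume 4: "bs s4 D4 g4 \<phi>4" "D4 = D3 \<and> g4 = g3 \<and> s4 = set_reg s3 0 (heap s3 i 3)"
          show "runs B (neq_flag 13 0 6) s4 (post s4 D4 g4 \<phi>4 {13} 0 2 ?R)"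
            by (rule post_weaken[OF post_neq_flag[OF 4(1), where W = "{13}"]])
              (use 2 3 4 r0 q in auto)
        qed (use r0 in auto)
      qed auto
    qed auto
  qed auto
  then have "runs B (Seq (Cond (Equal 33 7) (Copy 5 1) (new_prog K 5)) ?tail) ?s
    (\<lambda>t. post s D g \<phi> read_regs read_size read_cost ?R (t + 3))"
  proof (rule runs_mono)
    fix t s' assume "post ?s D g \<phi> read_regs (1 + (all_size xs + (0 + (0 + 0)))) (5 + (all_cost xs + (1 + (1 + 2)))) ?R t s'"
    then obtain \<phi>2 D2 g2 where **: "bs s' D2 g2 \<phi>2" "D \<subseteq> D2" "\<forall>a<free s. g2 a = g a" "free s \<le> free s'"
      "free s' \<le> free s + (1 + (all_size xs + (0 + (0 + 0))))" "\<forall>a<lo. heap s' a = heap s a"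
      "\<forall>r. r \<notin> read_regs \<longrightarrow> regs s' r = regs ?s r" "t + \<phi> \<le> \<phi>2 + (5 + (all_cost xs + (1 + (1 + 2))))" "?R D2 g2 s'"
      unfolding post_def set_reg_simps(1,2) by blast
    show "post s D g \<phi> read_regs read_size read_cost ?R (t + 3) s'"
      by (rule postI[where Q = ?R, OF **(1,2,3,4) _ **(6)]) (use ** in auto)
  qed
  then show ?thesis
    using i by (simp add: read_prog_def runs_Seq[of B "Load x y n" for x y n] runs_Load numeral_3_eq_3)
qed

lemma run_read_loop:
  assumes "bs s D g \<phi>" "cells code lo (heap s) (regs s 0) L"
    "regs s 13 = (if regs s 0 = Null then Null else Num 1)"
    "b \<in> nodes (free s)" "regs s 1 = Ref b" "p \<in> nodes (free s)" "regs s 4 = Ref p"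
    "\<And>lm. lm \<in> set L \<Longrightarrow> fst (fst lm) \<in> set xs" "marked_path (go (looped tlo hlo E)) (g b) (g p) L"
    "free s + length L * read_size \<le> lo + nmax"
  shows "runs B (While (Equal 13 7) (read_prog K code tlo hlo xs)) s
    (post s D g \<phi> read_regs (length L * read_size) (length L * (read_cost + 1) + 1)
      (\<lambda>D' g' s'. marked_path (go (looped tlo hlo (ED D'))) b p L))"
  using assms
proof (induction L arbitrary: s D g \<phi> p)
  case Nil
  have "post s D g \<phi> read_regs 0 1 (\<lambda>D' g' s'. True) 1 s"
    by (rule postI[OF Nil(1)]) auto
  then show ?case
    using Nil.prems(2,3) bs_regs[OF Nil.prems(1)] by (subst runs_While) simp
next
  case (Cons lm L)
  let ?Q = "\<lambda>D' g' s'. marked_path (go (looped tlo hlo (ED D'))) b p (lm # L)"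
  obtain i where i: "i < lo" "regs s 0 = Ref i" "heap s i 0 = Num (int (code (fst (fst lm))))"
      "heap s i 1 = Num (of_bool (snd (fst lm)))" "heap s i 2 = Num (of_bool (snd lm))"
      "cells code lo (heap s) (heap s i 3) L"
    using Cons.prems(2) by auto
  obtain Q where Q: "go (looped tlo hlo E) (fst lm) (g p) Q" "snd lm \<longrightarrow> Q = g b"
      "marked_path (go (looped tlo hlo E)) (g b) Q L"
    using Cons.prems(9) by auto
  let ?R = "\<lambda>D' g' s'. regs s' 0 = heap s i 3 \<and> regs s' 13 = (if heap s i 3 = Null then Null else Num 1) \<and>
      (\<exists>q\<in>nodes (free s'). regs s' 4 = Ref q \<and> (snd lm \<longrightarrow> q = b) \<and> g' q = Q \<and>
        go (looped tlo hlo (ED D')) (fst lm) p q)"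
  have body: "runs B (read_prog K code tlo hlo xs) s (post s D g \<phi> read_regs read_size read_cost ?R)"
    by (rule run_read[OF Cons.prems(1) i(1-5) Cons.prems(4-7) _ Q(1,2)]) (use Cons.prems(8,10) in auto)
  show ?case
  proof (rule runs_WhileI[OF _ body])
    show "test_holds (Equal 13 7) s" using Cons.prems(3) i(2) bs_regs[OF Cons.prems(1)] by simp
    fix t and s1 :: mstate assume "post s D g \<phi> read_regs read_size read_cost ?R t s1"
    then obtain \<phi>1 D1 g1 where 1: "bs s1 D1 g1 \<phi>1" "D \<subseteq> D1" "\<forall>a<free s. g1 a = g a" "free s \<le> free s1"
      "free s1 \<le> free s + read_size" "\<forall>a<lo. heap s1 a = heap s a"
      "\<forall>r. r \<notin> read_regs \<longrightarrow> regs s1 r = regs s r" "t + \<phi> \<le> \<phi>1 + read_cost" "?R D1 g1 s1"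
      unfolding post_def by blast
    obtain q where q: "q \<in> nodes (free s1)" "regs s1 4 = Ref q" "snd lm \<longrightarrow> q = b" "g1 q = Q"
      "go (looped tlo hlo (ED D1)) (fst lm) p q" and r0: "regs s1 0 = heap s i 3"
      "regs s1 13 = (if heap s i 3 = Null then Null else Num 1)"
      using 1(9) by blast
    have b: "b \<in> nodes (free s1)" "g1 b = g b" using Cons.prems(4) 1(3,4) by auto
    have "runs B (While (Equal 13 7) (read_prog K code tlo hlo xs)) s1
      (post s1 D1 g1 \<phi>1 read_regs (length L * read_size) (length L * (read_cost + 1) + 1)
      (\<lambda>D' g' s'. marked_path (go (looped tlo hlo (ED D'))) b q L))"
    proof (rule Cons.IH[OF 1(1) _ _ b(1) _ q(1,2)])
      show "cells code lo (heap s1) (regs s1 0) L" unfolding cells_cong[OF 1(6)] r0 by (rule i(6))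
      show "regs s1 1 = Ref b" using 1(7) Cons.prems(5) by simp
      show "marked_path (go (looped tlo hlo E)) (g1 b) (g1 q) L" using Q(3) b(2) q(4) by simp
      show "free s1 + length L * read_size \<le> lo + nmax" using Cons.prems(10) 1(5) by simp
    qed (use r0 Cons.prems(8) in auto)
    then show "runs B (While (Equal 13 7) (read_prog K code tlo hlo xs)) s1 (\<lambda>t' s''.
      post s D g \<phi> read_regs (length (lm # L) * read_size) (length (lm # L) * (read_cost + 1) + 1) ?Q (Suc (t + t')) s'')"
    proof (rule runs_mono)
      fix t' and s2 :: mstate assume "post s1 D1 g1 \<phi>1 read_regs (length L * read_size) (length L * (read_cost + 1) + 1)
        (\<lambda>D' g' s'. marked_path (go (looped tlo hlo (ED D'))) b q L) t' s2"
      then obtain \<phi>2 D2 g2 where 2: "bs s2 D2 g2 \<phi>2" "D1 \<subseteq> D2" "\<forall>a<free s1. g2 a = g1 a" "free s1 \<le> free s2"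
        "free s2 \<le> free s1 + length L * read_size" "\<forall>a<lo. heap s2 a = heap s1 a"
        "\<forall>r. r \<notin> read_regs \<longrightarrow> regs s2 r = regs s1 r" "t' + \<phi>1 \<le> \<phi>2 + (length L * (read_cost + 1) + 1)"
        "marked_path (go (looped tlo hlo (ED D2))) b q L"
        unfolding post_def by blast
      have "go (looped tlo hlo (ED D2)) (fst lm) p q"
        using q(5) looped_ED_mono[OF _ 2(2)] by (auto simp: go_def split: if_splits)
      then have m: "?Q D2 g2 s2" using q(3) 2(9) by auto
      have time: "Suc (t + t') + \<phi> \<le> \<phi>2 + (length (lm # L) * (read_cost + 1) + 1)"
        using 1(8) 2(8) unfolding list.size add_mult_distrib by simp
      have size: "free s2 \<le> free s + length (lm # L) * read_size"
        using 1(5) 2(5) by simp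
      show "post s D g \<phi> read_regs (length (lm # L) * read_size) (length (lm # L) * (read_cost + 1) + 1) ?Q (Suc (t + t')) s2"
        by (rule postI[where Q = ?Q, OF 2(1) _ _ _ size _ _ time m]) (use 1(2,3,4,6,7) 2(2,3,4,6,7) in auto)
    qed
  qed
qed

abbreviation "build_regs \<equiv> read_regs \<union> {1}"

text \<open>At the start there are no records, so the base point gets the address \<open>lo\<close>,
  by which it is referred to afterwards.\<close>

lemma run_build:
  assumes J: "bs s D g \<phi>" and fr: "free s = lo" and L: "cells code lo (heap s) (regs s 0) L"
    and xs: "\<And>lm. lm \<in> set L \<Longrightarrow> fst (fst lm) \<in> set xs" and path: "marked_path (go (looped tlo hlo E)) b0 b0 L"
    and bl: "\<And>r. r \<in> set bl \<Longrightarrow> r \<noteq> [] \<and> r \<in> words (set xs) \<and> run E b0 r b0"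
    and size: "1 + size_of bl + length L * read_size \<le> nmax"
  shows "runs B (build_prog K code tlo hlo bl xs) s (post s D g \<phi> build_regs
    (1 + (0 + (0 + (size_of bl + (0 + length L * read_size)))))
    (4 + (1 + (1 + (loops_cost bl + (2 + (length L * (read_cost + 1) + 1))))))
    (\<lambda>D' g' s'. regs s' 1 = Ref lo \<and> g' lo = b0 \<and> lo < free s' \<and>
      marked_path (go (looped tlo hlo (ED D'))) lo lo L \<and> (\<forall>r\<in>set bl. run (ED D') lo r lo)))"
  unfolding build_prog_def
proof (rule post_Seq[where ?W2.0 = build_regs, OF _ _ post_new[OF J, where W = "{1, 2}" and P = b0]])
  let ?R = "\<lambda>D' g' s'. regs s' 1 = Ref lo \<and> g' lo = b0 \<and> lo < free s' \<and>
      marked_path (go (looped tlo hlo (ED D'))) lo lo L \<and> (\<forall>r\<in>set bl. run (ED D') lo r lo)"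
  fix s1 D1 g1 \<phi>1 assume 1: "bs s1 D1 g1 \<phi>1" "\<forall>a<lo. heap s1 a = heap s a"
      "\<forall>r. r \<notin> {1, 2} \<longrightarrow> regs s1 r = regs s r"
      "D1 = D \<and> regs s1 1 = Ref (free s) \<and> g1 (free s) = b0 \<and> free s1 = Suc (free s)"
  show "runs B (Seq (Copy 4 1) (Seq (Copy 24 1) (Seq (loops_prog K code bl) (Seq (neq_flag 13 0 6)
       (While (Equal 13 7) (read_prog K code tlo hlo xs)))))) s1
     (post s1 D1 g1 \<phi>1 build_regs (0 + (0 + (size_of bl + (0 + length L * read_size))))
      (1 + (1 + (loops_cost bl + (2 + (length L * (read_cost + 1) + 1))))) ?R)"
  proof (rule post_Seq[where ?W2.0 = build_regs, OF _ _ post_Copy[OF 1(1), where W = "{4}"]])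
    fix s2 D2 g2 \<phi>2 assume 2: "bs s2 D2 g2 \<phi>2" "D2 = D1 \<and> g2 = g1 \<and> s2 = set_reg s1 4 (regs s1 1)"
    show "runs B (Seq (Copy 24 1) (Seq (loops_prog K code bl) (Seq (neq_flag 13 0 6)
       (While (Equal 13 7) (read_prog K code tlo hlo xs))))) s2
     (post s2 D2 g2 \<phi>2 build_regs (0 + (size_of bl + (0 + length L * read_size)))
      (1 + (loops_cost bl + (2 + (length L * (read_cost + 1) + 1)))) ?R)"
    proof (rule post_Seq[where ?W2.0 = build_regs, OF _ _ post_Copy[OF 2(1), where W = "{24}"]])
      fix s3 D3 g3 \<phi>3 assume 3: "bs s3 D3 g3 \<phi>3" "D3 = D2 \<and> g3 = g2 \<and> s3 = set_reg s2 24 (regs s2 1)"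
      show "runs B (Seq (loops_prog K code bl) (Seq (neq_flag 13 0 6)
         (While (Equal 13 7) (read_prog K code tlo hlo xs)))) s3
       (post s3 D3 g3 \<phi>3 build_regs (size_of bl + (0 + length L * read_size))
        (loops_cost bl + (2 + (length L * (read_cost + 1) + 1))) ?R)"
      proof (rule post_Seq[where ?W1.0 = attach_regs and ?W2.0 = build_regs])
        show "runs B (loops_prog K code bl) s3 (post s3 D3 g3 \<phi>3 attach_regs (size_of bl) (loops_cost bl)
          (\<lambda>D' g' s'. \<forall>r\<in>set bl. run (ED D') lo r lo))"
          by (rule run_loops[OF 3(1)]) (use 1 2 3 fr size bl in auto)
        fix s4 D4 g4 \<phi>4 assume 4: "bs s4 D4 g4 \<phi>4" "D3 \<subseteq> D4" "\<forall>a<free s3. g4 a = g3 a" "free s3 \<le> free s4"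
          "free s4 \<le> free s3 + size_of bl" "\<forall>a<lo. heap s4 a = heap s3 a"
          "\<forall>r. r \<notin> attach_regs \<longrightarrow> regs s4 r = regs s3 r" "\<forall>r\<in>set bl. run (ED D4) lo r lo"
        show "runs B (Seq (neq_flag 13 0 6) (While (Equal 13 7) (read_prog K code tlo hlo xs))) s4
         (post s4 D4 g4 \<phi>4 build_regs (0 + length L * read_size) (2 + (length L * (read_cost + 1) + 1)) ?R)"
        proof (rule post_Seq[where ?W2.0 = read_regs, OF _ _ post_neq_flag[OF 4(1), where W = "{13}"]])
          fix s5 D5 g5 \<phi>5 assume 5: "bs s5 D5 g5 \<phi>5"
            "D5 = D4 \<and> g5 = g4 \<and> s5 = set_reg s4 13 (if regs s4 0 = Null then Null else Num 1)"
          have lo5: "lo < free s5" "g5 lo = b0" "regs s5 1 = Ref lo" "regs s5 4 = Ref lo" "regs s5 0 = regs s 0"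
            "\<forall>a<lo. heap s5 a = heap s a" "free s5 \<le> Suc lo + size_of bl"
            using 1(2-4) 2(2) 3(2) 4(3-7) 5(2) fr by auto
          have "runs B (While (Equal 13 7) (read_prog K code tlo hlo xs)) s5
            (post s5 D5 g5 \<phi>5 read_regs (length L * read_size) (length L * (read_cost + 1) + 1)
            (\<lambda>D' g' s'. marked_path (go (looped tlo hlo (ED D'))) lo lo L))"
          proof (rule run_read_loop[OF 5(1)])
            show "cells code lo (heap s5) (regs s5 0) L" unfolding cells_cong[OF lo5(6)] lo5(5) by (rule L)
            show "regs s5 13 = (if regs s5 0 = Null then Null else Num 1)" using 5(2) by simp
            show "free s5 + length L * read_size \<le> lo + nmax" using lo5(7) size by linarith
            show "marked_path (go (looped tlo hlo E)) (g5 lo) (g5 lo) L" using path lo5(2) by simp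
            show "regs s5 1 = Ref lo" "regs s5 4 = Ref lo" by fact+
            show "lo \<in> nodes (free s5)" "lo \<in> nodes (free s5)" using lo5(1) by auto
          qed (rule xs)
          then show "runs B (While (Equal 13 7) (read_prog K code tlo hlo xs)) s5
            (post s5 D5 g5 \<phi>5 read_regs (length L * read_size) (length L * (read_cost + 1) + 1) ?R)"
          proof (rule runs_mono)
            fix t and s6 :: mstate assume "post s5 D5 g5 \<phi>5 read_regs (length L * read_size) (length L * (read_cost + 1) + 1)
              (\<lambda>D' g' s'. marked_path (go (looped tlo hlo (ED D'))) lo lo L) t s6"
            then obtain \<phi>6 D6 g6 where 6: "bs s6 D6 g6 \<phi>6" "D5 \<subseteq> D6" "\<forall>a<free s5. g6 a = g5 a" "free s5 \<le> free s6"
              "free s6 \<le> free s5 + length L * read_size" "\<forall>a<lo. heap s6 a = heap s5 a"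
              "\<forall>r. r \<notin> read_regs \<longrightarrow> regs s6 r = regs s5 r" "t + \<phi>5 \<le> \<phi>6 + (length L * (read_cost + 1) + 1)"
              "marked_path (go (looped tlo hlo (ED D6))) lo lo L"
              unfolding post_def by blast
            have loops6: "\<forall>r\<in>set bl. run (ED D6) lo r lo"
              using 4(8) 5(2) 6(2) run_ED_mono by blast
            have "?R D6 g6 s6"
              using lo5(1-3) 6(3,4,7,9) loops6 by auto
            then show "post s5 D5 g5 \<phi>5 read_regs (length L * read_size) (length L * (read_cost + 1) + 1) ?R t s6"
              by (rule postI[where Q = ?R, OF 6(1-8)])
          qed
        qed auto
      qed auto
    qed auto
  qed auto
qed (use fr size in auto)

end

section \<open>The final pass over all records\<close>

context folding_machine
begin

subsection \<open>Reading off the graph\<close>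

text \<open>The stack is empty, so every demand is met by a root. No unions follow, hence
  \<open>rk\<close> and \<open>rep\<close> are fixed parameters from here on.\<close>

definition fin_inv where
  "fin_inv rk rep D g (s :: mstate) \<longleftrightarrow> machine_inv (heap s) (free s) Null rk rep [] D D {} {} g \<and>
     regs s 3 = Null \<and> regs s 6 = Null \<and> regs s 7 = Num 1"

definition settled :: "(nat \<Rightarrow> nat) \<Rightarrow> memory \<Rightarrow> nat \<Rightarrow> nat \<Rightarrow> bool" where
  "settled rep hp a k \<longleftrightarrow> (\<forall>r. hp a k = Ref r \<longrightarrow> rep r = r)"

definition fin_step where
  "fin_step rk rep D g W c t (s :: mstate) s' \<longleftrightarrow> fin_inv rk rep D g s' \<and> free s' = free s \<and>
     (\<forall>a. \<forall>k\<in>set ks. settled rep (heap s) a k \<longrightarrow> settled rep (heap s') a k) \<and>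
     (\<forall>r. r \<notin> W \<longrightarrow> regs s' r = regs s r) \<and>
     t + pot (heap s) (free s) rk ([] :: nat list) \<le> pot (heap s') (free s) rk ([] :: nat list) + c"

lemma fin_step_trans:
  assumes "fin_step rk rep D g W1 c1 t1 s s1" "fin_step rk rep D g W2 c2 t2 s1 s2"
    "W1 \<subseteq> W" "W2 \<subseteq> W" "t + c1 + c2 \<le> t1 + t2 + c"
  shows "fin_step rk rep D g W c t s s2"
proof -
  have "regs s2 r = regs s r" if "r \<notin> W" for r
  proof -
    have "r \<notin> W1" "r \<notin> W2" using that assms(3,4) by blast+
    then show ?thesis using assms(1,2) unfolding fin_step_def by simp
  qed
  then show ?thesis using assms unfolding fin_step_def by simp
qed

lemma fin_step_reg:
  assumes "fin_inv rk rep D g s" "x \<notin> {3, 6, 7}" "x \<in> W" "t \<le> c"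
  shows "fin_step rk rep D g W c t s (set_reg s x w)"
  using assms unfolding fin_step_def fin_inv_def by (auto simp: set_reg_def)

lemma fin_step_reg6:
  assumes "fin_inv rk rep D g s" "t \<le> c"
  shows "fin_step rk rep D g W c t s (set_reg s 6 Null)"
  using assms unfolding fin_step_def fin_inv_def by (auto simp: set_reg_def)

lemma fin_find:
  assumes inv: "fin_inv rk rep D g s" and x: "x \<in> nodes (free s)" "regs s 10 = Ref x"
  shows "runs B (find_prog K) s (\<lambda>t s'. fin_step rk rep D g {10, 11, 12} cF t s s' \<and>
    regs s' 10 = Ref (rep x) \<and> (\<forall>a. \<forall>k<2 * K + 4. k \<noteq> 2 * K \<longrightarrow> heap s' a k = heap s a k))"
proof -
  have i: "machine_inv (heap s) (free s) (regs s 3) rk rep [] D D {} {} g" "regs s 3 = Null"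
      "regs s 6 = Null" "regs s 7 = Num 1"
    using inv by (auto simp: fin_inv_def)
  show ?thesis
  proof (rule runs_mono[OF run_find_inv[OF i(1) x i(4)]])
    fix t and s' :: mstate assume *: "machine_inv (heap s') (free s') (regs s' 3) rk rep [] D D {} {} g \<and> free s' = free s \<and>
      find_frame (free s) (heap s) (heap s') \<and>
      regs s' 10 = Ref (rep x) \<and> (\<forall>r. r \<notin> {10, 11, 12} \<longrightarrow> regs s' r = regs s r) \<and>
      t + pot (heap s) (free s) rk ([] :: nat list) \<le> pot (heap s') (free s) rk ([] :: nat list) + cF"
    then have f: "heap s' a k = heap s a k" if "k \<noteq> 2 * K" for a k
      using that by (simp add: find_frame_def)
    have "regs s' 3 = Null" using * i(2) by simp
    with * have "machine_inv (heap s') (free s) Null rk rep [] D D {} {} g" by auto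
    moreover note *
    moreover
    have "heap s' a k = heap s a k" if "k \<in> set ks" for a k
      using f keys[OF that] by simp
    ultimately show "fin_step rk rep D g {10, 11, 12} cF t s s' \<and>
      regs s' 10 = Ref (rep x) \<and> (\<forall>a. \<forall>k<2 * K + 4. k \<noteq> 2 * K \<longrightarrow> heap s' a k = heap s a k)"
      using f i(2-) unfolding fin_step_def fin_inv_def settled_def by simp
  qed
qed

text \<open>Replacing a target by its representative is invisible to demands, which are taken up to
  \<open>rep\<close>.\<close>

lemma fin_set_field:
  assumes inv: "fin_inv rk rep D g s" and a: "a \<in> nodes (free s)" and k: "k \<in> set ks"
    and q: "heap s a k = Ref q" and r: "regs s x = Ref a" "regs s y = Ref (rep q)"
  shows "runs B (Store x k y) s (\<lambda>t s'. fin_step rk rep D g {} 1 t s s' \<and>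
    settled rep (heap s') a k \<and> (\<forall>b j. j \<noteq> k \<longrightarrow> heap s' b j = heap s b j))"
proof -
  let ?hp = "heap s" and ?fr = "free s"
  let ?hp' = "set_field ?hp a k (Ref (rep q))"
  have i: "uf ?hp ?fr rk rep" "graph_inv ?hp ?fr rep D g" "pred_inv ?hp ?fr"
      "\<forall>d\<in>D. met ?hp rep (roots ?hp ?fr \<union> set [] \<union> {}) d"
    using inv by (auto simp: fin_inv_def machine_inv_def)
  have k2: "k < 2 * K" using keys k by blast
  have qn: "q \<in> nodes ?fr" "demanded rep D a k q" using field_demanded[OF i(2) a k q] by blast+
  have rq: "rep q \<in> nodes ?fr" "rep (rep q) = rep q"
    using uf_rep_node[OF i(1) qn(1)] uf_rep_idem[OF i(1) qn(1)] by blast+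
  have f: "?hp' b j = ?hp b j" if "j \<ge> 2 * K" for b j
    using that k2 by auto
  have f01: "?hp' b (2 * K) = ?hp b (2 * K)" "?hp' b (2 * K + 1) = ?hp b (2 * K + 1)"
    "?hp' b (2 * K + 3) = ?hp b (2 * K + 3)" for b
    by (rule f, simp)+
  have nr: "nonroots ?hp' ?fr = nonroots ?hp ?fr" by (simp only: nonroots_def f01)
  have par: "par ?hp' = par ?hp" by (intro ext) (simp only: par_def f01)
  have pot: "pot ?hp' ?fr rk ([] :: nat list) = pot ?hp ?fr rk ([] :: nat list)" by (simp add: pot_def \<Phi>1_def \<Phi>2_def nr par)
  have uf': "uf ?hp' ?fr rk rep" using i(1) unfolding uf_def par nr f01(1,2) .
  have met: "met ?hp' rep Act d" if "met ?hp rep Act d" for Act d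
    using that q rq(2) unfolding met_def by (fastforce split: prod.splits)
  have gi: "graph_inv ?hp' ?fr rep D g"
    unfolding graph_inv_def
  proof (intro conjI)
    have "demanded rep D a k (rep q)" using qn(2) rq(2) by (simp add: demanded_def)
    then show "\<forall>a\<in>nodes ?fr. \<forall>k\<in>set ks. ?hp' a k = Null \<or>
        (\<exists>r\<in>nodes ?fr. ?hp' a k = Ref r \<and> demanded rep D a k r)"
      using i(2) rq(1) unfolding graph_inv_def by auto
    show "\<forall>p k q. (p, k, q) \<in> D \<longrightarrow> p \<in> nodes ?fr \<and> q \<in> nodes ?fr \<and> k \<in> set ks \<and> keyE k (g p) (g q)"
      "\<forall>a\<in>nodes ?fr. g (rep a) = g a"
      using i(2) unfolding graph_inv_def by blast+
  qed
  have pi: "pred_inv ?hp' ?fr" using i(3) unfolding pred_inv_def f01(3) .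
  have "machine_inv ?hp' ?fr Null rk rep [] D D {} {} g"
    using uf' gi pi i(4) met by (auto simp: machine_inv_def nr)
  then have "fin_step rk rep D g {} 1 1 s (s\<lparr>heap := ?hp'\<rparr>)"
    using inv rq(2) pot unfolding fin_step_def fin_inv_def settled_def by auto
  then show ?thesis
    unfolding runs_Store using r rq(2) by (auto simp: settled_def)
qed

lemma run_final_keys:
  assumes "fin_inv rk rep D g s" "a \<in> nodes (free s)" "regs s 30 = Ref a" "set ks' \<subseteq> set ks"
  shows "runs B (final_keys K ks') s (\<lambda>t s'. fin_step rk rep D g {10, 11, 12} (length ks' * (cF + 4) + 1) t s s' \<and>
    (\<forall>k\<in>set ks'. settled rep (heap s') a k))"
  using assms
proof (induction ks' arbitrary: s)
  case Nil
  then show ?case by (simp add: final_keys_def runs_SetNull fin_step_reg6)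
next
  case (Cons k ks')
  have k: "k \<in> set ks" "k < 2 * K" using Cons.prems(4) keys by auto
  have gi: "graph_inv (heap s) (free s) rep D g" "regs s 6 = Null"
    using Cons.prems(1) by (auto simp: fin_inv_def machine_inv_def)
  let ?s = "set_reg s 10 (heap s a k)"
  have s: "fin_step rk rep D g {10, 11, 12} 1 1 s ?s"
    by (rule fin_step_reg[OF Cons.prems(1)]) auto
  then have inv: "fin_inv rk rep D g ?s" by (simp add: fin_step_def)
  have prog: "final_keys K (k # ks') = Seq (Seq (Load 10 30 k) (Cond (Equal 10 6) (SetNull 6)
     (Seq (find_prog K) (Store 30 k 10)))) (final_keys K ks')"
    by (simp add: final_keys_def)
  have 1: "runs B (Cond (Equal 10 6) (SetNull 6) (Seq (find_prog K) (Store 30 k 10))) ?s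
    (\<lambda>t s'. fin_step rk rep D g {10, 11, 12} (cF + 2) t ?s s' \<and> settled rep (heap s') a k)"
  proof (cases "heap s a k = Null")
    case True
    have "fin_step rk rep D g {10, 11, 12} (cF + 2) 2 ?s (set_reg ?s 6 Null)"
      by (rule fin_step_reg6[OF inv]) simp
    then show ?thesis
      using True gi(2) by (simp add: runs_Cond runs_SetNull settled_def numeral_2_eq_2)
  next
    case False
    then obtain q where q: "q \<in> nodes (free s)" "heap s a k = Ref q"
      using gi(1) Cons.prems(2) k(1) unfolding graph_inv_def by blast
    have "runs B (Seq (find_prog K) (Store 30 k 10)) ?s
      (\<lambda>t s'. fin_step rk rep D g {10, 11, 12} (cF + 2) (Suc t) ?s s' \<and> settled rep (heap s') a k)"
    proof (rule runs_SeqI[OF fin_find[OF inv, of q]])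
      show "q \<in> nodes (free ?s)" "regs ?s 10 = Ref q" using q by auto
      fix t1 and s1 :: mstate assume s1: "fin_step rk rep D g {10, 11, 12} cF t1 ?s s1 \<and>
        regs s1 10 = Ref (rep q) \<and> (\<forall>a. \<forall>k<2 * K + 4. k \<noteq> 2 * K \<longrightarrow> heap s1 a k = heap ?s a k)"
      then have hs: "heap s1 a k = Ref q" using k(2) q by simp
      have f1: "fin_inv rk rep D g s1" "a \<in> nodes (free s1)" "regs s1 30 = Ref a"
        using s1 Cons.prems(2,3) by (auto simp: fin_step_def)
      show "runs B (Store 30 k 10) s1 (\<lambda>t' s''. fin_step rk rep D g {10, 11, 12} (cF + 2) (Suc (t1 + t')) ?s s'' \<and>
        settled rep (heap s'') a k)"
      proof (rule runs_mono[OF fin_set_field[OF f1(1,2) k(1) hs f1(3)]])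
        show "regs s1 10 = Ref (rep q)" using s1 by blast
        fix t' and s2 :: mstate assume "fin_step rk rep D g {} 1 t' s1 s2 \<and> settled rep (heap s2) a k \<and>
          (\<forall>b j. j \<noteq> k \<longrightarrow> heap s2 b j = heap s1 b j)"
        then show "fin_step rk rep D g {10, 11, 12} (cF + 2) (Suc (t1 + t')) ?s s2 \<and> settled rep (heap s2) a k"
          using s1 fin_step_trans[of rk rep D g "{10, 11, 12}" cF t1 ?s s1 "{}" 1 t' s2 "{10, 11, 12}"] by auto
      qed
    qed
    then show ?thesis using q gi(2) by (simp add: runs_Cond)
  qed
  have 2: "runs B (Seq (Load 10 30 k) (Cond (Equal 10 6) (SetNull 6) (Seq (find_prog K) (Store 30 k 10)))) s
    (\<lambda>t s'. fin_step rk rep D g {10, 11, 12} (cF + 3) t s s' \<and> settled rep (heap s') a k)"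
    unfolding runs_Seq[of B "Load x y n" for x y n] runs_Load
    by (rule exI[of _ a], rule conjI[OF Cons.prems(3)], rule runs_mono[OF 1], elim conjE,
      rule conjI[OF fin_step_trans[OF s]]) auto
  show ?case
    unfolding prog
  proof (rule runs_SeqI[OF 2])
    fix t1 and s1 :: mstate assume s1: "fin_step rk rep D g {10, 11, 12} (cF + 3) t1 s s1 \<and> settled rep (heap s1) a k"
    have IH: "runs B (final_keys K ks') s1 (\<lambda>t s'. fin_step rk rep D g {10, 11, 12} (length ks' * (cF + 4) + 1) t s1 s' \<and>
      (\<forall>k\<in>set ks'. settled rep (heap s') a k))"
      by (rule Cons.IH) (use s1 Cons.prems in \<open>auto simp: fin_step_def\<close>)
    show "runs B (final_keys K ks') s1 (\<lambda>t' s''. fin_step rk rep D g {10, 11, 12}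
       (length (k # ks') * (cF + 4) + 1) (t1 + t') s s'' \<and> (\<forall>k\<in>set (k # ks'). settled rep (heap s'') a k))"
    proof (rule runs_mono[OF IH], elim conjE, intro conjI)
      fix t' and s2 :: mstate assume s2: "fin_step rk rep D g {10, 11, 12} (length ks' * (cF + 4) + 1) t' s1 s2"
        "\<forall>k\<in>set ks'. settled rep (heap s2) a k"
      show "fin_step rk rep D g {10, 11, 12} (length (k # ks') * (cF + 4) + 1) (t1 + t') s s2"
        by (rule fin_step_trans[OF conjunct1[OF s1] s2(1)]) auto
      show "\<forall>k\<in>set (k # ks'). settled rep (heap s2) a k"
        using s1 s2 k(1) by (auto simp: fin_step_def)
    qed
  qed
qed

abbreviation "cFin \<equiv> length ks * (cF + 4) + 5"

text \<open>\<open>n\<close> records remain, the next one being \<open>lo + n - 1\<close>; the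
  predecessor field of \<open>lo\<close> is null and ends the pass.\<close>

lemma run_final_loop:
  assumes "fin_inv rk rep D g s" "lo + n \<le> free s" "regs s 30 = (if n = 0 then Null else Ref (lo + n - 1))"
    "regs s 13 = (if n = 0 then Null else Num 1)"
  shows "runs B (While (Equal 13 7) (Seq (final_keys K ks) (Seq (Load 30 30 (2 * K + 3)) (neq_flag 13 30 6)))) s
    (\<lambda>t s'. fin_step rk rep D g {10, 11, 12, 13, 30} (n * cFin + 1) t s s' \<and>
      (\<forall>a\<in>{lo..<lo + n}. \<forall>k\<in>set ks. settled rep (heap s') a k))"
  using assms
proof (induction n arbitrary: s)
  case 0
  have "fin_step rk rep D g {10, 11, 12, 13, 30} 1 1 s s"
    using 0(1) by (simp add: fin_step_def)
  then show ?case using 0 by (subst runs_While) (simp add: fin_inv_def)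
next
  case (Suc n)
  let ?W = "{10, 11, 12, 13, 30} :: nat set"
  let ?a = "lo + n" and ?v = "if n = 0 then Null else Ref (lo + n - 1)"
  have a: "?a \<in> nodes (free s)" "regs s 30 = Ref ?a" using Suc.prems(2,3) by auto
  define Q where "Q t s' \<longleftrightarrow> fin_step rk rep D g ?W (cFin - 1) t s s' \<and>
      (\<forall>k\<in>set ks. settled rep (heap s') ?a k) \<and> regs s' 30 = ?v \<and>
      regs s' 13 = (if n = 0 then Null else Num 1)" for t and s' :: mstate
  have body: "runs B (Seq (final_keys K ks) (Seq (Load 30 30 (2 * K + 3)) (neq_flag 13 30 6))) s Q"
  proof (rule runs_SeqI[OF run_final_keys[OF Suc.prems(1) a subset_refl]], elim conjE)
    fix t1 and s1 :: mstate
    assume s1: "fin_step rk rep D g {10, 11, 12} (length ks * (cF + 4) + 1) t1 s s1"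
      "\<forall>k\<in>set ks. settled rep (heap s1) ?a k"
    then have i: "fin_inv rk rep D g s1" "free s1 = free s" "regs s1 30 = Ref ?a"
      using a(2) by (auto simp: fin_step_def)
    then have r: "regs s1 6 = Null" "regs s1 7 = Num 1" "pred_inv (heap s1) (free s1)"
      by (auto simp: fin_inv_def machine_inv_def)
    then have v: "heap s1 ?a (2 * K + 3) = ?v"
      using a(1) i(2) unfolding pred_inv_def by (cases n) auto
    let ?s = "set_reg (set_reg s1 30 ?v) 13 (if n = 0 then Null else Num 1)"
    have st: "fin_step rk rep D g ?W 0 0 s1 (set_reg s1 30 ?v)"
      by (rule fin_step_reg[OF i(1)]) auto
    have "fin_step rk rep D g ?W 3 3 s1 ?s"
      by (rule fin_step_trans[OF st fin_step_reg[where W = ?W and t = 3 and c = 3]]) (use st in \<open>auto simp: fin_step_def\<close>)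
    from fin_step_trans[OF s1(1) this, of ?W]
    have "fin_step rk rep D g ?W (cFin - 1) (t1 + 3) s ?s" by auto
    then have "Q (t1 + 3) ?s" using s1(2) by (auto simp: Q_def)
    moreover have "runs B (Seq (Load 30 30 (2 * K + 3)) (neq_flag 13 30 6)) s1 (\<lambda>t s'. t = 3 \<and> s' = ?s)"
      using i(3) r(1,2) v
      by (cases "n = 0") (auto simp: neq_flag_def runs_Seq runs_Load runs_Cond runs_SetNull runs_Copy)
    ultimately show "runs B (Seq (Load 30 30 (2 * K + 3)) (neq_flag 13 30 6)) s1 (\<lambda>t' s''. Q (t1 + t') s'')"
      by (auto elim!: runs_mono)
  qed
  show ?case
  proof (rule runs_WhileI[OF _ body])
    show "test_holds (Equal 13 7) s" using Suc.prems(1,4) by (simp add: fin_inv_def)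
    fix t1 and s1 :: mstate assume s1: "Q t1 s1"
    have IH: "runs B (While (Equal 13 7) (Seq (final_keys K ks) (Seq (Load 30 30 (2 * K + 3)) (neq_flag 13 30 6)))) s1
      (\<lambda>t s'. fin_step rk rep D g ?W (n * cFin + 1) t s1 s' \<and>
      (\<forall>a\<in>{lo..<lo + n}. \<forall>k\<in>set ks. settled rep (heap s') a k))"
      by (rule Suc.IH) (use s1 Suc.prems(2) in \<open>auto simp: Q_def fin_step_def\<close>)
    show "runs B (While (Equal 13 7) (Seq (final_keys K ks) (Seq (Load 30 30 (2 * K + 3)) (neq_flag 13 30 6)))) s1
      (\<lambda>t' s''. fin_step rk rep D g ?W (Suc n * cFin + 1) (Suc (t1 + t')) s s'' \<and>
        (\<forall>a\<in>{lo..<lo + Suc n}. \<forall>k\<in>set ks. settled rep (heap s'') a k))"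
    proof (rule runs_mono[OF IH], elim conjE, intro conjI)
      fix t' and s2 :: mstate assume s2: "fin_step rk rep D g ?W (n * cFin + 1) t' s1 s2"
        "\<forall>a\<in>{lo..<lo + n}. \<forall>k\<in>set ks. settled rep (heap s2) a k"
      show "fin_step rk rep D g ?W (Suc n * cFin + 1) (Suc (t1 + t')) s s2"
        by (rule fin_step_trans[OF _ s2(1)]) (use s1 in \<open>auto simp: Q_def\<close>)
      show "\<forall>a\<in>{lo..<lo + Suc n}. \<forall>k\<in>set ks. settled rep (heap s2) a k"
        using s1 s2 by (auto simp: Q_def fin_step_def less_Suc_eq)
    qed
  qed
qed

lemma run_final:
  assumes J: "state_inv s D D {} {} g \<phi>" and w: "regs s 3 = Null" and b: "b \<in> nodes (free s)" "regs s 1 = Ref b"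
  shows "runs B (final_prog K ks) s (\<lambda>t s'. \<exists>rk rep. fin_inv rk rep D g s' \<and> free s' = free s \<and>
     regs s' 0 = Ref (rep b) \<and> (\<forall>a\<in>nodes (free s'). \<forall>k\<in>set ks. settled rep (heap s') a k) \<and>
     t + \<phi> \<le> pot (heap s') (free s') rk ([] :: nat list) + (nmax * cFin + cF + 6))"
proof -
  obtain rk rep ys where inv: "machine_inv (heap s) (free s) (regs s 3) rk rep ys D D {} {} g"
    and \<phi>: "\<phi> = pot (heap s) (free s) rk ys"
    and r: "regs s 6 = Null" "regs s 7 = Num 1" "lo \<le> free s"
      "regs s 2 = (if free s = lo then Null else Ref (free s - 1))"
    using J unfolding state_inv_def by blast
  have "ys = []" using inv w by (cases ys) (auto simp: machine_inv_def)
  then have fi: "fin_inv rk rep D g s" using inv w r by (simp add: fin_inv_def)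
  define n where "n = free s - lo"
  have n: "free s = lo + n" "0 < n" using r(3) b(1) by (auto simp: n_def)
  have "n \<le> nmax" using uf_size[OF inv_uf[OF inv]] n(1) by simp
  then have nc: "n * cFin \<le> nmax * cFin" by (rule mult_le_mono1)
  let ?s = "set_reg (set_reg s 30 (regs s 2)) 13 (Num 1)"
  let ?W = "{10, 11, 12, 13, 30} :: nat set"
  have r2: "regs s 2 = Ref (lo + n - 1)" using r(4) n by simp
  have 1: "runs B (Seq (Copy 30 2) (neq_flag 13 30 6)) s (\<lambda>t s'. t = 3 \<and> s' = ?s)"
    using r(1,2) r2 by (simp add: neq_flag_def runs_Seq runs_Copy runs_Cond)
  have st: "fin_step rk rep D g ?W 3 3 s ?s"
    using fi unfolding fin_step_def fin_inv_def by (auto simp: set_reg_def)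
  have 2: "runs B (While (Equal 13 7) (Seq (final_keys K ks) (Seq (Load 30 30 (2 * K + 3)) (neq_flag 13 30 6)))) ?s
    (\<lambda>t s'. fin_step rk rep D g ?W (n * cFin + 1) t ?s s' \<and>
      (\<forall>a\<in>{lo..<lo + n}. \<forall>k\<in>set ks. settled rep (heap s') a k))"
    by (rule run_final_loop) (use st n r2 in \<open>auto simp: fin_step_def\<close>)
  show ?thesis
    unfolding final_prog_def
  proof (rule runs_SeqI[OF 1], elim conjE, hypsubst, rule runs_SeqI[OF 2], elim conjE)
    fix t2 and s2 :: mstate assume s2: "fin_step rk rep D g ?W (n * cFin + 1) t2 ?s s2"
      "\<forall>a\<in>{lo..<lo + n}. \<forall>k\<in>set ks. settled rep (heap s2) a k"
    have "fin_step rk rep D g ?W (n * cFin + 4) (t2 + 3) s s2"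
      by (rule fin_step_trans[OF st s2(1)]) auto
    then have i2: "fin_inv rk rep D g s2" "free s2 = free s" "regs s2 1 = Ref b"
        "t2 + 3 + \<phi> \<le> pot (heap s2) (free s) rk ([] :: nat list) + (n * cFin + 4)"
      using b(2) \<phi> \<open>ys = []\<close> by (auto simp: fin_step_def)
    let ?s2 = "set_reg s2 10 (Ref b)"
    have i3: "fin_inv rk rep D g ?s2" using i2(1) by (simp add: fin_inv_def)
    have 3: "runs B (find_prog K) ?s2 (\<lambda>t s'. fin_step rk rep D g {10, 11, 12} cF t ?s2 s' \<and>
      regs s' 10 = Ref (rep b) \<and> (\<forall>a. \<forall>k<2 * K + 4. k \<noteq> 2 * K \<longrightarrow> heap s' a k = heap ?s2 a k))"
      by (rule fin_find[OF i3]) (use b(1) i2(2) in auto)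
    show "runs B (Seq (Copy 10 1) (Seq (find_prog K) (Copy 0 10))) s2
      (\<lambda>t' s''. \<exists>rk rep. fin_inv rk rep D g s'' \<and> free s'' = free s \<and> regs s'' 0 = Ref (rep b) \<and>
         (\<forall>a\<in>nodes (free s''). \<forall>k\<in>set ks. settled rep (heap s'') a k) \<and>
         3 + (t2 + t') + \<phi> \<le> pot (heap s'') (free s'') rk ([] :: nat list) + (nmax * cFin + cF + 6))"
      unfolding runs_Seq runs_Copy i2(3)
    proof (rule runs_mono[OF 3], elim conjE, intro exI conjI)
      fix t3 and s3 :: mstate assume s3: "fin_step rk rep D g {10, 11, 12} cF t3 ?s2 s3" "regs s3 10 = Ref (rep b)"
      let ?s3 = "set_reg s3 0 (regs s3 10)"
      show "fin_inv rk rep D g ?s3" using s3(1) by (auto simp: fin_step_def fin_inv_def)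
      show f: "free ?s3 = free s" using s3(1) i2(2) by (simp add: fin_step_def)
      show "regs ?s3 0 = Ref (rep b)" using s3(2) by simp
      show "\<forall>a\<in>nodes (free ?s3). \<forall>k\<in>set ks. settled rep (heap ?s3) a k"
        using s3(1) s2(2) n(1) f by (simp add: fin_step_def)
      have "t3 + pot (heap s2) (free s) rk ([] :: nat list) \<le> pot (heap s3) (free s) rk ([] :: nat list) + cF"
        using s3(1) i2(2) by (simp add: fin_step_def)
      then show "3 + (t2 + (1 + (t3 + 1))) + \<phi> \<le> pot (heap ?s3) (free ?s3) rk ([] :: nat list) + (nmax * cFin + cF + 6)"
        using i2(4) nc unfolding set_reg_simps f[unfolded set_reg_simps] by linarith
    qed
  qed
qed

lemma fin_uf: "fin_inv rk rep D g s \<Longrightarrow> uf (heap s) (free s) rk rep"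
  and fin_graph: "fin_inv rk rep D g s \<Longrightarrow> graph_inv (heap s) (free s) rep D g"
  by (auto simp: fin_inv_def machine_inv_def)

context
  fixes rk rep D g and s :: mstate
  assumes inv: "fin_inv rk rep D g s"
    and settled: "\<forall>a\<in>nodes (free s). \<forall>k\<in>set ks. settled rep (heap s) a k"
begin

lemma fin_field:
  assumes "a \<in> nodes (free s)" "k \<in> set ks" "heap s a k \<noteq> Null"
  shows "\<exists>r\<in>nodes (free s). heap s a k = Ref r \<and> rep r = r \<and> keyE k (g a) (g r)"
proof -
  obtain r where r: "r \<in> nodes (free s)" "heap s a k = Ref r" "demanded rep D a k r"
    using fin_graph[OF inv] assms unfolding graph_inv_def by blast
  moreover have "keyE k (g a) (g r)" by (rule demanded_keyE(2)[OF fin_graph[OF inv] r(3) assms(1) r(1)])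
  ultimately show ?thesis using settled assms unfolding settled_def by blast
qed

text \<open>The active record that meets the demand is a root, hence its own representative, and its
  settled field holds a representative; so the two are those of \<open>p\<close> and
  \<open>q\<close>.\<close>

lemma fin_demand:
  assumes "(p, k, q) \<in> D"
  shows "p \<in> nodes (free s)" "q \<in> nodes (free s)" "heap s (rep p) k = Ref (rep q)"
proof -
  have d: "p \<in> nodes (free s)" "q \<in> nodes (free s)" "k \<in> set ks"
    using fin_graph[OF inv] assms unfolding graph_inv_def by blast+
  then show "p \<in> nodes (free s)" "q \<in> nodes (free s)" by blast+
  have "met (heap s) rep (roots (heap s) (free s)) (p, k, q)"
    using inv assms by (auto simp: fin_inv_def machine_inv_def)
  then obtain y r where y: "y \<in> roots (heap s) (free s)" "rep y = rep p" "heap s y k = Ref r" "rep r = rep q"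
    unfolding met_def prod.case by blast
  then have "rep y = y" using nonroots_iff(1)[OF fin_uf[OF inv], of y] by blast
  moreover have "rep r = r" using settled y(1,3) d(3) unfolding settled_def by blast
  ultimately show "heap s (rep p) k = Ref (rep q)" using y by simp
qed

end

end

lemma go_hom:
  assumes "run P p r q" "\<And>p x q. P p x q \<Longrightarrow> Q (h p) x (h q)"
  shows "run Q (h p) r (h q)"
  using assms(1)
proof (induction r arbitrary: p)
  case (Cons l r)
  then obtain p' where "go P l p p'" "run Q (h p') r (h q)" by auto
  moreover from this(1) have "go Q l (h p) (h p')" using assms(2) by (auto simp: go_def split: if_splits)
  ultimately show ?case by auto
qed simp

text \<open>All machine costs are linear in \<open>G\<close>, and these constants bound them after
  \<open>G + 1\<close> is factored out. Here 260 comes from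
  \<open>cE = 42 * G + 260\<close>.\<close>

definition loops_const :: "'x word list \<Rightarrow> nat" where
  "loops_const rs = sum_list (map (\<lambda>r. length r * 260 + 1) rs) + 1"

text \<open>251 comes from \<open>2 * cP + 11 = 42 * G + 251\<close>, the part of the cost of a
  letter outside its loops; 13 is the remaining cost of reading a record, including the loop
  test.\<close>

definition read_const :: "('x \<Rightarrow> 'x word list) \<Rightarrow> ('x \<Rightarrow> 'x word list) \<Rightarrow> 'x list \<Rightarrow> nat" where
  "read_const tlo hlo xs = sum_list (map (\<lambda>x. loops_const (tlo x) + loops_const (hlo x) + 251) xs) + 13"

text \<open>154 is 130 + 24, from \<open>cP + 10 = 21 * G + 130\<close> for draining and
  \<open>cF + 4 = 7 * G + 24\<close> for the final pass; 200 collects the additive terms.\<close>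

definition time_const where
  "time_const tlo hlo bl ks xs = 154 * length ks + loops_const bl + read_const tlo hlo xs + 200"

section \<open>Comparison of the memory with a folded graph, and the total time\<close>

context letter_machine
begin

text \<open>Both half edges are required; as a field holds one value, determinism in both directions
  is immediate.\<close>

definition final_edge :: "(nat \<Rightarrow> nat) \<Rightarrow> mstate \<Rightarrow> nat \<Rightarrow> 'x \<Rightarrow> nat \<Rightarrow> bool" where
  "final_edge rep s p x q \<longleftrightarrow> x \<in> set xs \<and> p \<in> nodes (free s) \<and> rep p = p \<and> q \<in> nodes (free s) \<and> rep q = q \<and>
     heap s p (2 * code x) = Ref q \<and> heap s q (2 * code x + 1) = Ref p"

lemma det_final_edge: "det (final_edge rep s)"
  by (auto simp: det_iff final_edge_def)

context
  fixes rk rep D g and s :: mstate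
  assumes inv: "fin_inv rk rep D g s"
    and settled: "\<forall>a\<in>nodes (free s). \<forall>k\<in>set ks. settled rep (heap s) a k"
begin

lemma ED_final_edge: "ED D p x q \<Longrightarrow> final_edge rep s (rep p) x (rep q)"
  unfolding ED_def final_edge_def
  using fin_demand[OF inv settled] uf_rep_node[OF fin_uf[OF inv]] uf_rep_idem[OF fin_uf[OF inv]] by blast

lemma final_edge_sound:
  assumes "final_edge rep s p x q"
  shows "E (g p) x (g q)"
proof -
  have x: "x \<in> set xs" "2 * code x \<in> set ks" and p: "p \<in> nodes (free s)" "heap s p (2 * code x) = Ref q"
    using assms by (auto simp: final_edge_def set_all_keys)
  have "keyE (2 * code x) (g p) (g q)"
    using fin_field[OF inv settled p(1) x(2)] p(2) by auto
  then show ?thesis using keyE_iff(1)[OF x(1)] by blast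
qed

lemma looped_final:
  assumes "looped tlo hlo (ED D) p x q"
  shows "looped tlo hlo (final_edge rep s) (rep p) x (rep q)"
  using assms go_hom[where P = "ED D" and Q = "final_edge rep s" and h = rep, OF _ ED_final_edge] ED_final_edge unfolding looped_def by blast

lemma marked_path_final:
  assumes "marked_path (go (looped tlo hlo (ED D))) b p L"
  shows "marked_path (go (looped tlo hlo (final_edge rep s))) (rep b) (rep p) L"
  using assms
proof (induction L arbitrary: p)
  case (Cons lm L)
  then obtain q where q: "go (looped tlo hlo (ED D)) (fst lm) p q" "snd lm \<longrightarrow> q = b"
      "marked_path (go (looped tlo hlo (final_edge rep s))) (rep b) (rep q) L" by auto
  moreover from q(1) have "go (looped tlo hlo (final_edge rep s)) (fst lm) (rep p) (rep q)"
    using looped_final by (auto simp: go_def split: if_splits)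
  ultimately show ?case by auto
qed simp

text \<open>\<open>g\<close> maps the final graph to \<open>\<Gamma>\<close> and
  \<open>\<theta>\<close> maps back. Both fix the base point, so along a path to any vertex
  determinism gives \<open>g (\<theta> p) = p\<close>, and \<open>\<theta>\<close> is injective. A
  nonempty field at \<open>\<theta> p\<close> has as image under \<open>g\<close> an edge of
  \<open>\<Gamma>\<close> at \<open>p\<close>, so absent edges have empty fields.\<close>

lemma final_represents:
  fixes \<Gamma> :: "('m, 'f, 'x) lgraph"
  assumes E: "E = edge_of \<Gamma>" and b: "b \<in> nodes (free s)" "regs s 0 = Ref (rep b)" "g b = base \<Gamma>"
    and hom: "graph_hom \<theta> \<Gamma> (final_edge rep s)" "\<theta> (base \<Gamma>) = rep b"
    and reach: "\<And>p. p \<in> verts \<Gamma> \<Longrightarrow> \<exists>U. run E (base \<Gamma>) U p"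
  shows "represents_graph code (set xs) s \<Gamma>"
proof -
  have rb: "rep b \<in> nodes (free s)" "rep (rep b) = rep b" "g (rep b) = base \<Gamma>"
    using uf_rep_node[OF fin_uf[OF inv] b(1)] uf_rep_idem[OF fin_uf[OF inv] b(1)]
      graph_inv_g[OF fin_graph[OF inv] b(1)] b(3) by auto
  have closed: "q \<in> nodes (free s) \<and> rep q = q"
    if "run (final_edge rep s) p U q" "p \<in> nodes (free s) \<and> rep p = p" for p U q
    using that
  proof (induction U arbitrary: p)
    case (Cons l U)
    then obtain p' where p': "go (final_edge rep s) l p p'" "run (final_edge rep s) p' U q" by auto
    then have "p' \<in> nodes (free s) \<and> rep p' = p'" by (auto simp: go_def final_edge_def split: if_splits)
    then show ?case using Cons.IH p'(2) by blast
  qed simp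
  have node: "\<theta> p \<in> nodes (free s)" "rep (\<theta> p) = \<theta> p" "g (\<theta> p) = p" if p: "p \<in> verts \<Gamma>" for p
  proof -
    obtain U where U: "run E (base \<Gamma>) U p" using reach[OF p] by blast
    have R: "run (final_edge rep s) (rep b) U (\<theta> p)"
      using graph_hom_run[OF hom(1)] U hom(2) unfolding E by metis
    then show "\<theta> p \<in> nodes (free s)" "rep (\<theta> p) = \<theta> p" using closed rb(1,2) by blast+
    have "run E (g (rep b)) U (g (\<theta> p))" by (rule go_hom[where h = g and P = "final_edge rep s" and Q = E, OF R final_edge_sound])
    then show "g (\<theta> p) = p" using run_det[OF det_E _ U] rb(3) by metis
  qed
  have out: "\<exists>f. f \<in> arcs \<Gamma> \<and> lab \<Gamma> f = x \<and> tail \<Gamma> f = p"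
    if "p \<in> verts \<Gamma>" "x \<in> set xs" "heap s (\<theta> p) (2 * code x) \<noteq> Null" for p x
  proof -
    have "2 * code x \<in> set ks" using that(2) by (auto simp: set_all_keys)
    from fin_field[OF inv settled node(1)[OF that(1)] this that(3)] obtain r where
      r: "keyE (2 * code x) (g (\<theta> p)) (g r)" by blast
    have "E (g (\<theta> p)) x (g r)" by (rule iffD1[OF keyE_iff(1)[OF that(2)] r])
    then show ?thesis unfolding E edge_of_def node(3)[OF that(1)] by blast
  qed
  have in': "\<exists>f. f \<in> arcs \<Gamma> \<and> lab \<Gamma> f = x \<and> head \<Gamma> f = p"
    if "p \<in> verts \<Gamma>" "x \<in> set xs" "heap s (\<theta> p) (2 * code x + 1) \<noteq> Null" for p x
  proof -
    have "2 * code x + 1 \<in> set ks" using that(2) by (auto simp: set_all_keys)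
    from fin_field[OF inv settled node(1)[OF that(1)] this that(3)] obtain r where
      r: "keyE (2 * code x + 1) (g (\<theta> p)) (g r)" by blast
    have "E (g r) x (g (\<theta> p))" by (rule iffD1[OF keyE_iff(2)[OF that(2)] r])
    then show ?thesis unfolding E edge_of_def node(3)[OF that(1)] by blast
  qed
  show ?thesis
    unfolding represents_graph_def
  proof (intro exI[of _ \<theta>] conjI)
    show "inj_on \<theta> (verts \<Gamma>)" by (rule inj_on_inverseI[of _ g]) (rule node(3))
    show "\<forall>p\<in>verts \<Gamma>. \<theta> p < free s" using node(1) by auto
    show "regs s 0 = Ref (\<theta> (base \<Gamma>))" using b(2) hom(2) by simp
    show "\<forall>f\<in>arcs \<Gamma>. heap s (\<theta> (tail \<Gamma> f)) (2 * code (lab \<Gamma> f)) = Ref (\<theta> (head \<Gamma> f)) \<and>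
        heap s (\<theta> (head \<Gamma> f)) (2 * code (lab \<Gamma> f) + 1) = Ref (\<theta> (tail \<Gamma> f))"
      using hom(1) unfolding graph_hom_def final_edge_def by blast
    show "\<forall>p\<in>verts \<Gamma>. \<forall>x\<in>set xs.
        ((\<nexists>f. f \<in> arcs \<Gamma> \<and> lab \<Gamma> f = x \<and> tail \<Gamma> f = p) \<longrightarrow> heap s (\<theta> p) (2 * code x) = Null) \<and>
        ((\<nexists>f. f \<in> arcs \<Gamma> \<and> lab \<Gamma> f = x \<and> head \<Gamma> f = p) \<longrightarrow> heap s (\<theta> p) (2 * code x + 1) = Null)"
      using out in' by blast
  qed
qed

end

abbreviation "build_cost n bl \<equiv> 4 + (1 + (1 + (loops_cost bl + (2 + (n * (read_cost + 1) + 1)))))"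

lemma run_fold:
  assumes B: "1 \<le> B" and fr: "free s = lo" and L: "cells code lo (heap s) (regs s 0) L"
    and xs: "\<And>lm. lm \<in> set L \<Longrightarrow> fst (fst lm) \<in> set xs" and path: "marked_path (go (looped tlo hlo E)) b0 b0 L"
    and bl: "\<And>r. r \<in> set bl \<Longrightarrow> r \<noteq> [] \<and> r \<in> words (set xs) \<and> run E b0 r b0"
    and size: "1 + size_of bl + length L * read_size \<le> nmax"
  shows "runs B (fold_prog K code tlo hlo bl xs) s (\<lambda>t s'.
    t \<le> pot_max + (build_cost (length L) bl + nmax * cFin + cF + 13) \<and>
    (\<exists>rk rep D g. fin_inv rk rep D g s' \<and> lo \<in> nodes (free s') \<and> regs s' 0 = Ref (rep lo) \<and> g lo = b0 \<and>
      (\<forall>a\<in>nodes (free s'). \<forall>k\<in>set ks. settled rep (heap s') a k) \<and>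
      marked_path (go (looped tlo hlo (ED D))) lo lo L \<and> (\<forall>r\<in>set bl. run (ED D) lo r lo)))"
proof -
  let ?s = "set_reg (set_reg (set_reg (set_reg s 6 Null) 7 (Num 1)) 2 Null) 3 Null"
  have init: "runs B (Seq (SetNull 6) (Seq (SetNum 7 1) (Seq (SetNull 2) (SetNull 3)))) s (\<lambda>t s'. t = 4 \<and> s' = ?s)"
    using B by (simp add: runs_Seq runs_SetNull runs_SetNum)
  \<comment> \<open>No record exists yet, so any ghost map satisfies the invariant.\<close>
  define g0 :: "nat \<Rightarrow> 'm" where "g0 = undefined"
  have "machine_inv (heap ?s) (free ?s) (regs ?s 3) (\<lambda>_. 0) id [] {} {} {} {} g0"
    using fr by (simp add: machine_inv_def uf_def graph_inv_def pred_inv_def nonroots_def)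
  then have "bs ?s {} g0 (pot (heap ?s) (free ?s) (\<lambda>_. 0) ([] :: nat list))"
    by (rule state_invI) (use fr in auto)
  then obtain \<phi> where J: "bs ?s {} g0 \<phi>" by blast
  let ?R = "\<lambda>D' g' s'. regs s' 1 = Ref lo \<and> g' lo = b0 \<and> lo < free s' \<and>
      marked_path (go (looped tlo hlo (ED D'))) lo lo L \<and> (\<forall>r\<in>set bl. run (ED D') lo r lo)"
  let ?M = "1 + (0 + (0 + (size_of bl + (0 + length L * read_size))))"
  have build: "runs B (build_prog K code tlo hlo bl xs) ?s (post ?s {} g0 \<phi> build_regs ?M (build_cost (length L) bl) ?R)"
    by (rule run_build[OF J]) (use fr L xs path bl size in auto)
  show ?thesis
    unfolding fold_prog_def
  proof (rule runs_SeqI[OF init], elim conjE, hypsubst, rule runs_SeqI[OF build])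
    fix t1 and s1 :: mstate assume "post ?s {} g0 \<phi> build_regs ?M (build_cost (length L) bl) ?R t1 s1"
    then obtain \<phi>1 D g where 1: "bs s1 D g \<phi>1" "t1 + \<phi> \<le> \<phi>1 + build_cost (length L) bl" "?R D g s1"
      unfolding post_def by blast
    show "runs B (Seq (drain_prog K ks) (final_prog K ks)) s1 (\<lambda>t' s''.
      4 + (t1 + t') \<le> pot_max + (build_cost (length L) bl + nmax * cFin + cF + 13) \<and>
      (\<exists>rk rep D g. fin_inv rk rep D g s'' \<and> lo \<in> nodes (free s'') \<and> regs s'' 0 = Ref (rep lo) \<and> g lo = b0 \<and>
        (\<forall>a\<in>nodes (free s''). \<forall>k\<in>set ks. settled rep (heap s'') a k) \<and>
        marked_path (go (looped tlo hlo (ED D))) lo lo L \<and> (\<forall>r\<in>set bl. run (ED D) lo r lo)))"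
    proof (rule runs_SeqI[OF run_drain[OF 1(1)]], elim exE conjE)
      fix t2 \<phi>2 and s2 :: mstate assume 2: "bs s2 D g \<phi>2" "regs s2 3 = Null" "free s2 = free s1"
        "regs s2 1 = regs s1 1" "t2 + \<phi>1 \<le> \<phi>2 + 3"
      have lo: "lo \<in> nodes (free s2)" "regs s2 1 = Ref lo" using 1(3) 2(3,4) by auto
      show "runs B (final_prog K ks) s2 (\<lambda>t' s''.
        4 + (t1 + (t2 + t')) \<le> pot_max + (build_cost (length L) bl + nmax * cFin + cF + 13) \<and>
        (\<exists>rk rep D g. fin_inv rk rep D g s'' \<and> lo \<in> nodes (free s'') \<and> regs s'' 0 = Ref (rep lo) \<and> g lo = b0 \<and>
          (\<forall>a\<in>nodes (free s''). \<forall>k\<in>set ks. settled rep (heap s'') a k) \<and>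
          marked_path (go (looped tlo hlo (ED D))) lo lo L \<and> (\<forall>r\<in>set bl. run (ED D) lo r lo)))"
      proof (rule runs_mono[OF run_final[OF 2(1,2) lo]], elim exE conjE)
        fix t3 and s3 :: mstate and rk rep
        assume 3: "fin_inv rk rep D g s3" "free s3 = free s2" "regs s3 0 = Ref (rep lo)"
          "\<forall>a\<in>nodes (free s3). \<forall>k\<in>set ks. settled rep (heap s3) a k"
          "t3 + \<phi>2 \<le> pot (heap s3) (free s3) rk ([] :: nat list) + (nmax * cFin + cF + 6)"
        \<comment> \<open>The phases telescope: time is bounded by the growth of the potential plus
          constants, and the final potential is at most \<open>pot_max\<close>.\<close>
        have "pot (heap s3) (free s3) rk ([] :: nat list) \<le> pot_max"
          by (rule pot_bound[OF fin_uf[OF 3(1)]])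
        then have "4 + (t1 + (t2 + t3)) \<le> pot_max + (build_cost (length L) bl + nmax * cFin + cF + 13)"
          using 3(5) 2(5) 1(2) by linarith
        moreover have "lo \<in> nodes (free s3)" using lo(1) 3(2) by simp
        ultimately show "4 + (t1 + (t2 + t3)) \<le> pot_max + (build_cost (length L) bl + nmax * cFin + cF + 13) \<and>
          (\<exists>rk rep D g. fin_inv rk rep D g s3 \<and> lo \<in> nodes (free s3) \<and> regs s3 0 = Ref (rep lo) \<and> g lo = b0 \<and>
            (\<forall>a\<in>nodes (free s3). \<forall>k\<in>set ks. settled rep (heap s3) a k) \<and>
            marked_path (go (looped tlo hlo (ED D))) lo lo L \<and> (\<forall>r\<in>set bl. run (ED D) lo r lo))"
          using 3(1,3,4) 1(3) by blast
      qed
    qed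
  qed
qed

lemma fold_time:
  fixes bl :: "'x word list"
  assumes n: "n \<le> nmax" "1 \<le> nmax"
  shows "pot_max + (build_cost n bl + nmax * cFin + cF + 13) \<le> time_const tlo hlo bl ks xs * (nmax * (G + 1))"
proof -
  let ?G = "G + 1" and ?k = "length ks"
  have lc: "loops_cost rs \<le> loops_const rs * ?G" for rs :: "'x word list"
  proof -
    have e: "cE \<le> 260 * ?G" by (simp add: cP_def cF_def)
    have "length r * cE + 1 \<le> (length r * 260 + 1) * ?G" for r :: "'x word"
      using mult_le_mono2[OF e, of "length r"] by (simp add: algebra_simps)
    then have "sum_list (map (\<lambda>r. length r * cE + 1) rs) \<le> sum_list (map (\<lambda>r. (length r * 260 + 1) * ?G) rs)"
      by (rule sum_list_mono)
    also have "\<dots> = sum_list (map (\<lambda>r. length r * 260 + 1) rs) * ?G" by (rule sum_list_mult_const)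
    finally show ?thesis by (simp add: loops_const_def algebra_simps)
  qed
  have rc: "read_cost + 1 \<le> read_const tlo hlo xs * ?G"
  proof -
    have "letter_cost x + 5 \<le> (loops_const (tlo x) + loops_const (hlo x) + 251) * ?G" for x
    proof -
      have "2 * cP + 11 \<le> 251 * ?G" by (simp add: cP_def cF_def)
      then show ?thesis using lc[of "tlo x"] lc[of "hlo x"] by (simp only: add_mult_distrib)
    qed
    then have "all_cost xs \<le> sum_list (map (\<lambda>x. (loops_const (tlo x) + loops_const (hlo x) + 251) * ?G) xs)"
      by (rule sum_list_mono)
    also have "\<dots> = sum_list (map (\<lambda>x. loops_const (tlo x) + loops_const (hlo x) + 251) xs) * ?G"
      by (rule sum_list_mult_const)
    finally have le: "all_cost xs \<le> \<dots>" .
    have "a + 12 + 1 \<le> b + 13 * ?G" if "a \<le> b" for a b :: nat using that by simp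
    from this[OF le] show ?thesis unfolding read_const_def add_mult_distrib[of _ 13] .
  qed
  \<comment> \<open>Every summand is bounded by a multiple of \<open>M\<close>; additive constants
    are absorbed because \<open>1 \<le> M\<close>.\<close>
  define M where "M = nmax * ?G"
  have M: "nmax \<le> M" "?G \<le> M" "1 \<le> M" "nmax * (G + 2) \<le> 2 * M"
    using n(2) mult_le_mono1[OF n(2), of ?G] by (auto simp: M_def algebra_simps)
  have 1: "cD * nmax \<le> (130 * ?k + 20) * M"
  proof -
    have "cP + 10 \<le> 130 * ?G" by (simp add: cP_def cF_def)
    then have "?k * (cP + 10) \<le> ?k * (130 * ?G)" by (rule mult_le_mono2)
    then have "cD \<le> (130 * ?k + 20) * ?G" by (simp add: cD_def algebra_simps)
    then have "cD * nmax \<le> (130 * ?k + 20) * ?G * nmax" by (rule mult_le_mono1)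
    then show ?thesis by (simp only: M_def ac_simps)
  qed
  have 2: "nmax * cFin \<le> (24 * ?k + 5) * M"
  proof -
    have "cF + 4 \<le> 24 * ?G" by (simp add: cF_def)
    then have "?k * (cF + 4) \<le> ?k * (24 * ?G)" by (rule mult_le_mono2)
    then have "cFin \<le> (24 * ?k + 5) * ?G" by (simp add: algebra_simps)
    then have "nmax * cFin \<le> nmax * ((24 * ?k + 5) * ?G)" by (rule mult_le_mono2)
    then show ?thesis by (simp only: M_def ac_simps)
  qed
  have 3: "n * (read_cost + 1) \<le> read_const tlo hlo xs * M"
  proof -
    have "n * (read_cost + 1) \<le> nmax * (read_const tlo hlo xs * ?G)" by (rule mult_le_mono[OF n(1) rc])
    then show ?thesis by (simp only: M_def ac_simps)
  qed
  have 4: "loops_cost bl \<le> loops_const bl * M"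
    using lc[of bl] mult_le_mono2[OF M(2), of "loops_const bl"] by linarith
  have 5: "cF \<le> 20 * M" using M(2) by (simp add: cF_def)
  have "time_const tlo hlo bl ks xs * M = (130 * ?k + 20) * M + (24 * ?k + 5) * M + loops_const bl * M +
      read_const tlo hlo xs * M + 175 * M"
    by (simp add: time_const_def algebra_simps)
  then show ?thesis
    unfolding M_def[symmetric] pot_max_def using 1 2 3 4 5 M by linarith
qed

end

section \<open>Input format, asymptotics and the choice of the program\<close>

section \<open>The theorem\<close>

lemma length_marked [simp]: "length (marked W) = length W"
  by (simp add: marked_def)

lemma length_concat_marked: "length (concat (map marked Ws)) = total_length Ws"
  by (induction Ws) (simp_all add: total_length_def)

lemma concat_marked_letters:
  assumes "\<And>W. W \<in> set Ws \<Longrightarrow> W \<in> words X" "lm \<in> set (concat (map marked Ws))"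
  shows "fst (fst lm) \<in> X"
proof -
  obtain W where "W \<in> set Ws" "lm \<in> set (marked W)" using assms(2) by auto
  moreover from this have "\<forall>l\<in>set W. fst l \<in> X" using assms(1)[of W] by (auto simp: words_def)
  ultimately show ?thesis by (auto simp: marked_def)
qed

lemma input_cells:
  fixes Ws :: "'x word list" and code :: "'x \<Rightarrow> nat"
  defines "s \<equiv> input_state code Ws"
  shows "cells code (free s) (heap s) (regs s 0) (concat (map marked Ws))" "free s = total_length Ws"
proof -
  define L where "L = concat (map marked Ws)"
  define w where "w i = (if i < length L then Ref i else Null)" for i
  have h: "heap s i 0 = Num (int (code (fst (fst (L ! i)))))" "heap s i 1 = Num (of_bool (snd (fst (L ! i))))"
    "heap s i 2 = Num (of_bool (snd (L ! i)))" "heap s i 3 = w (Suc i)" if "i < length L" for i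
    using that by (simp_all add: s_def input_state_def L_def[symmetric] Let_def w_def)
  have f: "free s = length L" and r: "regs s 0 = w 0"
    by (simp_all add: s_def input_state_def L_def[symmetric] Let_def w_def)
  show "free s = total_length Ws" unfolding f L_def by (rule length_concat_marked)
  have "cells code (length L) (heap s) (w i) (drop i L)" if "i \<le> length L" for i
    using that
  proof (induction rule: inc_induct)
    case base
    then show ?case by (simp add: w_def)
  next
    case (step i)
    have "drop i L = L ! i # drop (Suc i) L" using step(2) by (simp add: Cons_nth_drop_Suc)
    then show ?case using h[OF step(2)] step by (simp add: w_def[of i])
  qed
  from this[of 0] show "cells code (free s) (heap s) (regs s 0) (concat (map marked Ws))"
    unfolding f r by (simp add: L_def[symmetric])
qed

text \<open>A linear function is eventually below an exponential, and exponentiation raises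
  \<open>log_star\<close> by at most one. For \<open>N \<ge> 2\<close> the value
  \<open>log_star N\<close> is positive, so \<open>log_star N + 2\<close> is at most three times it;
  with \<open>N + 1 \<le> 2 * N\<close> this gives the factor 6.\<close>

lemma log_star_bigo:
  fixes c C :: nat
  shows "(\<lambda>N. real (C * (c * (N + 1) * (log_star (c * (N + 1)) + 1)))) \<in> O(\<lambda>N. real N * real (log_star N))"
proof -
  have "((\<lambda>N::nat. real c * (real N + 1) / 2 ^ N) \<longlongrightarrow> 0) at_top" by real_asymp
  then have "\<forall>\<^sub>F N in at_top. real c * (real N + 1) / 2 ^ N < 1" by (rule order_tendstoD) simp
  then have ev: "\<forall>\<^sub>F N in at_top. c * (N + 1) \<le> 2 ^ N"
  proof eventually_elim
    case (elim N)
    then have "real c * (real N + 1) < 2 ^ N" by (simp add: divide_simps)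
    then have "real (c * (N + 1)) < real (2 ^ N)" by (simp add: algebra_simps)
    then show ?case by linarith
  qed
  have "\<forall>\<^sub>F N in at_top. norm (real (C * (c * (N + 1) * (log_star (c * (N + 1)) + 1))))
      \<le> real (C * c * 6) * norm (real N * real (log_star N))"
    using ev eventually_ge_at_top[of 2]
  proof eventually_elim
    case (elim N)
    let ?l = "log_star N"
    have "c * (N + 1) \<le> 2 ^ N" by (rule elim(1))
    also have "\<dots> \<le> tower (Suc ?l)" using le_tower_log_star by simp
    finally have "log_star (c * (N + 1)) \<le> Suc ?l" by (rule log_star_le)
    moreover have "?l \<noteq> 0"
    proof
      assume "?l = 0"
      then show False using le_tower_log_star[of N] elim(2) by simp
    qed
    ultimately have "log_star (c * (N + 1)) + 1 \<le> 3 * ?l" by simp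
    moreover have "c * (N + 1) \<le> c * (2 * N)" using elim(2) by (intro mult_le_mono2) simp
    ultimately have "c * (N + 1) * (log_star (c * (N + 1)) + 1) \<le> c * (2 * N) * (3 * ?l)"
      by (rule mult_le_mono[rotated])
    then have "C * (c * (N + 1) * (log_star (c * (N + 1)) + 1)) \<le> C * (c * (2 * N) * (3 * ?l))"
      by (rule mult_le_mono2)
    also have "\<dots> = C * c * 6 * (N * ?l)" by simp
    finally have "real (C * (c * (N + 1) * (log_star (c * (N + 1)) + 1))) \<le> real (C * c * 6 * (N * ?l))"
      by (rule of_nat_mono)
    then show ?case by simp
  qed
  then show ?thesis by (rule bigoI)
qed

context gog
begin

lemma finite_X: "finite X"
  using finite_Es finite_V by (auto simp: alphabet_def)

lemma finite_cay_loops: "w \<in> V \<Longrightarrow> finite (cay_loops w)"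
  unfolding cay_loops_def using finite_vgroup by (intro finite_image_set2) auto

lemma finite_loops:
  assumes "x \<in> X"
  shows "finite (tail_loops x \<union> head_loops x)"
proof (cases x)
  case (Gen s)
  then obtain w where "w \<in> V" "s \<in> gs w" using assms by (auto simp: Gen_in_X)
  then show ?thesis using Gen finite_cay_loops vert_of by auto
next
  case (Edge e)
  then have "e \<in> Es" using assms by simp
  then show ?thesis using Edge finite_cay_loops finite_egroup by auto
qed

lemma loops_nonempty: "r \<in> tail_loops x \<union> head_loops x \<Longrightarrow> r \<noteq> []" and cay_loops_nonempty: "r \<in> cay_loops w \<Longrightarrow> r \<noteq> []"
proof -
  have *: "r \<in> cay_loops w \<Longrightarrow> r \<noteq> []" for w
    by (auto simp: cay_loops_def cay_loop_def gen_word_def)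
  then show "r \<in> cay_loops w \<Longrightarrow> r \<noteq> []" .
  show "r \<in> tail_loops x \<union> head_loops x \<Longrightarrow> r \<noteq> []"
    using * by (cases x) (auto simp: edge_rel_def)
qed

text \<open>Program and time bound are fixed before the input. For each input an output
  \<open>\<Gamma>\<close> is then chosen and used as the ghost target of the run, and the run is
  shown to end with a representation of this very graph.\<close>

theorem folding_time:
  assumes inj: "inj_on code X"
  shows "\<exists>prog B. \<exists>T :: nat \<Rightarrow> nat. (\<lambda>N. real (T N)) \<in> O(\<lambda>N. real N * real (log_star N)) \<and>
    (\<forall>Ws. folding_input A v Ws \<longrightarrow> (\<exists>\<Gamma> t s. folding_output A v Ws \<Gamma> \<and>
       exec B prog (input_state code Ws) t s \<and> t \<le> T (total_length Ws) \<and> represents_graph code X s \<Gamma>))"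
proof -
  obtain xs where xs: "set xs = X" using finite_list[OF finite_X] by blast
  have "\<forall>x. \<exists>r. x \<in> X \<longrightarrow> set r = tail_loops x" "\<forall>x. \<exists>r. x \<in> X \<longrightarrow> set r = head_loops x"
    using finite_loops finite_list by blast+
  then obtain tlo hlo where tlo: "\<And>x. x \<in> X \<Longrightarrow> set (tlo x) = tail_loops x"
    and hlo: "\<And>x. x \<in> X \<Longrightarrow> set (hlo x) = head_loops x" by metis
  obtain bl where bl: "set bl = cay_loops v" using finite_list[OF finite_cay_loops[OF v_vert]] by blast
  \<comment> \<open>All codes are below \<open>K\<close>, which also bounds the integers used.
    Inserting 0 covers an empty alphabet, and the successor gives \<open>1 \<le> K\<close>, as the
    flag in register 7 requires.\<close>
  define K where "K = Suc (Max (insert 0 (code ` X)))"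
  have codeK: "code x < K" if "x \<in> X" for x
    using that finite_X by (simp add: K_def less_Suc_eq_le Max_ge_iff)
  let ?size = "\<lambda>rs. sum_list (map length rs)"
  define rs where "rs = 1 + sum_list (map (\<lambda>x. ?size (tlo x) + ?size (hlo x)) xs)"
  \<comment> \<open>Counts the records created: the base point, those on the loops at it, and at
    most \<open>rs\<close> for each input letter; \<open>c * (N + 1)\<close> bounds their
    total.\<close>
  define c where "c = 1 + ?size bl + rs"
  define prog where "prog = fold_prog K code tlo hlo bl xs"
  define C where "C = time_const tlo hlo bl (all_keys code xs) xs"
  define T where "T N = C * (c * (N + 1) * (log_star (c * (N + 1)) + 1))" for N
  have "\<exists>\<Gamma> t s. folding_output A v Ws \<Gamma> \<and> exec (int K) prog (input_state code Ws) t s \<and>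
      t \<le> T (total_length Ws) \<and> represents_graph code X s \<Gamma>" if inp: "folding_input A v Ws" for Ws
  proof -
    have Ws: "W \<in> words X" if "W \<in> set Ws" for W using inp that by (simp add: folding_input_def)
    obtain \<Gamma> where out: "folding_output A v Ws \<Gamma>" using folding_output_exists[OF Ws] by blast
    then have folds: "fold_step\<^sup>*\<^sup>* (saturated_graph Ws) \<Gamma>" and folded: "\<not> (\<exists>\<Gamma>'. fold_step \<Gamma> \<Gamma>')"
      by (simp_all add: folding_output_def saturated_graph_def)
    obtain \<psi> where q: "quotient_map \<psi> (saturated_graph Ws) \<Gamma>" using folds_quotient[OF folds] by blast
    define E where "E = edge_of \<Gamma>"
    have det: "det E" unfolding E_def by (rule folded_det[OF folded])
    note facts = output_facts[OF _ q det[unfolded E_def], folded E_def]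
    have typed: "vtype E v (base \<Gamma>)" by (rule facts(2)) (rule Ws)
    have reach: "\<exists>U. run E (base \<Gamma>) U p" if "p \<in> verts \<Gamma>" for p
      by (rule facts(4)[OF _ that]) (rule Ws)
    have good: "path (go (gadget E)) (base \<Gamma>) W (base \<Gamma>)" if "W \<in> set Ws" for W
      by (rule facts(3)[OF _ that]) (rule Ws)
    define N where "N = total_length Ws"
    define nmax where "nmax = c * (N + 1)"
    let ?s = "input_state code Ws"
    let ?L = "concat (map marked Ws)"
    interpret letter_machine "int K" K N nmax xs code tlo hlo E
    proof
      show "inj_on code (set xs)" using inj xs by simp
      show "det E" by (rule det)
      fix x assume "x \<in> set xs"
      then have "code x < K" using codeK xs by simp
      then show "code x < K" "int (code x) \<le> int K" by simp_all
    next
      fix x r assume x: "x \<in> set xs" and r: "r \<in> set (tlo x) \<union> set (hlo x)"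
      have X: "x \<in> X" using x unfolding xs .
      have r': "r \<in> tail_loops x \<union> head_loops x" using r unfolding tlo[OF X] hlo[OF X] .
      show "r \<noteq> [] \<and> r \<in> words (set xs)"
        unfolding xs using loops_trivial[OF X r'] loops_nonempty[OF r'] by blast
    qed
    have looped: "looped tlo hlo E' p x q \<longleftrightarrow> gadget E' p x q" if "x \<in> X"
      for E' :: "'n \<Rightarrow> ('e, 's) letter \<Rightarrow> 'n \<Rightarrow> bool" and p x q
      using tlo[OF that] hlo[OF that] by (simp add: looped_def gadget_def)
    have len: "length ?L = N" unfolding N_def by (rule length_concat_marked)
    have size: "1 + ?size bl + length ?L * rs \<le> nmax"
    proof -
      have "1 + ?size bl + N * rs \<le> c + c * N" by (simp add: c_def algebra_simps)
      then show ?thesis by (simp add: len nmax_def)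
    qed
    have "runs (int K) prog ?s (\<lambda>t s'.
      t \<le> pot_max + (build_cost (length ?L) bl + nmax * cFin + cF + 13) \<and>
      (\<exists>rk rep D g. fin_inv rk rep D g s' \<and> N \<in> nodes (free s') \<and> regs s' 0 = Ref (rep N) \<and> g N = base \<Gamma> \<and>
        (\<forall>a\<in>nodes (free s'). \<forall>k\<in>set (all_keys code xs). settled rep (heap s') a k) \<and>
        marked_path (go (looped tlo hlo (ED D))) N N ?L \<and> (\<forall>r\<in>set bl. run (ED D) N r N)))"
      unfolding prog_def
    proof (rule run_fold)
      show "1 \<le> int K" by (simp add: K_def)
      show "free ?s = N" using input_cells(2)[of code Ws] by (simp add: N_def)
      then show "cells code N (heap ?s) (regs ?s 0) ?L" using input_cells(1)[of code Ws] by simp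
      show "fst (fst lm) \<in> set xs" if "lm \<in> set ?L" for lm
        unfolding xs by (rule concat_marked_letters[OF Ws that])
      have "path (go (looped tlo hlo E)) (base \<Gamma>) W (base \<Gamma>)" if W: "W \<in> set Ws" for W
      proof (rule path_mono[OF good[OF W]])
        fix l p q assume l: "l \<in> set W" "go (gadget E) l p q"
        then have "fst l \<in> X" using Ws[OF W] by (auto simp: words_def)
        then show "go (looped tlo hlo E) l p q" using l(2) by (simp add: go_def looped split: if_splits)
      qed
      then show "marked_path (go (looped tlo hlo E)) (base \<Gamma>) (base \<Gamma>) ?L"
        by (simp add: marked_path_concat)
      show "r \<noteq> [] \<and> r \<in> words (set xs) \<and> run E (base \<Gamma>) r (base \<Gamma>)" if "r \<in> set bl" for r
        using that cay_loops_nonempty cay_loops_trivial(1)[OF v_vert] typed vtype_iff_loops[OF v_vert det]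
        unfolding bl xs by blast
      show "1 + ?size bl + length ?L * read_size \<le> nmax" using size by (simp add: rs_def)
    qed
    then obtain t s rk rep D g where ex: "exec (int K) prog ?s t s"
      and t: "t \<le> pot_max + (build_cost (length ?L) bl + nmax * cFin + cF + 13)"
      and inv: "fin_inv rk rep D g s" and b: "N \<in> nodes (free s)" "regs s 0 = Ref (rep N)" "g N = base \<Gamma>"
      and st: "\<forall>a\<in>nodes (free s). \<forall>k\<in>set (all_keys code xs). settled rep (heap s) a k"
      and path: "marked_path (go (looped tlo hlo (ED D))) N N ?L" and loops: "\<forall>r\<in>set bl. run (ED D) N r N"
      unfolding runs_def by blast
    have "t \<le> T N"
    proof -
      have "N \<le> nmax" "1 \<le> nmax" by (auto simp: nmax_def c_def)
      from fold_time[OF this, of bl] t show ?thesis by (simp add: T_def C_def nmax_def len)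
    qed
    let ?F = "final_edge rep s"
    \<comment> \<open>The loops demanded during the run have become loops of the final graph, so
      this graph has the saturation properties and receives the saturated graph.\<close>
    have "vtype ?F v (rep N)"
      unfolding vtype_iff_loops[OF v_vert det_final_edge] bl[symmetric]
      using loops go_hom[where P = "ED D" and Q = ?F and h = rep, OF _ ED_final_edge[OF inv st]] by blast
    moreover have "path (go (gadget ?F)) (rep N) W (rep N)" if W: "W \<in> set Ws" for W
    proof (rule path_mono)
      show "path (go (looped tlo hlo ?F)) (rep N) W (rep N)"
        using marked_path_final[OF inv st path] W by (simp add: marked_path_concat)
      fix l p q assume l: "l \<in> set W" "go (looped tlo hlo ?F) l p q"
      then have "fst l \<in> X" using Ws[OF W] by (auto simp: words_def)
      then show "go (gadget ?F) l p q" using l(2) by (simp add: go_def looped split: if_splits)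
    qed
    ultimately obtain \<theta> where \<theta>: "graph_hom \<theta> (saturated_graph Ws) ?F" "\<theta> (base (saturated_graph Ws)) = rep N"
      using saturated_graph_hom[OF det_final_edge Ws] by blast
    have h: "graph_hom \<theta> \<Gamma> ?F" "\<theta> (base \<Gamma>) = rep N"
      using folds_graph_hom[OF folds \<theta>(1) det_final_edge] \<theta>(2) by auto
    have "represents_graph code (set xs) s \<Gamma>"
      by (rule final_represents[OF inv st E_def b h reach])
    then show ?thesis using out ex \<open>t \<le> T N\<close> unfolding xs N_def by blast
  qed
  moreover have "(\<lambda>N. real (T N)) \<in> O(\<lambda>N. real N * real (log_star N))"
    unfolding T_def by (rule log_star_bigo)
  ultimately show ?thesis by blast
qed

end

text \<open>Letters reach the machine as numbers, so the program may depend on \<open>code\<close>,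
  but it is the same for all inputs.\<close>

theorem theorem1p4:
  fixes A :: "('v, 'e, 'g, 'h, 's) presented_gog" and v :: 'v
  assumes "is_presented_gog A"
    and "fin_digraph (dgraph A)"
    and "\<And>w. w \<in> verts (dgraph A) \<Longrightarrow> finite (carrier (vgroup A w))"
    and "v \<in> verts (dgraph A)"
  shows "(\<forall>Ws. folding_input A v Ws \<longrightarrow>
            (\<exists>\<Gamma>. folding_output A v Ws \<Gamma>) \<and>
            (\<forall>\<Gamma>. folding_output A v Ws \<Gamma> \<longrightarrow>
              (\<forall>g \<in> pi1 A v.
                (g \<in> generate (Bass A) (bass_eval A ` set Ws) \<longleftrightarrow>
                  (\<forall>U. gog_path A v U v \<and> reduced A U \<and> bass_eval A U = g \<longrightarrow>
                     reads \<Gamma> (base \<Gamma>) U (base \<Gamma>))) \<and>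
                (g \<in> generate (Bass A) (bass_eval A ` set Ws) \<longleftrightarrow>
                  (\<exists>U \<in> words (alphabet A). reduced A U \<and> bass_eval A U = g \<and>
                     reads \<Gamma> (base \<Gamma>) U (base \<Gamma>))))))
       \<and> (\<forall>code. inj_on code (alphabet A) \<longrightarrow>
            (\<exists>prog B. \<exists>T :: nat \<Rightarrow> nat.
              (\<lambda>N. real (T N)) \<in> O(\<lambda>N. real N * real (log_star N)) \<and>
              (\<forall>Ws. folding_input A v Ws \<longrightarrow>
                (\<exists>\<Gamma> t s. folding_output A v Ws \<Gamma> \<and>
                   exec B prog (input_state code Ws) t s \<and>
                   t \<le> T (total_length Ws) \<and>
                   represents_graph code (alphabet A) s \<Gamma>))))"
proof -
  interpret gog A v by (rule gog.intro) (fact assms)+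
  have 1: "\<exists>\<Gamma>. folding_output A v Ws \<Gamma>" if "folding_input A v Ws" for Ws
    by (rule folding_output_exists) (use that in \<open>simp add: folding_input_def\<close>)
  show ?thesis
    by (intro conjI allI impI ballI, erule 1, erule (2) output_correct(1), erule (2) output_correct(2),
      erule folding_time)
qed

end
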